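(* Let $k,l,r,s,m,n\in\mathbb Z_+$. The superalgebra homomorphism $$\Psi^{k|l}_{r|s}:\mathcal M^{k|l}_{r|s}|_{q=1}\to\mathcal X^{k|l}_{r|s}|_{q=1},\qquad t_{ab}\mapsto X_{ab},$$ to the algebra of $\mathrm U(\mathfrak{gl}_{m|n})$-invariants is surjective. Moreover, $\Psi^{k|l}_{r|s}$ is a $\mathrm U(\mathfrak{gl}_{k|l})\otimes\mathrm U(\mathfrak{gl}_{r|s})$-module homomorphism.
   Context: The base field is $\mathbb C$; $\mathbb Z_+=\{0,1,2,\dots\}$. For $m,n\in\mathbb Z_+$, $\mathbf I_{m|n}=\{1,\dots,m+n\}$ with $[a]=\bar0$ for $a\le m$, $[a]=\bar1$ for $a>m$ (parity taken in the index set to which the index belongs). $\mathfrak{gl}_{m|n}$ is the general linear Lie superalgebra of $(m+n)\times(m+n)$ matrices, $\pi$ its natural representation; $\mathrm U(\mathfrak{gl}_{m|n})$ is a Hopf superalgebra with $\Delta(x)=x\otimes1+1\otimes x$, $\epsilon(x)=0$, $S(x)=-x$ for $x\in\mathfrak{gl}_{m|n}$. $\mathcal M^{k|l}_{r|s}|_{q=1}$ is the free supercommutative $\mathbb C$-superalgebra on generators $t_{ab}$ ($a\in\mathbf I_{k|l}$, $b\in\mathbf I_{r|s}$) with $[t_{ab}]=[a]+[b]$ (so $t_{ab}^2=0$ for odd $t_{ab}$). $\mathcal P^{k|l}_{r|s}|_{q=1}$ is the free supercommutative superalgebra on $T_{ai}$, $\overline T_{bj}$ ($a\in\mathbf I_{k|l}$,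 $b\in\mathbf I_{r|s}$, $i,j\in\mathbf I_{m|n}$), $[T_{ai}]=[a]+[i]$, $[\overline T_{bj}]=[b]+[j]$. Homogeneous $x\in\mathfrak{gl}_{m|n}$ acts by superderivations ($x.(fg)=(x.f)g+(-1)^{[x][f]}f(x.g)$) with $x.T_{ai}=\sum_cT_{ac}\pi(x)_{ci}$, $x.\overline T_{bi}=-\sum_d(-1)^{[i]([d]+[i])}\overline T_{bd}\pi(x)_{id}$. $\mathcal X^{k|l}_{r|s}|_{q=1}=\{f:x.f=0\ \forall x\in\mathfrak{gl}_{m|n}\}$, and $X_{ab}=\sum_{i\in\mathbf I_{m|n}}(-1)^{[a]([b]+[i])}T_{ai}\overline T_{bi}$, which is an invariant; the $X_{ab}$ supercommute and $X_{ab}^2=0$ if $[a]+[b]=\bar1$. Module structures (the $q=1$ versions of the quantum ones). $\mathrm U(\mathfrak{gl}_{k|l})$ acts on the subalgebra generated by the $T_{ai}$ through $\mathcal L_x(f)=\sum\langle f_{(1)},w(x)\rangle f_{(2)}$ and $\mathrm U(\mathfrak{gl}_{r|s})$ on that generated by the $\overline T_{bj}$ through $\widetilde{\mathcal L}_y(g)=\sum\langle g_{(1)},S(y)\rangle g_{(2)}$, where $f\mapsto\sum f_{(1)}\otimes f_{(2)}$ are the superalgebra coactions $T_{ai}\mapsto\sum_{c\in\mathbf I_{k|l}}(-1)^{([a]+[c])([c]+[i])}t_{ac}\otimes T_{ci}$, $\overline T_{bj}\mapsto\sum_{c\in\mathbf I_{r|s}}(-1)^{([b]+[c])([c]+[j])}\bar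 t_{bc}\otimes\overline T_{cj}$; here $t_{ac}$, $\bar t_{bc}$ are the linear functions $\langle t_{ac},x\rangle=\pi(x)_{ac}$, $\langle\bar t_{bc},y\rangle=(-1)^{[c]([b]+[c])}\pi(S(y))_{cb}$, products of such functions are $\langle tt',x\rangle=\sum(-1)^{[t'][x_{(1)}]}\langle t,x_{(1)}\rangle\langle t',x_{(2)}\rangle$, and $w$ is the anti-automorphism with $w(e_{a,a+1})=e_{a+1,a}$, $w(e_{a+1,a})=e_{a,a+1}$, $w(e_{aa})=e_{aa}$. $\mathcal L\otimes\widetilde{\mathcal L}$ graded-commutes with $\mathfrak{gl}_{m|n}$ and so acts on $\mathcal X^{k|l}_{r|s}|_{q=1}$. For $m,n$ sufficiently large ($m\ge\max\{k,r\}$, $n\ge\max\{l,s\}$) $\Psi^{k|l}_{r|s}$ is an isomorphism, and $\mathcal M^{k|l}_{r|s}|_{q=1}$ carries the module structure transported along such an isomorphism. *)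

theory Defs
  imports
    "HOL-Library.Poly_Mapping"
    "HOL-Library.Z2"
    "HOL-Algebra.QuotRing"
    "Jordan_Normal_Form.Matrix"
begin

section \<open>Conventions\<close>

text \<open>
  Index sets start at 0: the set of indices of type (m|n) is \<^term>\<open>{..<m + n}\<close>, and
  the even indices are those below \<^term>\<open>m\<close>.  Parities live in the two-element field
  \<^typ>\<open>bit\<close>.
\<close>

definition par :: "nat \<Rightarrow> nat \<Rightarrow> bit" where
  "par m a = (if a < m then 0 else 1)"

definition sg :: "bit \<Rightarrow> complex" where
  "sg e = (if e = 0 then 1 else - 1)"

section \<open>Free superalgebras and their tensor products\<close>

instantiation list :: (type) monoid_add
begin

definition zero_list :: "'a list" where "zero_list = []"

definition plus_list :: "'a list \<Rightarrow> 'a list \<Rightarrow> 'a list" where "plus_list u v = u @ v"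

instance by standard (simp_all add: zero_list_def plus_list_def)

end

text \<open>The monoid algebra of words, that is, the free associative algebra.\<close>

type_synonym 'g falg = "'g list \<Rightarrow>\<^sub>0 complex"

text \<open>The tensor product of two free algebras, with the pairs of words as its basis.\<close>

type_synonym ('g, 'h) ftens = "('g list \<times> 'h list) \<Rightarrow>\<^sub>0 complex"

definition gen :: "'g \<Rightarrow> 'g falg" where
  "gen g = Poly_Mapping.single [g] 1"

definition scale :: "complex \<Rightarrow> ('b \<Rightarrow>\<^sub>0 complex) \<Rightarrow> ('b \<Rightarrow>\<^sub>0 complex)" where
  "scale c x = Poly_Mapping.map (\<lambda>d. c * d) x"

definition linext :: "('b \<Rightarrow> ('c \<Rightarrow>\<^sub>0 complex)) \<Rightarrow> ('b \<Rightarrow>\<^sub>0 complex) \<Rightarrow> ('c \<Rightarrow>\<^sub>0 complex)" where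
  "linext \<phi> x = (\<Sum>w\<in>Poly_Mapping.keys x. scale (Poly_Mapping.lookup x w) (\<phi> w))"

definition wpar :: "('g \<Rightarrow> bit) \<Rightarrow> 'g list \<Rightarrow> bit" where
  "wpar p w = (\<Sum>g\<leftarrow>w. p g)"

text \<open>The multiplication of the super tensor product,
  (u (x) v)(u' (x) v') = (-1)^([v][u']) uu' (x) vv'.\<close>

definition tmult ::
    "('g \<Rightarrow> bit) \<Rightarrow> ('h \<Rightarrow> bit) \<Rightarrow> ('g, 'h) ftens \<Rightarrow> ('g, 'h) ftens \<Rightarrow> ('g, 'h) ftens" where
  "tmult p q x y =
     (\<Sum>(u, v)\<in>Poly_Mapping.keys x. \<Sum>(u', v')\<in>Poly_Mapping.keys y.
        Poly_Mapping.single (u @ u', v @ v')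
          (sg (wpar q v * wpar p u') * Poly_Mapping.lookup x (u, v) * Poly_Mapping.lookup y (u', v')))"

definition tone :: "('g, 'h) ftens" where
  "tone = Poly_Mapping.single ([], []) 1"

definition tleft :: "'g falg \<Rightarrow> ('g, 'h) ftens" where
  "tleft x = linext (\<lambda>u. Poly_Mapping.single (u, []) 1) x"

definition tright :: "'h falg \<Rightarrow> ('g, 'h) ftens" where
  "tright y = linext (\<lambda>v. Poly_Mapping.single ([], v) 1) y"

text \<open>The algebra homomorphisms out of a free algebra with prescribed values on the generators.\<close>

definition fhom :: "('g \<Rightarrow> 'h falg) \<Rightarrow> 'g falg \<Rightarrow> 'h falg" where
  "fhom \<phi> x = linext (\<lambda>w. prod_list (map \<phi> w)) x"

definition thom ::
    "('h \<Rightarrow> bit) \<Rightarrow> ('j \<Rightarrow> bit) \<Rightarrow> ('g \<Rightarrow> ('h, 'j) ftens) \<Rightarrow> 'g falg \<Rightarrow> ('h, 'j) ftens" where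
  "thom p q \<phi> x = linext (\<lambda>w. foldr (\<lambda>g z. tmult p q (\<phi> g) z) w tone) x"

text \<open>The superderivation of degree \<^term>\<open>e\<close> with prescribed values on the generators.\<close>

primrec sder_word :: "('g \<Rightarrow> bit) \<Rightarrow> bit \<Rightarrow> ('g \<Rightarrow> 'g falg) \<Rightarrow> 'g list \<Rightarrow> 'g falg" where
  "sder_word p e d [] = 0"
| "sder_word p e d (g # w) =
     d g * Poly_Mapping.single w 1 + scale (sg (e * p g)) (gen g * sder_word p e d w)"

definition sder :: "('g \<Rightarrow> bit) \<Rightarrow> bit \<Rightarrow> ('g \<Rightarrow> 'g falg) \<Rightarrow> 'g falg \<Rightarrow> 'g falg" where
  "sder p e d x = linext (sder_word p e d) x"

definition free_alg :: "'g set \<Rightarrow> 'g falg ring" where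
  "free_alg G =
     \<lparr>carrier = {x. Poly_Mapping.keys x \<subseteq> lists G}, monoid.mult = (*), one = 1, zero = 0, add = (+)\<rparr>"

definition free_tens ::
    "'g set \<Rightarrow> ('g \<Rightarrow> bit) \<Rightarrow> 'h set \<Rightarrow> ('h \<Rightarrow> bit) \<Rightarrow> ('g, 'h) ftens ring" where
  "free_tens G p H q =
     \<lparr>carrier = {x. Poly_Mapping.keys x \<subseteq> lists G \<times> lists H},
      monoid.mult = tmult p q, one = tone, zero = 0, add = (+)\<rparr>"

section \<open>Superalgebras\<close>

record 'a superalgebra = "(complex, 'a) module" +
  homog :: "bit \<Rightarrow> 'a set"

definition superalgebra_hom ::
    "('a, 'c) superalgebra_scheme \<Rightarrow> ('b, 'd) superalgebra_scheme \<Rightarrow> ('a \<Rightarrow> 'b) set" where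
  "superalgebra_hom A B =
     {h \<in> Ring.ring_hom A B.
        (\<forall>c. \<forall>x\<in>carrier A. h (c \<odot>\<^bsub>A\<^esub> x) = c \<odot>\<^bsub>B\<^esub> h x) \<and>
        (\<forall>e. h ` homog A e \<subseteq> homog B e)}"

text \<open>The superalgebra with generators \<^term>\<open>G\<close> and relators \<^term>\<open>R\<close>, as a quotient of the
  free algebra; \<open>residue\<close> is the projection.\<close>

definition residue :: "'g set \<Rightarrow> 'g falg set \<Rightarrow> 'g falg \<Rightarrow> 'g falg set" where
  "residue G R x = Idl\<^bsub>free_alg G\<^esub> R +>\<^bsub>free_alg G\<^esub> x"

definition presented :: "'g set \<Rightarrow> ('g \<Rightarrow> bit) \<Rightarrow> 'g falg set \<Rightarrow> 'g falg set superalgebra" where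
  "presented G p R =
     (let Q = free_alg G Quot (Idl\<^bsub>free_alg G\<^esub> R) in
      \<lparr>carrier = carrier Q, monoid.mult = monoid.mult Q, one = one Q, zero = zero Q, add = add Q,
       smult = (\<lambda>c C. residue G R (Poly_Mapping.single [] c) \<otimes>\<^bsub>Q\<^esub> C),
       homog = (\<lambda>e. residue G R `
                  {x \<in> carrier (free_alg G). \<forall>w\<in>Poly_Mapping.keys x. wpar p w = e})\<rparr>)"

text \<open>The map induced on cosets by a map that is constant on each of them.\<close>

definition descend :: "('a \<Rightarrow> 'b) \<Rightarrow> 'a set \<Rightarrow> 'b" where
  "descend \<phi> C = the_elem (\<phi> ` C)"

text \<open>For an odd generator the case g = h is the relator 2 g^2.\<close>

definition scomm_rels :: "'g set \<Rightarrow> ('g \<Rightarrow> bit) \<Rightarrow> 'g falg set" where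
  "scomm_rels G p = {gen g * gen h - scale (sg (p g * p h)) (gen h * gen g) | g h. g \<in> G \<and> h \<in> G}"

section \<open>The enveloping superalgebra of gl(k|l)\<close>

text \<open>The generator \<^term>\<open>(a, b)\<close> stands for the matrix unit with its 1 in row a and column b.
  In the same way \<^term>\<open>gpar k m\<close> is the parity of doubly indexed generators whose two indices
  are of types (k|l) and (m|n).\<close>

definition gpar :: "nat \<Rightarrow> nat \<Rightarrow> nat \<times> nat \<Rightarrow> bit" where
  "gpar k m = (\<lambda>(a, i). par k a + par m i)"

definition gl_gens :: "nat \<Rightarrow> nat \<Rightarrow> (nat \<times> nat) set" where
  "gl_gens k l = {..<k + l} \<times> {..<k + l}"

definition gl_rels :: "nat \<Rightarrow> nat \<Rightarrow> (nat \<times> nat) falg set" where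
  "gl_rels k l =
     {gen (a, b) * gen (c, d)
        - scale (sg (gpar k k (a, b) * gpar k k (c, d))) (gen (c, d) * gen (a, b))
        - ((if b = c then gen (a, d) else 0)
           - scale (sg (gpar k k (a, b) * gpar k k (c, d))) (if a = d then gen (c, b) else 0))
      | a b c d. (a, b) \<in> gl_gens k l \<and> (c, d) \<in> gl_gens k l}"

text \<open>
  U(gl(k|l)) is the quotient of the free algebra on \<^term>\<open>gl_gens k l\<close> by the ideal I generated
  by \<^term>\<open>gl_rels k l\<close>.  The free algebra is itself a Hopf superalgebra with primitive
  generators, and I is a Hopf ideal; the structure maps of U(gl(k|l)) are therefore given on
  representatives in the free algebra.  The tensor product of the two enveloping superalgebras is
  the quotient of the tensor product of the free algebras by the ideal generated by both sets of
  relators.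
\<close>

definition UU_ideal :: "nat \<Rightarrow> nat \<Rightarrow> nat \<Rightarrow> nat \<Rightarrow> (nat \<times> nat, nat \<times> nat) ftens set" where
  "UU_ideal k l r s =
     Idl\<^bsub>free_tens (gl_gens k l) (gpar k k) (gl_gens r s) (gpar r r)\<^esub>
       (tleft ` gl_rels k l \<union> tright ` gl_rels r s)"

definition UU :: "nat \<Rightarrow> nat \<Rightarrow> nat \<Rightarrow> nat \<Rightarrow> (nat \<times> nat, nat \<times> nat) ftens set ring" where
  "UU k l r s =
     free_tens (gl_gens k l) (gpar k k) (gl_gens r s) (gpar r r) Quot UU_ideal k l r s"

definition coprod :: "nat \<Rightarrow> (nat \<times> nat) falg \<Rightarrow> (nat \<times> nat, nat \<times> nat) ftens" where
  "coprod k x = thom (gpar k k) (gpar k k) (\<lambda>g. tleft (gen g) + tright (gen g)) x"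

definition counit :: "(nat \<times> nat) falg \<Rightarrow> complex" where
  "counit x = Poly_Mapping.lookup x []"

text \<open>The antipode is a graded anti-automorphism, S(xy) = (-1)^([x][y]) S(y)S(x).\<close>

primrec antipode_word :: "nat \<Rightarrow> (nat \<times> nat) list \<Rightarrow> (nat \<times> nat) falg" where
  "antipode_word k [] = 1"
| "antipode_word k (g # w) =
     scale (sg (gpar k k g * wpar (gpar k k) w)) (antipode_word k w * (- gen g))"

definition antipode :: "nat \<Rightarrow> (nat \<times> nat) falg \<Rightarrow> (nat \<times> nat) falg" where
  "antipode k x = linext (antipode_word k) x"

text \<open>
  The anti-automorphism w is an ungraded one, w(xy) = w(y)w(x): a graded one could not fix the
  diagonal matrix units and interchange the odd simple root vectors.  Its values on the simple
  root vectors and on the diagonal extend uniquely to the transposition of all matrix units.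
\<close>

definition wanti :: "(nat \<times> nat) falg \<Rightarrow> (nat \<times> nat) falg" where
  "wanti x = linext (\<lambda>u. Poly_Mapping.single (rev (map prod.swap u)) 1) x"

definition mat_unit :: "nat \<Rightarrow> nat \<times> nat \<Rightarrow> complex mat" where
  "mat_unit N = (\<lambda>(a, b). mat N N (\<lambda>(i, j). if i = a \<and> j = b then 1 else 0))"

definition natrep :: "nat \<Rightarrow> (nat \<times> nat) falg \<Rightarrow> complex mat" where
  "natrep N x = mat N N (\<lambda>ij. \<Sum>w\<in>Poly_Mapping.keys x.
     Poly_Mapping.lookup x w * (foldr (\<lambda>g A. mat_unit N g * A) w (1\<^sub>m N) $$ ij))"

text \<open>
  Evaluation at \<^term>\<open>x\<close> of a product of linear functions on the enveloping superalgebra.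
  The factors are \<^term>\<open>\<tau> g\<close>, of parity \<^term>\<open>gpar k k g\<close>; the empty product is the counit.
\<close>

primrec pairing ::
    "nat \<Rightarrow> (nat \<times> nat \<Rightarrow> (nat \<times> nat) falg \<Rightarrow> complex) \<Rightarrow> (nat \<times> nat) list \<Rightarrow>
     (nat \<times> nat) falg \<Rightarrow> complex" where
  "pairing k \<tau> [] x = counit x"
| "pairing k \<tau> (g # u) x =
     (\<Sum>(x1, x2)\<in>Poly_Mapping.keys (coprod k x).
        Poly_Mapping.lookup (coprod k x) (x1, x2) * sg (wpar (gpar k k) u * wpar (gpar k k) x1) *
        \<tau> g (Poly_Mapping.single x1 1) * pairing k \<tau> u (Poly_Mapping.single x2 1))"

definition tfun :: "nat \<Rightarrow> nat \<times> nat \<Rightarrow> (nat \<times> nat) falg \<Rightarrow> complex" where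
  "tfun N = (\<lambda>(a, c) x. natrep N x $$ (a, c))"

definition tbarfun :: "nat \<Rightarrow> nat \<Rightarrow> nat \<times> nat \<Rightarrow> (nat \<times> nat) falg \<Rightarrow> complex" where
  "tbarfun N r = (\<lambda>(b, c) y. sg (par r c * (par r b + par r c)) * natrep N (antipode r y) $$ (c, b))"

section \<open>The superalgebras M, P and X\<close>

definition M_gens :: "nat \<Rightarrow> nat \<Rightarrow> nat \<Rightarrow> nat \<Rightarrow> (nat \<times> nat) set" where
  "M_gens k l r s = {..<k + l} \<times> {..<r + s}"

definition M_alg :: "nat \<Rightarrow> nat \<Rightarrow> nat \<Rightarrow> nat \<Rightarrow> (nat \<times> nat) falg set superalgebra" where
  "M_alg k l r s =
     presented (M_gens k l r s) (gpar k r) (scomm_rels (M_gens k l r s) (gpar k r))"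

definition M_class :: "nat \<Rightarrow> nat \<Rightarrow> nat \<Rightarrow> nat \<Rightarrow> (nat \<times> nat) falg \<Rightarrow> (nat \<times> nat) falg set" where
  "M_class k l r s = residue (M_gens k l r s) (scomm_rels (M_gens k l r s) (gpar k r))"

text \<open>\<^term>\<open>Inl (a, i)\<close> is the generator T with indices a, i, and \<^term>\<open>Inr (b, j)\<close> is the
  generator T-bar with indices b, j.\<close>

type_synonym pgen = "(nat \<times> nat) + (nat \<times> nat)"

definition ppar :: "nat \<Rightarrow> nat \<Rightarrow> nat \<Rightarrow> pgen \<Rightarrow> bit" where
  "ppar k r m = case_sum (gpar k m) (gpar r m)"

definition P_gens :: "nat \<Rightarrow> nat \<Rightarrow> nat \<Rightarrow> nat \<Rightarrow> nat \<Rightarrow> nat \<Rightarrow> pgen set" where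
  "P_gens k l r s m n = ({..<k + l} \<times> {..<m + n}) <+> ({..<r + s} \<times> {..<m + n})"

definition P_alg :: "nat \<Rightarrow> nat \<Rightarrow> nat \<Rightarrow> nat \<Rightarrow> nat \<Rightarrow> nat \<Rightarrow> pgen falg set superalgebra" where
  "P_alg k l r s m n =
     presented (P_gens k l r s m n) (ppar k r m) (scomm_rels (P_gens k l r s m n) (ppar k r m))"

definition P_class ::
    "nat \<Rightarrow> nat \<Rightarrow> nat \<Rightarrow> nat \<Rightarrow> nat \<Rightarrow> nat \<Rightarrow> pgen falg \<Rightarrow> pgen falg set" where
  "P_class k l r s m n =
     residue (P_gens k l r s m n) (scomm_rels (P_gens k l r s m n) (ppar k r m))"

definition homog_part :: "nat \<Rightarrow> bit \<Rightarrow> complex mat \<Rightarrow> complex mat" where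
  "homog_part m e x = mat (dim_row x) (dim_col x)
     (\<lambda>(i, j). if par m i + par m j = e then x $$ (i, j) else 0)"

definition gl_on_gen :: "nat \<Rightarrow> nat \<Rightarrow> complex mat \<Rightarrow> pgen \<Rightarrow> pgen falg" where
  "gl_on_gen m n x g = (case g of
     Inl (a, i) \<Rightarrow> (\<Sum>c<m + n. scale (x $$ (c, i)) (gen (Inl (a, c))))
   | Inr (b, i) \<Rightarrow>
       - (\<Sum>d<m + n. scale (sg (par m i * (par m d + par m i)) * x $$ (i, d)) (gen (Inr (b, d)))))"

text \<open>The action of an arbitrary, not necessarily homogeneous matrix of gl(m|n) on P.\<close>

definition gl_act ::
    "nat \<Rightarrow> nat \<Rightarrow> nat \<Rightarrow> nat \<Rightarrow> nat \<Rightarrow> nat \<Rightarrow> complex mat \<Rightarrow> pgen falg set \<Rightarrow> pgen falg set" where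
  "gl_act k l r s m n x =
     descend (\<lambda>f. P_class k l r s m n
       (\<Sum>e\<in>{0, 1}. sder (ppar k r m) e (gl_on_gen m n (homog_part m e x)) f))"

definition X_alg :: "nat \<Rightarrow> nat \<Rightarrow> nat \<Rightarrow> nat \<Rightarrow> nat \<Rightarrow> nat \<Rightarrow> pgen falg set superalgebra" where
  "X_alg k l r s m n =
     (let P = P_alg k l r s m n;
          C = {f \<in> carrier P. \<forall>x\<in>carrier_mat (m + n) (m + n). gl_act k l r s m n x f = \<zero>\<^bsub>P\<^esub>}
      in P\<lparr>carrier := C, homog := (\<lambda>e. homog P e \<inter> C)\<rparr>)"

definition X_elem :: "nat \<Rightarrow> nat \<Rightarrow> nat \<Rightarrow> nat \<Rightarrow> nat \<times> nat \<Rightarrow> pgen falg" where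
  "X_elem k r m n = (\<lambda>(a, b). \<Sum>i<m + n.
     scale (sg (par k a * (par r b + par m i))) (gen (Inl (a, i)) * gen (Inr (b, i))))"

definition Psi ::
    "nat \<Rightarrow> nat \<Rightarrow> nat \<Rightarrow> nat \<Rightarrow> nat \<Rightarrow> nat \<Rightarrow> (nat \<times> nat) falg set \<Rightarrow> pgen falg set" where
  "Psi k l r s m n = descend (\<lambda>f. P_class k l r s m n (fhom (X_elem k r m n) f))"

section \<open>The module structures\<close>

text \<open>
  The coactions of the two kinds of generators have the same form.  The left tensor factor
  consists of formal products of the linear functions t (or t-bar), to be evaluated by
  \<^const>\<open>pairing\<close>.
\<close>

definition coaction :: "nat \<Rightarrow> nat \<Rightarrow> nat \<Rightarrow> (nat \<times> nat) falg \<Rightarrow> (nat \<times> nat, nat \<times> nat) ftens" where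
  "coaction N k m f = thom (gpar k k) (gpar k m)
     (\<lambda>(a, i). \<Sum>c<N. Poly_Mapping.single ([(a, c)], [(c, i)])
        (sg ((par k a + par k c) * (par k c + par m i)))) f"

definition slice :: "('g list \<Rightarrow> complex) \<Rightarrow> ('g, 'h) ftens \<Rightarrow> 'h falg" where
  "slice \<chi> z = linext (\<lambda>(u, v). Poly_Mapping.single v (\<chi> u)) z"

text \<open>As w is ungraded, the operators satisfy L_(xy) = (-1)^([x][y]) L_x L_y, so a module map is
  read as a map commuting with all of them.  No such sign occurs for \<open>Lt_act\<close>.\<close>

definition L_act ::
    "nat \<Rightarrow> nat \<Rightarrow> nat \<Rightarrow> (nat \<times> nat) falg \<Rightarrow> (nat \<times> nat) falg \<Rightarrow> (nat \<times> nat) falg" where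
  "L_act k l m x f = slice (\<lambda>u. pairing k (tfun (k + l)) u (wanti x)) (coaction (k + l) k m f)"

definition Lt_act ::
    "nat \<Rightarrow> nat \<Rightarrow> nat \<Rightarrow> (nat \<times> nat) falg \<Rightarrow> (nat \<times> nat) falg \<Rightarrow> (nat \<times> nat) falg" where
  "Lt_act r s m y g = slice (\<lambda>u. pairing r (tbarfun (r + s) r) u (antipode r y)) (coaction (r + s) r m g)"

text \<open>The isomorphism of P with the tensor product of the subalgebras generated by the T and by
  the T-bar, on representatives.\<close>

definition split_P :: "nat \<Rightarrow> nat \<Rightarrow> nat \<Rightarrow> pgen falg \<Rightarrow> (nat \<times> nat, nat \<times> nat) ftens" where
  "split_P k r m f = thom (gpar k m) (gpar r m)
     (case_sum (\<lambda>t. tleft (gen t)) (\<lambda>t. tright (gen t))) f"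

text \<open>(x (x) y).(fg) = (-1)^([y][f]) L_x(f) Lt_y(g), for f in the subalgebra generated by the T
  and g in the one generated by the T-bar.\<close>

definition tens_act ::
    "nat \<Rightarrow> nat \<Rightarrow> nat \<Rightarrow> nat \<Rightarrow> nat \<Rightarrow> (nat \<times> nat, nat \<times> nat) ftens \<Rightarrow> pgen falg \<Rightarrow> pgen falg" where
  "tens_act k l r s m z f =
     linext (\<lambda>(x, y). linext (\<lambda>(u, v).
         scale (sg (wpar (gpar r r) y * wpar (gpar k m) u))
           (fhom (\<lambda>t. gen (Inl t)) (L_act k l m (Poly_Mapping.single x 1) (Poly_Mapping.single u 1)) *
            fhom (\<lambda>t. gen (Inr t)) (Lt_act r s m (Poly_Mapping.single y 1) (Poly_Mapping.single v 1))))
       (split_P k r m f)) z"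

definition X_act ::
    "nat \<Rightarrow> nat \<Rightarrow> nat \<Rightarrow> nat \<Rightarrow> nat \<Rightarrow> nat \<Rightarrow>
     (nat \<times> nat, nat \<times> nat) ftens set \<Rightarrow> pgen falg set \<Rightarrow> pgen falg set" where
  "X_act k l r s m n Z C =
     descend (\<lambda>(z, f). P_class k l r s m n (tens_act k l r s m z f)) (Z \<times> C)"

text \<open>The module structure of M transported from the invariants of gl(m|n), meaningful when
  \<^const>\<open>Psi\<close> is a bijection onto them.\<close>

definition M_act ::
    "nat \<Rightarrow> nat \<Rightarrow> nat \<Rightarrow> nat \<Rightarrow> nat \<Rightarrow> nat \<Rightarrow>
     (nat \<times> nat, nat \<times> nat) ftens set \<Rightarrow> (nat \<times> nat) falg set \<Rightarrow> (nat \<times> nat) falg set" where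
  "M_act k l r s m n Z f =
     the_inv_into (carrier (M_alg k l r s)) (Psi k l r s m n)
       (X_act k l r s m n Z (Psi k l r s m n f))"

end

theory Submission
  imports Defs "HOL-Combinatorics.Permutations"
begin

text \<open>
  The elements X are annihilated by gl(m|n) because T and T-bar carry dual representations, so that
  \<^const>\<open>Psi\<close> takes values in the invariants.  The two remaining assertions are the surjectivity,
  which is a first fundamental theorem of invariant theory, and the compatibility with the actions.

  Surjectivity (\<open>Psi_surj\<close>).  Let f be an element of the free algebra that represents an invariant.
  The signed symmetrisation \<open>Sym\<close> changes f by relations only, annihilates the relations and commutes
  with the superderivations by which matrix units act.  Hence \<open>Sym f\<close> represents the same invariant
  and is annihilated by the matrix units in the free algebra itself, which gives linear equations
  between coefficients of words.  As the coefficients are unchanged, up to sign, when letters are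
  permuted, words with the T to the left of the T-bar suffice.  For fixed rows of the letters the
  coefficient is a function of the columns i of the T and j of the T-bar.  The diagonal matrix units
  show that it vanishes unless i is a rearrangement of j; the other ones show that, up to a sign, it is
  a kernel commuting with the diagonal action of gl(m|n) on words (\<open>kernel_commuting\<close>).  Such a
  kernel is a combination of signed permutations (\<open>double_centralizer\<close>), and modulo
  supercommutativity each signed permutation contributes a product of elements X, up to sign
  (\<open>contraction_X\<close>, \<open>permuted_contraction\<close>).

  The double centralizer property is shown directly.  A kernel that commutes with the diagonal action
  commutes with all sums that let given matrix units act at distinct positions: multiplying by one
  more matrix unit produces the sum for one more position, and terms in which the new matrix unit is
  absorbed by an old one.  With as many matrix units as positions such a sum is the symmetrisation of an
  arbitrary matrix unit on the space of words, and commuting with it is a relation between the entries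
  of the kernel (\<open>commuting_star\<close>).  If the kernel is moreover orthogonal to all signed permutations, then
  the two sides of the relation are orthogonal, hence zero, and the kernel vanishes.  Subtracting
  the orthogonal projection to the span of the signed permutations reduces the general case to this one.

  Equivariance (\<open>Psi_equivariant\<close>).  The operators belonging to words in the enveloping superalgebras
  are, up to sign, compositions of superderivations of P that replace rows (\<open>tens_act_word\<close>).
  These send the elements X to multiples of elements X, with coefficients that do not depend on m and n;
  so \<^const>\<open>Psi\<close> intertwines them, for all m and n at once, with superderivations of M.  For large
  m' and n' the homomorphism is injective, since specialising the T-bar to unit vectors gives a left
  inverse (\<open>Psi_inj\<close>); therefore the module structure transported from there is the one given by
  these superderivations of M, and it is respected by \<^const>\<open>Psi\<close> for every m and n.
\<close>


section \<open>Signs\<close>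

declare add_bit_eq_xor [simp del] mult_bit_eq_and [simp del]

lemma bit_add_self [simp]: "(x::bit) + x = 0" "x + (x + y) = y"
  by (cases x; cases y; simp)+

lemma sg_0 [simp]: "sg 0 = 1"
  by (simp add: sg_def)

lemma sg_1 [simp]: "sg 1 = -1"
  by (simp add: sg_def)

lemma sg_add: "sg (a + b) = sg a * sg b"
  by (cases a; cases b; simp)

lemma sg_mult_self [simp]: "sg a * sg a = 1" "sg a * (sg a * z) = z"
  by (cases a; simp)+

lemma sg_nonzero [simp]: "sg a \<noteq> 0"
  by (cases a; simp)

lemma cnj_sg [simp]: "cnj (sg a) = sg a"
  by (cases a; simp)

lemma wpar_simps [simp]:
  "wpar p [] = 0" "wpar p (g # w) = p g + wpar p w" "wpar p (u @ v) = wpar p u + wpar p v"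
  by (simp_all add: wpar_def)

section \<open>Linear maps between spaces of finitely supported functions\<close>

abbreviation elt :: "'b \<Rightarrow> ('b \<Rightarrow>\<^sub>0 complex)" where
  "elt w \<equiv> Poly_Mapping.single w 1"

abbreviation lk :: "('b \<Rightarrow>\<^sub>0 complex) \<Rightarrow> 'b \<Rightarrow> complex" where
  "lk \<equiv> Poly_Mapping.lookup"

lemma lookup_scale [simp]: "lk (scale c x) w = c * lk x w"
  by (simp add: scale_def Poly_Mapping.map.rep_eq when_def)

lemma scale_simps [simp]:
  "scale c 0 = 0" "scale 0 x = 0" "scale 1 x = x" "scale a (scale b x) = scale (a * b) x"
  "scale c (- x) = - scale c x" "scale (- c) x = - scale c x"
  by (rule poly_mapping_eqI; simp)+

lemma scale_single: "scale a (Poly_Mapping.single w b) = Poly_Mapping.single w (a * b)"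
  by (rule poly_mapping_eqI) (simp add: lookup_single when_def)

lemma scale_add: "scale c (x + y) = scale c x + scale c y"
  by (rule poly_mapping_eqI; simp add: lookup_add algebra_simps)

lemma scale_add_left: "scale (a + b) x = scale a x + scale b x"
  by (rule poly_mapping_eqI; simp add: lookup_add algebra_simps)

lemma scale_diff: "scale c (x - y) = scale c x - scale c y"
  by (rule poly_mapping_eqI; simp add: lookup_minus algebra_simps)

lemma scale_sum: "scale c (\<Sum>i\<in>A. f i) = (\<Sum>i\<in>A. scale c (f i))"
  by (induction A rule: infinite_finite_induct) (simp_all add: scale_add)

lemma scale_sum_scalar: "scale (\<Sum>i\<in>A. f i) x = (\<Sum>i\<in>A. scale (f i) x)"
  by (induction A rule: infinite_finite_induct) (simp_all add: scale_add_left)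

lemma lookup_sum: "lk (\<Sum>i\<in>A. f i) w = (\<Sum>i\<in>A. lk (f i) w)"
  by (induction A rule: infinite_finite_induct) (simp_all add: lookup_add)

lemma keys_scale: "Poly_Mapping.keys (scale c x) \<subseteq> Poly_Mapping.keys x"
  by (auto simp: in_keys_iff)

lemma expand_elt: "x = (\<Sum>w\<in>Poly_Mapping.keys x. scale (lk x w) (elt w))"
proof (rule poly_mapping_eqI)
  fix w
  have "lk (\<Sum>w\<in>Poly_Mapping.keys x. scale (lk x w) (elt w)) w
      = (\<Sum>u\<in>Poly_Mapping.keys x. if w = u then lk x u else 0)"
    by (simp add: lookup_sum lookup_single when_def if_distrib cong: if_cong)
  also have "\<dots> = lk x w"
    by (simp add: in_keys_iff)
  finally show "lk x w = lk (\<Sum>w\<in>Poly_Mapping.keys x. scale (lk x w) (elt w)) w" ..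
qed

definition lin :: "(('b \<Rightarrow>\<^sub>0 complex) \<Rightarrow> ('c \<Rightarrow>\<^sub>0 complex)) \<Rightarrow> bool" where
  "lin h \<longleftrightarrow> (\<forall>x y. h (x + y) = h x + h y) \<and> (\<forall>c x. h (scale c x) = scale c (h x))"

lemma linI: "(\<And>x y. h (x + y) = h x + h y) \<Longrightarrow> (\<And>c x. h (scale c x) = scale c (h x)) \<Longrightarrow> lin h"
  by (simp add: lin_def)

lemma lin_add: "lin h \<Longrightarrow> h (x + y) = h x + h y"
  and lin_scale: "lin h \<Longrightarrow> h (scale c x) = scale c (h x)"
  by (simp_all add: lin_def)

lemma lin_0: "lin h \<Longrightarrow> h 0 = 0"
  using lin_scale[of h 0 0] by simp

lemma lin_uminus: "lin h \<Longrightarrow> h (- x) = - h x"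
  using lin_scale[of h "-1" x] by simp

lemma lin_diff: "lin h \<Longrightarrow> h (x - y) = h x - h y"
  using lin_add[of h x "- y"] by (simp add: lin_uminus)

lemma lin_sum: "lin h \<Longrightarrow> h (\<Sum>i\<in>A. f i) = (\<Sum>i\<in>A. h (f i))"
  by (induction A rule: infinite_finite_induct) (simp_all add: lin_0 lin_add)

lemmas lin_simps = lin_add lin_scale lin_0 lin_uminus lin_diff lin_sum

lemma lin_expand: "lin h \<Longrightarrow> h x = (\<Sum>w\<in>Poly_Mapping.keys x. scale (lk x w) (h (elt w)))"
  by (subst expand_elt) (simp only: lin_sum lin_scale)

lemma lin_eq_on: 
  assumes "lin h" "lin h'" "\<And>w. w \<in> Poly_Mapping.keys x \<Longrightarrow> h (elt w) = h' (elt w)"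
  shows "h x = h' x"
  by (simp add: lin_expand[OF assms(1), of x] lin_expand[OF assms(2), of x] assms(3))

lemma lin_eq: "lin h \<Longrightarrow> lin h' \<Longrightarrow> (\<And>w. h (elt w) = h' (elt w)) \<Longrightarrow> h x = h' x"
  by (rule lin_eq_on)

lemma lin_id: "lin (\<lambda>x. x)"
  by (simp add: lin_def)

lemma lin_const0: "lin (\<lambda>x. 0)"
  by (simp add: lin_def)

lemma lin_plus: "lin f \<Longrightarrow> lin g \<Longrightarrow> lin (\<lambda>x. f x + g x)"
  by (simp add: lin_def scale_add algebra_simps)

lemma lin_minus: "lin f \<Longrightarrow> lin g \<Longrightarrow> lin (\<lambda>x. f x - g x)"
  by (simp add: lin_def scale_diff algebra_simps)

lemma lin_neg: "lin f \<Longrightarrow> lin (\<lambda>x. - f x)"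
  by (simp add: lin_def algebra_simps)

lemma lin_scaled: "lin f \<Longrightarrow> lin (\<lambda>x. scale c (f x))"
  by (simp add: lin_def scale_add algebra_simps)

lemma lin_setsum: "(\<And>i. i \<in> A \<Longrightarrow> lin (f i)) \<Longrightarrow> lin (\<lambda>x. \<Sum>i\<in>A. f i x)"
  by (simp add: lin_def sum.distrib scale_sum)

lemma lin_compose: "lin h \<Longrightarrow> lin f \<Longrightarrow> lin (\<lambda>x. h (f x))"
  by (simp add: lin_def)

lemma linext_superset:
  assumes "finite S" "Poly_Mapping.keys x \<subseteq> S"
  shows "linext \<phi> x = (\<Sum>w\<in>S. scale (lk x w) (\<phi> w))"
  unfolding linext_def using assms
  by (intro sum.mono_neutral_left) (auto simp: in_keys_iff)

lemma lin_linext: "lin (linext \<phi>)"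
proof (rule linI)
  fix x y :: "'a \<Rightarrow>\<^sub>0 complex" 
  let ?S = "Poly_Mapping.keys x \<union> Poly_Mapping.keys y"
  have "linext \<phi> (x + y) = (\<Sum>w\<in>?S. scale (lk (x + y) w) (\<phi> w))"
    by (rule linext_superset) (auto dest: subsetD[OF keys_add])
  also have "\<dots> = (\<Sum>w\<in>?S. scale (lk x w) (\<phi> w)) + (\<Sum>w\<in>?S. scale (lk y w) (\<phi> w))"
    by (simp add: lookup_add scale_add_left sum.distrib)
  also have "\<dots> = linext \<phi> x + linext \<phi> y"
    by (simp add: linext_superset[of ?S])
  finally show "linext \<phi> (x + y) = linext \<phi> x + linext \<phi> y" .
next
  fix c :: complex and x :: "'a \<Rightarrow>\<^sub>0 complex"
  have "linext \<phi> (scale c x) = (\<Sum>w\<in>Poly_Mapping.keys x. scale (lk (scale c x) w) (\<phi> w))"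
    by (rule linext_superset) (auto simp: keys_scale)
  then show "linext \<phi> (scale c x) = scale c (linext \<phi> x)"
    by (simp add: linext_def scale_sum)
qed

lemma linext_single [simp]: "linext \<phi> (Poly_Mapping.single w c) = scale c (\<phi> w)"
  by (cases "c = 0") (simp_all add: linext_def)

lemma linext_elt: "linext \<phi> (elt w) = \<phi> w"
  by simp

lemma linext_cong: "(\<And>w. w \<in> Poly_Mapping.keys x \<Longrightarrow> \<phi> w = \<psi> w) \<Longrightarrow> linext \<phi> x = linext \<psi> x"
  by (simp add: linext_def)

lemma linext_fun:
  assumes "\<And>w. lin (\<lambda>x. \<phi> x w)"
  shows "lin (\<lambda>x. linext (\<phi> x) y)"
  unfolding linext_def by (intro lin_setsum lin_scaled assms)

lemma lin_linext_comp: "lin f \<Longrightarrow> lin (\<lambda>x. linext \<phi> (f x))"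
  by (rule lin_compose[OF lin_linext])

lemma bilin_eq:
  assumes "\<And>y. lin (\<lambda>x. f x y)" "\<And>x. lin (f x)" "\<And>y. lin (\<lambda>x. g x y)" "\<And>x. lin (g x)"
    and "\<And>u v. f (elt u) (elt v) = g (elt u) (elt v)"
  shows "f x y = g x y"
proof (rule lin_eq[where h = "\<lambda>x. f x y" and h' = "\<lambda>x. g x y"])
  fix w
  show "f (elt w) y = g (elt w) y"
    by (rule lin_eq[where h = "f (elt w)" and h' = "g (elt w)"]) (use assms in auto)
qed (use assms in auto)

definition subsp :: "('b \<Rightarrow>\<^sub>0 complex) set \<Rightarrow> bool" where
  "subsp K \<longleftrightarrow> 0 \<in> K \<and> (\<forall>x\<in>K. \<forall>y\<in>K. x + y \<in> K) \<and> (\<forall>c. \<forall>x\<in>K. scale c x \<in> K)"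

lemma subsp_0: "subsp K \<Longrightarrow> 0 \<in> K"
  and subsp_add: "subsp K \<Longrightarrow> x \<in> K \<Longrightarrow> y \<in> K \<Longrightarrow> x + y \<in> K"
  and subsp_scale: "subsp K \<Longrightarrow> x \<in> K \<Longrightarrow> scale c x \<in> K"
  by (auto simp: subsp_def)

lemma subsp_uminus: "subsp K \<Longrightarrow> x \<in> K \<Longrightarrow> - x \<in> K"
  using subsp_scale[of K x "-1"] by simp

lemma subsp_diff: "subsp K \<Longrightarrow> x \<in> K \<Longrightarrow> y \<in> K \<Longrightarrow> x - y \<in> K"
  using subsp_add[of K x "- y"] subsp_uminus[of K y] by simp

lemma subsp_sum: "subsp K \<Longrightarrow> (\<And>i. i \<in> A \<Longrightarrow> f i \<in> K) \<Longrightarrow> (\<Sum>i\<in>A. f i) \<in> K"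
  by (induction A rule: infinite_finite_induct) (simp_all add: subsp_0 subsp_add)

lemma subsp_zero: "subsp {0}"
  by (simp add: subsp_def)

lemma lin_in:
  assumes "lin h" "subsp K" "\<And>w. w \<in> Poly_Mapping.keys x \<Longrightarrow> h (elt w) \<in> K"
  shows "h x \<in> K"
  unfolding lin_expand[OF assms(1), of x] by (intro subsp_sum subsp_scale assms)

lemma subsp_supp: "subsp {x. Poly_Mapping.keys x \<subseteq> S}"
proof -
  have "Poly_Mapping.keys (x + y) \<subseteq> S" if "Poly_Mapping.keys x \<subseteq> S" "Poly_Mapping.keys y \<subseteq> S"
    for x y :: "'a \<Rightarrow>\<^sub>0 complex" using keys_add[of x y] that by blast
  moreover have "Poly_Mapping.keys (scale c x) \<subseteq> S" if "Poly_Mapping.keys x \<subseteq> S"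
    for c and x :: "'a \<Rightarrow>\<^sub>0 complex" using keys_scale[of c x] that by blast
  ultimately show ?thesis by (auto simp: subsp_def simp del: scale_simps)
qed

section \<open>The free algebra\<close>

definition fa :: "'g set \<Rightarrow> 'g falg set" where
  "fa G = {x. Poly_Mapping.keys x \<subseteq> lists G}"

lemma fa_keys: "x \<in> fa G \<Longrightarrow> w \<in> Poly_Mapping.keys x \<Longrightarrow> w \<in> lists G"
  by (auto simp: fa_def)

lemma elt_mult [simp]: "elt u * elt v = (elt (u @ v) :: 'g falg)"
  by (simp add: mult_single plus_list_def)

lemma gen_elt: "gen g = elt [g]"
  by (simp add: gen_def)

lemma one_elt: "(1 :: 'g falg) = elt []"
  by (metis single_one zero_list_def)

lemma scale_mult_left: "scale c x * y = scale c (x * y)" for x y :: "'g falg"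
proof -
  have sc: "scale c z = Poly_Mapping.single [] c * z" for z :: "'g falg"
    unfolding scale_def using mult_map_scale_conv_mult[of c z] by (simp add: zero_list_def)
  show ?thesis by (simp add: sc mult.assoc)
qed

lemma scale_conv_mult: "scale c x = Poly_Mapping.single [] c * x" for x :: "'g falg"
  unfolding scale_def using mult_map_scale_conv_mult[of c x] by (simp add: zero_list_def)

lemma lin_mult_const: "lin f \<Longrightarrow> lin (\<lambda>x. f x * (y :: 'g falg))"
  by (simp add: lin_def distrib_right scale_mult_left)

lemma scale_mult_right: "x * scale c y = scale c (x * y)" for x y :: "'g falg"
proof (rule lin_eq[where h = "\<lambda>x. x * scale c y" and h' = "\<lambda>x. scale c (x * y)"])
  fix w
  show "elt w * scale c y = scale c (elt w * y)"
  proof -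
    have "elt w * scale c y = (elt w * Poly_Mapping.single [] c) * y"
      by (simp add: scale_conv_mult mult.assoc)
    also have "\<dots> = scale c (elt w) * y"
      by (simp add: mult_single plus_list_def scale_single)
    finally show ?thesis by (simp only: scale_mult_left)
  qed
qed (intro lin_mult_const lin_scaled lin_id)+

lemma lin_const_mult: "lin f \<Longrightarrow> lin (\<lambda>x. (y :: 'g falg) * f x)"
  by (simp add: lin_def distrib_left scale_mult_right)

lemmas scale_mult = scale_mult_left scale_mult_right

lemma subsp_fa: "subsp (fa G)"
  unfolding fa_def by (rule subsp_supp)

lemma fa_mult [intro]: "x \<in> fa G \<Longrightarrow> y \<in> fa G \<Longrightarrow> x * y \<in> fa G"
  using keys_mult[of x y] by (fastforce simp: plus_list_def fa_def)

lemma fa_elt [simp]: "elt w \<in> fa G \<longleftrightarrow> w \<in> lists G"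
  by (simp add: fa_def)

lemma fa_gen [simp]: "gen g \<in> fa G \<longleftrightarrow> g \<in> G"
  by (simp add: gen_elt)

lemma fa_one [simp]: "1 \<in> fa G"
  by (simp add: one_elt)

lemma fa_linear [intro]:
  "x \<in> fa G \<Longrightarrow> y \<in> fa G \<Longrightarrow> x + y \<in> fa G"
  "x \<in> fa G \<Longrightarrow> y \<in> fa G \<Longrightarrow> x - y \<in> fa G"
  "x \<in> fa G \<Longrightarrow> - x \<in> fa G"
  "x \<in> fa G \<Longrightarrow> scale c x \<in> fa G"
  "(\<And>i. i \<in> A \<Longrightarrow> f i \<in> fa G) \<Longrightarrow> (\<Sum>i\<in>A. f i) \<in> fa G"
  by (auto simp: subsp_add[OF subsp_fa] subsp_diff[OF subsp_fa] subsp_uminus[OF subsp_fa]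
      subsp_scale[OF subsp_fa] intro: subsp_sum[OF subsp_fa])

lemma fa_0 [simp]: "0 \<in> fa G"
  by (rule subsp_0[OF subsp_fa])

lemma lin_fhom: "lin (fhom \<phi>)"
  unfolding fhom_def[abs_def] by (rule lin_linext)

lemma fhom_elt [simp]: "fhom \<phi> (elt w) = prod_list (map \<phi> w)"
  by (simp add: fhom_def)

lemma fhom_gen [simp]: "fhom \<phi> (gen g) = \<phi> g"
  by (simp add: gen_elt)

lemma fhom_one [simp]: "fhom \<phi> 1 = 1"
  by (simp add: one_elt)

lemma fhom_mult: "fhom \<phi> (x * y) = fhom \<phi> x * fhom \<phi> y"
  by (rule bilin_eq[where f = "\<lambda>x y. fhom \<phi> (x * y)" and g = "\<lambda>x y. fhom \<phi> x * fhom \<phi> y"])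
     ((intro lin_compose[OF lin_fhom] lin_mult_const lin_const_mult lin_id lin_fhom)+, simp)

lemma fhom_fa:
  assumes "\<And>g. g \<in> G \<Longrightarrow> \<phi> g \<in> fa H" "x \<in> fa G"
  shows "fhom \<phi> x \<in> fa H"
proof (rule lin_in[OF lin_fhom subsp_fa])
  fix w assume "w \<in> Poly_Mapping.keys x"
  then have "w \<in> lists G" using assms(2) by (auto dest: fa_keys)
  then show "fhom \<phi> (elt w) \<in> fa H"
  proof (induction w)
    case (Cons g w)
    then show ?case
      using fa_mult[OF assms(1)[of g], of "fhom \<phi> (elt w)"] by simp
  qed (simp add: one_elt)
qed

subsection \<open>Parity\<close>

definition homogen :: "('g \<Rightarrow> bit) \<Rightarrow> bit \<Rightarrow> 'g falg \<Rightarrow> bool" where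
  "homogen p a x \<longleftrightarrow> (\<forall>w\<in>Poly_Mapping.keys x. wpar p w = a)"

text \<open>The grading automorphism \<open>x \<mapsto> (-1)^(e [x]) x\<close>; with it the product rule of a superderivation also
  holds for factors that are not homogeneous.\<close>

definition twist :: "('g \<Rightarrow> bit) \<Rightarrow> bit \<Rightarrow> 'g falg \<Rightarrow> 'g falg" where
  "twist p e x = linext (\<lambda>w. scale (sg (e * wpar p w)) (elt w)) x"

lemma homogen_alt: "homogen p a x \<longleftrightarrow> x \<in> {x. Poly_Mapping.keys x \<subseteq> {w. wpar p w = a}}"
  by (auto simp: homogen_def)

lemma subsp_homogen: "subsp {x. homogen p a x}"
  using subsp_supp[of "{w. wpar p w = a}"] by (simp add: homogen_alt)

lemma homogen_0 [simp]: "homogen p a 0"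
  and homogen_elt [simp]: "homogen p a (elt w) \<longleftrightarrow> wpar p w = a"
  and homogen_gen [simp]: "homogen p a (gen g) \<longleftrightarrow> p g = a"
  by (simp_all add: homogen_def gen_elt)

lemma homogen_one: "homogen p a 1 \<longleftrightarrow> a = 0"
  by (metis homogen_elt one_elt wpar_simps(1))

lemma homogen_add: "homogen p a x \<Longrightarrow> homogen p a y \<Longrightarrow> homogen p a (x + y)"
  using subsp_add[OF subsp_homogen, of x p a y] by simp

lemma homogen_scale: "homogen p a x \<Longrightarrow> homogen p a (scale c x)"
  using subsp_scale[OF subsp_homogen, of x p a c] by simp

lemma homogen_uminus: "homogen p a x \<Longrightarrow> homogen p a (- x)"
  using subsp_uminus[OF subsp_homogen, of x p a] by simp

lemma homogen_sum: "(\<And>i. i \<in> A \<Longrightarrow> homogen p a (f i)) \<Longrightarrow> homogen p a (\<Sum>i\<in>A. f i)"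
  using subsp_sum[OF subsp_homogen, of A f p a] by simp

lemma homogen_mult:
  assumes "homogen p a x" "homogen p b y"
  shows "homogen p (a + b) (x * y)"
  unfolding homogen_def
proof
  fix w assume "w \<in> Poly_Mapping.keys (x * y)"
  then obtain u v where "w = u @ v" "u \<in> Poly_Mapping.keys x" "v \<in> Poly_Mapping.keys y"
    using keys_mult[of x y] by (auto simp: plus_list_def)
  with assms show "wpar p w = a + b"
    by (simp add: homogen_def)
qed

lemma lin_twist: "lin (twist p e)"
  unfolding twist_def[abs_def] by (rule lin_linext)

lemma twist_elt: "twist p e (elt w) = scale (sg (e * wpar p w)) (elt w)"
  by (simp add: twist_def)

lemma lin_scale_self: "lin (scale c)"
  by (rule lin_scaled[OF lin_id])

lemma twist_homogen:
  assumes "homogen p a x"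
  shows "twist p e x = scale (sg (e * a)) x"
proof (rule lin_eq_on[OF lin_twist lin_scale_self])
  fix w assume "w \<in> Poly_Mapping.keys x"
  with assms have "wpar p w = a" by (simp add: homogen_def)
  then show "twist p e (elt w) = scale (sg (e * a)) (elt w)" by (simp add: twist_elt)
qed

lemma homogen_fhom:
  assumes "\<And>g. g \<in> G \<Longrightarrow> homogen q (p g) (\<phi> g)" "x \<in> fa G" "homogen p a x"
  shows "homogen q a (fhom \<phi> x)"
proof -
  have word: "homogen q (wpar p w) (prod_list (map \<phi> w))" if "w \<in> lists G" for w
    using that
  proof (induction w)
    case (Cons g w)
    then have "homogen q (p g + wpar p w) (\<phi> g * prod_list (map \<phi> w))"
      by (intro homogen_mult assms(1)) auto
    then show ?case by simp
  qed (simp add: homogen_one)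
  have "fhom \<phi> x \<in> {x. homogen q a x}"
  proof (rule lin_in[OF lin_fhom subsp_homogen])
    fix w assume "w \<in> Poly_Mapping.keys x"
    with assms(2,3) have "w \<in> lists G" "wpar p w = a"
      by (auto simp: homogen_def dest: fa_keys)
    with word[of w] show "fhom \<phi> (elt w) \<in> {x. homogen q a x}" by simp
  qed
  then show ?thesis by simp
qed

subsection \<open>Superderivations\<close>

lemma lin_sder: "lin (sder p e d)"
  unfolding sder_def[abs_def] by (rule lin_linext)

lemma sder_elt [simp]: "sder p e d (elt w) = sder_word p e d w"
  by (simp add: sder_def)

lemma sder_gen [simp]: "sder p e d (gen g) = d g"
  by (simp add: gen_elt flip: one_elt)

lemma sder_one [simp]: "sder p e d 1 = 0"
  by (simp add: one_elt)

lemma sder_mult: "sder p e d (x * y) = sder p e d x * y + twist p e x * sder p e d y"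
proof (rule bilin_eq[where f = "\<lambda>x y. sder p e d (x * y)"
      and g = "\<lambda>x y. sder p e d x * y + twist p e x * sder p e d y"])
  fix u v :: "'a list"
  have "sder_word p e d (u @ v) = sder_word p e d u * elt v + scale (sg (e * wpar p u)) (elt u * sder_word p e d v)"
  proof (induction u)
    case (Cons g u)
    have "sder_word p e d ((g # u) @ v) = d g * elt (u @ v) + scale (sg (e * p g)) (gen g * sder_word p e d (u @ v))"
      by simp
    also have "\<dots> = (d g * elt u) * elt v + (scale (sg (e * p g)) (gen g * sder_word p e d u) * elt v
        + scale (sg (e * p g) * sg (e * wpar p u)) ((gen g * elt u) * sder_word p e d v))"
      by (simp only: Cons elt_mult[symmetric] distrib_left scale_add scale_mult mult.assoc scale_simps)
    also have "\<dots> = sder_word p e d (g # u) * elt v + scale (sg (e * wpar p (g # u))) (elt (g # u) * sder_word p e d v)"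
      by (simp add: gen_elt sg_add distrib_left algebra_simps)
    finally show ?case .
  qed (simp flip: one_elt)
  then show "sder p e d (elt u * elt v) = sder p e d (elt u) * elt v + twist p e (elt u) * sder p e d (elt v)"
    by (simp add: twist_elt scale_mult)
qed (intro lin_plus lin_compose[OF lin_sder] lin_mult_const lin_const_mult lin_id lin_twist lin_sder)+


section \<open>Relations in a free algebra\<close>

lemma carrier_free_alg [simp]: "carrier (free_alg G) = fa G"
  and ops_free_alg [simp]: "monoid.mult (free_alg G) = (*)" "one (free_alg G) = 1"
    "zero (free_alg G) = 0" "add (free_alg G) = (+)"
  by (simp_all add: free_alg_def fa_def)

lemma ring_free_alg: "ring (free_alg G)"
proof (rule ringI)
  show "abelian_group (free_alg G)"
  proof (rule abelian_groupI)
    fix x assume "x \<in> carrier (free_alg G)"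
    then show "\<exists>y\<in>carrier (free_alg G). y \<oplus>\<^bsub>free_alg G\<^esub> x = \<zero>\<^bsub>free_alg G\<^esub>"
      by (intro bexI[of _ "- x"]) auto
  qed (use fa_linear in \<open>simp_all add: add.assoc add.commute\<close>)
  show "monoid (free_alg G)"
    by (rule monoidI) (use fa_mult in \<open>simp_all add: mult.assoc\<close>)
qed (auto simp: distrib_left distrib_right)

abbreviation relid :: "'g set \<Rightarrow> 'g falg set \<Rightarrow> 'g falg set" where
  "relid G R \<equiv> Idl\<^bsub>free_alg G\<^esub> R"

lemma ideal_relid: "R \<subseteq> fa G \<Longrightarrow> ideal (relid G R) (free_alg G)"
  by (rule ring.genideal_ideal[OF ring_free_alg]) simp

lemma relid_gen: "R \<subseteq> fa G \<Longrightarrow> r \<in> R \<Longrightarrow> r \<in> relid G R"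
  using ring.genideal_self[OF ring_free_alg, of R G] by auto

lemma relid_fa: "R \<subseteq> fa G \<Longrightarrow> x \<in> relid G R \<Longrightarrow> x \<in> fa G"
  using ideal.Icarr[OF ideal_relid, of R G x] by simp

lemma relid_mult_left: "R \<subseteq> fa G \<Longrightarrow> x \<in> relid G R \<Longrightarrow> y \<in> fa G \<Longrightarrow> y * x \<in> relid G R"
  using ideal.I_l_closed[OF ideal_relid, of R G x y] by simp

lemma relid_mult_right: "R \<subseteq> fa G \<Longrightarrow> x \<in> relid G R \<Longrightarrow> y \<in> fa G \<Longrightarrow> x * y \<in> relid G R"
  using ideal.I_r_closed[OF ideal_relid, of R G x y] by simp

lemma subsp_relid: 
  assumes "R \<subseteq> fa G"
  shows "subsp (relid G R)"
proof -
  have "0 \<in> relid G R"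
    using additive_subgroup.zero_closed[OF ideal.axioms(1)[OF ideal_relid[OF assms]]] by simp
  moreover have "x + y \<in> relid G R" if "x \<in> relid G R" "y \<in> relid G R" for x y
    using additive_subgroup.a_closed[OF ideal.axioms(1)[OF ideal_relid[OF assms]] that] by simp
  moreover have "scale c x \<in> relid G R" if "x \<in> relid G R" for c x
    unfolding scale_conv_mult
    by (rule relid_mult_left[OF assms that]) (simp add: fa_def)
  ultimately show ?thesis by (auto simp: subsp_def)
qed

text \<open>An additive map sends an ideal into a subgroup as soon as it does so for all two-sided
  multiples of the generators: the elements all of whose two-sided multiples are sent there form an
  ideal.\<close>

lemma genideal_additive_in:
  fixes h :: "'a \<Rightarrow> 'b :: ab_group_add"
  assumes "ring A" and S: "S \<subseteq> carrier A"
    and add: "\<And>x y. x \<in> carrier A \<Longrightarrow> y \<in> carrier A \<Longrightarrow> h (x \<oplus>\<^bsub>A\<^esub> y) = h x + h y"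
    and K: "0 \<in> K" "\<And>x y. x \<in> K \<Longrightarrow> y \<in> K \<Longrightarrow> x + y \<in> K" "\<And>x. x \<in> K \<Longrightarrow> - x \<in> K"
    and *: "\<And>r y z. r \<in> S \<Longrightarrow> y \<in> carrier A \<Longrightarrow> z \<in> carrier A \<Longrightarrow> h (y \<otimes>\<^bsub>A\<^esub> r \<otimes>\<^bsub>A\<^esub> z) \<in> K"
    and x: "x \<in> Idl\<^bsub>A\<^esub> S"
  shows "h x \<in> K"
proof -
  interpret ring A by fact
  define J where "J = {x \<in> carrier A. \<forall>y\<in>carrier A. \<forall>z\<in>carrier A. h (y \<otimes>\<^bsub>A\<^esub> x \<otimes>\<^bsub>A\<^esub> z) \<in> K}"
  have h0: "h \<zero>\<^bsub>A\<^esub> = 0"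
    using add[of "\<zero>\<^bsub>A\<^esub>" "\<zero>\<^bsub>A\<^esub>"] by simp
  have hneg: "h (\<ominus>\<^bsub>A\<^esub> x) = - h x" if "x \<in> carrier A" for x
    using add[of x "\<ominus>\<^bsub>A\<^esub> x"] that h0 by (simp add: r_neg eq_neg_iff_add_eq_0 add.commute)
  have "ideal J A"
  proof (rule idealI[OF \<open>ring A\<close>])
    show "subgroup J (add_monoid A)"
    proof (rule add.subgroupI)
      show "J \<noteq> {}" using K(1) h0 by (auto simp: J_def)
      fix a assume "a \<in> J"
      then show "\<ominus>\<^bsub>A\<^esub> a \<in> J"
        using K(3) by (auto simp: J_def r_minus l_minus hneg)
    qed (use K(2) in \<open>auto simp: J_def r_distr l_distr add\<close>)
  qed (auto simp: J_def m_assoc[symmetric], auto simp: J_def m_assoc)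
  moreover have "S \<subseteq> J" using S * by (auto simp: J_def)
  ultimately have "Idl\<^bsub>A\<^esub> S \<subseteq> J" by (rule genideal_minimal)
  with x have "x \<in> J" by blast
  then have "h (\<one>\<^bsub>A\<^esub> \<otimes>\<^bsub>A\<^esub> x \<otimes>\<^bsub>A\<^esub> \<one>\<^bsub>A\<^esub>) \<in> K" "x \<in> carrier A" unfolding J_def by blast+
  then show ?thesis by simp
qed

text \<open>The ideal is spanned by the multiples of the relators by words.\<close>

lemma relid_lin_in:
  assumes R: "R \<subseteq> fa G" and "lin h" "subsp K"
    and *: "\<And>r u v. r \<in> R \<Longrightarrow> u \<in> lists G \<Longrightarrow> v \<in> lists G \<Longrightarrow> h (elt u * r * elt v) \<in> K"
    and x: "x \<in> relid G R"
  shows "h x \<in> K"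
proof (rule genideal_additive_in[OF ring_free_alg, where h = h and S = R])
  fix r y z assume r: "r \<in> R" and yz: "y \<in> carrier (free_alg G)" "z \<in> carrier (free_alg G)"
  have "h (y * r * z) \<in> K"
  proof (rule lin_in[where h = "\<lambda>y. h (y * r * z)" and x = y, OF _ \<open>subsp K\<close>])
    show "lin (\<lambda>y. h (y * r * z))"
      by (intro lin_compose[OF \<open>lin h\<close>] lin_mult_const lin_id)
    fix u assume u: "u \<in> Poly_Mapping.keys y"
    show "h (elt u * r * z) \<in> K"
    proof (rule lin_in[where h = "\<lambda>z. h (elt u * r * z)" and x = z, OF _ \<open>subsp K\<close>])
      show "lin (\<lambda>z. h (elt u * r * z))"
        by (intro lin_compose[OF \<open>lin h\<close>] lin_const_mult lin_id)
    qed (rule *, use r u yz fa_keys in \<open>simp_all\<close>)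
  qed
  then show "h (y \<otimes>\<^bsub>free_alg G\<^esub> r \<otimes>\<^bsub>free_alg G\<^esub> z) \<in> K" by simp
qed (use R x \<open>subsp K\<close> in \<open>auto simp: lin_add[OF \<open>lin h\<close>] subsp_0 subsp_add subsp_uminus\<close>)

definition cong :: "'g set \<Rightarrow> 'g falg set \<Rightarrow> 'g falg \<Rightarrow> 'g falg \<Rightarrow> bool" where
  "cong G R x y \<longleftrightarrow> x - y \<in> relid G R"

lemma cong_refl: "R \<subseteq> fa G \<Longrightarrow> cong G R x x"
  using subsp_0[OF subsp_relid] by (auto simp: cong_def)

lemma cong_sym: "R \<subseteq> fa G \<Longrightarrow> cong G R x y \<Longrightarrow> cong G R y x"
  using subsp_uminus[OF subsp_relid, of R G "x - y"] by (auto simp: cong_def)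

lemma cong_trans: "R \<subseteq> fa G \<Longrightarrow> cong G R x y \<Longrightarrow> cong G R y z \<Longrightarrow> cong G R x z"
  using subsp_add[OF subsp_relid, of R G "x - y" "y - z"] by (auto simp: cong_def)

lemma cong_add: "R \<subseteq> fa G \<Longrightarrow> cong G R x y \<Longrightarrow> cong G R x' y' \<Longrightarrow> cong G R (x + x') (y + y')"
  using subsp_add[OF subsp_relid, of R G "x - y" "x' - y'"] by (auto simp: cong_def algebra_simps)

lemma cong_scale: "R \<subseteq> fa G \<Longrightarrow> cong G R x y \<Longrightarrow> cong G R (scale c x) (scale c y)"
  using subsp_scale[OF subsp_relid, of R G "x - y" c] by (auto simp: cong_def scale_diff)

lemma cong_sum: "R \<subseteq> fa G \<Longrightarrow> (\<And>i. i \<in> A \<Longrightarrow> cong G R (f i) (g i)) \<Longrightarrow> cong G R (\<Sum>i\<in>A. f i) (\<Sum>i\<in>A. g i)"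
  using subsp_sum[OF subsp_relid, of R G A "\<lambda>i. f i - g i"] by (auto simp: cong_def sum_subtractf)

lemma cong_mult:
  assumes "R \<subseteq> fa G" "cong G R x y" "cong G R x' y'" "x \<in> fa G" "y' \<in> fa G"
  shows "cong G R (x * x') (y * y')"
proof -
  have "x * (x' - y') + (x - y) * y' \<in> relid G R"
    using assms by (intro subsp_add[OF subsp_relid] relid_mult_left relid_mult_right) (auto simp: cong_def)
  then show ?thesis by (simp add: cong_def algebra_simps)
qed

lemma cong_fa: "R \<subseteq> fa G \<Longrightarrow> cong G R x y \<Longrightarrow> y \<in> fa G \<Longrightarrow> x \<in> fa G"
  using relid_fa[of R G "x - y"] subsp_add[OF subsp_fa, of "x - y" G y] by (simp add: cong_def)

section \<open>Presented superalgebras\<close>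

lemma residue_eq: "R \<subseteq> fa G \<Longrightarrow> x \<in> fa G \<Longrightarrow> y \<in> fa G \<Longrightarrow> residue G R x = residue G R y \<longleftrightarrow> cong G R x y"
proof -
  assume R: "R \<subseteq> fa G" and xy: "x \<in> fa G" "y \<in> fa G"
  have res: "residue G R z = {i + z | i. i \<in> relid G R}" for z
    by (auto simp: residue_def a_r_coset_def r_coset_def)
  show "residue G R x = residue G R y \<longleftrightarrow> cong G R x y"
  proof
    assume "residue G R x = residue G R y"
    moreover have "x \<in> residue G R x"
      using subsp_0[OF subsp_relid[OF R]] by (auto simp: res intro: exI[of _ 0])
    ultimately obtain i where "i \<in> relid G R" "x = i + y" by (auto simp: res)
    then show "cong G R x y" by (simp add: cong_def)
  next
    have sub: "residue G R x \<subseteq> residue G R y" if "cong G R x y" for x y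
    proof
      fix z assume "z \<in> residue G R x"
      then obtain i where i: "i \<in> relid G R" "z = i + x" by (auto simp: res)
      then have "i + (x - y) \<in> relid G R" "z = (i + (x - y)) + y"
        using that subsp_add[OF subsp_relid[OF R]] by (auto simp: cong_def)
      then show "z \<in> residue G R y" by (auto simp only: res)
    qed
    assume "cong G R x y"
    then show "residue G R x = residue G R y"
      using sub[of x y] sub[of y x] cong_sym[OF R] by blast
  qed
qed

lemma residue_cong: "R \<subseteq> fa G \<Longrightarrow> y \<in> fa G \<Longrightarrow> cong G R x y \<Longrightarrow> residue G R x = residue G R y"
  using residue_eq[of R G x y] cong_fa[of R G x y] by simp

lemma residue_self: "R \<subseteq> fa G \<Longrightarrow> x \<in> residue G R x"
  using subsp_0[OF subsp_relid, of R G] by (auto simp: residue_def a_r_coset_def r_coset_def intro!: exI[of _ 0])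

lemma residue_mem: "R \<subseteq> fa G \<Longrightarrow> y \<in> residue G R x \<longleftrightarrow> cong G R y x"
  by (auto simp: residue_def a_r_coset_def r_coset_def cong_def intro!: bexI[of _ "y - x"])

lemma carrier_presented: "carrier (presented G p R) = residue G R ` fa G"
  by (auto simp: presented_def Let_def FactRing_def A_RCOSETS_def RCOSETS_def residue_def a_r_coset_def)

lemma presented_add:
  assumes "R \<subseteq> fa G" "x \<in> fa G" "y \<in> fa G"
  shows "residue G R x \<oplus>\<^bsub>presented G p R\<^esub> residue G R y = residue G R (x + y)"
proof -
  interpret ideal "relid G R" "free_alg G" by (rule ideal_relid[OF assms(1)])
  show ?thesis
    using a_rcos_sum[of x y] assms(2,3) by (simp add: presented_def Let_def FactRing_def residue_def)
qed

lemma presented_mult: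
  assumes "R \<subseteq> fa G" "x \<in> fa G" "y \<in> fa G"
  shows "residue G R x \<otimes>\<^bsub>presented G p R\<^esub> residue G R y = residue G R (x * y)"
proof -
  interpret ideal "relid G R" "free_alg G" by (rule ideal_relid[OF assms(1)])
  show ?thesis
    using rcoset_mult_add[of x y] assms(2,3) by (simp add: presented_def Let_def FactRing_def residue_def)
qed

lemma presented_one: "\<one>\<^bsub>presented G p R\<^esub> = residue G R 1"
  by (simp add: presented_def Let_def FactRing_def residue_def)

lemma presented_zero: 
  assumes "R \<subseteq> fa G"
  shows "\<zero>\<^bsub>presented G p R\<^esub> = residue G R 0"
proof -
  interpret ideal "relid G R" "free_alg G" by (rule ideal_relid[OF assms(1)])
  show ?thesis
    by (auto simp: presented_def Let_def FactRing_def residue_def a_r_coset_def r_coset_def)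
qed

lemma presented_smult:
  assumes "R \<subseteq> fa G" "x \<in> fa G"
  shows "c \<odot>\<^bsub>presented G p R\<^esub> residue G R x = residue G R (scale c x)"
proof -
  have "Poly_Mapping.single [] c \<in> fa G" by (simp add: fa_def)
  then show ?thesis
    using presented_mult[OF assms(1) _ assms(2), of "Poly_Mapping.single [] c" p] 
    by (simp add: scale_conv_mult presented_def Let_def)
qed

lemma descend_residue:
  assumes "R \<subseteq> fa G" "x \<in> fa G" "\<And>y. cong G R y x \<Longrightarrow> \<phi> y = \<phi> x"
  shows "descend \<phi> (residue G R x) = \<phi> x"
proof -
  have "\<phi> ` residue G R x = {\<phi> x}"
    using assms(3) residue_mem[OF assms(1)] residue_self[OF assms(1)] by blast
  then show ?thesis by (simp add: descend_def)
qed

section \<open>The relations of supercommutativity\<close>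

abbreviation scr :: "'g set \<Rightarrow> ('g \<Rightarrow> bit) \<Rightarrow> 'g falg set" where
  "scr \<equiv> scomm_rels"

lemma scr_fa: "scr G p \<subseteq> fa G"
proof
  fix x assume "x \<in> scr G p"
  then obtain g h where "g \<in> G" "h \<in> G" "x = gen g * gen h - scale (sg (p g * p h)) (gen h * gen g)"
    by (auto simp: scomm_rels_def)
  then show "x \<in> fa G"
    by (simp only:, intro fa_linear fa_mult) simp_all
qed

abbreviation scong :: "'g set \<Rightarrow> ('g \<Rightarrow> bit) \<Rightarrow> 'g falg \<Rightarrow> 'g falg \<Rightarrow> bool" where
  "scong G p \<equiv> cong G (scr G p)"

lemmas scong_refl = cong_refl[OF scr_fa]
lemmas scong_sym = cong_sym[OF scr_fa]
lemmas scong_trans [trans] = cong_trans[OF scr_fa]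
lemmas scong_add = cong_add[OF scr_fa]
lemmas scong_scale = cong_scale[OF scr_fa]
lemmas scong_sum = cong_sum[OF scr_fa]
lemmas scong_mult = cong_mult[OF scr_fa]
lemmas subsp_scr = subsp_relid[OF scr_fa]

lemma scong_swap:
  assumes "u \<in> lists G" "v \<in> lists G" "g \<in> G" "h \<in> G"
  shows "scong G p (elt (u @ [g, h] @ v)) (scale (sg (p g * p h)) (elt (u @ [h, g] @ v)))"
proof -
  have "gen g * gen h - scale (sg (p g * p h)) (gen h * gen g) \<in> relid G (scr G p)"
    using assms(3,4) unfolding scomm_rels_def by (intro relid_gen[OF scr_fa[unfolded scomm_rels_def]]) blast
  then have "elt u * (gen g * gen h - scale (sg (p g * p h)) (gen h * gen g)) * elt v \<in> relid G (scr G p)"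
    using assms by (intro relid_mult_left[OF scr_fa] relid_mult_right[OF scr_fa]) auto
  then show ?thesis
    by (simp add: cong_def gen_elt right_diff_distrib left_diff_distrib scale_mult)
qed

text \<open>The ideal of supercommutativity is spanned by the signed differences of words that differ by the
  exchange of two neighbouring letters.\<close>

lemma scr_lin_in:
  assumes "lin h" "subsp K"
    and "\<And>u v g g'. u \<in> lists G \<Longrightarrow> v \<in> lists G \<Longrightarrow> g \<in> G \<Longrightarrow> g' \<in> G \<Longrightarrow>
      h (elt (u @ [g, g'] @ v)) - scale (sg (p g * p g')) (h (elt (u @ [g', g] @ v))) \<in> K"
    and "x \<in> relid G (scr G p)"
  shows "h x \<in> K"
proof (rule relid_lin_in[OF scr_fa assms(1,2) _ assms(4)])
  fix r u v assume r: "r \<in> scr G p" and uv: "u \<in> lists G" "v \<in> lists G"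
  from r obtain g g' where g: "g \<in> G" "g' \<in> G"
    "r = gen g * gen g' - scale (sg (p g * p g')) (gen g' * gen g)"
    by (auto simp: scomm_rels_def)
  have "elt u * r * elt v = elt (u @ [g, g'] @ v) - scale (sg (p g * p g')) (elt (u @ [g', g] @ v))"
    by (simp add: g gen_elt right_diff_distrib left_diff_distrib scale_mult)
  then show "h (elt u * r * elt v) \<in> K"
    using assms(3)[OF uv g(1,2)] by (simp only: lin_diff[OF assms(1)] lin_scale[OF assms(1)])
qed

text \<open>Letters are moved past each other one at a time, and a homogeneous element is a combination of
  words of the same parity.\<close>

lemma scong_commute:
  assumes x: "x \<in> fa G" "homogen p a x" and y: "y \<in> fa G" "homogen p b y"
  shows "scong G p (x * y) (scale (sg (a * b)) (y * x))"
proof -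
  have letter: "scong G p (elt [g] * elt v) (scale (sg (p g * wpar p v)) (elt v * elt [g]))"
    if "g \<in> G" "v \<in> lists G" for g v
    using that(2)
  proof (induction v)
    case Nil
    then show ?case by (simp add: scong_refl)
  next
    case (Cons h v)
    have "scong G p (elt (g # h # v)) (scale (sg (p g * p h)) (elt (h # g # v)))"
      using scong_swap[of "[]" G v g h p] Cons that by simp
    also have "scong G p (scale (sg (p g * p h)) (elt (h # g # v)))
        (scale (sg (p g * p h)) (elt [h] * scale (sg (p g * wpar p v)) (elt v * elt [g])))"
    proof (rule scong_scale)
      have "scong G p (elt [h] * (elt [g] * elt v)) (elt [h] * scale (sg (p g * wpar p v)) (elt v * elt [g]))"
        using Cons that subsp_scale[OF subsp_fa]
        by (intro scong_mult scong_refl Cons.IH) auto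
      then show "scong G p (elt (h # g # v)) (elt [h] * scale (sg (p g * wpar p v)) (elt v * elt [g]))"
        by simp
    qed
    finally show ?case
      by (simp add: scale_mult sg_add distrib_left)
  qed
  have words: "scong G p (elt u * elt v) (scale (sg (wpar p u * wpar p v)) (elt v * elt u))"
    if "u \<in> lists G" "v \<in> lists G" for u v
    using that(1)
  proof (induction u)
    case Nil
    then show ?case by (simp add: scong_refl)
  next
    case (Cons g u)
    have "scong G p (elt [g] * (elt u * elt v)) (elt [g] * scale (sg (wpar p u * wpar p v)) (elt v * elt u))"
      using Cons that by (intro scong_mult scong_refl Cons.IH) auto
    also have "scong G p (elt [g] * scale (sg (wpar p u * wpar p v)) (elt v * elt u))
       (scale (sg (wpar p u * wpar p v)) (scale (sg (p g * wpar p v)) (elt v * elt [g]) * elt u))"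
    proof -
      have "scong G p ((elt [g] * elt v) * elt u) (scale (sg (p g * wpar p v)) (elt v * elt [g]) * elt u)"
        using Cons that by (intro scong_mult scong_refl letter) auto
      then have "scong G p (scale (sg (wpar p u * wpar p v)) ((elt [g] * elt v) * elt u))
         (scale (sg (wpar p u * wpar p v)) (scale (sg (p g * wpar p v)) (elt v * elt [g]) * elt u))"
        by (rule scong_scale)
      then show ?thesis by (simp add: scale_mult)
    qed
    finally show ?case
      by (simp add: sg_add distrib_left scale_mult mult_ac)
  qed
  have "x * y - scale (sg (a * b)) (y * x) \<in> relid G (scr G p)"
  proof (rule lin_in[where h = "\<lambda>x. x * y - scale (sg (a * b)) (y * x)" and x = x, OF _ subsp_scr])
    show "lin (\<lambda>x. x * y - scale (sg (a * b)) (y * x))"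
      by (intro lin_minus lin_scaled lin_mult_const lin_const_mult lin_id)
    fix u assume u: "u \<in> Poly_Mapping.keys x"
    show "elt u * y - scale (sg (a * b)) (y * elt u) \<in> relid G (scr G p)"
    proof (rule lin_in[where h = "\<lambda>y. elt u * y - scale (sg (a * b)) (y * elt u)" and x = y, OF _ subsp_scr])
      show "lin (\<lambda>y. elt u * y - scale (sg (a * b)) (y * elt u))"
        by (intro lin_minus lin_scaled lin_mult_const lin_const_mult lin_id)
      fix v assume v: "v \<in> Poly_Mapping.keys y"
      from x y u v have "u \<in> lists G" "v \<in> lists G" "wpar p u = a" "wpar p v = b"
        by (auto simp: homogen_def dest: fa_keys)
      with words[of u v] show "elt u * elt v - scale (sg (a * b)) (elt v * elt u) \<in> relid G (scr G p)"
        by (simp add: cong_def)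
    qed
  qed
  then show ?thesis by (simp add: cong_def)
qed

lemma sder_fa:
  assumes "\<And>g. g \<in> G \<Longrightarrow> d g \<in> fa G" "x \<in> fa G"
  shows "sder p e d x \<in> fa G"
proof (rule lin_in[OF lin_sder subsp_fa])
  fix w assume "w \<in> Poly_Mapping.keys x"
  then have "w \<in> lists G" using assms(2) by (auto dest: fa_keys)
  then show "sder p e d (elt w) \<in> fa G"
  proof (induction w)
    case (Cons g w)
    then have "d g * elt w \<in> fa G" "gen g * sder_word p e d w \<in> fa G"
      using assms(1)[of g] by auto
    then show ?case
      by auto
  qed simp
qed

text \<open>A homogeneous superderivation of the free algebra preserves the relations of
  supercommutativity: it supercommutes past each generator up to elements which are themselves
  homogeneous, so its value on a relator is again a sum of supercommutators.\<close>

lemma sder_scr: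
  assumes d: "\<And>g. g \<in> G \<Longrightarrow> d g \<in> fa G" "\<And>g. g \<in> G \<Longrightarrow> homogen p (e + p g) (d g)"
    and x: "x \<in> relid G (scr G p)"
  shows "sder p e d x \<in> relid G (scr G p)"
proof (rule relid_lin_in[OF scr_fa lin_sder subsp_scr _ x])
  fix r u v assume r: "r \<in> scr G p" and uv: "u \<in> lists G" "v \<in> lists G"
  from r obtain g h where g: "g \<in> G" "h \<in> G"
    and r_eq: "r = gen g * gen h - scale (sg (p g * p h)) (gen h * gen g)"
    by (auto simp: scomm_rels_def)
  have gfa: "gen g \<in> fa G" "gen h \<in> fa G" using g by (auto simp: gen_elt)
  have rI: "r \<in> relid G (scr G p)" using relid_gen[OF scr_fa r] .
  have rh: "homogen p (p g + p h) r"
    unfolding r_eq gen_elt elt_mult diff_conv_add_uminus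
    by (intro homogen_add homogen_uminus homogen_scale) (simp_all add: add.commute)
  have c1: "scong G p (d g * gen h) (scale (sg ((e + p g) * p h)) (gen h * d g))"
    using g d gfa by (intro scong_commute) auto
  have c2: "scong G p (gen g * d h) (scale (sg (p g * (e + p h))) (d h * gen g))"
    using g d gfa by (intro scong_commute) auto
  have tw: "twist p e (gen z) = scale (sg (e * p z)) (gen z)" for z
    by (rule twist_homogen) simp
  have "sder p e d r = (d g * gen h + scale (sg (e * p g)) (gen g * d h))
      - scale (sg (p g * p h)) (d h * gen g + scale (sg (e * p h)) (gen h * d g))"
    by (simp add: r_eq lin_diff[OF lin_sder] lin_scale[OF lin_sder] sder_mult tw scale_mult scale_add)
  also have "\<dots> = (d g * gen h - scale (sg ((e + p g) * p h)) (gen h * d g))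
      + scale (sg (e * p g)) (gen g * d h - scale (sg (p g * (e + p h))) (d h * gen g))"
  proof -
    have "sg (p g * p h) * sg (e * p h) = sg ((e + p g) * p h)"
      by (simp add: distrib_right sg_add)
    moreover have "sg (e * p g) * sg (p g * (e + p h)) = sg (p g * p h)"
      by (simp add: distrib_left sg_add mult_ac)
    ultimately show ?thesis
      by (simp add: scale_add scale_diff algebra_simps)
  qed
  also have "\<dots> \<in> relid G (scr G p)"
    using c1 c2 by (intro subsp_add[OF subsp_scr] subsp_scale[OF subsp_scr]) (auto simp: cong_def)
  finally have dr: "sder p e d r \<in> relid G (scr G p)" .
  have "sder p e d (elt u * r * elt v) = (sder p e d (elt u) * r) * elt v
      + scale (sg (e * wpar p u)) (elt u * (sder p e d r * elt v))
      + scale (sg (e * wpar p u)) (scale (sg (e * (p g + p h))) (elt u * (r * sder p e d (elt v))))"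
    by (simp add: sder_mult twist_homogen[OF rh] twist_elt scale_mult scale_add distrib_right
        distrib_left mult.assoc mult.commute[of "sg _" "sg _"] del: sder_elt)
  also have "\<dots> \<in> relid G (scr G p)"
    using uv rI dr sder_fa[of G d "elt u" p e] sder_fa[of G d "elt v" p e] d(1)
    by (intro subsp_add[OF subsp_scr] subsp_scale[OF subsp_scr] relid_mult_left[OF scr_fa] relid_mult_right[OF scr_fa]) 
       auto
  finally show "sder p e d (elt u * r * elt v) \<in> relid G (scr G p)" .
qed


section \<open>Homomorphisms and superderivations\<close>

text \<open>The images of the generators are homogeneous, hence supercommute.\<close>

lemma fhom_scr:
  assumes \<phi>: "\<And>g. g \<in> G \<Longrightarrow> \<phi> g \<in> fa H" "\<And>g. g \<in> G \<Longrightarrow> homogen q (p g) (\<phi> g)"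
    and x: "x \<in> relid G (scr G p)"
  shows "fhom \<phi> x \<in> relid H (scr H q)"
proof (rule relid_lin_in[OF scr_fa lin_fhom subsp_scr _ x])
  fix r u v assume r: "r \<in> scr G p" and uv: "u \<in> lists G" "v \<in> lists G"
  from r obtain g h where g: "g \<in> G" "h \<in> G"
    and r_eq: "r = gen g * gen h - scale (sg (p g * p h)) (gen h * gen g)"
    by (auto simp: scomm_rels_def)
  have "scong H q (\<phi> g * \<phi> h) (scale (sg (p g * p h)) (\<phi> h * \<phi> g))"
    using g \<phi> by (intro scong_commute) auto
  then have "fhom \<phi> r \<in> relid H (scr H q)"
    by (simp add: r_eq lin_diff[OF lin_fhom] lin_scale[OF lin_fhom] fhom_mult cong_def)
  moreover have "fhom \<phi> (elt w) \<in> fa H" if "w \<in> lists G" for w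
    using that by (intro fhom_fa[OF \<phi>(1)]) auto
  ultimately show "fhom \<phi> (elt u * r * elt v) \<in> relid H (scr H q)"
    unfolding fhom_mult using uv by (intro relid_mult_left[OF scr_fa] relid_mult_right[OF scr_fa])
qed

text \<open>Along the homomorphism both sides obey the product rule of a superderivation, so they need to be
  compared on generators only.\<close>

lemma sder_fhom:
  assumes "\<And>g. g \<in> G \<Longrightarrow> homogen q (p g) (\<phi> g)"
    and "\<And>g. g \<in> G \<Longrightarrow> sder q e d' (\<phi> g) = fhom \<phi> (d g)"
    and x: "x \<in> fa G"
  shows "sder q e d' (fhom \<phi> x) = fhom \<phi> (sder p e d x)"
proof (rule lin_eq_on[where h = "\<lambda>x. sder q e d' (fhom \<phi> x)" and h' = "\<lambda>x. fhom \<phi> (sder p e d x)"])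
  fix w assume "w \<in> Poly_Mapping.keys x"
  then have "w \<in> lists G" using x by (auto dest: fa_keys)
  then show "sder q e d' (fhom \<phi> (elt w)) = fhom \<phi> (sder p e d (elt w))"
  proof (induction w)
    case Nil
    then show ?case by (simp add: lin_0[OF lin_fhom])
  next
    case (Cons g w)
    then have g: "g \<in> G" by simp
    have "sder q e d' (fhom \<phi> (elt (g # w)))
        = sder q e d' (\<phi> g) * fhom \<phi> (elt w) + twist q e (\<phi> g) * sder q e d' (fhom \<phi> (elt w))"
      by (simp add: sder_mult)
    also have "\<dots> = fhom \<phi> (d g) * fhom \<phi> (elt w)
        + scale (sg (e * p g)) (\<phi> g) * fhom \<phi> (sder p e d (elt w))"
      using Cons assms(2)[OF g] by (simp add: twist_homogen[OF assms(1)[OF g]])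
    also have "\<dots> = fhom \<phi> (sder p e d (elt (g # w)))"
      by (simp add: lin_add[OF lin_fhom] lin_scale[OF lin_fhom] fhom_mult scale_mult)
    finally show ?case .
  qed
qed (intro lin_compose[OF lin_sder] lin_compose[OF lin_fhom] lin_fhom lin_sder)+

lemma sder_zero: "sder p e (\<lambda>_. 0) x = 0"
proof (rule lin_eq[OF lin_sder lin_const0])
  fix w show "sder p e (\<lambda>_. 0) (elt w) = 0"
    by (induction w) simp_all
qed

lemma sder_fhom_zero:
  assumes "\<And>g. g \<in> G \<Longrightarrow> homogen q (p g) (\<phi> g)" "\<And>g. g \<in> G \<Longrightarrow> sder q e d (\<phi> g) = 0" "x \<in> fa G"
  shows "sder q e d (fhom \<phi> x) = 0"
  using sder_fhom[of G q p \<phi> e d "\<lambda>_. 0" x] assms by (simp add: sder_zero lin_0[OF lin_fhom])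

lemma fhom_fhom:
  assumes "\<And>g. g \<in> G \<Longrightarrow> fhom \<theta> (\<phi> g) = gen g" "x \<in> fa G"
  shows "fhom \<theta> (fhom \<phi> x) = x"
proof (rule lin_eq_on[where h = "\<lambda>x. fhom \<theta> (fhom \<phi> x)" and h' = "\<lambda>x. x"])
  fix w assume "w \<in> Poly_Mapping.keys x"
  then have "w \<in> lists G" using assms(2) by (auto dest: fa_keys)
  then show "fhom \<theta> (fhom \<phi> (elt w)) = elt w"
    by (induction w) (simp_all add: fhom_mult assms(1) one_elt gen_elt)
qed (intro lin_compose[OF lin_fhom] lin_fhom lin_id)+

section \<open>The action of gl(m|n) and the elements X\<close>

lemma gpar_simp [simp]: "gpar k m (a, i) = par k a + par m i"
  by (simp add: gpar_def)

lemma ppar_simps [simp]: "ppar k r m (Inl t) = gpar k m t" "ppar k r m (Inr t) = gpar r m t"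
  by (simp_all add: ppar_def)

lemma P_gens_iff [simp]:
  "Inl (a, i) \<in> P_gens k l r s m n \<longleftrightarrow> a < k + l \<and> i < m + n"
  "Inr (b, i) \<in> P_gens k l r s m n \<longleftrightarrow> b < r + s \<and> i < m + n"
  by (auto simp: P_gens_def)

lemma M_gens_iff [simp]: "(a, b) \<in> M_gens k l r s \<longleftrightarrow> a < k + l \<and> b < r + s"
  by (auto simp: M_gens_def)

lemma P_gens_cases:
  assumes "g \<in> P_gens k l r s m n"
  obtains a i where "g = Inl (a, i)" "a < k + l" "i < m + n"
  | b i where "g = Inr (b, i)" "b < r + s" "i < m + n"
  using assms by (auto simp: P_gens_def)

lemma gl_on_gen_simps:
  "gl_on_gen m n x (Inl (a, i)) = (\<Sum>c<m + n. scale (x $$ (c, i)) (gen (Inl (a, c))))"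
  "gl_on_gen m n x (Inr (b, i)) =
     - (\<Sum>d<m + n. scale (sg (par m i * (par m d + par m i)) * x $$ (i, d)) (gen (Inr (b, d))))"
  by (simp_all add: gl_on_gen_def)

lemma gl_on_gen_fa: "g \<in> P_gens k l r s m n \<Longrightarrow> gl_on_gen m n x g \<in> fa (P_gens k l r s m n)"
  by (erule P_gens_cases) (auto simp: gl_on_gen_simps intro!: fa_linear)

text \<open>Homogeneity of parity \<open>e\<close>, asked for where the entries of a matrix of size \<open>N\<close> are specified.\<close>

definition parmat :: "nat \<Rightarrow> nat \<Rightarrow> bit \<Rightarrow> complex mat \<Rightarrow> bool" where
  "parmat m N e x \<longleftrightarrow> (\<forall>i<N. \<forall>j<N. par m i + par m j \<noteq> e \<longrightarrow> x $$ (i, j) = 0)"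

lemma parmat_homog_part: "x \<in> carrier_mat N N \<Longrightarrow> parmat m N e (homog_part m e x)"
  by (auto simp: parmat_def homog_part_def)

lemma homogen_scale_cond: "(c \<noteq> 0 \<Longrightarrow> homogen p a x) \<Longrightarrow> homogen p a (scale c x)"
  by (cases "c = 0") (auto intro: homogen_scale)

lemma gl_on_gen_homogen:
  assumes "parmat m (m + n) e x" "g \<in> P_gens k l r s m n"
  shows "homogen (ppar k r m) (e + ppar k r m g) (gl_on_gen m n x g)"
  using assms(2)
proof (cases rule: P_gens_cases)
  case (1 a i)
  have "homogen (ppar k r m) (e + (par k a + par m i)) (scale (x $$ (c, i)) (gen (Inl (a, c))))"
    if "c < m + n" for c
  proof (rule homogen_scale_cond)
    assume "x $$ (c, i) \<noteq> 0"
    then have "e = par m c + par m i" using assms(1) that 1 by (auto simp: parmat_def)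
    then show "homogen (ppar k r m) (e + (par k a + par m i)) (gen (Inl (a, c)))"
      by (simp add: ac_simps)
  qed
  then show ?thesis using 1 by (auto simp: gl_on_gen_simps intro!: homogen_sum)
next
  case (2 b i)
  have "homogen (ppar k r m) (e + (par r b + par m i))
      (scale (sg (par m i * (par m d + par m i)) * x $$ (i, d)) (gen (Inr (b, d))))"
    if "d < m + n" for d
  proof (rule homogen_scale_cond)
    assume "sg (par m i * (par m d + par m i)) * x $$ (i, d) \<noteq> 0"
    then have "e = par m i + par m d" using assms(1) that 2 by (auto simp: parmat_def)
    then show "homogen (ppar k r m) (e + (par r b + par m i)) (gen (Inr (b, d)))"
      by (simp add: ac_simps)
  qed
  then show ?thesis using 2 by (auto simp: gl_on_gen_simps intro!: homogen_sum homogen_uminus)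
qed

lemma X_elem_simp:
  "X_elem k r m n (a, b) = (\<Sum>i<m + n.
     scale (sg (par k a * (par r b + par m i))) (gen (Inl (a, i)) * gen (Inr (b, i))))"
  by (simp add: X_elem_def)

lemma X_elem_fa: "g \<in> M_gens k l r s \<Longrightarrow> X_elem k r m n g \<in> fa (P_gens k l r s m n)"
  by (cases g) (auto simp: X_elem_simp intro!: fa_linear fa_mult)

lemma X_elem_homogen: "homogen (ppar k r m) (gpar k r g) (X_elem k r m n g)"
proof (cases g)
  case (Pair a b)
  have "homogen (ppar k r m) (par k a + par r b) (gen (Inl (a, i)) * gen (Inr (b, i)))" for i
    by (simp add: gen_elt ac_simps)
  then show ?thesis
    using Pair by (auto simp: X_elem_simp intro!: homogen_sum homogen_scale)
qed

text \<open>The columns of T span a representation and those of T-bar its dual, so the two halves of the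
  product rule cancel.\<close>

lemma X_elem_invariant:
  assumes x: "parmat m (m + n) e x"
  shows "sder (ppar k r m) e (gl_on_gen m n x) (X_elem k r m n g) = 0"
proof (cases g)
  case (Pair a b)
  define T where "T i j = gen (Inl (a, i)) * gen (Inr (b, j))" for i j :: nat
  define s where "s i = sg (par k a * (par r b + par m i))" for i
  have tw: "twist (ppar k r m) e (gen (Inl (a, i))) = scale (sg (e * (par k a + par m i))) (gen (Inl (a, i)))" for i
    by (rule twist_homogen) simp
  have "sder (ppar k r m) e (gl_on_gen m n x) (X_elem k r m n g)
     = (\<Sum>i<m+n. \<Sum>c<m+n. scale (s i * x $$ (c, i)) (T c i))
       - (\<Sum>i<m+n. \<Sum>d<m+n. scale (s i * sg (e * (par k a + par m i)) * sg (par m i * (par m d + par m i)) * x $$ (i, d)) (T i d))"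
    by (simp add: Pair X_elem_simp s_def[symmetric] lin_sum[OF lin_sder] lin_scale[OF lin_sder] sder_mult tw
        gl_on_gen_simps sum_distrib_left sum_distrib_right scale_mult scale_sum scale_add sum.distrib
        T_def mult_ac sum_negf sum_subtractf scale_diff)
  also have "(\<Sum>i<m+n. \<Sum>c<m+n. scale (s i * x $$ (c, i)) (T c i))
      = (\<Sum>i<m+n. \<Sum>d<m+n. scale (s d * x $$ (i, d)) (T i d))"
    by (rule sum.swap)
  also have "\<dots> = (\<Sum>i<m+n. \<Sum>d<m+n. scale (s i * sg (e * (par k a + par m i)) * sg (par m i * (par m d + par m i)) * x $$ (i, d)) (T i d))"
  proof (intro sum.cong refl)
    fix i d assume "i \<in> {..<m + n}" "d \<in> {..<m + n}"
    show "scale (s d * x $$ (i, d)) (T i d) =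
      scale (s i * sg (e * (par k a + par m i)) * sg (par m i * (par m d + par m i)) * x $$ (i, d)) (T i d)"
    proof (cases "x $$ (i, d) = 0")
      case False
      then have e: "e = par m i + par m d"
        using x \<open>i \<in> _\<close> \<open>d \<in> _\<close> by (auto simp: parmat_def)
      have "s d = s i * sg (e * (par k a + par m i)) * sg (par m i * (par m d + par m i))"
        unfolding s_def e sg_add[symmetric]
        by (cases "par m i"; cases "par m d"; cases "par k a"; cases "par r b"; simp)
      then show ?thesis by simp
    qed simp
  qed
  finally show ?thesis by simp
qed

lemma lin_gl:
  "lin (\<lambda>f. \<Sum>e\<in>{0, 1}. sder (ppar k r m) e (gl_on_gen m n (homog_part m e x)) f)"
  by (intro lin_setsum lin_sder)

text \<open>The action of a matrix on representatives.\<close>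

definition gl_rep :: "nat \<Rightarrow> nat \<Rightarrow> nat \<Rightarrow> nat \<Rightarrow> complex mat \<Rightarrow> pgen falg \<Rightarrow> pgen falg" where
  "gl_rep k r m n x f = (\<Sum>e\<in>{0, 1}. sder (ppar k r m) e (gl_on_gen m n (homog_part m e x)) f)"

lemma P_class_eq:
  "f \<in> fa (P_gens k l r s m n) \<Longrightarrow> g \<in> fa (P_gens k l r s m n) \<Longrightarrow>
   P_class k l r s m n f = P_class k l r s m n g \<longleftrightarrow> scong (P_gens k l r s m n) (ppar k r m) f g"
  unfolding P_class_def by (rule residue_eq[OF scr_fa])

lemma M_class_eq:
  "f \<in> fa (M_gens k l r s) \<Longrightarrow> g \<in> fa (M_gens k l r s) \<Longrightarrow>
   M_class k l r s f = M_class k l r s g \<longleftrightarrow> scong (M_gens k l r s) (gpar k r) f g"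
  unfolding M_class_def by (rule residue_eq[OF scr_fa])

lemma carrier_P: "carrier (P_alg k l r s m n) = P_class k l r s m n ` fa (P_gens k l r s m n)"
  unfolding P_alg_def P_class_def carrier_presented by (rule refl)

lemma carrier_M: "carrier (M_alg k l r s) = M_class k l r s ` fa (M_gens k l r s)"
  unfolding M_alg_def M_class_def carrier_presented by (rule refl)

lemma gl_rep_fa: 
  "f \<in> fa (P_gens k l r s m n) \<Longrightarrow> gl_rep k r m n x f \<in> fa (P_gens k l r s m n)"
  unfolding gl_rep_def by (intro fa_linear sder_fa gl_on_gen_fa)

lemma gl_rep_scr:
  assumes "x \<in> carrier_mat (m + n) (m + n)"
    "f \<in> relid (P_gens k l r s m n) (scr (P_gens k l r s m n) (ppar k r m))"
  shows "gl_rep k r m n x f \<in> relid (P_gens k l r s m n) (scr (P_gens k l r s m n) (ppar k r m))"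
  unfolding gl_rep_def
  by (intro subsp_sum[OF subsp_scr] sder_scr gl_on_gen_fa gl_on_gen_homogen parmat_homog_part assms)

lemma gl_act_class:
  assumes "x \<in> carrier_mat (m + n) (m + n)" "f \<in> fa (P_gens k l r s m n)"
  shows "gl_act k l r s m n x (P_class k l r s m n f) = P_class k l r s m n (gl_rep k r m n x f)"
proof -
  have "descend (\<lambda>f. P_class k l r s m n (gl_rep k r m n x f)) (P_class k l r s m n f)
      = P_class k l r s m n (gl_rep k r m n x f)"
    unfolding P_class_def
  proof (rule descend_residue[OF scr_fa assms(2)])
    fix y assume y: "scong (P_gens k l r s m n) (ppar k r m) y f"
    then have "gl_rep k r m n x (y - f) \<in> relid (P_gens k l r s m n) (scr (P_gens k l r s m n) (ppar k r m))"
      by (intro gl_rep_scr assms) (simp add: cong_def)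
    then have "scong (P_gens k l r s m n) (ppar k r m) (gl_rep k r m n x y) (gl_rep k r m n x f)"
      unfolding cong_def gl_rep_def by (simp only: lin_diff[OF lin_gl])
    then show "residue (P_gens k l r s m n) (scr (P_gens k l r s m n) (ppar k r m)) (gl_rep k r m n x y)
        = residue (P_gens k l r s m n) (scr (P_gens k l r s m n) (ppar k r m)) (gl_rep k r m n x f)"
      by (intro residue_cong[OF scr_fa] gl_rep_fa assms(2))
  qed
  then show ?thesis by (simp add: gl_act_def gl_rep_def)
qed

lemma zero_P: "\<zero>\<^bsub>P_alg k l r s m n\<^esub> = P_class k l r s m n 0"
  unfolding P_alg_def P_class_def by (rule presented_zero[OF scr_fa])

lemma gl_act_zero_iff:
  assumes "x \<in> carrier_mat (m + n) (m + n)" "f \<in> fa (P_gens k l r s m n)"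
  shows "gl_act k l r s m n x (P_class k l r s m n f) = \<zero>\<^bsub>P_alg k l r s m n\<^esub> \<longleftrightarrow>
    gl_rep k r m n x f \<in> relid (P_gens k l r s m n) (scr (P_gens k l r s m n) (ppar k r m))"
  unfolding gl_act_class[OF assms] zero_P
  using P_class_eq[of "gl_rep k r m n x f" k l r s m n 0] gl_rep_fa[OF assms(2), of x]
  by (simp add: cong_def)

lemma carrier_X:
  "carrier (X_alg k l r s m n) = {P_class k l r s m n f | f. f \<in> fa (P_gens k l r s m n) \<and>
     (\<forall>x\<in>carrier_mat (m + n) (m + n).
        gl_rep k r m n x f \<in> relid (P_gens k l r s m n) (scr (P_gens k l r s m n) (ppar k r m)))}"
  using gl_act_zero_iff by (auto simp: X_alg_def Let_def carrier_P) blast+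

section \<open>The homomorphism\<close>

lemma Psi_class:
  assumes "f \<in> fa (M_gens k l r s)"
  shows "Psi k l r s m n (M_class k l r s f) = P_class k l r s m n (fhom (X_elem k r m n) f)"
  unfolding Psi_def M_class_def
proof (rule descend_residue[OF scr_fa assms])
  fix y assume y: "scong (M_gens k l r s) (gpar k r) y f"
  then have "fhom (X_elem k r m n) (y - f) \<in> relid (P_gens k l r s m n) (scr (P_gens k l r s m n) (ppar k r m))"
    by (intro fhom_scr[where p = "gpar k r"] X_elem_fa X_elem_homogen) (auto simp: cong_def)
  then have "scong (P_gens k l r s m n) (ppar k r m) (fhom (X_elem k r m n) y) (fhom (X_elem k r m n) f)"
    by (simp add: cong_def lin_diff[OF lin_fhom])
  then show "P_class k l r s m n (fhom (X_elem k r m n) y) = P_class k l r s m n (fhom (X_elem k r m n) f)"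
    unfolding P_class_def by (intro residue_cong[OF scr_fa] fhom_fa[OF X_elem_fa assms])
qed

lemma Psi_gen:
  assumes "a < k + l" "b < r + s"
  shows "Psi k l r s m n (M_class k l r s (gen (a, b))) = P_class k l r s m n (X_elem k r m n (a, b))"
  using assms by (subst Psi_class) simp_all

lemma fhom_X_fa: "f \<in> fa (M_gens k l r s) \<Longrightarrow> fhom (X_elem k r m n) f \<in> fa (P_gens k l r s m n)"
  by (intro fhom_fa[OF X_elem_fa])

text \<open>A superderivation that annihilates the images of the generators annihilates the whole image.\<close>

lemma gl_rep_fhom_X:
  assumes "f \<in> fa (M_gens k l r s)" "x \<in> carrier_mat (m + n) (m + n)"
  shows "gl_rep k r m n x (fhom (X_elem k r m n) f) = 0"
  unfolding gl_rep_def
  by (intro sum.neutral ballI sder_fhom_zero[where G = "M_gens k l r s" and p = "gpar k r"]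
      X_elem_homogen X_elem_invariant parmat_homog_part assms)

lemma Psi_in_X:
  assumes "f \<in> fa (M_gens k l r s)"
  shows "Psi k l r s m n (M_class k l r s f) \<in> carrier (X_alg k l r s m n)"
  unfolding carrier_X Psi_class[OF assms]
  by (intro CollectI exI[of _ "fhom (X_elem k r m n) f"])
    (simp add: fhom_X_fa[OF assms] gl_rep_fhom_X[OF assms] subsp_0[OF subsp_scr])

lemma Psi_superalgebra_hom: "Psi k l r s m n \<in> superalgebra_hom (M_alg k l r s) (X_alg k l r s m n)"
proof -
  have opsX: "monoid.mult (X_alg k l r s m n) = monoid.mult (P_alg k l r s m n)"
    "add (X_alg k l r s m n) = add (P_alg k l r s m n)"
    "one (X_alg k l r s m n) = one (P_alg k l r s m n)"
    "smult (X_alg k l r s m n) = smult (P_alg k l r s m n)"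
    "\<And>e. homog (X_alg k l r s m n) e = homog (P_alg k l r s m n) e \<inter> carrier (X_alg k l r s m n)"
    by (simp_all add: X_alg_def Let_def)
  note P = presented_mult[OF scr_fa] presented_add[OF scr_fa] presented_smult[OF scr_fa] presented_one
  have M: "x \<in> carrier (M_alg k l r s) \<Longrightarrow> \<exists>f\<in>fa (M_gens k l r s). x = M_class k l r s f" for x
    by (auto simp: carrier_M)
  have "Psi k l r s m n \<in> Ring.ring_hom (M_alg k l r s) (X_alg k l r s m n)"
  proof (rule ring_hom_memI)
    fix x y assume "x \<in> carrier (M_alg k l r s)" "y \<in> carrier (M_alg k l r s)"
    then obtain f g where f: "f \<in> fa (M_gens k l r s)" "x = M_class k l r s f"
      and g: "g \<in> fa (M_gens k l r s)" "y = M_class k l r s g"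
      using M by meson
    have "x \<otimes>\<^bsub>M_alg k l r s\<^esub> y = M_class k l r s (f * g)"
      "x \<oplus>\<^bsub>M_alg k l r s\<^esub> y = M_class k l r s (f + g)"
      using f g by (simp_all add: M_alg_def M_class_def P)
    moreover have "Psi k l r s m n x \<otimes>\<^bsub>P_alg k l r s m n\<^esub> Psi k l r s m n y
        = P_class k l r s m n (fhom (X_elem k r m n) f * fhom (X_elem k r m n) g)"
      "Psi k l r s m n x \<oplus>\<^bsub>P_alg k l r s m n\<^esub> Psi k l r s m n y
        = P_class k l r s m n (fhom (X_elem k r m n) f + fhom (X_elem k r m n) g)"
      using f g fhom_X_fa[OF f(1)] fhom_X_fa[OF g(1)]
      by (simp_all add: Psi_class) (simp_all add: P_alg_def P_class_def P)
    ultimately show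
      "Psi k l r s m n (x \<otimes>\<^bsub>M_alg k l r s\<^esub> y) = Psi k l r s m n x \<otimes>\<^bsub>X_alg k l r s m n\<^esub> Psi k l r s m n y"
      "Psi k l r s m n (x \<oplus>\<^bsub>M_alg k l r s\<^esub> y) = Psi k l r s m n x \<oplus>\<^bsub>X_alg k l r s m n\<^esub> Psi k l r s m n y"
      using f g by (simp_all add: opsX Psi_class fa_mult fa_linear fhom_mult lin_add[OF lin_fhom])
  next
    fix x assume "x \<in> carrier (M_alg k l r s)"
    then show "Psi k l r s m n x \<in> carrier (X_alg k l r s m n)"
      using M Psi_in_X by blast
  next
    have "\<one>\<^bsub>M_alg k l r s\<^esub> = M_class k l r s 1" "\<one>\<^bsub>P_alg k l r s m n\<^esub> = P_class k l r s m n 1"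
      by (simp_all add: M_alg_def M_class_def P_alg_def P_class_def P)
    then show "Psi k l r s m n \<one>\<^bsub>M_alg k l r s\<^esub> = \<one>\<^bsub>X_alg k l r s m n\<^esub>"
      by (simp add: opsX Psi_class)
  qed
  moreover have "Psi k l r s m n (c \<odot>\<^bsub>M_alg k l r s\<^esub> x) = c \<odot>\<^bsub>X_alg k l r s m n\<^esub> Psi k l r s m n x"
    if x: "x \<in> carrier (M_alg k l r s)" for c x
  proof -
    obtain f where f: "f \<in> fa (M_gens k l r s)" "x = M_class k l r s f" using M[OF x] by blast
    have "c \<odot>\<^bsub>M_alg k l r s\<^esub> x = M_class k l r s (scale c f)"
      using f by (simp add: M_alg_def M_class_def P)
    moreover have "c \<odot>\<^bsub>P_alg k l r s m n\<^esub> Psi k l r s m n x = P_class k l r s m n (scale c (fhom (X_elem k r m n) f))"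
      using f fhom_X_fa[OF f(1)] by (simp add: Psi_class) (simp add: P_alg_def P_class_def P)
    ultimately show ?thesis
      using f by (simp add: opsX Psi_class fa_linear lin_scale[OF lin_fhom])
  qed
  moreover have "Psi k l r s m n ` homog (M_alg k l r s) e \<subseteq> homog (X_alg k l r s m n) e" for e
  proof
    fix y assume "y \<in> Psi k l r s m n ` homog (M_alg k l r s) e"
    then obtain f where f: "f \<in> fa (M_gens k l r s)" "homogen (gpar k r) e f"
      and y: "y = Psi k l r s m n (M_class k l r s f)"
      by (auto simp: M_alg_def presented_def Let_def M_class_def homogen_def)
    have "homogen (ppar k r m) e (fhom (X_elem k r m n) f)"
      using f by (intro homogen_fhom[OF X_elem_homogen]) auto
    then have "y \<in> homog (P_alg k l r s m n) e"
      using f fhom_X_fa[OF f(1)]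
      by (auto simp: y Psi_class P_alg_def presented_def Let_def P_class_def homogen_def)
    then show "y \<in> homog (X_alg k l r s m n) e"
      using Psi_in_X[OF f(1)] y opsX(5) by simp
  qed
  ultimately show ?thesis by (auto simp: superalgebra_hom_def)
qed

text \<open>For large m and n a left inverse is the specialisation which turns the row b of T-bar into
  the unit vector at a position of the same parity as b.\<close>

lemma Psi_inj:
  assumes mn: "r \<le> m" "s \<le> n"
  shows "inj_on (Psi k l r s m n) (carrier (M_alg k l r s))"
proof -
  \<comment> \<open>\<open>\<iota> b\<close> is a column of the parity of the row b; T-bar becomes the matrix of \<open>\<iota>\<close>.\<close>
  define \<iota> where "\<iota> b = (if b < r then b else m + (b - r))" for b
  define \<theta> :: "pgen \<Rightarrow> (nat \<times> nat) falg" where "\<theta> = case_sum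
    (\<lambda>(a, i). if i \<in> \<iota> ` {..<r + s} then gen (a, the_inv_into {..<r + s} \<iota> i) else 0)
    (\<lambda>(b, i). if i = \<iota> b then 1 else 0)"
  have inj: "inj_on \<iota> {..<r + s}"
    using mn by (auto simp: inj_on_def \<iota>_def split: if_splits)
  have lt: "\<iota> b < m + n" if "b < r + s" for b using that mn by (auto simp: \<iota>_def)
  have par: "par m (\<iota> b) = par r b" if "b < r + s" for b
    using that mn by (auto simp: \<iota>_def par_def)
  have \<theta>r: "\<theta> (Inl (a, \<iota> b)) = gen (a, b)" if "b < r + s" for a b
    using that by (auto simp: \<theta>_def the_inv_into_f_f[OF inj])
  have \<theta>0: "\<theta> (Inl (a, i)) = 0" if "i \<notin> \<iota> ` {..<r + s}" for a i
    using that by (simp add: \<theta>_def)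
  have \<theta>b: "\<theta> (Inr (b, i)) = (if i = \<iota> b then 1 else 0)" for b i
    by (simp add: \<theta>_def)
  have \<theta>: "\<theta> g \<in> fa (M_gens k l r s) \<and> homogen (gpar k r) (ppar k r m g) (\<theta> g)"
    if "g \<in> P_gens k l r s m n" for g
    using that
  proof (cases rule: P_gens_cases)
    case (1 a i)
    show ?thesis
    proof (cases "i \<in> \<iota> ` {..<r + s}")
      case True
      then obtain b where "b < r + s" "i = \<iota> b" by auto
      then show ?thesis using 1 par by (simp add: \<theta>r)
    qed (simp add: 1 \<theta>0)
  next
    case (2 b i)
    then show ?thesis using par by (auto simp: \<theta>b homogen_one)
  qed
  have \<theta>X: "fhom \<theta> (X_elem k r m n g) = gen g" if g: "g \<in> M_gens k l r s" for g
  proof (cases g)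
    case (Pair a b)
    with g have b: "b < r + s" by simp
    have "fhom \<theta> (X_elem k r m n g)
      = (\<Sum>i<m + n. scale (sg (par k a * (par r b + par m i))) (\<theta> (Inl (a, i)) * (if i = \<iota> b then 1 else 0)))"
      by (simp add: Pair X_elem_simp lin_sum[OF lin_fhom] lin_scale[OF lin_fhom] fhom_mult \<theta>b)
    also have "\<dots> = (\<Sum>i<m + n. if i = \<iota> b then scale (sg (par k a * (par r b + par m i))) (\<theta> (Inl (a, i))) else 0)"
      by (intro sum.cong) auto
    also have "\<dots> = gen g"
      using lt[OF b] by (simp add: \<theta>r[OF b] par[OF b] Pair)
    finally show ?thesis .
  qed
  show ?thesis
  proof (rule inj_onI)
    fix x y assume "x \<in> carrier (M_alg k l r s)" "y \<in> carrier (M_alg k l r s)"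
      and eq: "Psi k l r s m n x = Psi k l r s m n y"
    then obtain f g where f: "f \<in> fa (M_gens k l r s)" "x = M_class k l r s f"
      and g: "g \<in> fa (M_gens k l r s)" "y = M_class k l r s g"
      by (auto simp: carrier_M)
    from eq have "scong (P_gens k l r s m n) (ppar k r m) (fhom (X_elem k r m n) f) (fhom (X_elem k r m n) g)"
      using f g fhom_X_fa by (simp add: Psi_class P_class_eq)
    then have "fhom \<theta> (fhom (X_elem k r m n) f - fhom (X_elem k r m n) g) \<in> relid (M_gens k l r s) (scr (M_gens k l r s) (gpar k r))"
      using \<theta> by (intro fhom_scr[where p = "ppar k r m"]) (auto simp: cong_def)
    then have "scong (M_gens k l r s) (gpar k r) f g"
      by (simp add: cong_def lin_diff[OF lin_fhom] fhom_fhom[OF \<theta>X f(1)] fhom_fhom[OF \<theta>X g(1)])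
    then show "x = y" using f g by (simp add: M_class_eq)
  qed
qed


section \<open>The super tensor product of two free algebras\<close>

lemma tmult_alt:
  "tmult p q x y = linext (\<lambda>(u, v). linext (\<lambda>(u', v').
     Poly_Mapping.single (u @ u', v @ v') (sg (wpar q v * wpar p u'))) y) x"
  by (auto simp: tmult_def linext_def scale_sum scale_single mult_ac case_prod_unfold intro!: sum.cong)

lemma lin_tmult1: "lin f \<Longrightarrow> lin (\<lambda>x. tmult p q (f x) y)"
  unfolding tmult_alt by (rule lin_linext_comp)

lemma lin_tmult2: "lin f \<Longrightarrow> lin (\<lambda>y. tmult p q x (f y))"
  unfolding tmult_alt by (rule lin_compose[of "\<lambda>y. linext (\<lambda>(u, v). linext (\<lambda>(u', v').
     Poly_Mapping.single (u @ u', v @ v') (sg (wpar q v * wpar p u'))) y) x"])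
    (auto intro!: linext_fun lin_linext simp: case_prod_unfold)

lemma tmult_elt:
  "tmult p q (elt (u, v)) (elt (u', v')) = scale (sg (wpar q v * wpar p u')) (elt (u @ u', v @ v'))"
  by (simp add: tmult_alt scale_single)

lemma tmult_assoc: "tmult p q (tmult p q x y) z = tmult p q x (tmult p q y z)"
proof (rule lin_eq[where h = "\<lambda>z. tmult p q (tmult p q x y) z" and h' = "\<lambda>z. tmult p q x (tmult p q y z)"])
  fix w :: "'a list \<times> 'b list"
  show "tmult p q (tmult p q x y) (elt w) = tmult p q x (tmult p q y (elt w))"
  proof (rule bilin_eq[where f = "\<lambda>x y. tmult p q (tmult p q x y) (elt w)"
        and g = "\<lambda>x y. tmult p q x (tmult p q y (elt w))"])
    fix u v :: "'a list \<times> 'b list"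
    show "tmult p q (tmult p q (elt u) (elt v)) (elt w) = tmult p q (elt u) (tmult p q (elt v) (elt w))"
      by (cases u; cases v; cases w)
         (simp add: tmult_elt lin_scale[OF lin_tmult1[OF lin_id]] lin_scale[OF lin_tmult2[OF lin_id]]
           sg_add distrib_left distrib_right mult_ac)
  qed (intro lin_tmult1 lin_tmult2 lin_id)+
qed (intro lin_tmult1 lin_tmult2 lin_id)+

lemma tone_elt: "tone = elt ([], [])"
  by (simp add: tone_def)

lemma tmult_tone: "tmult p q tone x = x" "tmult p q x tone = x"
  by (rule lin_eq[OF _ lin_id], intro lin_tmult1 lin_tmult2 lin_id, auto simp: tone_elt tmult_elt)+

definition tfa :: "'g set \<Rightarrow> 'h set \<Rightarrow> ('g, 'h) ftens set" where
  "tfa G H = {x. Poly_Mapping.keys x \<subseteq> lists G \<times> lists H}"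

lemma subsp_tfa: "subsp (tfa G H)"
  unfolding tfa_def by (rule subsp_supp)

lemma tfa_elt [simp]: "elt (u, v) \<in> tfa G H \<longleftrightarrow> u \<in> lists G \<and> v \<in> lists H"
  by (simp add: tfa_def)

lemma tfa_keys: "x \<in> tfa G H \<Longrightarrow> (u, v) \<in> Poly_Mapping.keys x \<Longrightarrow> u \<in> lists G \<and> v \<in> lists H"
  by (auto simp: tfa_def)

lemma tfa_mult:
  assumes "x \<in> tfa G H" "y \<in> tfa G H"
  shows "tmult p q x y \<in> tfa G H"
proof (rule lin_in[where h = "\<lambda>x. tmult p q x y" and x = x, OF lin_tmult1[OF lin_id] subsp_tfa])
  fix w assume w: "w \<in> Poly_Mapping.keys x"
  show "tmult p q (elt w) y \<in> tfa G H"
  proof (rule lin_in[where h = "tmult p q (elt w)" and x = y, OF lin_tmult2[OF lin_id] subsp_tfa])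
    fix w' assume w': "w' \<in> Poly_Mapping.keys y"
    obtain u v u' v' where "w = (u, v)" "w' = (u', v')" by (cases w, cases w')
    moreover from this have "u \<in> lists G \<and> v \<in> lists H" "u' \<in> lists G \<and> v' \<in> lists H"
      using w w' assms tfa_keys by metis+
    ultimately show "tmult p q (elt w) (elt w') \<in> tfa G H"
      by (simp add: tmult_elt subsp_scale[OF subsp_tfa])
  qed
qed

lemma ops_free_tens [simp]:
  "carrier (free_tens G p H q) = tfa G H" "monoid.mult (free_tens G p H q) = tmult p q"
  "one (free_tens G p H q) = tone" "zero (free_tens G p H q) = 0" "add (free_tens G p H q) = (+)"
  by (simp_all add: free_tens_def tfa_def)

lemma ring_free_tens: "ring (free_tens G p H q)"
proof (rule ringI)
  show "abelian_group (free_tens G p H q)"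
  proof (rule abelian_groupI)
    fix x assume "x \<in> carrier (free_tens G p H q)"
    then show "\<exists>y\<in>carrier (free_tens G p H q). y \<oplus>\<^bsub>free_tens G p H q\<^esub> x = \<zero>\<^bsub>free_tens G p H q\<^esub>"
      by (intro bexI[of _ "- x"]) (auto intro: subsp_uminus[OF subsp_tfa])
  qed (auto simp: add.assoc add.commute subsp_add[OF subsp_tfa] subsp_0[OF subsp_tfa])
  show "monoid (free_tens G p H q)"
    by (rule monoidI) (auto simp: tfa_mult tmult_assoc tmult_tone, simp add: tone_elt)
qed (auto simp: lin_add[OF lin_tmult1[OF lin_id]] lin_add[OF lin_tmult2[OF lin_id]])

lemma lin_tleft: "lin tleft"
  and lin_tright: "lin tright"
  unfolding tleft_def[abs_def] tright_def[abs_def] by (rule lin_linext)+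

lemma tleft_elt [simp]: "tleft (elt u) = elt (u, [])"
  and tright_elt [simp]: "tright (elt v) = elt ([], v)"
  by (simp_all add: tleft_def tright_def)

lemma tleft_fa: "x \<in> fa G \<Longrightarrow> tleft x \<in> tfa G H"
  by (rule lin_in[OF lin_tleft subsp_tfa]) (auto dest: fa_keys)

lemma tright_fa: "x \<in> fa H \<Longrightarrow> tright x \<in> tfa G H"
  by (rule lin_in[OF lin_tright subsp_tfa]) (auto dest: fa_keys)

lemma thom_elt: "thom p q \<phi> (elt w) = foldr (\<lambda>g z. tmult p q (\<phi> g) z) w tone"
  by (simp add: thom_def)

lemma lin_thom: "lin (thom p q \<phi>)"
  unfolding thom_def[abs_def] by (rule lin_linext)

lemma thom_Nil: "thom p q \<phi> (elt []) = elt ([], [])"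
  by (simp add: thom_elt tone_elt)

lemma thom_Cons: "thom p q \<phi> (elt (g # w)) = tmult p q (\<phi> g) (thom p q \<phi> (elt w))"
  by (simp add: thom_elt)

section \<open>The coproduct of a word\<close>

abbreviation cop :: "nat \<Rightarrow> (nat \<times> nat) list \<Rightarrow> (nat \<times> nat, nat \<times> nat) ftens" where
  "cop k x \<equiv> coprod k (elt x)"

lemma cop_Nil: "cop k [] = elt ([], [])"
  by (simp add: coprod_def thom_Nil)

lemma cop_Cons:
  "cop k (h # x) = linext (\<lambda>(u, v). elt (h # u, v) + scale (sg (gpar k k h * wpar (gpar k k) u)) (elt (u, h # v))) (cop k x)"
proof -
  have "cop k (h # x) = tmult (gpar k k) (gpar k k) (elt ([h], []) + elt ([], [h])) (cop k x)"
    by (simp add: coprod_def thom_Cons) (simp add: gen_elt)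
  also have "\<dots> = linext (\<lambda>(u, v). elt (h # u, v) + scale (sg (gpar k k h * wpar (gpar k k) u)) (elt (u, h # v))) (cop k x)"
    by (rule lin_eq[OF lin_tmult2[OF lin_id] lin_linext])
       (auto simp: lin_add[OF lin_tmult1[OF lin_id]] tmult_elt)
  finally show ?thesis .
qed

text \<open>Evaluation of a scalar function of the basis, linearly extended.\<close>

definition ev :: "('b \<Rightarrow> complex) \<Rightarrow> ('b \<Rightarrow>\<^sub>0 complex) \<Rightarrow> complex" where
  "ev \<phi> z = (\<Sum>w\<in>Poly_Mapping.keys z. lk z w * \<phi> w)"

lemma ev_alt: "ev \<phi> z = lk (linext (\<lambda>w. Poly_Mapping.single () (\<phi> w)) z) ()"
  by (simp add: ev_def linext_def lookup_sum)

lemma ev_add: "ev \<phi> (x + y) = ev \<phi> x + ev \<phi> y"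
  and ev_scale: "ev \<phi> (scale c x) = c * ev \<phi> x"
  and ev_0 [simp]: "ev \<phi> 0 = 0"
  by (simp_all add: ev_alt lin_simps[OF lin_linext] lookup_add)

lemma ev_sum: "ev \<phi> (\<Sum>i\<in>A. f i) = (\<Sum>i\<in>A. ev \<phi> (f i))"
  by (induction A rule: infinite_finite_induct) (simp_all add: ev_add)

lemma ev_elt [simp]: "ev \<phi> (elt w) = \<phi> w"
  by (simp add: ev_alt)

lemma ev_linext: "ev \<phi> (linext \<psi> z) = ev (\<lambda>w. ev \<phi> (\<psi> w)) z"
  by (simp add: linext_def[of \<psi>] ev_sum ev_scale) (simp add: ev_def)

lemma ev_cong: "(\<And>w. w \<in> Poly_Mapping.keys z \<Longrightarrow> \<phi> w = \<psi> w) \<Longrightarrow> ev \<phi> z = ev \<psi> z"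
  by (simp add: ev_def)

lemma cop_keys: "(u, v) \<in> Poly_Mapping.keys (cop k x) \<Longrightarrow>
   wpar (gpar k k) u + wpar (gpar k k) v = wpar (gpar k k) x"
proof (induction x arbitrary: u v)
  case Nil
  then show ?case by (simp add: cop_Nil)
next
  case (Cons h x)
  let ?S = "{(u, v). wpar (gpar k k) u + wpar (gpar k k) v = wpar (gpar k k) (h # x)}"
  have "cop k (h # x) \<in> {x. Poly_Mapping.keys x \<subseteq> ?S}"
    unfolding cop_Cons
  proof (rule lin_in[OF lin_linext subsp_supp])
    fix w assume "w \<in> Poly_Mapping.keys (cop k x)"
    then obtain u v where w: "w = (u, v)" "wpar (gpar k k) u + wpar (gpar k k) v = wpar (gpar k k) x"
      using Cons.IH by (cases w) auto
    have "elt (h # u, v) \<in> {x. Poly_Mapping.keys x \<subseteq> ?S}" "elt (u, h # v) \<in> {x. Poly_Mapping.keys x \<subseteq> ?S}"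
      using w by (auto simp: ac_simps)
    then show "linext (\<lambda>(u, v). elt (h # u, v) + scale (sg (gpar k k h * wpar (gpar k k) u)) (elt (u, h # v))) (elt w)
        \<in> {x. Poly_Mapping.keys x \<subseteq> ?S}"
      unfolding w linext_elt prod.case by (intro subsp_add[OF subsp_supp] subsp_scale[OF subsp_supp])
  qed
  then show ?case using Cons.prems by auto
qed

lemma cop_counit: "ev (\<lambda>(u, v). \<phi> u * (if v = [] then 1 else 0)) (cop k x) = \<phi> x"
proof (induction x arbitrary: \<phi>)
  case (Cons h x)
  have "ev (\<lambda>(u, v). \<phi> u * (if v = [] then 1 else 0)) (cop k (h # x))
     = ev (\<lambda>(u, v). \<phi> (h # u) * (if v = [] then 1 else 0)) (cop k x)"
    unfolding cop_Cons ev_linext by (rule ev_cong) (auto simp: ev_add ev_scale)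
  then show ?case using Cons.IH[of "\<lambda>u. \<phi> (h # u)"] by simp
qed (simp add: cop_Nil)

section \<open>The operators defined by a family of matrix coefficients\<close>

lemma pairing_Cons: "pairing k \<tau> (g # u) x = ev (\<lambda>(x1, x2).
    sg (wpar (gpar k k) u * wpar (gpar k k) x1) * \<tau> g (elt x1) * pairing k \<tau> u (elt x2)) (coprod k x)"
  by (simp add: ev_def case_prod_unfold mult.assoc)

lemma pairing_Nil_elt: "pairing k \<tau> [] (elt x) = (if x = [] then 1 else 0)"
  by (simp add: counit_def lookup_single when_def)

lemma pairing_scale: "pairing k \<tau> u (scale c x) = c * pairing k \<tau> u x"
proof (cases u)
  case (Cons g u)
  then show ?thesis
    unfolding Cons pairing_Cons coprod_def by (simp only: lin_scale[OF lin_thom] ev_scale)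
qed (simp add: counit_def)

lemma pairing_single: "pairing k \<tau> [g] (elt x) = \<tau> g (elt x)"
  using cop_counit[of "\<lambda>u. \<tau> g (elt u)" k x]
  by (simp add: pairing_Cons pairing_Nil_elt del: pairing.simps)

lemma lin_slice: "lin (slice \<chi>)"
  unfolding slice_def[abs_def] by (rule lin_linext)

lemma slice_single: "slice \<chi> (Poly_Mapping.single (u, v) c) = scale (c * \<chi> u) (elt v)"
  by (simp add: slice_def scale_single)

lemma slice_expand: "slice \<chi> z = (\<Sum>uv\<in>Poly_Mapping.keys z. scale (lk z uv * \<chi> (fst uv)) (elt (snd uv)))"
  by (simp add: slice_def linext_def case_prod_unfold scale_single)

lemma slice_scale: "slice (\<lambda>u. c * \<chi> u) z = scale c (slice \<chi> z)"
  by (rule lin_eq[OF lin_slice lin_scaled[OF lin_slice]])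
     (auto simp: slice_single scale_single mult_ac)

text \<open>Both \<^const>\<open>L_act\<close> and \<^const>\<open>Lt_act\<close> are operators of this kind, for the two families of
  linear functions and a word modified by w or by the antipode.\<close>

definition Rop :: "nat \<Rightarrow> nat \<Rightarrow> nat \<Rightarrow> (nat \<times> nat \<Rightarrow> (nat \<times> nat) falg \<Rightarrow> complex) \<Rightarrow>
    (nat \<times> nat) list \<Rightarrow> (nat \<times> nat) falg \<Rightarrow> (nat \<times> nat) falg" where
  "Rop k N m \<tau> x f = slice (\<lambda>u. pairing k \<tau> u (elt x)) (coaction N k m f)"

lemma lin_coaction: "lin (coaction N k m)"
  unfolding coaction_def[abs_def] by (rule lin_thom)

lemma lin_Rop: "lin (Rop k N m \<tau> x)"
  unfolding Rop_def[abs_def] by (rule lin_compose[OF lin_slice lin_coaction])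

definition csg :: "nat \<Rightarrow> nat \<Rightarrow> nat \<Rightarrow> nat \<Rightarrow> nat \<Rightarrow> complex" where
  "csg k m a c i = sg ((par k a + par k c) * (par k c + par m i))"

lemma coaction_Nil: "coaction N k m (elt []) = elt ([], [])"
  by (simp add: coaction_def thom_Nil)

lemma coaction_Cons: "coaction N k m (elt ((a, i) # w)) =
   (\<Sum>c<N. scale (csg k m a c i) (linext (\<lambda>(u, v). scale (sg (gpar k m (c, i) * wpar (gpar k k) u))
      (elt ((a, c) # u, (c, i) # v))) (coaction N k m (elt w))))"
proof -
  have "coaction N k m (elt ((a, i) # w)) = tmult (gpar k k) (gpar k m)
     (\<Sum>c<N. scale (csg k m a c i) (elt ([(a, c)], [(c, i)]))) (coaction N k m (elt w))"
    by (simp add: coaction_def thom_Cons csg_def scale_single)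
  also have "\<dots> = (\<Sum>c<N. scale (csg k m a c i) (tmult (gpar k k) (gpar k m) (elt ([(a, c)], [(c, i)])) (coaction N k m (elt w))))"
    by (simp add: lin_sum[OF lin_tmult1[OF lin_id]] lin_scale[OF lin_tmult1[OF lin_id]])
  finally have sum: "coaction N k m (elt ((a, i) # w)) = (\<Sum>c<N. scale (csg k m a c i)
      (tmult (gpar k k) (gpar k m) (elt ([(a, c)], [(c, i)])) (coaction N k m (elt w))))" .
  have "tmult (gpar k k) (gpar k m) (elt ([(a, c)], [(c, i)])) (coaction N k m (elt w)) =
      linext (\<lambda>(u, v). scale (sg (gpar k m (c, i) * wpar (gpar k k) u)) (elt ((a, c) # u, (c, i) # v)))
        (coaction N k m (elt w))" for c
    by (rule lin_eq[OF lin_tmult2[OF lin_id] lin_linext]) (auto simp: tmult_elt)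
  with sum show ?thesis by simp
qed

lemma coaction_keys:
  "w \<in> lists ({..<N} \<times> I) \<Longrightarrow> (u, v) \<in> Poly_Mapping.keys (coaction N k m (elt w)) \<Longrightarrow>
   u \<in> lists ({..<N} \<times> {..<N})"
proof (induction w arbitrary: u v)
  case Nil
  then show ?case by (simp add: coaction_Nil)
next
  case (Cons g w)
  obtain a i where g: "g = (a, i)" "a < N" using Cons.prems(1) by auto
  let ?S = "lists ({..<N} \<times> {..<N}) \<times> UNIV"
  have "coaction N k m (elt (g # w)) \<in> {x. Poly_Mapping.keys x \<subseteq> ?S}"
    unfolding g coaction_Cons
  proof (rule subsp_sum[OF subsp_supp], rule subsp_scale[OF subsp_supp], rule lin_in[OF lin_linext subsp_supp])
    fix c z assume c: "c \<in> {..<N}" and z: "z \<in> Poly_Mapping.keys (coaction N k m (elt w))"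
    obtain u v where "z = (u, v)" by (cases z)
    then have "elt ((a, c) # u, (c, i) # v) \<in> {x. Poly_Mapping.keys x \<subseteq> ?S}"
      using Cons.IH[of u v] Cons.prems(1) z c g by auto
    then show "linext (\<lambda>(u, v). scale (sg (gpar k m (c, i) * wpar (gpar k k) u)) (elt ((a, c) # u, (c, i) # v))) (elt z)
        \<in> {x. Poly_Mapping.keys x \<subseteq> ?S}"
      unfolding \<open>z = (u, v)\<close> linext_elt prod.case by (rule subsp_scale[OF subsp_supp])
  qed
  then show ?case using Cons.prems(2) by auto
qed

text \<open>A family of matrix coefficients of a representation, given on words.\<close>

locale matrix_coeffs =
  fixes k N :: nat and \<tau> :: "nat \<times> nat \<Rightarrow> (nat \<times> nat) falg \<Rightarrow> complex"
  assumes coeff_Nil: "a < N \<Longrightarrow> c < N \<Longrightarrow> \<tau> (a, c) (elt []) = (if a = c then 1 else 0)"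
    and coeff_Cons: "a < N \<Longrightarrow> c < N \<Longrightarrow>
      \<tau> (a, c) (elt (h # x)) = (\<Sum>d<N. \<tau> (a, d) (elt [h]) * \<tau> (d, c) (elt x))"
    and coeff_par: "a < N \<Longrightarrow> c < N \<Longrightarrow> \<tau> (a, c) (elt x) \<noteq> 0 \<Longrightarrow> par k a + par k c = wpar (gpar k k) x"
begin

text \<open>A matrix coefficient at row a and column c is supported on words of parity [a] + [c],
  and the coproduct preserves the parity.\<close>

lemma pairing_par:
  "u \<in> lists ({..<N} \<times> {..<N}) \<Longrightarrow> pairing k \<tau> u (elt x) \<noteq> 0 \<Longrightarrow> wpar (gpar k k) u = wpar (gpar k k) x"
proof (induction u arbitrary: x)
  case Nil
  then show ?case by (simp add: pairing_Nil_elt split: if_splits del: pairing.simps)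
next
  case (Cons g u)
  from Cons.prems(2) obtain w where w: "w \<in> Poly_Mapping.keys (cop k x)"
    "(\<lambda>(x1, x2). sg (wpar (gpar k k) u * wpar (gpar k k) x1) * \<tau> g (elt x1) * pairing k \<tau> u (elt x2)) w \<noteq> 0"
    unfolding pairing_Cons ev_def by (metis (no_types, lifting) mult_zero_right sum.neutral)
  obtain x1 x2 where x: "w = (x1, x2)" by (cases w)
  obtain a c where g: "g = (a, c)" "a < N" "c < N" using Cons.prems(1) by auto
  have "gpar k k g = wpar (gpar k k) x1"
    using coeff_par[OF g(2,3), of x1] w(2) g x by simp
  moreover have "wpar (gpar k k) u = wpar (gpar k k) x2"
    using Cons.IH[of x2] Cons.prems(1) w(2) x by simp
  ultimately show ?case using cop_keys[of x1 x2 k x] w(1) x by simp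
qed

lemma Rop_Nil: "Rop k N m \<tau> x (elt []) = (if x = [] then elt [] else 0)"
  by (simp add: Rop_def coaction_Nil slice_single pairing_Nil_elt del: pairing.simps)

lemma Rop_letter: "Rop k N m \<tau> x (elt [(a, i)]) = (\<Sum>c<N. scale (csg k m a c i * \<tau> (a, c) (elt x)) (elt [(c, i)]))"
  unfolding Rop_def coaction_Cons coaction_Nil
  by (simp add: lin_sum[OF lin_slice] lin_scale[OF lin_slice] slice_single pairing_single del: pairing.simps)

text \<open>The coaction is multiplicative, and a product of linear functions is evaluated through the
  coproduct; hence the operators satisfy a product rule governed by the coproduct.\<close>

lemma Rop_Cons:
  assumes "a < N" "w \<in> lists ({..<N} \<times> I)"
  shows "Rop k N m \<tau> x (elt ((a, i) # w)) = linext (\<lambda>(x1, x2).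
     scale (sg (gpar k m (a, i) * wpar (gpar k k) x2)) (Rop k N m \<tau> x1 (elt [(a, i)]) * Rop k N m \<tau> x2 (elt w))) (cop k x)"
proof -
  let ?z = "coaction N k m (elt w)" and ?D = "cop k x"
  let ?p = "wpar (gpar k k)"
  have slice_lin: "slice \<chi> (linext \<psi> y) = linext (\<lambda>w. slice \<chi> (\<psi> w)) y" for \<chi> \<psi> and y :: "(nat \<times> nat, nat \<times> nat) ftens"
    by (simp add: linext_def[of \<psi>] lin_sum[OF lin_slice] lin_scale[OF lin_slice]) (simp add: linext_def)
  have "Rop k N m \<tau> x (elt ((a, i) # w)) = (\<Sum>c<N. \<Sum>uv\<in>Poly_Mapping.keys ?z. \<Sum>xx\<in>Poly_Mapping.keys ?D.
      scale (csg k m a c i * lk ?z uv * (sg (gpar k m (c, i) * ?p (fst uv)) * 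
        (lk ?D xx * (sg (?p (fst uv) * ?p (fst xx)) * \<tau> (a, c) (elt (fst xx)) * pairing k \<tau> (fst uv) (elt (snd xx))))))
       (elt ((c, i) # snd uv)))" (is "_ = ?L")
    unfolding Rop_def coaction_Cons lin_sum[OF lin_slice] lin_scale[OF lin_slice] slice_lin
    by (simp add: linext_def case_prod_unfold lin_scale[OF lin_slice] slice_single pairing_Cons ev_def
        scale_sum sum_distrib_left scale_sum_scalar mult_ac del: pairing.simps)
  also have "\<dots> = (\<Sum>c<N. \<Sum>uv\<in>Poly_Mapping.keys ?z. \<Sum>xx\<in>Poly_Mapping.keys ?D.
      scale (lk ?D xx * (sg (gpar k m (a, i) * ?p (snd xx)) * (csg k m a c i * \<tau> (a, c) (elt (fst xx)) *
          (lk ?z uv * pairing k \<tau> (fst uv) (elt (snd xx)))))) (elt ((c, i) # snd uv)))" (is "_ = ?R")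
  proof (intro sum.cong refl)
    fix c uv xx assume c: "c \<in> {..<N}" and uv: "uv \<in> Poly_Mapping.keys ?z" and xx: "xx \<in> Poly_Mapping.keys ?D"
    have u: "fst uv \<in> lists ({..<N} \<times> {..<N})"
      using coaction_keys[OF assms(2), of "fst uv" "snd uv" k m] uv by simp
    show "scale (csg k m a c i * lk ?z uv * (sg (gpar k m (c, i) * ?p (fst uv)) * 
        (lk ?D xx * (sg (?p (fst uv) * ?p (fst xx)) * \<tau> (a, c) (elt (fst xx)) * pairing k \<tau> (fst uv) (elt (snd xx))))))
         (elt ((c, i) # snd uv))
      = scale (lk ?D xx * (sg (gpar k m (a, i) * ?p (snd xx)) * (csg k m a c i * \<tau> (a, c) (elt (fst xx)) *
          (lk ?z uv * pairing k \<tau> (fst uv) (elt (snd xx)))))) (elt ((c, i) # snd uv))"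
    proof (cases "\<tau> (a, c) (elt (fst xx)) = 0 \<or> pairing k \<tau> (fst uv) (elt (snd xx)) = 0")
      case False
      then have "par k a + par k c = ?p (fst xx)" "?p (fst uv) = ?p (snd xx)"
        using coeff_par[OF assms(1), of c "fst xx"] pairing_par[OF u] c by auto
      then have "sg (gpar k m (c, i) * ?p (fst uv)) * sg (?p (fst uv) * ?p (fst xx)) = sg (gpar k m (a, i) * ?p (snd xx))"
        unfolding sg_add[symmetric]
        by (simp flip: \<open>par k a + par k c = _\<close>) (cases "par k a"; cases "par k c"; cases "par m i"; cases "?p (snd xx)"; simp)
      then show ?thesis by (simp add: mult_ac)
    qed auto
  qed
  also have "\<dots> = (\<Sum>xx\<in>Poly_Mapping.keys ?D. \<Sum>c<N. \<Sum>uv\<in>Poly_Mapping.keys ?z. 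
      scale (lk ?D xx * (sg (gpar k m (a, i) * ?p (snd xx)) * (csg k m a c i * \<tau> (a, c) (elt (fst xx)) *
          (lk ?z uv * pairing k \<tau> (fst uv) (elt (snd xx)))))) (elt ((c, i) # snd uv)))"
    by (rule trans[OF sum.cong[OF refl sum.swap] sum.swap])
  also have "\<dots> = linext (\<lambda>(x1, x2).
     scale (sg (gpar k m (a, i) * ?p x2)) (Rop k N m \<tau> x1 (elt [(a, i)]) * Rop k N m \<tau> x2 (elt w))) ?D"
    unfolding Rop_letter
    by (simp add: linext_def case_prod_unfold Rop_def slice_expand scale_sum sum_distrib_left sum_distrib_right
        scale_mult mult_ac del: pairing.simps, rule sum.cong[OF refl], rule sum.swap)
  finally show ?thesis .
qed

text \<open>By induction on the word, such a product rule makes the letters act by superderivations and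
  turns concatenation into composition in the opposite order.\<close>

abbreviation rows :: "(nat \<times> nat) set" where "rows \<equiv> {..<N} \<times> UNIV"

lemma linext_linext: "linext \<phi> (linext \<psi> z) = linext (\<lambda>w. linext \<phi> (\<psi> w)) z"
  by (simp add: linext_def[of \<psi>] lin_sum[OF lin_linext] lin_scale[OF lin_linext]) (simp add: linext_def)

lemma Rop_mult:
  assumes F: "\<And>w. w \<in> Poly_Mapping.keys F \<Longrightarrow> \<exists>d i. w = [(d, i)] \<and> d < N \<and> gpar k m (d, i) = e"
    and f: "f \<in> fa rows"
  shows "Rop k N m \<tau> x (F * f) = linext (\<lambda>(x1, x2).
     scale (sg (e * wpar (gpar k k) x2)) (Rop k N m \<tau> x1 F * Rop k N m \<tau> x2 f)) (cop k x)"
proof -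
  have lin: "lin (\<lambda>F. linext (\<lambda>(x1, x2). scale (sg (e * wpar (gpar k k) x2)) (Rop k N m \<tau> x1 (g F) * Rop k N m \<tau> x2 y)) (cop k x))"
    "lin (\<lambda>F. linext (\<lambda>(x1, x2). scale (sg (e * wpar (gpar k k) x2)) (Rop k N m \<tau> x1 y * Rop k N m \<tau> x2 (g F))) (cop k x))"
    if "lin g" for g :: "(nat \<times> nat) falg \<Rightarrow> (nat \<times> nat) falg" and y
    unfolding case_prod_unfold
    by (rule linext_fun, intro lin_scaled lin_mult_const lin_const_mult lin_compose[OF lin_Rop] that)+
  show ?thesis
  proof (rule lin_eq_on[where h = "\<lambda>F. Rop k N m \<tau> x (F * f)" and x = F])
    show "lin (\<lambda>F. Rop k N m \<tau> x (F * f))" by (intro lin_compose[OF lin_Rop] lin_mult_const lin_id)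
    show "lin (\<lambda>F. linext (\<lambda>(x1, x2). scale (sg (e * wpar (gpar k k) x2)) (Rop k N m \<tau> x1 F * Rop k N m \<tau> x2 f)) (cop k x))"
      by (rule lin(1)[OF lin_id])
    fix w assume "w \<in> Poly_Mapping.keys F"
    then obtain d i where w: "w = [(d, i)]" "d < N" "gpar k m (d, i) = e" using F by blast
    show "Rop k N m \<tau> x (elt w * f) = linext (\<lambda>(x1, x2). scale (sg (e * wpar (gpar k k) x2)) (Rop k N m \<tau> x1 (elt w) * Rop k N m \<tau> x2 f)) (cop k x)"
    proof (rule lin_eq_on[where h = "\<lambda>f. Rop k N m \<tau> x (elt w * f)" and x = f])
      show "lin (\<lambda>f. Rop k N m \<tau> x (elt w * f))" by (intro lin_compose[OF lin_Rop] lin_const_mult lin_id)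
      show "lin (\<lambda>f. linext (\<lambda>(x1, x2). scale (sg (e * wpar (gpar k k) x2)) (Rop k N m \<tau> x1 (elt w) * Rop k N m \<tau> x2 f)) (cop k x))"
        by (rule lin(2)[OF lin_id])
      fix v assume "v \<in> Poly_Mapping.keys f"
      then have "v \<in> lists rows" using f by (auto dest: fa_keys)
      from Rop_Cons[OF w(2) this, of m x i] w
      show "Rop k N m \<tau> x (elt w * elt v) = linext (\<lambda>(x1, x2). scale (sg (e * wpar (gpar k k) x2)) (Rop k N m \<tau> x1 (elt w) * Rop k N m \<tau> x2 (elt v))) (cop k x)"
        by simp
    qed
  qed
qed

lemma Rop_fa_letter: "a < N \<Longrightarrow> Rop k N m \<tau> x (elt [(a, i)]) \<in> fa rows"
  unfolding Rop_letter by (intro fa_linear) auto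

lemma Rop_id: "w \<in> lists rows \<Longrightarrow> Rop k N m \<tau> [] (elt w) = elt w"
proof (induction w)
  case (Cons g w)
  obtain a i where g: "g = (a, i)" "a < N" using Cons.prems by auto
  have "Rop k N m \<tau> [] (elt [(a, i)]) = (\<Sum>c<N. if c = a then elt [(c, i)] else 0)"
    unfolding Rop_letter using g by (intro sum.cong) (auto simp: coeff_Nil csg_def)
  also have "\<dots> = elt [(a, i)]" using g by simp
  finally show ?case
    using Rop_Cons[of a w UNIV m "[]" i] Cons g by (simp add: cop_Nil)
qed (simp add: Rop_Nil)

text \<open>A letter is primitive, so only two terms remain in the product rule.\<close>

lemma Rop_derivation:
  assumes "a < N" "w \<in> lists rows"
  shows "Rop k N m \<tau> [h] (elt ((a, i) # w)) = Rop k N m \<tau> [h] (elt [(a, i)]) * elt w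
    + scale (sg (gpar k k h * gpar k m (a, i))) (elt [(a, i)] * Rop k N m \<tau> [h] (elt w))"
  using Rop_Cons[OF assms, of m "[h]" i] Rop_id[of "[(a, i)]" m] Rop_id[of w m] assms
  by (simp add: cop_Cons cop_Nil lin_add[OF lin_linext] mult.commute)

lemma Rop_sder:
  assumes "f \<in> fa rows"
  shows "Rop k N m \<tau> [h] f = sder (gpar k m) (gpar k k h) (\<lambda>g. Rop k N m \<tau> [h] (gen g)) f"
proof (rule lin_eq_on[OF lin_Rop lin_sder])
  fix w assume "w \<in> Poly_Mapping.keys f"
  then have "w \<in> lists rows" using assms by (auto dest: fa_keys)
  then show "Rop k N m \<tau> [h] (elt w) = sder (gpar k m) (gpar k k h) (\<lambda>g. Rop k N m \<tau> [h] (gen g)) (elt w)"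
  proof (induction w)
    case (Cons g w)
    obtain a i where g: "g = (a, i)" "a < N" using Cons by auto
    have w: "w \<in> lists rows" using Cons by simp
    have "Rop k N m \<tau> [h] (elt (g # w)) = Rop k N m \<tau> [h] (gen g) * elt w
        + scale (sg (gpar k k h * gpar k m g)) (gen g * Rop k N m \<tau> [h] (elt w))"
      unfolding g(1) gen_elt by (rule Rop_derivation[OF g(2) w])
    then show ?case using Cons.IH by simp
  qed (simp add: Rop_Nil)
qed

lemma Rop_letter_support:
  assumes "a < N" "w \<in> Poly_Mapping.keys (Rop k N m \<tau> x (elt [(a, i)]))"
  shows "\<exists>d j. w = [(d, j)] \<and> d < N \<and> gpar k m (d, j) = wpar (gpar k k) x + gpar k m (a, i)"
proof -
  let ?S = "{w. \<exists>d j. w = [(d, j)] \<and> d < N \<and> gpar k m (d, j) = wpar (gpar k k) x + gpar k m (a, i)}"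
  have "Rop k N m \<tau> x (elt [(a, i)]) \<in> {x. Poly_Mapping.keys x \<subseteq> ?S}"
    unfolding Rop_letter
  proof (rule subsp_sum[OF subsp_supp])
    fix c assume c: "c \<in> {..<N}"
    show "scale (csg k m a c i * \<tau> (a, c) (elt x)) (elt [(c, i)]) \<in> {x. Poly_Mapping.keys x \<subseteq> ?S}"
    proof (cases "\<tau> (a, c) (elt x) = 0")
      case False
      then have "wpar (gpar k k) x = par k a + par k c" using coeff_par assms(1) c by auto
      then have "elt [(c, i)] \<in> {x. Poly_Mapping.keys x \<subseteq> ?S}" using c by (simp add: ac_simps)
      then show ?thesis by (rule subsp_scale[OF subsp_supp])
    qed simp
  qed
  then show ?thesis using assms(2) by blast
qed

lemma Rop_fa:
  assumes "f \<in> fa rows"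
  shows "Rop k N m \<tau> [h] f \<in> fa rows"
  unfolding Rop_sder[OF assms] using assms by (intro sder_fa) (auto simp: gen_elt Rop_fa_letter)

text \<open>On a generator the operators multiply matrix coefficients; the row index is hit first, which
  reverses the order of composition.\<close>

lemma Rop_comp_letter:
  assumes "a < N"
  shows "Rop k N m \<tau> (h # x) (elt [(a, i)]) = scale (sg (gpar k k h * wpar (gpar k k) x)) (Rop k N m \<tau> x (Rop k N m \<tau> [h] (elt [(a, i)])))"
proof -
  have "Rop k N m \<tau> (h # x) (elt [(a, i)])
      = (\<Sum>c<N. \<Sum>d<N. scale (csg k m a c i * (\<tau> (a, d) (elt [h]) * \<tau> (d, c) (elt x))) (elt [(c, i)]))"
    unfolding Rop_letter using assms
    by (intro sum.cong refl) (simp add: coeff_Cons scale_sum_scalar sum_distrib_left)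
  also have "\<dots> = (\<Sum>c<N. \<Sum>d<N. scale (sg (gpar k k h * wpar (gpar k k) x) * (csg k m a d i * \<tau> (a, d) (elt [h]) * (csg k m d c i * \<tau> (d, c) (elt x)))) (elt [(c, i)]))"
  proof (intro sum.cong refl)
    fix c d assume cd: "c \<in> {..<N}" "d \<in> {..<N}"
    show "scale (csg k m a c i * (\<tau> (a, d) (elt [h]) * \<tau> (d, c) (elt x))) (elt [(c, i)])
      = scale (sg (gpar k k h * wpar (gpar k k) x) * (csg k m a d i * \<tau> (a, d) (elt [h]) * (csg k m d c i * \<tau> (d, c) (elt x)))) (elt [(c, i)])"
    proof (cases "\<tau> (a, d) (elt [h]) = 0 \<or> \<tau> (d, c) (elt x) = 0")
      case False
      then have p: "gpar k k h = par k a + par k d" "wpar (gpar k k) x = par k d + par k c"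
        using coeff_par[of a d "[h]"] coeff_par[of d c x] assms cd by auto
      have "csg k m a c i = sg (gpar k k h * wpar (gpar k k) x) * (csg k m a d i * csg k m d c i)"
        unfolding p csg_def sg_add[symmetric]
        by (cases "par k a"; cases "par k c"; cases "par k d"; cases "par m i"; simp)
      then show ?thesis by (simp add: mult_ac)
    qed auto
  qed
  also have "\<dots> = scale (sg (gpar k k h * wpar (gpar k k) x)) (Rop k N m \<tau> x (Rop k N m \<tau> [h] (elt [(a, i)])))"
    unfolding Rop_letter lin_sum[OF lin_Rop] lin_scale[OF lin_Rop]
    by (simp add: scale_sum mult.assoc) (rule sum.swap)
  finally show ?thesis .
qed

lemma Rop_comp_word:
  "w \<in> lists rows \<Longrightarrow>
   Rop k N m \<tau> (h # x) (elt w) = scale (sg (gpar k k h * wpar (gpar k k) x)) (Rop k N m \<tau> x (Rop k N m \<tau> [h] (elt w)))"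
proof (induction w arbitrary: x)
  case Nil
  then show ?case by (simp add: Rop_Nil lin_0[OF lin_Rop])
next
  case (Cons g w)
  obtain a i where g: "g = (a, i)" "a < N" using Cons.prems by auto
  have w: "w \<in> lists rows" using Cons.prems by simp
  let ?R = "Rop k N m \<tau>" and ?p = "wpar (gpar k k)" and ?g = "gpar k m (a, i)" and ?h = "gpar k k h"
  have Rw: "?R [h] (elt w) \<in> fa rows" using w by (intro Rop_fa) simp
  have "?R (h # x) (elt (g # w)) = linext (\<lambda>(x1, x2).
     scale (sg (?g * ?p x2)) (?R (h # x1) (elt [(a, i)]) * ?R x2 (elt w))
     + scale (sg (?h * ?p x1) * sg (?g * (?h + ?p x2))) (?R x1 (elt [(a, i)]) * ?R (h # x2) (elt w))) (cop k x)"
    unfolding g(1) Rop_Cons[OF g(2) w] cop_Cons linext_linext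
    by (intro linext_cong) (auto simp: lin_add[OF lin_linext] lin_scale[OF lin_linext])
  also have "\<dots> = linext (\<lambda>(x1, x2). scale (sg (?h * ?p x))
      (scale (sg ((?h + ?g) * ?p x2)) (?R x1 (?R [h] (elt [(a, i)])) * ?R x2 (elt w))
      + scale (sg (?h * ?g)) (scale (sg (?g * ?p x2)) (?R x1 (elt [(a, i)]) * ?R x2 (?R [h] (elt w)))))) (cop k x)"
  proof (rule linext_cong, clarify)
    fix x1 x2 assume "(x1, x2) \<in> Poly_Mapping.keys (cop k x)"
    then have x: "?p x = ?p x1 + ?p x2" using cop_keys by metis
    have s1: "sg (?g * ?p x2) * sg (?h * ?p x1) = sg (?h * ?p x) * sg ((?h + ?g) * ?p x2)"
      unfolding x sg_add[symmetric] by (cases "?p x1"; cases "?p x2"; cases ?h; cases ?g; simp)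
    have s2: "sg (?h * ?p x1) * sg (?g * (?h + ?p x2)) * sg (?h * ?p x2) = sg (?h * ?p x) * (sg (?h * ?g) * sg (?g * ?p x2))"
      unfolding x sg_add[symmetric] by (cases "?p x1"; cases "?p x2"; cases ?h; cases ?g; simp)
    show "scale (sg (?g * ?p x2)) (?R (h # x1) (elt [(a, i)]) * ?R x2 (elt w))
       + scale (sg (?h * ?p x1) * sg (?g * (?h + ?p x2))) (?R x1 (elt [(a, i)]) * ?R (h # x2) (elt w))
      = scale (sg (?h * ?p x)) (scale (sg ((?h + ?g) * ?p x2)) (?R x1 (?R [h] (elt [(a, i)])) * ?R x2 (elt w))
       + scale (sg (?h * ?g)) (scale (sg (?g * ?p x2)) (?R x1 (elt [(a, i)]) * ?R x2 (?R [h] (elt w)))))"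
      unfolding Rop_comp_letter[OF g(2), of m h x1 i] Cons.IH[OF w, of x2] scale_mult scale_add
      by (simp only: scale_simps s1 s2)
  qed
  also have "\<dots> = scale (sg (?h * ?p x)) (?R x (?R [h] (elt [(a, i)]) * elt w)
      + scale (sg (?h * ?g)) (?R x (elt [(a, i)] * ?R [h] (elt w))))"
  proof -
    have scale_in: "linext (\<lambda>z. scale c (\<phi> z)) y = scale c (linext \<phi> y)" for c \<phi> and y :: "(nat \<times> nat, nat \<times> nat) ftens"
      by (simp add: linext_def scale_sum mult.commute)
    have add_in: "linext (\<lambda>z. \<phi> z + \<psi> z) y = linext \<phi> y + linext \<psi> y" for \<phi> \<psi> and y :: "(nat \<times> nat, nat \<times> nat) ftens"
      by (simp add: linext_def scale_add sum.distrib)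
    have 1: "?R x (?R [h] (elt [(a, i)]) * elt w) = linext (\<lambda>(x1, x2).
         scale (sg ((?h + ?g) * ?p x2)) (?R x1 (?R [h] (elt [(a, i)])) * ?R x2 (elt w))) (cop k x)"
    proof (rule Rop_mult)
      fix w' assume "w' \<in> Poly_Mapping.keys (?R [h] (elt [(a, i)]))"
      from Rop_letter_support[OF g(2) this]
      show "\<exists>d i'. w' = [(d, i')] \<and> d < N \<and> gpar k m (d, i') = ?h + ?g" by (simp del: gpar_simp)
    qed (use w in simp)
    have 2: "?R x (elt [(a, i)] * ?R [h] (elt w)) = linext (\<lambda>(x1, x2).
         scale (sg (?g * ?p x2)) (?R x1 (elt [(a, i)]) * ?R x2 (?R [h] (elt w)))) (cop k x)"
      using Rw g(2) by (intro Rop_mult) auto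
    show ?thesis unfolding 1 2 case_prod_unfold scale_in add_in by (rule refl)
  qed
  also have "\<dots> = scale (sg (?h * ?p x)) (?R x (?R [h] (elt (g # w))))"
    unfolding g(1) Rop_derivation[OF g(2) w] by (simp only: lin_add[OF lin_Rop] lin_scale[OF lin_Rop])
  finally show ?case .
qed

end

text \<open>The sign picked up when the letters of a word are reversed in order.\<close>

primrec revsg :: "('g \<Rightarrow> bit) \<Rightarrow> 'g list \<Rightarrow> complex" where
  "revsg p [] = 1"
| "revsg p (g # w) = sg (p g * wpar p w) * revsg p w"

context matrix_coeffs
begin

text \<open>Every operator is known as soon as the superderivations belonging to the letters are known.\<close>

lemma Rop_word:
  assumes "f \<in> fa rows"
  shows "Rop k N m \<tau> x f = scale (revsg (gpar k k) x) (fold (\<lambda>h. Rop k N m \<tau> [h]) x f)"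
  using assms
proof (induction x arbitrary: f)
  case Nil
  have "Rop k N m \<tau> [] f = f"
    by (rule lin_eq_on[OF lin_Rop lin_id]) (use Nil Rop_id fa_keys in blast)
  then show ?case by simp
next
  case (Cons h x)
  have "Rop k N m \<tau> (h # x) f = scale (sg (gpar k k h * wpar (gpar k k) x)) (Rop k N m \<tau> x (Rop k N m \<tau> [h] f))"
  proof (rule lin_eq_on[OF lin_Rop])
    show "lin (\<lambda>f. scale (sg (gpar k k h * wpar (gpar k k) x)) (Rop k N m \<tau> x (Rop k N m \<tau> [h] f)))"
      by (intro lin_scaled lin_compose[OF lin_Rop] lin_Rop)
  qed (use Cons.prems Rop_comp_word fa_keys in blast)
  then show ?case using Cons.IH[OF Rop_fa[OF Cons.prems]] by simp
qed

end


section \<open>The two families of matrix coefficients\<close>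

definition unit_prod :: "nat \<Rightarrow> (nat \<times> nat) list \<Rightarrow> complex mat" where
  "unit_prod N x = foldr (\<lambda>g A. mat_unit N g * A) x (1\<^sub>m N)"

lemma mat_unit_carrier [simp]: "mat_unit N g \<in> carrier_mat N N"
  by (cases g) (simp add: mat_unit_def)

lemma mat_unit_entry: "i < N \<Longrightarrow> j < N \<Longrightarrow> mat_unit N (a, b) $$ (i, j) = (if i = a \<and> j = b then 1 else 0)"
  by (simp add: mat_unit_def)

lemma unit_prod_carrier [simp]: "unit_prod N x \<in> carrier_mat N N"
  by (induction x) (auto simp: unit_prod_def intro!: mult_carrier_mat[of _ N N _ N])

lemma unit_prod_append: "unit_prod N (x @ y) = unit_prod N x * unit_prod N y"
proof (induction x)
  case (Cons g x)
  have "unit_prod N ((g # x) @ y) = mat_unit N g * (unit_prod N x * unit_prod N y)"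
    using Cons by (simp add: unit_prod_def)
  also have "\<dots> = (mat_unit N g * unit_prod N x) * unit_prod N y"
    by (rule assoc_mult_mat[symmetric, of _ N N _ N _ N]) simp_all
  finally show ?case by (simp add: unit_prod_def)
next
  case Nil
  have "1\<^sub>m N * unit_prod N y = unit_prod N y" by (rule left_mult_one_mat[OF unit_prod_carrier])
  then show ?case by (simp add: unit_prod_def)
qed

lemma mat_mult_entry:
  "A \<in> carrier_mat N N \<Longrightarrow> B \<in> carrier_mat N N \<Longrightarrow> i < N \<Longrightarrow> j < N \<Longrightarrow>
   (A * B) $$ (i, j) = (\<Sum>d<N. A $$ (i, d) * B $$ (d, j))"
  by (simp add: scalar_prod_def lessThan_atLeast0)

lemma unit_prod_single: "unit_prod N [g] = mat_unit N g"
  unfolding unit_prod_def by (simp add: right_mult_one_mat[of _ N N])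

lemma unit_prod_par:
  "i < N \<Longrightarrow> j < N \<Longrightarrow> unit_prod N x $$ (i, j) \<noteq> 0 \<Longrightarrow> par k i + par k j = wpar (gpar k k) x"
proof (induction x arbitrary: i)
  case Nil
  then show ?case by (auto simp: unit_prod_def split: if_splits)
next
  case (Cons g x)
  obtain a b where g: "g = (a, b)" by (cases g)
  have "unit_prod N (g # x) = mat_unit N g * unit_prod N x" by (simp add: unit_prod_def)
  then have "(\<Sum>d<N. mat_unit N g $$ (i, d) * unit_prod N x $$ (d, j)) \<noteq> 0"
    using Cons.prems mat_mult_entry[OF mat_unit_carrier unit_prod_carrier, of i N j g x] by simp
  then obtain d where d: "d < N" "mat_unit N g $$ (i, d) \<noteq> 0" "unit_prod N x $$ (d, j) \<noteq> 0"
    by (metis (no_types, lifting) lessThan_iff mult_zero_left mult_zero_right sum.neutral)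
  then have "i = a" "d = b" using Cons.prems g by (auto simp: mat_unit_entry split: if_splits)
  then show ?case using Cons.IH[of d] d Cons.prems g by (auto simp: ac_simps simp flip: Cons.IH[of d])
qed

lemma natrep_elt: "i < N \<Longrightarrow> j < N \<Longrightarrow> natrep N (scale c (elt x)) $$ (i, j) = c * unit_prod N x $$ (i, j)"
  by (cases "c = 0") (simp_all add: natrep_def unit_prod_def scale_single lookup_single)

lemma tfun_elt: "a < N \<Longrightarrow> c < N \<Longrightarrow> tfun N (a, c) (elt x) = unit_prod N x $$ (a, c)"
  using natrep_elt[of a N c 1 x] by (simp add: tfun_def)

text \<open>The coefficient with which the antipode reverses a word.\<close>

primrec antisg :: "('g \<Rightarrow> bit) \<Rightarrow> 'g list \<Rightarrow> complex" where
  "antisg p [] = 1"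
| "antisg p (g # w) = - sg (p g * wpar p w) * antisg p w"

lemma antipode_elt: "antipode k (elt y) = scale (antisg (gpar k k) y) (elt (rev y))"
proof -
  have "antipode_word k y = scale (antisg (gpar k k) y) (elt (rev y))"
    by (induction y) (simp_all add: one_elt gen_elt scale_mult)
  then show ?thesis by (simp add: antipode_def)
qed

lemma tbarfun_elt: "b < N \<Longrightarrow> c < N \<Longrightarrow> tbarfun N r (b, c) (elt y)
    = sg (par r c * (par r b + par r c)) * (antisg (gpar r r) y * unit_prod N (rev y) $$ (c, b))"
  by (simp add: tbarfun_def antipode_elt natrep_elt)

lemma wpar_rev [simp]: "wpar p (rev x) = wpar p x"
  by (induction x) (simp_all add: add.commute)

lemma matrix_coeffs_tfun: "matrix_coeffs k N (tfun N)"
proof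
  fix a c h x assume ac: "a < N" "c < N"
  have "unit_prod N (h # x) = unit_prod N [h] * unit_prod N x"
    using unit_prod_append[of N "[h]" x] by simp
  then show "tfun N (a, c) (elt (h # x)) = (\<Sum>d<N. tfun N (a, d) (elt [h]) * tfun N (d, c) (elt x))"
    using ac by (simp add: tfun_elt mat_mult_entry[OF unit_prod_carrier unit_prod_carrier])
  show "tfun N (a, c) (elt []) = (if a = c then 1 else 0)"
    using ac by (simp add: tfun_elt unit_prod_def)
next
  fix a c x assume "a < N" "c < N" "tfun N (a, c) (elt x) \<noteq> 0"
  then show "par k a + par k c = wpar (gpar k k) x"
    by (simp add: tfun_elt unit_prod_par)
qed

text \<open>The antipode reverses words and the exchange of rows and columns reverses products of matrices.
  The two reversals cancel, so these functions are the matrix coefficients of the dual representation.\<close>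

lemma matrix_coeffs_tbarfun: "matrix_coeffs r N (tbarfun N r)"
proof
  fix b c :: nat and h x assume bc: "b < N" "c < N"
  show "tbarfun N r (b, c) (elt []) = (if b = c then 1 else 0)"
    using bc by (auto simp: tbarfun_elt unit_prod_def)
  have "tbarfun N r (b, c) (elt (h # x)) = (\<Sum>d<N. sg (par r c * (par r b + par r c)) *
      (antisg (gpar r r) (h # x) * (unit_prod N (rev x) $$ (c, d) * unit_prod N [h] $$ (d, b))))"
    using bc by (simp add: tbarfun_elt unit_prod_append mat_mult_entry[OF unit_prod_carrier unit_prod_carrier] sum_distrib_left sum_negf)
  also have "\<dots> = (\<Sum>d<N. tbarfun N r (b, d) (elt [h]) * tbarfun N r (d, c) (elt x))"
  proof (intro sum.cong refl)
    fix d assume d: "d \<in> {..<N}"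
    show "sg (par r c * (par r b + par r c)) * (antisg (gpar r r) (h # x) * (unit_prod N (rev x) $$ (c, d) * unit_prod N [h] $$ (d, b)))
      = tbarfun N r (b, d) (elt [h]) * tbarfun N r (d, c) (elt x)"
    proof (cases "unit_prod N (rev x) $$ (c, d) = 0 \<or> unit_prod N [h] $$ (d, b) = 0")
      case False
      then have p: "wpar (gpar r r) x = par r c + par r d" "gpar r r h = par r d + par r b"
        using unit_prod_par[of c N d "rev x" r] unit_prod_par[of d N b "[h]" r] d bc by auto
      have "sg (par r c * (par r b + par r c)) * sg (gpar r r h * wpar (gpar r r) x)
         = sg (par r d * (par r b + par r d)) * sg (par r c * (par r d + par r c))"
        unfolding p sg_add[symmetric] by (cases "par r b"; cases "par r c"; cases "par r d"; simp)
      then show ?thesis using d bc by (simp add: tbarfun_elt mult_ac)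
    qed (use d bc in \<open>auto simp: tbarfun_elt\<close>)
  qed
  finally show "tbarfun N r (b, c) (elt (h # x)) = (\<Sum>d<N. tbarfun N r (b, d) (elt [h]) * tbarfun N r (d, c) (elt x))" .
next
  fix b c x assume "b < N" "c < N" "tbarfun N r (b, c) (elt x) \<noteq> 0"
  then show "par r b + par r c = wpar (gpar r r) x"
    using unit_prod_par[of c N b "rev x" r] by (simp add: tbarfun_elt add.commute)
qed

section \<open>The two actions as compositions of superderivations\<close>

text \<open>The matrix unit \<open>e_(p,q)\<close> is transposed by w, and the coefficient of \<open>e_(q,p)\<close> in row a and
  column c vanishes unless a = q and c = p: the row q is replaced by p.\<close>

definition dL :: "nat \<Rightarrow> nat \<Rightarrow> nat \<times> nat \<Rightarrow> nat \<times> nat \<Rightarrow> (nat \<times> nat) falg" where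
  "dL k m = (\<lambda>(p, q) (a, i). if a = q then scale (csg k m q p i) (gen (p, i)) else 0)"

text \<open>The antipode is applied twice, once by the action and once by \<^const>\<open>tbarfun\<close>, so \<open>e_(p,q)\<close> again
  replaces the row q by p; the signs of the coaction and of \<^const>\<open>tbarfun\<close> combine to the one given
  here.\<close>

definition dR :: "nat \<Rightarrow> nat \<Rightarrow> nat \<times> nat \<Rightarrow> nat \<times> nat \<Rightarrow> (nat \<times> nat) falg" where
  "dR r m = (\<lambda>(p, q) (b, j). if b = q then scale (sg ((par r p + par r q) * par m j)) (gen (p, j)) else 0)"

abbreviation DL :: "nat \<Rightarrow> nat \<Rightarrow> nat \<times> nat \<Rightarrow> (nat \<times> nat) falg \<Rightarrow> (nat \<times> nat) falg" where
  "DL k m g \<equiv> sder (gpar k m) (gpar k k g) (dL k m g)"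

abbreviation DR :: "nat \<Rightarrow> nat \<Rightarrow> nat \<times> nat \<Rightarrow> (nat \<times> nat) falg \<Rightarrow> (nat \<times> nat) falg" where
  "DR r m g \<equiv> sder (gpar r m) (gpar r r g) (dR r m g)"

lemma sder_cong:
  assumes "\<And>g. g \<in> G \<Longrightarrow> d g = d' g" "x \<in> fa G"
  shows "sder p e d x = sder p e d' x"
proof (rule lin_eq_on[OF lin_sder lin_sder])
  fix w assume "w \<in> Poly_Mapping.keys x"
  with assms(2) have "w \<in> lists G" by (auto dest: fa_keys)
  then show "sder p e d (elt w) = sder p e d' (elt w)"
    by (induction w) (auto simp: assms(1))
qed

lemma sder_uminus: "sder p e (\<lambda>g. - d g) x = - sder p e d x"
proof (rule lin_eq[OF lin_sder lin_neg[OF lin_sder]])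
  fix w show "sder p e (\<lambda>g. - d g) (elt w) = - sder p e d (elt w)"
    by (induction w) (simp_all add: scale_add)
qed

lemma revsg_append: "revsg p (u @ v) = revsg p u * revsg p v * sg (wpar p u * wpar p v)"
  by (induction u) (simp_all add: distrib_left distrib_right sg_add mult_ac)

lemma revsg_rev: "revsg p (rev u) = revsg p u"
  by (induction u) (simp_all add: revsg_append mult_ac)

lemma gpar_swap [simp]: "gpar k k (prod.swap g) = gpar k k g"
  by (cases g) (simp add: add.commute)

lemma wpar_map: "wpar p (map f u) = wpar (\<lambda>x. p (f x)) u"
  by (induction u) simp_all

lemma revsg_map: "revsg p (map f u) = revsg (\<lambda>x. p (f x)) u"
  by (induction u) (simp_all add: wpar_map)

lemma gl_gens_iff [simp]: "(p, q) \<in> gl_gens k l \<longleftrightarrow> p < k + l \<and> q < k + l"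
  by (auto simp: gl_gens_def)

text \<open>The map w reverses words and so undoes the reversal in the composition of the operators, but
  without the sign that a graded anti-automorphism would contribute.\<close>

lemma L_act_eq:
  assumes f: "f \<in> fa ({..<k + l} \<times> UNIV)" and x: "x \<in> lists (gl_gens k l)"
  shows "L_act k l m (elt x) f = scale (revsg (gpar k k) x) (foldr (DL k m) x f)"
    and "foldr (DL k m) x f \<in> fa ({..<k + l} \<times> UNIV)"
proof -
  interpret matrix_coeffs k "k + l" "tfun (k + l)" by (rule matrix_coeffs_tfun)
  let ?R = "Rop k (k + l) m (tfun (k + l))"
  have letter: "?R [prod.swap g] f' = DL k m g f'" and fa: "DL k m g f' \<in> fa rows"
    if g: "g \<in> gl_gens k l" and f': "f' \<in> fa rows" for g f'
  proof -
    obtain p q where pq: "g = (p, q)" "p < k + l" "q < k + l" using g by (cases g) auto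
    have "?R [(q, p)] (gen (a, i)) = dL k m g (a, i)" if "a < k + l" for a i
    proof -
      have "?R [(q, p)] (gen (a, i)) = (\<Sum>c<k + l. if c = p then scale (csg k m a c i * (if a = q then 1 else 0)) (elt [(c, i)]) else 0)"
        unfolding gen_elt Rop_letter using that
        by (intro sum.cong) (auto simp: tfun_elt unit_prod_single mat_unit_entry)
      also have "\<dots> = dL k m g (a, i)" using pq by (simp add: dL_def gen_elt)
      finally show ?thesis .
    qed
    then show "?R [prod.swap g] f' = DL k m g f'"
      unfolding Rop_sder[OF f'] gpar_swap wpar_simps
      by (intro sder_cong[OF _ f']) (auto simp: pq)
    show "DL k m g f' \<in> fa rows"
      using f' pq by (intro sder_fa) (auto simp: dL_def intro!: fa_linear)
  qed
  have "foldr (\<lambda>g. ?R [prod.swap g]) x f = foldr (DL k m) x f \<and> foldr (DL k m) x f \<in> fa rows"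
    using x by (induction x) (auto simp: f letter fa simp del: sder_elt)
  moreover have "L_act k l m (elt x) f = ?R (rev (map prod.swap x)) f"
    by (simp add: L_act_def wanti_def Rop_def)
  ultimately show "L_act k l m (elt x) f = scale (revsg (gpar k k) x) (foldr (DL k m) x f)"
    "foldr (DL k m) x f \<in> fa rows"
    by (simp_all add: Rop_word[OF f] revsg_rev revsg_map foldr_conv_fold rev_map[symmetric] fold_map comp_def)
       (simp add: rev_map fold_map comp_def)?
qed

text \<open>Here the reversal comes from the antipode, whose signs cancel those of the composition.\<close>

lemma Lt_act_eq:
  assumes f: "f \<in> fa ({..<r + s} \<times> UNIV)" and y: "y \<in> lists (gl_gens r s)"
  shows "Lt_act r s m (elt y) f = foldr (DR r m) y f"
    and "foldr (DR r m) y f \<in> fa ({..<r + s} \<times> UNIV)"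
proof -
  interpret matrix_coeffs r "r + s" "tbarfun (r + s) r" by (rule matrix_coeffs_tbarfun)
  let ?R = "Rop r (r + s) m (tbarfun (r + s) r)"
  have letter: "?R [g] f' = - DR r m g f'" and fa: "DR r m g f' \<in> fa rows"
    if g: "g \<in> gl_gens r s" and f': "f' \<in> fa rows" for g f'
  proof -
    obtain p q where pq: "g = (p, q)" "p < r + s" "q < r + s" using g by (cases g) auto
    have "?R [g] (gen (b, j)) = - dR r m g (b, j)" if "b < r + s" for b j
    proof -
      have "?R [g] (gen (b, j)) = (\<Sum>c<r + s. if c = p then
          scale (csg r m b c j * (sg (par r c * (par r b + par r c)) * (if b = q then -1 else 0))) (elt [(c, j)]) else 0)"
        unfolding gen_elt Rop_letter using that
        by (intro sum.cong) (auto simp: pq tbarfun_elt unit_prod_single mat_unit_entry)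
      also have "\<dots> = - dR r m g (b, j)"
      proof -
        have "csg r m q p j * sg (par r p * (par r q + par r p)) = sg ((par r p + par r q) * par m j)"
          unfolding csg_def sg_add[symmetric] by (cases "par r p"; cases "par r q"; cases "par m j"; simp)
        then show ?thesis using pq by (simp add: dR_def gen_elt)
      qed
      finally show ?thesis .
    qed
    then show "?R [g] f' = - DR r m g f'"
      unfolding Rop_sder[OF f'] sder_uminus[symmetric] by (intro sder_cong[OF _ f']) auto
    show "DR r m g f' \<in> fa rows"
      using f' pq by (intro sder_fa) (auto simp: dR_def intro!: fa_linear)
  qed
  have "scale (antisg (gpar r r) y * revsg (gpar r r) y) (foldr (\<lambda>g. ?R [g]) y f) = foldr (DR r m) y f
      \<and> foldr (\<lambda>g. ?R [g]) y f \<in> fa rows \<and> foldr (DR r m) y f \<in> fa rows"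
    using y
  proof (induction y)
    case (Cons g y)
    let ?c = "antisg (gpar r r) y * revsg (gpar r r) y" and ?z = "foldr (\<lambda>g. ?R [g]) y f"
    have g: "g \<in> gl_gens r s" and IH: "scale ?c ?z = foldr (DR r m) y f" "?z \<in> fa rows" "foldr (DR r m) y f \<in> fa rows"
      using Cons by auto
    have "scale (antisg (gpar r r) (g # y) * revsg (gpar r r) (g # y)) (foldr (\<lambda>g. ?R [g]) (g # y) f)
        = scale (- ?c) (- DR r m g ?z)"
      using letter[OF g IH(2)] by (simp add: mult_ac)
    also have "\<dots> = DR r m g (foldr (DR r m) y f)"
      by (simp add: IH(1)[symmetric] lin_scale[OF lin_sder])
    finally show ?case using g IH fa[OF g IH(2)] fa[OF g IH(3)] letter[OF g IH(2)] by (simp add: fa_linear)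
  qed (simp add: f)
  moreover have "Lt_act r s m (elt y) f = scale (antisg (gpar r r) y) (?R (rev y) f)"
    by (simp only: Lt_act_def antipode_elt pairing_scale slice_scale Rop_def)
  ultimately show "Lt_act r s m (elt y) f = foldr (DR r m) y f"
    "foldr (DR r m) y f \<in> fa rows"
    by (simp_all add: Rop_word[OF f] revsg_rev foldr_conv_fold)
qed


section \<open>The tensor action on P\<close>

text \<open>The extension of \<^const>\<open>dL\<close> to P that annihilates the T-bar.\<close>

definition eL :: "nat \<Rightarrow> nat \<Rightarrow> nat \<times> nat \<Rightarrow> pgen \<Rightarrow> pgen falg" where
  "eL k m = (\<lambda>(p, q). case_sum
     (\<lambda>(a, i). if a = q then scale (csg k m q p i) (gen (Inl (p, i))) else 0) (\<lambda>_. 0))"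

text \<open>The extension of \<^const>\<open>dR\<close> to P that annihilates the T.\<close>

definition eR :: "nat \<Rightarrow> nat \<Rightarrow> nat \<times> nat \<Rightarrow> pgen \<Rightarrow> pgen falg" where
  "eR r m = (\<lambda>(p, q). case_sum (\<lambda>_. 0)
     (\<lambda>(b, j). if b = q then scale (sg ((par r p + par r q) * par m j)) (gen (Inr (p, j))) else 0))"

abbreviation EL :: "nat \<Rightarrow> nat \<Rightarrow> nat \<Rightarrow> nat \<times> nat \<Rightarrow> pgen falg \<Rightarrow> pgen falg" where
  "EL k r m g \<equiv> sder (ppar k r m) (gpar k k g) (eL k m g)"

abbreviation ER :: "nat \<Rightarrow> nat \<Rightarrow> nat \<Rightarrow> nat \<times> nat \<Rightarrow> pgen falg \<Rightarrow> pgen falg" where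
  "ER k r m g \<equiv> sder (ppar k r m) (gpar r r g) (eR r m g)"

abbreviation incl :: "(nat \<times> nat) falg \<Rightarrow> pgen falg" where
  "incl \<equiv> fhom (\<lambda>t. gen (Inl t))"

abbreviation incr :: "(nat \<times> nat) falg \<Rightarrow> pgen falg" where
  "incr \<equiv> fhom (\<lambda>t. gen (Inr t))"

lemma fa_UNIV [simp]: "x \<in> fa UNIV"
  by (simp add: fa_def)

lemma eL_simps: "eL k m (p, q) (Inl (a, i)) = (if a = q then scale (csg k m q p i) (gen (Inl (p, i))) else 0)"
  "eL k m g (Inr t) = 0"
  by (simp add: eL_def, cases g, simp add: eL_def)

lemma eR_simps: "eR r m (p, q) (Inr (b, j)) = (if b = q then scale (sg ((par r p + par r q) * par m j)) (gen (Inr (p, j))) else 0)"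
  "eR r m g (Inl t) = 0"
  by (simp add: eR_def, cases g, simp add: eR_def)

lemma EL_incl: "EL k r m g (incl f) = incl (DL k m g f)"
proof (rule sder_fhom[where G = UNIV])
  fix t show "EL k r m g (gen (Inl t)) = incl (dL k m g t)"
    by (cases g; cases t) (simp add: eL_simps dL_def lin_scale[OF lin_fhom] lin_0[OF lin_fhom])
qed simp_all

lemma EL_incr: "EL k r m g (incr f) = 0"
  by (rule sder_fhom_zero[where G = UNIV and p = "gpar r m"]) (simp_all add: eL_simps)

lemma ER_incr: "ER k r m g (incr f) = incr (DR r m g f)"
proof (rule sder_fhom[where G = UNIV])
  fix t show "ER k r m g (gen (Inr t)) = incr (dR r m g t)"
    by (cases g; cases t) (simp add: eR_simps dR_def lin_scale[OF lin_fhom] lin_0[OF lin_fhom])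
qed simp_all

lemma ER_incl: "ER k r m g (incl f) = 0"
  by (rule sder_fhom_zero[where G = UNIV and p = "gpar k m"]) (simp_all add: eR_simps)

lemma foldr_EL: "foldr (EL k r m) x (incl f * incr f') = incl (foldr (DL k m) x f) * incr f'"
  by (induction x) (simp_all add: sder_mult EL_incl EL_incr del: sder_elt)

text \<open>A superderivation that annihilates the left factor picks up only the sign of passing it.\<close>

lemma foldr_ER: "foldr (ER k r m) y (incl (elt u) * incr f)
    = scale (sg (wpar (gpar r r) y * wpar (gpar k m) u)) (incl (elt u) * incr (foldr (DR r m) y f))"
proof (induction y)
  case (Cons g y)
  have "homogen (ppar k r m) (wpar (gpar k m) u) (incl (elt u))"
    by (rule homogen_fhom[where G = UNIV and p = "gpar k m"]) simp_all
  then have tw: "twist (ppar k r m) e (incl (elt u)) = scale (sg (e * wpar (gpar k m) u)) (incl (elt u))" for e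
    by (rule twist_homogen)
  have "foldr (ER k r m) (g # y) (incl (elt u) * incr f)
      = scale (sg (wpar (gpar r r) y * wpar (gpar k m) u)) (ER k r m g (incl (elt u) * incr (foldr (DR r m) y f)))"
    by (simp add: Cons lin_scale[OF lin_sder] del: sder_elt fhom_elt)
  also have "ER k r m g (incl (elt u) * incr (foldr (DR r m) y f))
      = scale (sg (gpar r r g * wpar (gpar k m) u)) (incl (elt u) * incr (foldr (DR r m) (g # y) f))"
    by (simp add: sder_mult ER_incl ER_incr tw scale_mult del: sder_elt fhom_elt)
  finally show ?case
    by (simp add: distrib_left sg_add mult.commute del: fhom_elt)
qed simp

lemma eL_fa: "g \<in> gl_gens k l \<Longrightarrow> t \<in> P_gens k l r s m n \<Longrightarrow> eL k m g t \<in> fa (P_gens k l r s m n)"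
  by (cases g, erule P_gens_cases) (auto simp: eL_simps intro!: fa_linear)

lemma eR_fa: "g \<in> gl_gens r s \<Longrightarrow> t \<in> P_gens k l r s m n \<Longrightarrow> eR r m g t \<in> fa (P_gens k l r s m n)"
  by (cases g, erule P_gens_cases) (auto simp: eR_simps intro!: fa_linear)

lemma eL_homogen: "homogen (ppar k r m) (gpar k k g + ppar k r m t) (eL k m g t)"
  by (cases g; cases t) (auto simp: eL_simps ac_simps intro!: homogen_scale)

lemma eR_homogen: "homogen (ppar k r m) (gpar r r g + ppar k r m t) (eR r m g t)"
  by (cases g; cases t) (auto simp: eR_simps ac_simps intro!: homogen_scale)

lemma foldr_EL_fa: "x \<in> lists (gl_gens k l) \<Longrightarrow> f \<in> fa (P_gens k l r s m n) \<Longrightarrow> foldr (EL k r m) x f \<in> fa (P_gens k l r s m n)"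
  by (induction x) (auto intro!: sder_fa eL_fa simp del: sder_elt)

lemma foldr_ER_fa: "y \<in> lists (gl_gens r s) \<Longrightarrow> f \<in> fa (P_gens k l r s m n) \<Longrightarrow> foldr (ER k r m) y f \<in> fa (P_gens k l r s m n)"
  by (induction y) (auto intro!: sder_fa eR_fa simp del: sder_elt)

lemma foldr_EL_rel: "x \<in> lists (gl_gens k l) \<Longrightarrow> f \<in> relid (P_gens k l r s m n) (scr (P_gens k l r s m n) (ppar k r m)) \<Longrightarrow> foldr (EL k r m) x f \<in> relid (P_gens k l r s m n) (scr (P_gens k l r s m n) (ppar k r m))"
  by (induction x) (auto intro!: sder_scr eL_fa eL_homogen simp del: sder_elt)

lemma foldr_ER_rel: "y \<in> lists (gl_gens r s) \<Longrightarrow> f \<in> relid (P_gens k l r s m n) (scr (P_gens k l r s m n) (ppar k r m)) \<Longrightarrow> foldr (ER k r m) y f \<in> relid (P_gens k l r s m n) (scr (P_gens k l r s m n) (ppar k r m))"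
  by (induction y) (auto intro!: sder_scr eR_fa eR_homogen simp del: sder_elt)

lemma lin_foldr_sder: "lin f \<Longrightarrow> lin (\<lambda>z. foldr (\<lambda>g. sder p (e g) (d g)) x (f z))"
  by (induction x) (simp_all add: lin_compose[OF lin_sder])

subsection \<open>Normal ordering\<close>

primrec lefts :: "pgen list \<Rightarrow> (nat \<times> nat) list" where
  "lefts [] = []"
| "lefts (g # w) = (case g of Inl t \<Rightarrow> t # lefts w | Inr t \<Rightarrow> lefts w)"

primrec rights :: "pgen list \<Rightarrow> (nat \<times> nat) list" where
  "rights [] = []"
| "rights (g # w) = (case g of Inl t \<Rightarrow> rights w | Inr t \<Rightarrow> t # rights w)"

text \<open>The sign of moving the T in a word to the left of the T-bar.\<close>

primrec ordsg :: "nat \<Rightarrow> nat \<Rightarrow> nat \<Rightarrow> pgen list \<Rightarrow> complex" where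
  "ordsg k r m [] = 1"
| "ordsg k r m (g # w) = (case g of Inl t \<Rightarrow> 1 | Inr t \<Rightarrow> sg (gpar r m t * wpar (gpar k m) (lefts w))) * ordsg k r m w"

lemma split_P_elt: "split_P k r m (elt w) = scale (ordsg k r m w) (elt (lefts w, rights w))"
proof (induction w)
  case Nil
  show ?case by (simp add: split_P_def thom_Nil)
next
  case (Cons g w)
  have "split_P k r m (elt (g # w)) = tmult (gpar k m) (gpar r m)
      (case_sum (\<lambda>t. tleft (gen t)) (\<lambda>t. tright (gen t)) g) (split_P k r m (elt w))"
    unfolding split_P_def by (rule thom_Cons)
  then show ?case
    unfolding Cons by (cases g) (simp_all add: gen_elt lin_scale[OF lin_tmult2[OF lin_id]] tmult_elt mult_ac)
qed

lemma lists_map: "w \<in> lists A \<Longrightarrow> (\<And>x. x \<in> A \<Longrightarrow> f x \<in> B) \<Longrightarrow> map f w \<in> lists B"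
  by (induction w) auto

lemma lists_weaken: "w \<in> lists A \<Longrightarrow> A \<subseteq> B \<Longrightarrow> w \<in> lists B"
  by (induction w) auto

lemma lefts_lists: "w \<in> lists (P_gens k l r s m n) \<Longrightarrow> lefts w \<in> lists ({..<k + l} \<times> {..<m + n})"
  by (induction w) (auto split: sum.splits)

lemma rights_lists: "w \<in> lists (P_gens k l r s m n) \<Longrightarrow> rights w \<in> lists ({..<r + s} \<times> {..<m + n})"
  by (induction w) (auto split: sum.splits)

lemma lin_split: "lin (split_P k r m)"
  unfolding split_P_def[abs_def] by (rule lin_thom)

definition nford :: "nat \<Rightarrow> nat \<Rightarrow> nat \<Rightarrow> pgen falg \<Rightarrow> pgen falg" where
  "nford k r m f = linext (\<lambda>(u, v). incl (elt u) * incr (elt v)) (split_P k r m f)"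

lemma lin_nford: "lin (nford k r m)"
  unfolding nford_def[abs_def] by (rule lin_linext_comp[OF lin_split])

lemma incl_elt: "incl (elt u) = elt (map Inl u)"
  and incr_elt: "incr (elt u) = elt (map Inr u)"
  by (induction u) (simp_all add: one_elt gen_elt)

lemma nford_cong:
  assumes "f \<in> fa (P_gens k l r s m n)"
  shows "scong (P_gens k l r s m n) (ppar k r m) (nford k r m f) f"
proof -
  let ?G = "P_gens k l r s m n"
  have word: "scong ?G (ppar k r m) (nford k r m (elt w)) (elt w)" if "w \<in> lists ?G" for w
    using that
  proof (induction w)
    case Nil
    have "nford k r m (elt []) = elt []" by (simp add: nford_def split_P_elt) (simp add: one_elt)
    then show ?case by (simp add: scong_refl)
  next
    case (Cons g w)
    have nf: "nford k r m (elt w) = scale (ordsg k r m w) (elt (map Inl (lefts w) @ map Inr (rights w)))" for w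
      by (simp add: nford_def split_P_elt lin_scale[OF lin_linext] incl_elt incr_elt del: fhom_elt)
    have L: "map Inl (lefts w) \<in> lists ?G" and R: "map Inr (rights w) \<in> lists ?G"
      by (rule lists_map[OF lefts_lists[OF Cons(2)]], force) (rule lists_map[OF rights_lists[OF Cons(2)]], force)
    have g: "g \<in> ?G" and IH: "scong ?G (ppar k r m) (nford k r m (elt w)) (elt w)" using Cons by auto
    have mult: "scong ?G (ppar k r m) (elt [g] * nford k r m (elt w)) (elt (g # w))"
      using scong_mult[OF scong_refl IH, of "elt [g]"] g Cons(2) by simp
    show ?case
    proof (cases g)
      case (Inl t)
      then have "nford k r m (elt (g # w)) = elt [g] * nford k r m (elt w)"
        by (simp add: nf scale_mult)
      then show ?thesis using mult by simp
    next
      case (Inr t)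
      have "scong ?G (ppar k r m) (elt [g] * elt (map Inl (lefts w)))
          (scale (sg (gpar r m t * wpar (gpar k m) (lefts w))) (elt (map Inl (lefts w)) * elt [g]))"
        using L g by (intro scong_commute) (auto simp: Inr wpar_map)
      then have "scong ?G (ppar k r m) (elt [g] * elt (map Inl (lefts w)) * elt (map Inr (rights w)))
          (scale (sg (gpar r m t * wpar (gpar k m) (lefts w))) (elt (map Inl (lefts w)) * elt [g]) * elt (map Inr (rights w)))"
        using L R g by (intro scong_mult scong_refl) auto
      from scong_scale[OF scong_scale[OF this, of "ordsg k r m w"], of "sg (gpar r m t * wpar (gpar k m) (lefts w))"]
      have "scong ?G (ppar k r m) (scale (sg (gpar r m t * wpar (gpar k m) (lefts w))) (elt [g] * nford k r m (elt w)))
           (scale (ordsg k r m w) (elt (map Inl (lefts w) @ g # map Inr (rights w))))"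
        by (simp add: nf scale_mult mult_ac)
      from scong_scale[OF scong_sym[OF this], of "sg (gpar r m t * wpar (gpar k m) (lefts w))"]
      have "scong ?G (ppar k r m) (nford k r m (elt (g # w))) (elt [g] * nford k r m (elt w))"
        by (simp add: nf Inr)
      then show ?thesis using mult scong_trans by blast
    qed
  qed
  have "nford k r m f - f \<in> relid ?G (scr ?G (ppar k r m))"
  proof (rule lin_in[where h = "\<lambda>f. nford k r m f - f", OF lin_minus[OF lin_nford lin_id] subsp_scr])
    fix w assume "w \<in> Poly_Mapping.keys f"
    then show "nford k r m (elt w) - elt w \<in> relid ?G (scr ?G (ppar k r m))"
      using word assms fa_keys unfolding cong_def by blast
  qed
  then show ?thesis by (simp add: cong_def)
qed

lemma nford_fa: "f \<in> fa (P_gens k l r s m n) \<Longrightarrow> nford k r m f \<in> fa (P_gens k l r s m n)"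
  by (rule cong_fa[OF scr_fa nford_cong])

lemma nford_rel: "f \<in> relid (P_gens k l r s m n) (scr (P_gens k l r s m n) (ppar k r m)) \<Longrightarrow>
    nford k r m f \<in> relid (P_gens k l r s m n) (scr (P_gens k l r s m n) (ppar k r m))"
  using subsp_add[OF subsp_scr, of "nford k r m f - f"] nford_cong[of f] relid_fa[OF scr_fa, of f]
  by (fastforce simp: cong_def)

subsection \<open>The action of pairs of words\<close>

lemma lin_tens_act1: "lin (\<lambda>z. tens_act k l r s m z f)"
  unfolding tens_act_def by (rule lin_linext)

lemma lin_tens_act2: "lin (\<lambda>f. tens_act k l r s m z f)"
  unfolding tens_act_def case_prod_unfold by (rule linext_fun) (rule lin_linext_comp[OF lin_split])

text \<open>Splitting an element of P into its two factors and multiplying them again is normal ordering;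
  between these two steps the two actions become superderivations of P.\<close>

lemma tens_act_word:
  assumes x: "x \<in> lists (gl_gens k l)" and y: "y \<in> lists (gl_gens r s)" and f: "f \<in> fa (P_gens k l r s m n)"
  shows "tens_act k l r s m (elt (x, y)) f
    = scale (revsg (gpar k k) x) (foldr (EL k r m) x (foldr (ER k r m) y (nford k r m f)))"
proof (rule lin_eq_on[where x = f, OF lin_tens_act2])
  show "lin (\<lambda>f. scale (revsg (gpar k k) x) (foldr (EL k r m) x (foldr (ER k r m) y (nford k r m f))))"
    by (intro lin_scaled lin_foldr_sder lin_nford)
  fix w assume "w \<in> Poly_Mapping.keys f"
  then have w: "w \<in> lists (P_gens k l r s m n)" using f by (auto dest: fa_keys)
  let ?u = "lefts w" and ?v = "rights w"
  have u: "elt ?u \<in> fa ({..<k + l} \<times> UNIV)" and v: "elt ?v \<in> fa ({..<r + s} \<times> UNIV)"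
    unfolding fa_elt by (rule lists_weaken[OF lefts_lists[OF w]], blast)
      (rule lists_weaken[OF rights_lists[OF w]], blast)
  have "tens_act k l r s m (elt (x, y)) (elt w) = scale (ordsg k r m w) (scale (sg (wpar (gpar r r) y * wpar (gpar k m) ?u))
      (incl (L_act k l m (elt x) (elt ?u)) * incr (Lt_act r s m (elt y) (elt ?v))))"
    by (simp add: tens_act_def split_P_elt lin_scale[OF lin_linext])
  also have "\<dots> = scale (revsg (gpar k k) x) (foldr (EL k r m) x (scale (ordsg k r m w)
      (foldr (ER k r m) y (incl (elt ?u) * incr (elt ?v)))))"
    unfolding L_act_eq(1)[OF u x] Lt_act_eq(1)[OF v y] foldr_ER
    by (simp add: lin_scale[OF lin_foldr_sder[OF lin_id]] lin_scale[OF lin_fhom] foldr_EL scale_mult mult_ac del: fhom_elt)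
  also have "\<dots> = scale (revsg (gpar k k) x) (foldr (EL k r m) x (foldr (ER k r m) y (nford k r m (elt w))))"
    by (simp add: nford_def split_P_elt lin_scale[OF lin_linext] lin_scale[OF lin_foldr_sder[OF lin_id]] del: fhom_elt)
  finally show "tens_act k l r s m (elt (x, y)) (elt w)
      = scale (revsg (gpar k k) x) (foldr (EL k r m) x (foldr (ER k r m) y (nford k r m (elt w))))" .
qed

lemma tens_act_in:
  assumes K: "subsp K" and z: "z \<in> tfa (gl_gens k l) (gl_gens r s)" and f: "f \<in> fa (P_gens k l r s m n)"
    and *: "\<And>x y. x \<in> lists (gl_gens k l) \<Longrightarrow> y \<in> lists (gl_gens r s) \<Longrightarrow>
      foldr (EL k r m) x (foldr (ER k r m) y (nford k r m f)) \<in> K"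
  shows "tens_act k l r s m z f \<in> K"
proof (rule lin_in[where x = z, OF lin_tens_act1 K])
  fix w assume "w \<in> Poly_Mapping.keys z"
  moreover obtain x y where "w = (x, y)" by (cases w)
  ultimately have "w = (x, y)" "x \<in> lists (gl_gens k l)" "y \<in> lists (gl_gens r s)"
    using tfa_keys[OF z, of x y] by auto
  then show "tens_act k l r s m (elt w) f \<in> K"
    using tens_act_word[of x k l y r s f m n] f * by (simp add: subsp_scale[OF K])
qed

lemma tens_act_fa:
  assumes "z \<in> tfa (gl_gens k l) (gl_gens r s)" "f \<in> fa (P_gens k l r s m n)"
  shows "tens_act k l r s m z f \<in> fa (P_gens k l r s m n)"
  by (rule tens_act_in[OF subsp_fa assms]) (intro foldr_EL_fa foldr_ER_fa nford_fa assms)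

lemma tens_act_rel:
  assumes "z \<in> tfa (gl_gens k l) (gl_gens r s)"
    "f \<in> relid (P_gens k l r s m n) (scr (P_gens k l r s m n) (ppar k r m))"
  shows "tens_act k l r s m z f \<in> relid (P_gens k l r s m n) (scr (P_gens k l r s m n) (ppar k r m))"
  by (rule tens_act_in[OF subsp_scr assms(1) relid_fa[OF scr_fa assms(2)]])
     (intro foldr_EL_rel foldr_ER_rel nford_rel assms)


section \<open>The relations of the enveloping superalgebra\<close>

text \<open>The supercommutator of two homogeneous superderivations is a superderivation, hence known
  once it is known on the generators.\<close>

lemma sder_bracket:
  assumes h1: "\<And>g. homogen p (e1 + p g) (d1 g)" and h2: "\<And>g. homogen p (e2 + p g) (d2 g)"
    and gen: "\<And>g. sder p e1 d1 (d2 g) - scale (sg (e1 * e2)) (sder p e2 d2 (d1 g)) = d3 g"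
  shows "sder p e1 d1 (sder p e2 d2 x) - scale (sg (e1 * e2)) (sder p e2 d2 (sder p e1 d1 x)) = sder p (e1 + e2) d3 x"
proof (rule lin_eq[where h = "\<lambda>x. sder p e1 d1 (sder p e2 d2 x) - scale (sg (e1 * e2)) (sder p e2 d2 (sder p e1 d1 x))"])
  fix w
  show "sder p e1 d1 (sder p e2 d2 (elt w)) - scale (sg (e1 * e2)) (sder p e2 d2 (sder p e1 d1 (elt w)))
      = sder p (e1 + e2) d3 (elt w)"
  proof (induction w)
    case Nil
    show ?case by (simp add: lin_0[OF lin_sder])
  next
    case (Cons g w)
    let ?D1 = "sder p e1 d1" and ?D2 = "sder p e2 d2" and ?w = "elt w"
    have step: "sder p e d (elt (g # w)) = d g * ?w + scale (sg (e * p g)) (gen g * sder p e d ?w)" for e d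
      by simp
    have tw1: "twist p e (d1 g) = scale (sg (e * (e1 + p g))) (d1 g)" 
      and tw2: "twist p e (d2 g) = scale (sg (e * (e2 + p g))) (d2 g)"
      and twg: "twist p e (gen g) = scale (sg (e * p g)) (gen g)" for e
      by (rule twist_homogen[OF h1] twist_homogen[OF h2] twist_homogen, simp?)+
    have A: "?D1 (?D2 (elt (g # w))) = ?D1 (d2 g) * ?w + scale (sg (e1 * (e2 + p g))) (d2 g * ?D1 ?w)
        + scale (sg (e2 * p g)) (d1 g * ?D2 ?w) + scale (sg (e2 * p g) * sg (e1 * p g)) (gen g * ?D1 (?D2 ?w))"
      unfolding step lin_add[OF lin_sder] lin_scale[OF lin_sder] sder_mult tw2 twg sder_gen
      by (simp add: scale_mult scale_add add.assoc del: sder_elt)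
    have B: "?D2 (?D1 (elt (g # w))) = ?D2 (d1 g) * ?w + scale (sg (e2 * (e1 + p g))) (d1 g * ?D2 ?w)
        + scale (sg (e1 * p g)) (d2 g * ?D1 ?w) + scale (sg (e1 * p g) * sg (e2 * p g)) (gen g * ?D2 (?D1 ?w))"
      unfolding step lin_add[OF lin_sder] lin_scale[OF lin_sder] sder_mult tw1 twg sder_gen
      by (simp add: scale_mult scale_add add.assoc del: sder_elt)
    have s: "sg (e1 * (e2 + p g)) = sg (e1 * e2) * sg (e1 * p g)"
      "sg (e2 * p g) = sg (e1 * e2) * sg (e2 * (e1 + p g))"
      "sg ((e1 + e2) * p g) = sg (e1 * p g) * sg (e2 * p g)"
      by (simp_all add: distrib_left distrib_right sg_add mult_ac)
    have "?D1 (?D2 (elt (g # w))) - scale (sg (e1 * e2)) (?D2 (?D1 (elt (g # w))))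
       = (?D1 (d2 g) - scale (sg (e1 * e2)) (?D2 (d1 g))) * ?w
       + scale (sg ((e1 + e2) * p g)) (gen g * (?D1 (?D2 ?w) - scale (sg (e1 * e2)) (?D2 (?D1 ?w))))"
    proof -
      have c1: "scale (sg (e1 * (e2 + p g))) (d2 g * ?D1 ?w) = scale (sg (e1 * e2)) (scale (sg (e1 * p g)) (d2 g * ?D1 ?w))"
        by (simp add: s(1))
      have c2: "scale (sg (e2 * p g)) (d1 g * ?D2 ?w) = scale (sg (e1 * e2)) (scale (sg (e2 * (e1 + p g))) (d1 g * ?D2 ?w))"
        using s(2) by simp
      show ?thesis
        unfolding A B c1 c2 s(3)
        by (simp add: scale_add scale_diff left_diff_distrib right_diff_distrib scale_mult mult_ac del: sder_elt)
    qed
    then show ?case unfolding gen Cons.IH step .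
  qed
qed (intro lin_minus lin_scaled lin_compose[OF lin_sder] lin_sder)+

lemma gl_rels_cases:
  assumes "\<rho> \<in> gl_rels k l"
  obtains a b c d where "(a, b) \<in> gl_gens k l" "(c, d) \<in> gl_gens k l"
    "\<rho> = gen (a, b) * gen (c, d)
        - scale (sg (gpar k k (a, b) * gpar k k (c, d))) (gen (c, d) * gen (a, b))
        - ((if b = c then gen (a, d) else 0)
           - scale (sg (gpar k k (a, b) * gpar k k (c, d))) (if a = d then gen (c, b) else 0))"
  using assms unfolding gl_rels_def by blast

lemma sder_fun_lin: "sder p e (\<lambda>g. d g - scale c (d' g)) x = sder p e d x - scale c (sder p e d' x)"
proof (rule lin_eq[OF lin_sder])
  show "lin (\<lambda>x. sder p e d x - scale c (sder p e d' x))" by (intro lin_minus lin_scaled lin_sder)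
  fix w show "sder p e (\<lambda>g. d g - scale c (d' g)) (elt w) = sder p e d (elt w) - scale c (sder p e d' (elt w))"
    by (induction w) (simp_all add: left_diff_distrib right_diff_distrib scale_mult scale_add scale_diff mult.commute)
qed

lemma sder_fun_scale: "sder p e (\<lambda>g. scale c (d g)) x = scale c (sder p e d x)"
proof (rule lin_eq[OF lin_sder lin_scaled[OF lin_sder]])
  fix w show "sder p e (\<lambda>g. scale c (d g)) (elt w) = scale c (sder p e d (elt w))"
    by (induction w) (simp_all add: scale_mult scale_add mult.commute)
qed

lemma sder_fun_if: "sder p e (\<lambda>g. if P then d g else 0) x = (if P then sder p e d x else 0)"
  by (simp add: sder_zero)

lemma gpar_chain:
  "b = c \<Longrightarrow> gpar k k (a, b) + gpar k k (c, d) = gpar k k (a, d)"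
  "a = d \<Longrightarrow> gpar k k (a, b) + gpar k k (c, d) = gpar k k (c, b)"
  by (cases "par k a"; cases "par k b"; cases "par k c"; cases "par k d"; simp)+

text \<open>The additional factor \<open>\<sigma>\<close> reflects that w is ungraded.\<close>

lemma EL_bracket:
  fixes k r m :: nat and a b c d :: nat
  defines "\<sigma> \<equiv> sg (gpar k k (a, b) * gpar k k (c, d))"
  shows "EL k r m (a, b) (EL k r m (c, d) x) - scale \<sigma> (EL k r m (c, d) (EL k r m (a, b) x))
    = scale \<sigma> ((if b = c then EL k r m (a, d) x else 0) - scale \<sigma> (if a = d then EL k r m (c, b) x else 0))"
proof -
  let ?e = "gpar k k (a, b) + gpar k k (c, d)"
  define d3 where "d3 g = scale \<sigma> ((if b = c then eL k m (a, d) g else 0) - scale \<sigma> (if a = d then eL k m (c, b) g else 0))" for g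
  have "EL k r m (a, b) (EL k r m (c, d) x) - scale \<sigma> (EL k r m (c, d) (EL k r m (a, b) x)) = sder (ppar k r m) ?e d3 x"
    unfolding \<sigma>_def
  proof (rule sder_bracket[OF eL_homogen eL_homogen])
    fix g
    have comp: "EL k r m (p, q) (eL k m (q', t) g) = (if q = q' then scale (sg (gpar k k (p, q) * gpar k k (q', t))) (eL k m (p, t) g) else 0)"
      for p q q' t
    proof (cases g)
      case (Inl ai)
      obtain a i where "ai = (a, i)" by (cases ai)
      moreover have "csg k m t q i * csg k m q p i = sg (gpar k k (p, q) * gpar k k (q, t)) * csg k m t p i"
        unfolding csg_def sg_add[symmetric]
        by (cases "par k p"; cases "par k q"; cases "par k t"; cases "par m i"; simp)
      ultimately show ?thesis
        using Inl by (cases "q = q'") (auto simp: eL_simps lin_scale[OF lin_sder] lin_0[OF lin_sder] simp del: gpar_simp)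
    qed (simp add: eL_simps lin_0[OF lin_sder])
    show "EL k r m (a, b) (eL k m (c, d) g) - scale (sg (gpar k k (a, b) * gpar k k (c, d))) (EL k r m (c, d) (eL k m (a, b) g)) = d3 g"
      unfolding comp d3_def \<sigma>_def by (simp add: scale_diff mult.commute[of "gpar k k (c, d)"] del: gpar_simp)
  qed
  also have "sder (ppar k r m) ?e d3 x = scale \<sigma> ((if b = c then EL k r m (a, d) x else 0) - scale \<sigma> (if a = d then EL k r m (c, b) x else 0))"
    unfolding d3_def sder_fun_scale sder_fun_lin sder_fun_if using gpar_chain[of b c k a d] gpar_chain[of a d k b c]
    by (cases "b = c"; cases "a = d") (simp_all del: gpar_simp)
  finally show ?thesis .
qed

lemma ER_bracket:
  fixes k r m :: nat and a b c d :: nat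
  defines "\<sigma> \<equiv> sg (gpar r r (a, b) * gpar r r (c, d))"
  shows "ER k r m (a, b) (ER k r m (c, d) x) - scale \<sigma> (ER k r m (c, d) (ER k r m (a, b) x))
    = (if b = c then ER k r m (a, d) x else 0) - scale \<sigma> (if a = d then ER k r m (c, b) x else 0)"
proof -
  let ?e = "gpar r r (a, b) + gpar r r (c, d)"
  define d3 where "d3 g = (if b = c then eR r m (a, d) g else 0) - scale \<sigma> (if a = d then eR r m (c, b) g else 0)" for g
  have "ER k r m (a, b) (ER k r m (c, d) x) - scale \<sigma> (ER k r m (c, d) (ER k r m (a, b) x)) = sder (ppar k r m) ?e d3 x"
    unfolding \<sigma>_def
  proof (rule sder_bracket[OF eR_homogen eR_homogen])
    fix g
    have comp: "ER k r m (p, q) (eR r m (q', t) g) = (if q = q' then eR r m (p, t) g else 0)"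
      for p q q' t
    proof (cases g)
      case (Inr bj)
      obtain b j where "bj = (b, j)" by (cases bj)
      moreover have "sg ((par r q + par r t) * par m j) * sg ((par r p + par r q) * par m j) = sg ((par r p + par r t) * par m j)"
        unfolding sg_add[symmetric]
        by (cases "par r p"; cases "par r q"; cases "par r t"; cases "par m j"; simp)
      ultimately show ?thesis
        using Inr by (cases "q = q'") (auto simp: eR_simps lin_scale[OF lin_sder] lin_0[OF lin_sder] simp del: gpar_simp)
    qed (simp add: eR_simps lin_0[OF lin_sder])
    show "ER k r m (a, b) (eR r m (c, d) g) - scale (sg (gpar r r (a, b) * gpar r r (c, d))) (ER k r m (c, d) (eR r m (a, b) g)) = d3 g"
      unfolding comp d3_def \<sigma>_def by (simp add: eq_commute[of d a])
  qed
  also have "sder (ppar k r m) ?e d3 x = (if b = c then ER k r m (a, d) x else 0) - scale \<sigma> (if a = d then ER k r m (c, b) x else 0)"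
    unfolding d3_def sder_fun_lin sder_fun_if using gpar_chain[of b c r a d] gpar_chain[of a d r b c]
    by (cases "b = c"; cases "a = d") (simp_all del: gpar_simp)
  finally show ?thesis .
qed

text \<open>By their brackets, both families of operators annihilate the relators.  The ungraded anti-automorphism shows up
  as the reversal sign in the first case.\<close>

lemma EL_rels:
  assumes "\<rho> \<in> gl_rels k l"
  shows "linext (\<lambda>w. scale (revsg (gpar k k) w) (foldr (EL k r m) w F)) \<rho> = 0"
proof -
  from assms obtain a b c d where \<rho>: "\<rho> = gen (a, b) * gen (c, d)
        - scale (sg (gpar k k (a, b) * gpar k k (c, d))) (gen (c, d) * gen (a, b))
        - ((if b = c then gen (a, d) else 0)
           - scale (sg (gpar k k (a, b) * gpar k k (c, d))) (if a = d then gen (c, b) else 0))"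
    by (rule gl_rels_cases)
  let ?\<sigma> = "sg (gpar k k (a, b) * gpar k k (c, d))"
  have "linext (\<lambda>w. scale (revsg (gpar k k) w) (foldr (EL k r m) w F)) \<rho>
    = scale ?\<sigma> (EL k r m (a, b) (EL k r m (c, d) F) - scale ?\<sigma> (EL k r m (c, d) (EL k r m (a, b) F)))
     - ((if b = c then EL k r m (a, d) F else 0) - scale ?\<sigma> (if a = d then EL k r m (c, b) F else 0))"
    unfolding \<rho> gen_elt elt_mult lin_diff[OF lin_linext] lin_scale[OF lin_linext]
    by (simp add: lin_0[OF lin_linext] scale_diff mult.commute[of "gpar k k (c, d)"] if_distrib[of "linext _"] del: gpar_simp cong: if_cong)
  then show ?thesis unfolding EL_bracket by simp
qed

lemma ER_rels:
  assumes "\<rho> \<in> gl_rels r s"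
  shows "linext (\<lambda>w. foldr (ER k r m) w F) \<rho> = 0"
proof -
  from assms obtain a b c d where \<rho>: "\<rho> = gen (a, b) * gen (c, d)
        - scale (sg (gpar r r (a, b) * gpar r r (c, d))) (gen (c, d) * gen (a, b))
        - ((if b = c then gen (a, d) else 0)
           - scale (sg (gpar r r (a, b) * gpar r r (c, d))) (if a = d then gen (c, b) else 0))"
    by (rule gl_rels_cases)
  let ?\<sigma> = "sg (gpar r r (a, b) * gpar r r (c, d))"
  have "linext (\<lambda>w. foldr (ER k r m) w F) \<rho>
    = (ER k r m (a, b) (ER k r m (c, d) F) - scale ?\<sigma> (ER k r m (c, d) (ER k r m (a, b) F)))
     - ((if b = c then ER k r m (a, d) F else 0) - scale ?\<sigma> (if a = d then ER k r m (c, b) F else 0))"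
    unfolding \<rho> gen_elt elt_mult lin_diff[OF lin_linext] lin_scale[OF lin_linext]
    by (simp add: lin_0[OF lin_linext] if_distrib[of "linext _"] del: gpar_simp cong: if_cong)
  then show ?thesis unfolding ER_bracket by simp
qed

lemma gl_rels_fa: "\<rho> \<in> gl_rels k l \<Longrightarrow> \<rho> \<in> fa (gl_gens k l)"
  by (erule gl_rels_cases) (auto intro!: fa_linear fa_mult)

lemma gl_rels_homogen: "\<rho> \<in> gl_rels k l \<Longrightarrow> \<exists>e. homogen (gpar k k) e \<rho>"
proof (erule gl_rels_cases)
  fix a b c d assume \<rho>: "\<rho> = gen (a, b) * gen (c, d)
        - scale (sg (gpar k k (a, b) * gpar k k (c, d))) (gen (c, d) * gen (a, b))
        - ((if b = c then gen (a, d) else 0)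
           - scale (sg (gpar k k (a, b) * gpar k k (c, d))) (if a = d then gen (c, b) else 0))"
  let ?e = "gpar k k (a, b) + gpar k k (c, d)"
  have "homogen (gpar k k) ?e (gen (a, b) * gen (c, d))" "homogen (gpar k k) ?e (gen (c, d) * gen (a, b))"
    by (simp_all add: gen_elt ac_simps)
  moreover have "homogen (gpar k k) ?e (if b = c then gen (a, d) else 0)" "homogen (gpar k k) ?e (if a = d then gen (c, b) else 0)"
    using gpar_chain[of b c k a d] gpar_chain[of a d k b c] by (auto simp del: gpar_simp)
  ultimately have "homogen (gpar k k) ?e \<rho>"
    unfolding \<rho> diff_conv_add_uminus by (intro homogen_add homogen_uminus homogen_scale)
  then show ?thesis by blast
qed

lemma UU_rels_tfa: "tleft ` gl_rels k l \<union> tright ` gl_rels r s \<subseteq> tfa (gl_gens k l) (gl_gens r s)"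
  using gl_rels_fa tleft_fa tright_fa by blast

text \<open>By the description of the action on words, a two-sided multiple of a relator contains the value
  of the relator itself on some element of P, which is zero.\<close>

lemma tens_act_UU_ideal:
  assumes z: "z \<in> UU_ideal k l r s" and f: "f \<in> fa (P_gens k l r s m n)"
  shows "tens_act k l r s m z f = 0"
proof -
  let ?T = "free_tens (gl_gens k l) (gpar k k) (gl_gens r s) (gpar r r)"
  let ?t = "tmult (gpar k k) (gpar r r)"
  let ?pk = "wpar (gpar k k)" and ?pr = "wpar (gpar r r)"
  let ?F = "nford k r m f"
  have words: "tens_act k l r s m (?t (?t (elt (x, y)) \<rho>) (elt (x', y'))) f = 0"
    if xy: "x \<in> lists (gl_gens k l)" "y \<in> lists (gl_gens r s)" "x' \<in> lists (gl_gens k l)" "y' \<in> lists (gl_gens r s)"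
    and \<rho>: "\<rho> \<in> tleft ` gl_rels k l \<union> tright ` gl_rels r s" for x y x' y' \<rho>
    using \<rho>
  proof
    assume "\<rho> \<in> tleft ` gl_rels k l"
    then obtain q where q: "q \<in> gl_rels k l" "\<rho> = tleft q" by blast
    then obtain e where e: "homogen (gpar k k) e q" using gl_rels_homogen by blast
    let ?C = "sg (?pr y * e) * sg (?pr y * ?pk x') * revsg (gpar k k) x * revsg (gpar k k) x' * sg (?pk x * (e + ?pk x')) * sg (e * ?pk x')"
    have "tens_act k l r s m (?t (?t (elt (x, y)) (tleft q)) (elt (x', y'))) f
      = scale ?C (foldr (EL k r m) x (linext (\<lambda>w. scale (revsg (gpar k k) w)
          (foldr (EL k r m) w (foldr (EL k r m) x' (foldr (ER k r m) (y @ y') ?F)))) q))"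
    proof (rule lin_eq_on[where x = q])
      show "lin (\<lambda>q. tens_act k l r s m (?t (?t (elt (x, y)) (tleft q)) (elt (x', y'))) f)"
        by (intro lin_compose[OF lin_tens_act1] lin_tmult1 lin_tmult2 lin_tleft)
      show "lin (\<lambda>q. scale ?C (foldr (EL k r m) x (linext (\<lambda>w. scale (revsg (gpar k k) w)
          (foldr (EL k r m) w (foldr (EL k r m) x' (foldr (ER k r m) (y @ y') ?F)))) q)))"
        by (intro lin_scaled lin_foldr_sder lin_linext)
      fix w assume w: "w \<in> Poly_Mapping.keys q"
      then have "w \<in> lists (gl_gens k l)" "?pk w = e" using fa_keys[OF gl_rels_fa[OF q(1)] w] e by (auto simp: homogen_def)
      then show "tens_act k l r s m (?t (?t (elt (x, y)) (tleft (elt w))) (elt (x', y'))) f = scale ?C (foldr (EL k r m) x (linext (\<lambda>w. scale (revsg (gpar k k) w)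
          (foldr (EL k r m) w (foldr (EL k r m) x' (foldr (ER k r m) (y @ y') ?F)))) (elt w)))"
        using xy f by (simp add: tmult_elt lin_scale[OF lin_tmult1[OF lin_id]] lin_scale[OF lin_tens_act1]
            tens_act_word[where n = n] revsg_append lin_scale[OF lin_foldr_sder[OF lin_id]] mult_ac)
    qed
    then show ?thesis using EL_rels[OF q(1)] by (simp add: q(2) lin_0[OF lin_foldr_sder[OF lin_id]])
  next
    assume "\<rho> \<in> tright ` gl_rels r s"
    then obtain q where q: "q \<in> gl_rels r s" "\<rho> = tright q" by blast
    then obtain e where e: "homogen (gpar r r) e q" using gl_rels_homogen by blast
    let ?C = "sg ((?pr y + e) * ?pk x') * revsg (gpar k k) (x @ x')"
    have "tens_act k l r s m (?t (?t (elt (x, y)) (tright q)) (elt (x', y'))) f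
      = scale ?C (foldr (EL k r m) (x @ x') (foldr (ER k r m) y (linext (\<lambda>w. foldr (ER k r m) w (foldr (ER k r m) y' ?F)) q)))"
    proof (rule lin_eq_on[where x = q])
      show "lin (\<lambda>q. tens_act k l r s m (?t (?t (elt (x, y)) (tright q)) (elt (x', y'))) f)"
        by (intro lin_compose[OF lin_tens_act1] lin_tmult1 lin_tmult2 lin_tright)
      show "lin (\<lambda>q. scale ?C (foldr (EL k r m) (x @ x') (foldr (ER k r m) y (linext (\<lambda>w. foldr (ER k r m) w (foldr (ER k r m) y' ?F)) q))))"
        by (intro lin_scaled lin_foldr_sder lin_linext)
      fix w assume w: "w \<in> Poly_Mapping.keys q"
      then have "w \<in> lists (gl_gens r s)" "?pr w = e" using fa_keys[OF gl_rels_fa[OF q(1)] w] e by (auto simp: homogen_def)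
      then show "tens_act k l r s m (?t (?t (elt (x, y)) (tright (elt w))) (elt (x', y'))) f
        = scale ?C (foldr (EL k r m) (x @ x') (foldr (ER k r m) y (linext (\<lambda>w. foldr (ER k r m) w (foldr (ER k r m) y' ?F)) (elt w))))"
        using xy f by (simp add: tmult_elt lin_scale[OF lin_tmult1[OF lin_id]] lin_scale[OF lin_tens_act1]
            tens_act_word[where n = n])
    qed
    then show ?thesis using ER_rels[OF q(1)] by (simp add: q(2) lin_0[OF lin_foldr_sder[OF lin_id]])
  qed
  have "tens_act k l r s m z f \<in> {0}"
  proof (rule genideal_additive_in[OF ring_free_tens, where h = "\<lambda>z. tens_act k l r s m z f"])
    show "z \<in> Idl\<^bsub>?T\<^esub> (tleft ` gl_rels k l \<union> tright ` gl_rels r s)" using z by (simp add: UU_ideal_def)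
    show "tleft ` gl_rels k l \<union> tright ` gl_rels r s \<subseteq> carrier ?T" using UU_rels_tfa by simp
    fix \<rho> y z assume \<rho>: "\<rho> \<in> tleft ` gl_rels k l \<union> tright ` gl_rels r s" and "y \<in> carrier ?T" "z \<in> carrier ?T"
    then have yz: "y \<in> tfa (gl_gens k l) (gl_gens r s)" "z \<in> tfa (gl_gens k l) (gl_gens r s)" by simp_all
    have "tens_act k l r s m (?t (?t y \<rho>) z) f \<in> {0}"
    proof (rule lin_in[where x = y, OF _ subsp_zero])
      show "lin (\<lambda>y. tens_act k l r s m (?t (?t y \<rho>) z) f)" by (intro lin_compose[OF lin_tens_act1] lin_tmult1 lin_id)
      fix u assume u: "u \<in> Poly_Mapping.keys y"
      show "tens_act k l r s m (?t (?t (elt u) \<rho>) z) f \<in> {0}"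
      proof (rule lin_in[where x = z, OF _ subsp_zero])
        show "lin (\<lambda>z. tens_act k l r s m (?t (?t (elt u) \<rho>) z) f)" by (intro lin_compose[OF lin_tens_act1] lin_tmult2 lin_id)
        fix v assume v: "v \<in> Poly_Mapping.keys z"
        show "tens_act k l r s m (?t (?t (elt u) \<rho>) (elt v)) f \<in> {0}"
          using words[OF _ _ _ _ \<rho>] tfa_keys[OF yz(1)] tfa_keys[OF yz(2)] u v by (cases u; cases v) blast
      qed
    qed
    then show "tens_act k l r s m (y \<otimes>\<^bsub>?T\<^esub> \<rho> \<otimes>\<^bsub>?T\<^esub> z) f \<in> {0}" by simp
  qed (simp_all add: lin_add[OF lin_tens_act1])
  then show ?thesis by simp
qed

section \<open>Equivariance\<close>

text \<open>The representative of an element of the enveloping superalgebra is chosen once for all m and n,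
  which allows different values of m and n to be compared later.\<close>

lemma X_act_class:
  assumes Z: "Z \<in> carrier (UU k l r s)"
  shows "\<exists>z\<in>tfa (gl_gens k l) (gl_gens r s). \<forall>m n. \<forall>f\<in>fa (P_gens k l r s m n).
    X_act k l r s m n Z (P_class k l r s m n f) = P_class k l r s m n (tens_act k l r s m z f)"
proof -
  let ?T = "free_tens (gl_gens k l) (gpar k k) (gl_gens r s) (gpar r r)"
  have ideal: "ideal (UU_ideal k l r s) ?T"
    unfolding UU_ideal_def using UU_rels_tfa by (intro ring.genideal_ideal[OF ring_free_tens]) simp
  from Z obtain z where z: "z \<in> tfa (gl_gens k l) (gl_gens r s)" and Zeq: "Z = {i + z | i. i \<in> UU_ideal k l r s}"
    by (auto simp: UU_def FactRing_def A_RCOSETS_def RCOSETS_def r_coset_def)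
  have "X_act k l r s m n Z (P_class k l r s m n f) = P_class k l r s m n (tens_act k l r s m z f)"
    if f: "f \<in> fa (P_gens k l r s m n)" for m n f
  proof -
    let ?cl = "P_class k l r s m n" and ?G = "P_gens k l r s m n"
    have eq: "?cl (tens_act k l r s m z' f') = ?cl (tens_act k l r s m z f)"
      if z': "z' \<in> Z" and f': "f' \<in> ?cl f" for z' f'
    proof -
      obtain i where i: "i \<in> UU_ideal k l r s" "z' = i + z" using z' Zeq by blast
      have c: "scong ?G (ppar k r m) f' f" using f' residue_mem[OF scr_fa] by (auto simp: P_class_def)
      then have fa': "f' \<in> fa ?G" using cong_fa[OF scr_fa _ f] by blast
      have "tens_act k l r s m z' f' = tens_act k l r s m z f'"
        by (simp add: i lin_add[OF lin_tens_act1] tens_act_UU_ideal[OF i(1) fa'])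
      moreover have "scong ?G (ppar k r m) (tens_act k l r s m z f') (tens_act k l r s m z f)"
        using tens_act_rel[OF z, of "f' - f" m n] c by (simp add: cong_def lin_diff[OF lin_tens_act2])
      ultimately show ?thesis
        unfolding P_class_def by (simp add: residue_cong[OF scr_fa tens_act_fa[OF z f]])
    qed
    have "0 \<in> UU_ideal k l r s"
      using additive_subgroup.zero_closed[OF ideal.axioms(1)[OF ideal]] by simp
    then have "z \<in> Z" unfolding Zeq by (metis (mono_tags, lifting) add_0 mem_Collect_eq)
    moreover have "f \<in> ?cl f" unfolding P_class_def by (rule residue_self[OF scr_fa])
    ultimately have zf: "(z, f) \<in> Z \<times> ?cl f" by simp
    have "(\<lambda>(z, f). ?cl (tens_act k l r s m z f)) ` (Z \<times> ?cl f) = (\<lambda>_. ?cl (tens_act k l r s m z f)) ` (Z \<times> ?cl f)"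
      using eq by (intro image_cong refl) (simp add: case_prod_unfold mem_Times_iff)
    also have "\<dots> = {?cl (tens_act k l r s m z f)}"
      using zf by (rule image_constant)
    finally have "(\<lambda>(z, f). ?cl (tens_act k l r s m z f)) ` (Z \<times> ?cl f) = {?cl (tens_act k l r s m z f)}" .
    then show ?thesis by (simp add: X_act_def descend_def)
  qed
  with z show ?thesis by blast
qed

text \<open>The operators on P restrict to the image of the homomorphism, where they come from
  superderivations of M which do not depend on m and n.\<close>

abbreviation mL :: "nat \<Rightarrow> nat \<Rightarrow> nat \<times> nat \<Rightarrow> (nat \<times> nat) falg \<Rightarrow> (nat \<times> nat) falg" where
  "mL k r g \<equiv> sder (gpar k r) (gpar k k g) (dL k r g)"

text \<open>The action on the second index of M; the signs in \<^const>\<open>eR\<close> and in \<^const>\<open>X_elem\<close> cancel.\<close>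

definition dMR :: "nat \<times> nat \<Rightarrow> nat \<times> nat \<Rightarrow> (nat \<times> nat) falg" where
  "dMR = (\<lambda>(p, q) (a, b). if b = q then gen (a, p) else 0)"

abbreviation mR :: "nat \<Rightarrow> nat \<Rightarrow> nat \<times> nat \<Rightarrow> (nat \<times> nat) falg \<Rightarrow> (nat \<times> nat) falg" where
  "mR k r g \<equiv> sder (gpar k r) (gpar r r g) (dMR g)"

lemma EL_X:
  assumes f: "f \<in> fa (M_gens k l r s)"
  shows "EL k r m g (fhom (X_elem k r m n) f) = fhom (X_elem k r m n) (mL k r g f)"
proof (rule sder_fhom[OF X_elem_homogen _ f])
  fix t :: "nat \<times> nat"
  obtain p q a b where gt: "g = (p, q)" "t = (a, b)" by (cases g; cases t)
  have "EL k r m g (X_elem k r m n t) = (\<Sum>i<m + n. scale (sg (par k a * (par r b + par m i))) (eL k m g (Inl (a, i)) * gen (Inr (b, i))))"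
    by (simp add: gt X_elem_simp lin_sum[OF lin_sder] lin_scale[OF lin_sder] sder_mult eL_simps(2))
  also have "\<dots> = (if a = q then scale (csg k r q p b) (X_elem k r m n (p, b)) else 0)"
  proof (cases "a = q")
    case True
    have "sg (par k q * (par r b + par m i)) * csg k m q p i = csg k r q p b * sg (par k p * (par r b + par m i))" for i
      unfolding csg_def sg_add[symmetric]
      by (cases "par k p"; cases "par k q"; cases "par r b"; cases "par m i"; simp)
    then show ?thesis
      by (simp add: True gt X_elem_simp eL_simps scale_mult scale_sum)
  qed (simp add: gt eL_simps)
  finally show "EL k r m g (X_elem k r m n t) = fhom (X_elem k r m n) (dL k r g t)"
    by (simp add: gt dL_def lin_scale[OF lin_fhom] lin_0[OF lin_fhom])
qed

lemma ER_X:
  assumes f: "f \<in> fa (M_gens k l r s)"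
  shows "ER k r m g (fhom (X_elem k r m n) f) = fhom (X_elem k r m n) (mR k r g f)"
proof (rule sder_fhom[OF X_elem_homogen _ f])
  fix t :: "nat \<times> nat"
  obtain p q a b where gt: "g = (p, q)" "t = (a, b)" by (cases g; cases t)
  have tw: "twist (ppar k r m) e (gen (Inl (a, i))) = scale (sg (e * (par k a + par m i))) (gen (Inl (a, i)))" for e i
    by (rule twist_homogen) simp
  have "ER k r m g (X_elem k r m n t) = (\<Sum>i<m + n. scale (sg (par k a * (par r b + par m i)) * sg (gpar r r g * (par k a + par m i)))
      (gen (Inl (a, i)) * eR r m g (Inr (b, i))))"
    by (simp add: gt X_elem_simp lin_sum[OF lin_sder] lin_scale[OF lin_sder] sder_mult eR_simps(2) tw scale_mult)
  also have "\<dots> = (if b = q then X_elem k r m n (a, p) else 0)"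
  proof (cases "b = q")
    case True
    have "sg (par k a * (par r q + par m i)) * (sg ((par r p + par r q) * (par k a + par m i)) * sg ((par r p + par r q) * par m i))
      = sg (par k a * (par r p + par m i))" for i
      unfolding sg_add[symmetric]
      by (cases "par k a"; cases "par r q"; cases "par r p"; cases "par m i"; simp)
    then show ?thesis
      by (simp add: True gt X_elem_simp eR_simps scale_mult mult.assoc)
  qed (simp add: gt eR_simps)
  finally show "ER k r m g (X_elem k r m n t) = fhom (X_elem k r m n) (dMR g t)"
    by (simp add: gt dMR_def lin_0[OF lin_fhom])
qed

text \<open>The action on M, on representatives.\<close>

definition M_rep :: "nat \<Rightarrow> nat \<Rightarrow> (nat \<times> nat, nat \<times> nat) ftens \<Rightarrow> (nat \<times> nat) falg \<Rightarrow> (nat \<times> nat) falg" where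
  "M_rep k r z f = linext (\<lambda>(x, y). scale (revsg (gpar k k) x) (foldr (mL k r) x (foldr (mR k r) y f))) z"

lemma mL_fa: "g \<in> gl_gens k l \<Longrightarrow> f \<in> fa (M_gens k l r s) \<Longrightarrow> mL k r g f \<in> fa (M_gens k l r s)"
  by (cases g) (auto simp: dL_def intro!: sder_fa fa_linear)

lemma mR_fa: "g \<in> gl_gens r s \<Longrightarrow> f \<in> fa (M_gens k l r s) \<Longrightarrow> mR k r g f \<in> fa (M_gens k l r s)"
  by (cases g) (auto simp: dMR_def intro!: sder_fa fa_linear)

lemma foldr_EL_X:
  assumes "x \<in> lists (gl_gens k l)" "f \<in> fa (M_gens k l r s)"
  shows "foldr (mL k r) x f \<in> fa (M_gens k l r s) \<and>
   foldr (EL k r m) x (fhom (X_elem k r m n) f) = fhom (X_elem k r m n) (foldr (mL k r) x f)"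
  using assms(1)
proof (induction x)
  case (Cons g x)
  then show ?case
    using EL_X[of "foldr (mL k r) x f" k l r s m g n] mL_fa[of g k l "foldr (mL k r) x f" r s] by simp
qed (simp add: assms)

lemma foldr_ER_X:
  assumes "y \<in> lists (gl_gens r s)" "f \<in> fa (M_gens k l r s)"
  shows "foldr (mR k r) y f \<in> fa (M_gens k l r s) \<and>
   foldr (ER k r m) y (fhom (X_elem k r m n) f) = fhom (X_elem k r m n) (foldr (mR k r) y f)"
  using assms(1)
proof (induction y)
  case (Cons g y)
  then show ?case
    using ER_X[of "foldr (mR k r) y f" k l r s m g n] mR_fa[of g r s "foldr (mR k r) y f" k l] by simp
qed (simp add: assms)

lemma M_rep_fa:
  assumes "z \<in> tfa (gl_gens k l) (gl_gens r s)" "f \<in> fa (M_gens k l r s)"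
  shows "M_rep k r z f \<in> fa (M_gens k l r s)"
  unfolding M_rep_def
proof (rule lin_in[OF lin_linext subsp_fa])
  fix w assume "w \<in> Poly_Mapping.keys z"
  then show "linext (\<lambda>(x, y). scale (revsg (gpar k k) x) (foldr (mL k r) x (foldr (mR k r) y f))) (elt w) \<in> fa (M_gens k l r s)"
    using assms tfa_keys[OF assms(1)] foldr_EL_X[of _ k l _ r s] foldr_ER_X[of _ r s f k l] by (cases w) (simp add: fa_linear)
qed

lemma tens_act_X:
  assumes z: "z \<in> tfa (gl_gens k l) (gl_gens r s)" and f: "f \<in> fa (M_gens k l r s)"
  shows "scong (P_gens k l r s m n) (ppar k r m) (tens_act k l r s m z (fhom (X_elem k r m n) f)) (fhom (X_elem k r m n) (M_rep k r z f))"
proof -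
  let ?X = "fhom (X_elem k r m n)" and ?I = "relid (P_gens k l r s m n) (scr (P_gens k l r s m n) (ppar k r m))"
  have "tens_act k l r s m z (?X f) - ?X (M_rep k r z f) \<in> ?I"
  proof (rule lin_in[where x = z, OF _ subsp_scr])
    show "lin (\<lambda>z. tens_act k l r s m z (?X f) - ?X (M_rep k r z f))"
      unfolding M_rep_def by (intro lin_minus lin_tens_act1 lin_compose[OF lin_fhom] lin_linext)
    fix w assume "w \<in> Poly_Mapping.keys z"
    moreover obtain x y where w: "w = (x, y)" by (cases w)
    ultimately have x: "x \<in> lists (gl_gens k l)" and y: "y \<in> lists (gl_gens r s)"
      using tfa_keys[OF z, of x y] by auto
    have "nford k r m (?X f) - ?X f \<in> ?I" using nford_cong[OF fhom_X_fa[OF f]] by (simp add: cong_def)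
    from foldr_EL_rel[OF x foldr_ER_rel[OF y this]]
    have "foldr (EL k r m) x (foldr (ER k r m) y (nford k r m (?X f))) - ?X (foldr (mL k r) x (foldr (mR k r) y f)) \<in> ?I"
      using foldr_EL_X[OF x, of "foldr (mR k r) y f" r s m n] foldr_ER_X[OF y f, of m n] by (simp add: lin_diff[OF lin_foldr_sder[OF lin_id]])
    from subsp_scale[OF subsp_scr this, of "revsg (gpar k k) x"]
    show "tens_act k l r s m (elt w) (?X f) - ?X (M_rep k r (elt w) f) \<in> ?I"
      by (simp add: w tens_act_word[OF x y fhom_X_fa[OF f]] M_rep_def lin_scale[OF lin_fhom] scale_diff)
  qed
  then show ?thesis by (simp add: cong_def)
qed

text \<open>The action on the image of M is induced by the same operators of M for all m and n.  For m' and
  n' the homomorphism is injective, so these operators are the transported action.\<close>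

lemma Psi_equivariant:
  assumes mn: "max k r \<le> m'" "max l s \<le> n'" and Z: "Z \<in> carrier (UU k l r s)" and f: "f \<in> carrier (M_alg k l r s)"
  shows "Psi k l r s m n (M_act k l r s m' n' Z f) = X_act k l r s m n Z (Psi k l r s m n f)"
proof -
  obtain z where z: "z \<in> tfa (gl_gens k l) (gl_gens r s)"
    and act: "\<And>m n f. f \<in> fa (P_gens k l r s m n) \<Longrightarrow>
      X_act k l r s m n Z (P_class k l r s m n f) = P_class k l r s m n (tens_act k l r s m z f)"
    using X_act_class[OF Z] by blast
  obtain h where h: "h \<in> fa (M_gens k l r s)" "f = M_class k l r s h" using f by (auto simp: carrier_M)
  have eq: "X_act k l r s m n Z (Psi k l r s m n f) = Psi k l r s m n (M_class k l r s (M_rep k r z h))" for m n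
  proof -
    have "P_class k l r s m n (tens_act k l r s m z (fhom (X_elem k r m n) h)) = P_class k l r s m n (fhom (X_elem k r m n) (M_rep k r z h))"
      unfolding P_class_def by (intro residue_cong[OF scr_fa] tens_act_X[OF z h(1)] fhom_X_fa M_rep_fa[OF z h(1)])
    then show ?thesis
      by (simp add: h Psi_class M_rep_fa[OF z h(1)] act fhom_X_fa)
  qed
  have "M_class k l r s (M_rep k r z h) \<in> carrier (M_alg k l r s)"
    using M_rep_fa[OF z h(1)] by (simp add: carrier_M)
  then have "M_act k l r s m' n' Z f = M_class k l r s (M_rep k r z h)"
    unfolding M_act_def eq using mn by (intro the_inv_into_f_f Psi_inj) auto
  then show ?thesis using eq by simp
qed


section \<open>Permutations of words with signs\<close>

abbreviation pinv :: "(nat \<Rightarrow> nat) \<Rightarrow> nat \<Rightarrow> nat" where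
  "pinv \<equiv> inv_into UNIV"

definition pairsum :: "nat \<Rightarrow> (nat \<Rightarrow> nat \<Rightarrow> bit) \<Rightarrow> bit" where
  "pairsum n H = (\<Sum>j<n. \<Sum>i<j. H i j)"

lemma pairsum_cong: "(\<And>i j. i < j \<Longrightarrow> j < n \<Longrightarrow> H i j = H' i j) \<Longrightarrow> pairsum n H = pairsum n H'"
  unfolding pairsum_def by (intro sum.cong refl) auto

lemma pairsum_add: "pairsum n (\<lambda>i j. H i j + H' i j) = pairsum n H + pairsum n H'"
  by (simp add: pairsum_def sum.distrib)

lemma pairsum_permute:
  assumes \<pi>: "\<pi> permutes {..<n}" and sym: "\<And>i j. H i j = H j i"
  shows "pairsum n (\<lambda>i j. H (\<pi> i) (\<pi> j)) = pairsum n H"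
proof -
  let ?S = "Sigma {..<n} (\<lambda>j. {..<j})"
  have sig: "pairsum n H = (\<Sum>(j, i)\<in>?S. H i j)" for H
    unfolding pairsum_def by (rule sum.Sigma) auto
  define f where "f \<rho> = (\<lambda>(j, i). (max (\<rho> i) (\<rho> j), min (\<rho> i) (\<rho> j)))" for \<rho> :: "nat \<Rightarrow> nat"
  have f_in: "f \<rho> x \<in> ?S" if \<rho>: "\<rho> permutes {..<n}" and S: "x \<in> ?S" for \<rho> x
  proof -
    obtain j i where x: "x = (j, i)" "i < j" "j < n" using S by auto
    then have "\<rho> i < n" "\<rho> j < n" using permutes_in_image[OF \<rho>] by (metis lessThan_iff less_trans)+
    moreover have "\<rho> i \<noteq> \<rho> j" using x(2) inj_eq[OF permutes_inj[OF \<rho>], of i j] by simp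
    ultimately show ?thesis by (auto simp: x f_def max_def min_def)
  qed
  have f_inv: "f \<rho>' (f \<rho> x) = x" if "x \<in> ?S" "\<And>i. \<rho>' (\<rho> i) = i" for \<rho> \<rho>' x
    using that by (auto simp: f_def max_def min_def)
  have "(\<Sum>(j, i)\<in>?S. H (\<pi> i) (\<pi> j)) = (\<Sum>(j, i)\<in>?S. H i j)"
  proof (rule sum.reindex_bij_witness[where i = "f (pinv \<pi>)" and j = "f \<pi>"])
    fix x assume x: "x \<in> ?S"
    show "f (pinv \<pi>) (f \<pi> x) = x" "f \<pi> (f (pinv \<pi>) x) = x"
      using f_inv[OF x] permutes_inverses[OF \<pi>] by auto
    show "f \<pi> x \<in> ?S" "f (pinv \<pi>) x \<in> ?S"
      using f_in[OF \<pi> x] f_in[OF permutes_inv[OF \<pi>] x] by auto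
    show "(case f \<pi> x of (j, i) \<Rightarrow> H i j) = (case x of (j, i) \<Rightarrow> H (\<pi> i) (\<pi> j))"
      using sym by (cases x) (auto simp: f_def max_def min_def)
  qed
  then show ?thesis by (simp add: sig)
qed

lemma pairsum_update:
  assumes sym: "\<And>i j. S i j = S j i" and t: "t < n" and q': "q' = q(t := q t + e)"
  shows "pairsum n (\<lambda>i j. S i j * (q' i * q' j)) = pairsum n (\<lambda>i j. S i j * (q i * q j))
    + e * (\<Sum>j<n. if j = t then 0 else S j t * q j)"
proof -
  let ?c = "\<lambda>i j. if i = t then e * (S t j * q j) else if j = t then e * (S i t * q i) else 0"
  have "pairsum n (\<lambda>i j. S i j * (q' i * q' j)) = pairsum n (\<lambda>i j. S i j * (q i * q j) + ?c i j)"
    by (rule pairsum_cong) (auto simp: q' algebra_simps)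
  also have "\<dots> = pairsum n (\<lambda>i j. S i j * (q i * q j)) + pairsum n ?c"
    by (rule pairsum_add)
  also have "pairsum n ?c = (\<Sum>j<n. if j = t then (\<Sum>i<t. e * (S i t * q i)) else if t < j then e * (S j t * q j) else 0)"
    unfolding pairsum_def
  proof (intro sum.cong refl)
    fix j assume "j \<in> {..<n}"
    show "(\<Sum>i<j. ?c i j) = (if j = t then (\<Sum>i<t. e * (S i t * q i)) else if t < j then e * (S j t * q j) else 0)"
    proof (cases "j = t")
      case False
      then have "(\<Sum>i<j. ?c i j) = (\<Sum>i<j. if i = t then e * (S t j * q j) else 0)" by (intro sum.cong) auto
      then show ?thesis using False sym[of t j] by simp
    qed simp
  qed
  also have "\<dots> = (\<Sum>i<t. e * (S i t * q i)) + (\<Sum>j<n. if t < j then e * (S j t * q j) else 0)"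
  proof -
    have "(\<Sum>j<n. if j = t then (\<Sum>i<t. e * (S i t * q i)) else if t < j then e * (S j t * q j) else 0)
      = (\<Sum>j<n. (if j = t then (\<Sum>i<t. e * (S i t * q i)) else 0) + (if t < j then e * (S j t * q j) else 0))"
      by (intro sum.cong) auto
    then show ?thesis using t by (simp add: sum.distrib)
  qed
  also have "(\<Sum>i<t. e * (S i t * q i)) = (\<Sum>j<n. if j < t then e * (S j t * q j) else 0)"
  proof -
    have "{j \<in> {..<n}. j < t} = {..<t}" using t by auto
    then show ?thesis by (simp add: sum.If_cases Int_def)
  qed
  also have "(\<Sum>j<n. if j < t then e * (S j t * q j) else 0) + (\<Sum>j<n. if t < j then e * (S j t * q j) else 0)
      = e * (\<Sum>j<n. if j = t then 0 else S j t * q j)"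
    unfolding sum.distrib[symmetric] sum_distrib_left by (intro sum.cong) auto
  finally show ?thesis .
qed

text \<open>The parity of the transpositions of odd letters when a word is rearranged by a permutation.\<close>

definition psg :: "('g \<Rightarrow> bit) \<Rightarrow> (nat \<Rightarrow> nat) \<Rightarrow> 'g list \<Rightarrow> bit" where
  "psg p \<pi> w = pairsum (length w) (\<lambda>i j. if \<pi> j < \<pi> i then p (w ! \<pi> i) * p (w ! \<pi> j) else 0)"

lemma psg_id [simp]: "psg p id w = 0"
  by (simp add: psg_def pairsum_def)

lemma psg_alt:
  assumes "\<pi> permutes {..<length w}"
  shows "psg p \<pi> w = pairsum (length w) (\<lambda>i j. (if (i < j) \<noteq> (\<pi> i < \<pi> j) then 1 else 0) * (p (w ! \<pi> i) * p (w ! \<pi> j)))"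
  unfolding psg_def
proof (rule pairsum_cong)
  fix i j :: nat assume "i < j"
  then have "\<pi> i \<noteq> \<pi> j" using inj_eq[OF permutes_inj[OF assms], of i j] by simp
  with \<open>i < j\<close> show "(if \<pi> j < \<pi> i then p (w ! \<pi> i) * p (w ! \<pi> j) else 0)
      = (if (i < j) \<noteq> (\<pi> i < \<pi> j) then 1 else 0) * (p (w ! \<pi> i) * p (w ! \<pi> j))" by auto
qed

text \<open>A pair of positions is inverted by the composition iff it is inverted by exactly one of the two
  permutations.\<close>

lemma psg_compose:
  assumes \<pi>: "\<pi> permutes {..<length w}" and \<sigma>: "\<sigma> permutes {..<length w}"
  shows "psg p (\<pi> \<circ> \<sigma>) w = psg p \<pi> w + psg p \<sigma> (permute_list \<pi> w)"
proof -
  let ?n = "length w" and ?q = "\<lambda>i. p (w ! \<pi> i)"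
  let ?H = "\<lambda>i j. (if (i < j) \<noteq> (\<pi> i < \<pi> j) then 1 else 0) * (?q i * ?q j)"
  have inj: "\<pi> i \<noteq> \<pi> j" "\<sigma> i \<noteq> \<sigma> j" if "i \<noteq> j" for i j
    using inj_eq[OF permutes_inj[OF \<pi>], of i j] inj_eq[OF permutes_inj[OF \<sigma>], of i j] that by auto
  have sym: "?H i j = ?H j i" for i j
    using inj(1)[of i j] by (cases "i = j") (auto simp: mult.commute not_less_iff_gr_or_eq)
  have "psg p \<pi> w = pairsum ?n (\<lambda>i j. ?H (\<sigma> i) (\<sigma> j))"
    unfolding psg_alt[OF \<pi>] by (rule pairsum_permute[OF \<sigma> sym, symmetric])
  moreover have "psg p \<sigma> (permute_list \<pi> w) = pairsum ?n (\<lambda>i j. if \<sigma> j < \<sigma> i then ?q (\<sigma> i) * ?q (\<sigma> j) else 0)"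
    unfolding psg_def length_permute_list
  proof (rule pairsum_cong)
    fix i j assume "i < j" "j < ?n"
    then have "\<sigma> i < ?n" "\<sigma> j < ?n" using permutes_in_image[OF \<sigma>] by (metis lessThan_iff less_trans)+
    then show "(if \<sigma> j < \<sigma> i then p (permute_list \<pi> w ! \<sigma> i) * p (permute_list \<pi> w ! \<sigma> j) else 0)
        = (if \<sigma> j < \<sigma> i then ?q (\<sigma> i) * ?q (\<sigma> j) else 0)"
      by (simp add: permute_list_nth[OF \<pi>])
  qed
  moreover have "psg p (\<pi> \<circ> \<sigma>) w = pairsum ?n (\<lambda>i j. ?H (\<sigma> i) (\<sigma> j) + (if \<sigma> j < \<sigma> i then ?q (\<sigma> i) * ?q (\<sigma> j) else 0))"
    unfolding psg_def
  proof (rule pairsum_cong)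
    fix i j :: nat assume "i < j"
    then have "\<sigma> i \<noteq> \<sigma> j" "\<pi> (\<sigma> i) \<noteq> \<pi> (\<sigma> j)" using inj by auto
    then show "(if (\<pi> \<circ> \<sigma>) j < (\<pi> \<circ> \<sigma>) i then p (w ! (\<pi> \<circ> \<sigma>) i) * p (w ! (\<pi> \<circ> \<sigma>) j) else 0)
      = ?H (\<sigma> i) (\<sigma> j) + (if \<sigma> j < \<sigma> i then ?q (\<sigma> i) * ?q (\<sigma> j) else 0)"
      by (cases "\<sigma> i < \<sigma> j"; cases "\<pi> (\<sigma> i) < \<pi> (\<sigma> j)") auto
  qed
  ultimately show ?thesis by (simp add: pairsum_add)
qed

lemma psg_inv:
  assumes "\<pi> permutes {..<length w}"
  shows "psg p (pinv \<pi>) (permute_list \<pi> w) = psg p \<pi> w"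
  using psg_compose[OF assms permutes_inv[OF assms], of p]
  by (simp add: permutes_inv_o(1)[OF assms]) (metis bit_add_self(2) add.right_neutral)

lemma permute_list_inv:
  assumes "\<pi> permutes {..<length w}"
  shows "permute_list (pinv \<pi>) (permute_list \<pi> w) = w" "permute_list \<pi> (permute_list (pinv \<pi>) w) = w"
  using permute_list_compose[OF permutes_inv[OF assms], of \<pi>] permute_list_compose[OF assms, of "pinv \<pi>"]
    permutes_inv_o[OF assms] by simp_all

abbreviation adj :: "nat \<Rightarrow> nat \<Rightarrow> nat" where
  "adj t \<equiv> Transposition.transpose t (Suc t)"

lemma adj_permutes: "Suc t < n \<Longrightarrow> adj t permutes {..<n}"
  by (rule permutes_swap_id) auto

text \<open>Permutations of an initial segment are products of transpositions of neighbours.\<close>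

lemma permutes_adj_induct [consumes 1, case_names id adj]:
  assumes \<pi>: "\<pi> permutes {..<n}" and id: "P id"
    and step: "\<And>\<pi> t. \<pi> permutes {..<n} \<Longrightarrow> Suc t < n \<Longrightarrow> P \<pi> \<Longrightarrow> P (adj t \<circ> \<pi>)"
  shows "P \<pi>"
proof -
  have seq: "apply_adj_transps xs \<circ> \<sigma> permutes {..<n} \<and> P (apply_adj_transps xs \<circ> \<sigma>)"
    if "\<forall>x\<in>set xs. Suc x < n" "\<sigma> permutes {..<n}" "P \<sigma>" for xs \<sigma>
    using that(1)
  proof (induction xs)
    case (Cons x xs)
    then have x: "Suc x < n" by simp
    have "apply_adj_transps xs \<circ> \<sigma> permutes {..<n} \<and> P (apply_adj_transps xs \<circ> \<sigma>)"
      by (rule Cons.IH) (use Cons.prems in simp)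
    then have IH: "apply_adj_transps xs \<circ> \<sigma> permutes {..<n}" "P (apply_adj_transps xs \<circ> \<sigma>)" by blast+
    have eq: "apply_adj_transps (x # xs) \<circ> \<sigma> = adj x \<circ> (apply_adj_transps xs \<circ> \<sigma>)" by (simp add: comp_assoc)
    show ?case unfolding eq using step[OF IH(1) x IH(2)] permutes_compose[OF IH(1) adj_permutes[OF x]] by blast
  qed (use that in simp)
  have "\<pi> permutes {..<n} \<and> P \<pi>"
    using \<pi> finite_lessThan[of n]
  proof (induction rule: permutes_induct)
    case (swap a b \<sigma>)
    let ?a = "min a b" and ?b = "max a b"
    have "Transposition.transpose a b = Transposition.transpose ?a ?b"
      by (simp add: min_def max_def transpose_commute)
    also have "\<dots> = apply_adj_transps (adj_transp_seq ?a ?b)"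
      using swap by (intro adj_transp_seq_correct[symmetric]) (simp add: min_def max_def)
    finally have tr: "Transposition.transpose a b = apply_adj_transps (adj_transp_seq ?a ?b)" .
    have "set (adj_transp_seq ?a ?b) = {?a..<?b}"
      using swap by (intro set_adj_transp_seq) (simp add: min_def max_def)
    then have "\<forall>x\<in>set (adj_transp_seq ?a ?b). Suc x < n"
      using swap by (auto simp: max_def split: if_splits)
    from seq[OF this, of \<sigma>] show ?case
      unfolding tr using swap by blast
  qed (use id permutes_id[of "{..<n}"] in \<open>simp add: id_def\<close>)
  then show ?thesis ..
qed

lemma permute_adj: "permute_list (adj (length u)) (u @ [g, h] @ v) = u @ [h, g] @ v"
proof (rule nth_equalityI)
  fix i assume "i < length (permute_list (adj (length u)) (u @ [g, h] @ v))"
  then have i: "i < length (u @ [g, h] @ v)" by simp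
  have "permute_list (adj (length u)) (u @ [g, h] @ v) ! i = (u @ [g, h] @ v) ! adj (length u) i"
    using i by (intro permute_list_nth adj_permutes) simp_all
  then show "permute_list (adj (length u)) (u @ [g, h] @ v) ! i = (u @ [h, g] @ v) ! i"
    by (auto simp: Transposition.transpose_def nth_append nth_Cons split: nat.splits)
qed simp

lemma psg_adj: "psg p (adj (length u)) (u @ [g, h] @ v) = p g * p h"
proof -
  let ?t = "length u" and ?w = "u @ [g, h] @ v"
  have "psg p (adj ?t) ?w = (\<Sum>j<length ?w. \<Sum>i<j. if j = Suc ?t then (if i = ?t then p g * p h else 0) else 0)"
    unfolding psg_def pairsum_def
    by (intro sum.cong refl) (auto simp: Transposition.transpose_def nth_append mult.commute split: if_splits)
  also have "\<dots> = (\<Sum>j<length ?w. if j = Suc ?t then p g * p h else 0)"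
    by (intro sum.cong refl) auto
  also have "\<dots> = p g * p h" by (subst sum.delta) auto
  finally show ?thesis .
qed

lemma split_adj: "Suc t < length w \<Longrightarrow> \<exists>u g h v. w = u @ [g, h] @ v \<and> length u = t"
proof -
  assume t: "Suc t < length w"
  have "w = take t w @ [w ! t, w ! Suc t] @ drop (Suc (Suc t)) w"
    using t by (metis Cons_nth_drop_Suc Suc_lessD append_Cons append_Nil append_take_drop_id)
  moreover have "length (take t w) = t" using t by simp
  ultimately show ?thesis by blast
qed

lemma wpar_take: "t \<le> length w \<Longrightarrow> wpar p (take t w) = (\<Sum>s<t. p (w ! s))"
  by (induction t) (auto simp: take_Suc_conv_app_nth)

text \<open>Only the pairs that contain the changed position contribute to the difference, and their sum
  depends on the letters to the left of that position, before and after the permutation.\<close>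

lemma psg_update:
  assumes \<pi>: "\<pi> permutes {..<length w}" and t: "t < length w"
  shows "psg p \<pi> (w[\<pi> t := g]) = psg p \<pi> w + (p g + p (w ! \<pi> t)) * (wpar p (take t (permute_list \<pi> w)) + wpar p (take (\<pi> t) w))"
proof -
  let ?n = "length w" and ?q = "\<lambda>i. p (w ! \<pi> i)"
  let ?S = "\<lambda>i j. if (i < j) \<noteq> (\<pi> i < \<pi> j) then 1 else (0 :: bit)"
  have inj: "\<pi> i = \<pi> j \<longleftrightarrow> i = j" for i j using inj_eq[OF permutes_inj[OF \<pi>]] .
  have lt: "\<pi> i < ?n \<longleftrightarrow> i < ?n" for i using permutes_in_image[OF \<pi>, of i] by simp
  have sym: "?S i j = ?S j i" for i j
    using inj[of i j] by (cases "i = j") (auto simp: not_less_iff_gr_or_eq)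
  have "psg p \<pi> (w[\<pi> t := g]) = pairsum ?n (\<lambda>i j. ?S i j * (p (w[\<pi> t := g] ! \<pi> i) * p (w[\<pi> t := g] ! \<pi> j)))"
    using psg_alt[of \<pi> "w[\<pi> t := g]" p] \<pi> by simp
  also have "\<dots> = pairsum ?n (\<lambda>i j. ?S i j * ((?q(t := ?q t + (p g + ?q t))) i * (?q(t := ?q t + (p g + ?q t))) j))"
  proof (rule pairsum_cong)
    have "p (w[\<pi> t := g] ! \<pi> i) = (?q(t := ?q t + (p g + ?q t))) i" for i
      using t lt[of t] inj[of t i] by (cases "i = t") (auto simp: add.commute)
    then show "?S i j * (p (w[\<pi> t := g] ! \<pi> i) * p (w[\<pi> t := g] ! \<pi> j))
      = ?S i j * ((?q(t := ?q t + (p g + ?q t))) i * (?q(t := ?q t + (p g + ?q t))) j)" for i j by presburger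
  qed
  also have "\<dots> = pairsum ?n (\<lambda>i j. ?S i j * (?q i * ?q j)) + (p g + ?q t) * (\<Sum>j<?n. if j = t then 0 else ?S j t * ?q j)"
    by (rule pairsum_update[OF sym t refl])
  also have "(\<Sum>j<?n. if j = t then 0 else ?S j t * ?q j) = (\<Sum>j<?n. (if j < t then ?q j else 0) + (if \<pi> j < \<pi> t then ?q j else 0))"
    by (intro sum.cong refl) auto
  also have "\<dots> = wpar p (take t (permute_list \<pi> w)) + wpar p (take (\<pi> t) w)"
  proof -
    have "(\<Sum>j<?n. if j < t then ?q j else 0) = wpar p (take t (permute_list \<pi> w))"
    proof -
      have "{j \<in> {..<?n}. j < t} = {..<t}" using t by auto
      then show ?thesis using t by (simp add: wpar_take sum.If_cases Int_def permute_list_nth[OF \<pi>])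
    qed
    moreover have "(\<Sum>j<?n. if \<pi> j < \<pi> t then ?q j else 0) = wpar p (take (\<pi> t) w)"
    proof -
      have "(\<Sum>j<?n. if \<pi> j < \<pi> t then ?q j else 0) = (\<Sum>s<?n. if s < \<pi> t then p (w ! s) else 0)"
        using sum.permute[OF \<pi>, of "\<lambda>s. if s < \<pi> t then p (w ! s) else 0"] by (simp add: comp_def)
      also have "\<dots> = (\<Sum>s<\<pi> t. p (w ! s))"
      proof -
        have "{s \<in> {..<?n}. s < \<pi> t} = {..<\<pi> t}" using lt[of t] t by auto
        then show ?thesis by (simp add: sum.If_cases Int_def)
      qed
      finally show ?thesis using lt[of t] t by (simp add: wpar_take)
    qed
    ultimately show ?thesis by (simp add: sum.distrib)
  qed
  finally show ?thesis by (simp add: psg_alt[OF \<pi>])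
qed

section \<open>Position operators on functions of words\<close>

text \<open>A homogeneous operator of parity e acting on the letter at position t; the sign comes from the
  letters to its left.\<close>

definition pos :: "('g \<Rightarrow> bit) \<Rightarrow> bit \<Rightarrow> ('g \<Rightarrow> complex) \<Rightarrow> ('g \<Rightarrow> 'g) \<Rightarrow> nat \<Rightarrow> ('g list \<Rightarrow> complex) \<Rightarrow> 'g list \<Rightarrow> complex" where
  "pos p e \<kappa> \<rho> t \<phi> w = sg (e * wpar p (take t w)) * \<kappa> (w ! t) * \<phi> (w[t := \<rho> (w ! t)])"

text \<open>The signed action of a permutation on functions of words.\<close>

definition pact :: "('g \<Rightarrow> bit) \<Rightarrow> (nat \<Rightarrow> nat) \<Rightarrow> ('g list \<Rightarrow> complex) \<Rightarrow> 'g list \<Rightarrow> complex" where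
  "pact p \<pi> \<phi> w = sg (psg p \<pi> w) * \<phi> (permute_list \<pi> w)"

lemma permute_list_update:
  assumes \<pi>: "\<pi> permutes {..<length w}" and t: "t < length w"
  shows "permute_list \<pi> (w[\<pi> t := g]) = (permute_list \<pi> w)[t := g]"
proof (rule nth_equalityI)
  fix i assume "i < length (permute_list \<pi> (w[\<pi> t := g]))"
  then have i: "i < length w" by simp
  have "\<pi> t < length w" using permutes_in_image[OF \<pi>, of t] t by simp
  then show "permute_list \<pi> (w[\<pi> t := g]) ! i = (permute_list \<pi> w)[t := g] ! i"
    using i t \<pi> inj_eq[OF permutes_inj[OF \<pi>], of t i]
    by (cases "i = t") (simp_all add: permute_list_nth nth_list_update)
qed simp

text \<open>A signed permutation carries an operator at one position to the same operator at another; the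
  change of its sign is the change of the sign of the permutation when a letter is replaced.\<close>

lemma pact_pos:
  assumes \<pi>: "\<pi> permutes {..<length w}" and t: "t < length w"
    and \<kappa>: "\<And>g. \<kappa> g \<noteq> 0 \<Longrightarrow> p (\<rho> g) = p g + e"
  shows "pact p \<pi> (pos p e \<kappa> \<rho> t \<phi>) w = pos p e \<kappa> \<rho> (\<pi> t) (pact p \<pi> \<phi>) w"
proof (cases "\<kappa> (w ! \<pi> t) = 0")
  case True
  then show ?thesis using t by (simp add: pact_def pos_def permute_list_nth[OF \<pi>])
next
  case False
  let ?g = "w ! \<pi> t"
  have nth: "permute_list \<pi> w ! t = ?g" by (rule permute_list_nth[OF \<pi> t])
  have "psg p \<pi> (w[\<pi> t := \<rho> ?g]) = psg p \<pi> w + e * (wpar p (take t (permute_list \<pi> w)) + wpar p (take (\<pi> t) w))"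
    unfolding psg_update[OF \<pi> t] using \<kappa>[OF False] by (simp add: add.commute)
  then have "sg (e * wpar p (take (\<pi> t) w)) * sg (psg p \<pi> (w[\<pi> t := \<rho> ?g])) = sg (psg p \<pi> w) * sg (e * wpar p (take t (permute_list \<pi> w)))"
    by (simp add: distrib_left sg_add mult_ac)
  then show ?thesis
    unfolding pact_def pos_def nth permute_list_update[OF \<pi> t] by (simp add: mult_ac)
qed


section \<open>The double centralizer of the signed permutations\<close>

text \<open>The transposed action of a matrix unit on the letter at position t: the value at a word with the
  letter \<^term>\<open>fst x\<close> is taken from the word with the letter \<^term>\<open>snd x\<close>.\<close>

definition punit :: "('g \<Rightarrow> bit) \<Rightarrow> nat \<Rightarrow> 'g \<times> 'g \<Rightarrow> ('g list \<Rightarrow> complex) \<Rightarrow> 'g list \<Rightarrow> complex" where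
  "punit p t x \<phi> w = (if t < length w \<and> w ! t = fst x
     then sg ((p (fst x) + p (snd x)) * wpar p (take t w)) * \<phi> (w[t := snd x]) else 0)"

abbreviation upar :: "('g \<Rightarrow> bit) \<Rightarrow> 'g \<times> 'g \<Rightarrow> bit" where
  "upar p x \<equiv> p (fst x) + p (snd x)"

lemma punit_sum: "punit p t x (\<lambda>w. \<Sum>u\<in>S. f u w) w = (\<Sum>u\<in>S. punit p t x (f u) w)"
  by (cases "t < length w \<and> w ! t = fst x") (auto simp: punit_def sum_distrib_left)

lemma punit_diff: "punit p t x (\<lambda>w. f w - g w) w = punit p t x f w - punit p t x g w"
  by (simp add: punit_def algebra_simps)

lemma punit_scale: "punit p t x (\<lambda>w. c * f w) w = c * punit p t x f w"
  by (simp add: punit_def algebra_simps)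

lemma punit_sum_list: "punit p t x (\<lambda>w. \<Sum>(c, ys)\<leftarrow>L. c * f ys w) w = (\<Sum>(c, ys)\<leftarrow>L. c * punit p t x (f ys) w)"
proof (induction L)
  case (Cons a L)
  have "punit p t x (\<lambda>w. f w + g w) w = punit p t x f w + punit p t x g w" for f g
    by (simp add: punit_def algebra_simps)
  then show ?case using Cons by (cases a) (simp add: punit_scale)
qed (simp add: punit_def)

lemma punit_cong: "(\<And>w'. length w' = length w \<Longrightarrow> \<phi> w' = \<psi> w') \<Longrightarrow> punit p t x \<phi> w = punit p t x \<psi> w"
  by (simp add: punit_def)

lemma punit_same: "punit p t x (punit p t z \<phi>) w = (if snd x = fst z then punit p t (fst x, snd z) \<phi> w else 0)"
proof (cases "snd x = fst z \<and> t < length w \<and> w ! t = fst x")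
  case True
  have "sg (upar p x * c) * sg (upar p z * c) = sg ((p (fst x) + p (snd z)) * c)" for c
    using True unfolding sg_add[symmetric] distrib_right[symmetric] by (simp add: ac_simps)
  then show ?thesis using True by (simp add: punit_def mult.assoc[symmetric])
qed (auto simp: punit_def)

lemma wpar_update: "u < length w \<Longrightarrow> wpar p (w[u := g]) = wpar p w + (p g + p (w ! u))"
  by (induction w arbitrary: u) (auto simp: ac_simps split: nat.splits)

text \<open>Operators at different positions supercommute.\<close>

lemma punit_other:
  assumes "t \<noteq> u"
  shows "punit p t x (punit p u z \<phi>) w = sg (upar p x * upar p z) * punit p u z (punit p t x \<phi>) w"
proof (cases "t < length w \<and> u < length w \<and> w ! t = fst x \<and> w ! u = fst z")
  case True
  have pre: "wpar p (take b (w[a := g])) = wpar p (take b w) + (if a < b then p g + p (w ! a) else 0)"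
    if "a < length w" for a b g
    using that by (auto simp: take_update_swap wpar_update list_update_beyond)
  have "sg (upar p x * wpar p (take t w)) * sg (upar p z * wpar p (take u (w[t := snd x])))
     = sg (upar p x * upar p z) * (sg (upar p z * wpar p (take u w)) * sg (upar p x * wpar p (take t (w[u := snd z]))))"
    using True assms unfolding sg_add[symmetric]
    by (cases "t < u") (auto simp: pre distrib_left distrib_right ac_simps)
  then show ?thesis
    using True assms by (simp add: punit_def list_update_swap[of t u] mult.assoc[symmetric])
qed (use assms in \<open>auto simp: punit_def\<close>)

text \<open>The sum of the products of given operators over all ways to let them act at distinct positions
  outside A.\<close>

primrec Sop :: "('g \<Rightarrow> bit) \<Rightarrow> nat \<Rightarrow> ('g \<times> 'g) list \<Rightarrow> nat set \<Rightarrow> ('g list \<Rightarrow> complex) \<Rightarrow> 'g list \<Rightarrow> complex" where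
  "Sop p n [] A \<phi> = \<phi>"
| "Sop p n (x # xs) A \<phi> = (\<lambda>w. \<Sum>t\<in>{..<n} - A. punit p t x (Sop p n xs (insert t A) \<phi>) w)"

text \<open>The results of multiplying \<open>x\<close> into one of the given matrix units, with the sign of moving \<open>x\<close>
  to its place.\<close>

primrec absorb :: "('g \<Rightarrow> bit) \<Rightarrow> 'g \<times> 'g \<Rightarrow> ('g \<times> 'g) list \<Rightarrow> (complex \<times> ('g \<times> 'g) list) list" where
  "absorb p x [] = []"
| "absorb p x (z # zs) = (if snd x = fst z then [(1, (fst x, snd z) # zs)] else [])
     @ map (\<lambda>(c, ys). (sg (upar p x * upar p z) * c, z # ys)) (absorb p x zs)"

lemma absorb_length: "(c, ys) \<in> set (absorb p x zs) \<Longrightarrow> length ys = length zs"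
  by (induction zs arbitrary: c ys) (auto split: if_splits)

lemma absorb_set: "(c, ys) \<in> set (absorb p x zs) \<Longrightarrow> x \<in> I \<times> I \<Longrightarrow> set zs \<subseteq> I \<times> I \<Longrightarrow> set ys \<subseteq> I \<times> I"
proof (induction zs arbitrary: c ys)
  case (Cons z zs)
  from Cons.prems(1) consider "snd x = fst z" "ys = (fst x, snd z) # zs"
    | c' ys' where "(c', ys') \<in> set (absorb p x zs)" "ys = z # ys'"
    by (auto split: if_splits)
  then show ?case
  proof cases
    case 1
    then show ?thesis using Cons.prems(2,3) by (auto simp: mem_Times_iff)
  next
    case 2
    then show ?thesis using Cons.IH[OF 2(1) Cons.prems(2)] Cons.prems(3) by auto
  qed
qed simp

text \<open>If a further operator acts at a position which is already in use, then it is absorbed by the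
  operator there.  This is the difference between the two sums below.\<close>

lemma Sop_absorb:
  "(\<Sum>t\<in>{..<n} - A. punit p t x (Sop p n xs A \<phi>) w - punit p t x (Sop p n xs (insert t A) \<phi>) w)
    = (\<Sum>(c, ys)\<leftarrow>absorb p x xs. c * Sop p n ys A \<phi> w)"
proof (induction xs arbitrary: A w)
  case (Cons z zs)
  let ?S = "{..<n} - A" and ?\<sigma> = "sg (upar p x * upar p z)"
  let ?P = "punit p" and ?Sop = "\<lambda>A. Sop p n zs A \<phi>"
  have ins: "{..<n} - insert t A = ?S - {t}" for t by auto
  have step: "?P t x (Sop p n (z # zs) A \<phi>) w - ?P t x (Sop p n (z # zs) (insert t A) \<phi>) w
     = ?P t x (?P t z (?Sop (insert t A))) w
     + (\<Sum>u\<in>?S - {t}. ?\<sigma> * (?P u z (\<lambda>w. ?P t x (?Sop (insert u A)) w - ?P t x (?Sop (insert t (insert u A))) w) w))"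
    if t: "t \<in> ?S" for t
  proof -
    have "?P t x (Sop p n (z # zs) A \<phi>) w = ?P t x (?P t z (?Sop (insert t A))) w
        + (\<Sum>u\<in>?S - {t}. ?P t x (?P u z (?Sop (insert u A))) w)"
      unfolding Sop.simps punit_sum using t by (simp add: sum.remove)
    moreover have "?P t x (Sop p n (z # zs) (insert t A) \<phi>) w = (\<Sum>u\<in>?S - {t}. ?P t x (?P u z (?Sop (insert t (insert u A)))) w)"
      unfolding Sop.simps punit_sum ins by (simp add: insert_commute)
    moreover have "(\<Sum>u\<in>?S - {t}. ?P t x (?P u z (?Sop (insert u A))) w) - (\<Sum>u\<in>?S - {t}. ?P t x (?P u z (?Sop (insert t (insert u A)))) w)
       = (\<Sum>u\<in>?S - {t}. ?\<sigma> * (?P u z (\<lambda>w. ?P t x (?Sop (insert u A)) w - ?P t x (?Sop (insert t (insert u A))) w) w))"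
      unfolding sum_subtractf[symmetric]
      by (intro sum.cong refl) (auto simp: punit_other[of t _ p x z] punit_diff right_diff_distrib)
    ultimately show ?thesis by simp
  qed
  have "(\<Sum>t\<in>?S. ?P t x (Sop p n (z # zs) A \<phi>) w - ?P t x (Sop p n (z # zs) (insert t A) \<phi>) w)
     = (\<Sum>t\<in>?S. ?P t x (?P t z (?Sop (insert t A))) w)
     + (\<Sum>t\<in>?S. \<Sum>u\<in>?S - {t}. ?\<sigma> * (?P u z (\<lambda>w. ?P t x (?Sop (insert u A)) w - ?P t x (?Sop (insert t (insert u A))) w) w))"
    unfolding sum.distrib[symmetric] by (intro sum.cong refl step)
  also have "(\<Sum>t\<in>?S. \<Sum>u\<in>?S - {t}. ?\<sigma> * (?P u z (\<lambda>w. ?P t x (?Sop (insert u A)) w - ?P t x (?Sop (insert t (insert u A))) w) w))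
     = (\<Sum>u\<in>?S. \<Sum>t\<in>?S - {u}. ?\<sigma> * (?P u z (\<lambda>w. ?P t x (?Sop (insert u A)) w - ?P t x (?Sop (insert t (insert u A))) w) w))"
  proof -
    have "{u \<in> ?S. u \<noteq> t} = ?S - {t}" "{u \<in> ?S. t \<noteq> u} = ?S - {t}" for t by auto
    then show ?thesis using sum.swap_restrict[of ?S ?S _ "(\<noteq>)"] by simp
  qed
  also have "\<dots> = (\<Sum>u\<in>?S. ?\<sigma> * ?P u z (\<lambda>w. \<Sum>(c, ys)\<leftarrow>absorb p x zs. c * Sop p n ys (insert u A) \<phi> w) w)"
    by (simp add: Cons.IH[symmetric] ins punit_sum sum_distrib_left)
  also have "\<dots> = (\<Sum>(c, ys)\<leftarrow>map (\<lambda>(c, ys). (?\<sigma> * c, z # ys)) (absorb p x zs). c * Sop p n ys A \<phi> w)"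
  proof -
    have "(\<Sum>u\<in>?S. ?\<sigma> * (\<Sum>(c, ys)\<leftarrow>L. c * punit p u z (Sop p n ys (insert u A) \<phi>) w))
      = (\<Sum>(c, ys)\<leftarrow>map (\<lambda>(c, ys). (?\<sigma> * c, z # ys)) L. c * Sop p n ys A \<phi> w)" for L
      by (induction L) (auto simp: sum.distrib distrib_left sum_distrib_left mult.assoc)
    then show ?thesis unfolding punit_sum_list .
  qed
  also have "(\<Sum>t\<in>?S. ?P t x (?P t z (?Sop (insert t A))) w) = (\<Sum>(c, ys)\<leftarrow>(if snd x = fst z then [(1, (fst x, snd z) # zs)] else []). c * Sop p n ys A \<phi> w)"
    by (simp add: punit_same)
  finally show ?case by simp
qed simp

definition arrangements :: "nat \<Rightarrow> nat set \<Rightarrow> nat \<Rightarrow> nat list set" where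
  "arrangements n A j = {us. distinct us \<and> set us \<subseteq> {..<n} - A \<and> length us = j}"

definition at_positions :: "('g \<Rightarrow> bit) \<Rightarrow> nat list \<Rightarrow> ('g \<times> 'g) list \<Rightarrow> ('g list \<Rightarrow> complex) \<Rightarrow> 'g list \<Rightarrow> complex" where
  "at_positions p us xs \<phi> = foldr (\<lambda>(u, x). punit p u x) (zip us xs) \<phi>"

lemma finite_arrangements: "finite (arrangements n A j)"
  by (rule finite_subset[OF _ finite_lists_length_eq[of "{..<n}" j]]) (auto simp: arrangements_def)

lemma Sop_arrangements: "Sop p n xs A \<phi> w = (\<Sum>us\<in>arrangements n A (length xs). at_positions p us xs \<phi> w)"
proof (induction xs arbitrary: A w)
  case Nil
  have "arrangements n A 0 = {[]}" by (auto simp: arrangements_def)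
  then show ?case by (simp add: at_positions_def)
next
  case (Cons x xs)
  let ?Sig = "Sigma ({..<n} - A) (\<lambda>t. arrangements n (insert t A) (length xs))"
  have img: "arrangements n A (Suc (length xs)) = (\<lambda>(t, us). t # us) ` ?Sig"
  proof (intro equalityI subsetI)
    fix us assume "us \<in> arrangements n A (Suc (length xs))"
    then show "us \<in> (\<lambda>(t, us). t # us) ` ?Sig"
      by (cases us) (auto simp: arrangements_def intro!: image_eqI[of _ _ "(hd us, tl us)"])
  qed (auto simp: arrangements_def)
  have "Sop p n (x # xs) A \<phi> w = (\<Sum>t\<in>{..<n} - A. \<Sum>us\<in>arrangements n (insert t A) (length xs). punit p t x (at_positions p us xs \<phi>) w)"
    unfolding Sop.simps punit_sum[symmetric] using Cons.IH by (intro sum.cong refl punit_cong) simp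
  also have "\<dots> = (\<Sum>(t, us)\<in>?Sig. at_positions p (t # us) (x # xs) \<phi> w)"
    by (subst sum.Sigma) (auto simp: finite_arrangements at_positions_def)
  also have "\<dots> = (\<Sum>us\<in>arrangements n A (length (x # xs)). at_positions p us (x # xs) \<phi> w)"
    unfolding list.size add_Suc_right add_0_right img
    by (subst sum.reindex) (auto simp: inj_on_def case_prod_unfold)
  finally show ?case .
qed

lemma arrangements_permutes: 
  "bij_betw (\<lambda>\<pi>. map \<pi> [0..<n]) {\<pi>. \<pi> permutes {..<n}} (arrangements n {} n)"
proof (rule bij_betwI')
  fix \<pi> \<sigma> :: "nat \<Rightarrow> nat" assume "\<pi> \<in> {\<pi>. \<pi> permutes {..<n}}" "\<sigma> \<in> {\<pi>. \<pi> permutes {..<n}}"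
  then have \<pi>: "\<pi> permutes {..<n}" "\<sigma> permutes {..<n}" by auto
  show "(map \<pi> [0..<n] = map \<sigma> [0..<n]) = (\<pi> = \<sigma>)"
  proof
    assume eq: "map \<pi> [0..<n] = map \<sigma> [0..<n]"
    show "\<pi> = \<sigma>"
    proof
      fix i show "\<pi> i = \<sigma> i"
        using eq permutes_not_in[OF \<pi>(1), of i] permutes_not_in[OF \<pi>(2), of i] by (cases "i < n") auto
    qed
  qed simp
next
  fix \<pi> :: "nat \<Rightarrow> nat" assume "\<pi> \<in> {\<pi>. \<pi> permutes {..<n}}"
  then have \<pi>: "\<pi> permutes {..<n}" by simp
  show "map \<pi> [0..<n] \<in> arrangements n {} n"
    using permutes_in_image[OF \<pi>] inj_on_subset[OF permutes_inj[OF \<pi>]]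
    by (auto simp: arrangements_def distinct_map)
next
  fix us assume us: "us \<in> arrangements n {} n"
  define \<pi> where "\<pi> i = (if i < n then us ! i else i)" for i
  have "\<pi> permutes {..<n}"
  proof (rule inj_imp_permutes)
    show "inj_on \<pi> {..<n}" using us by (auto simp: inj_on_def \<pi>_def arrangements_def nth_eq_iff_index_eq)
    show "\<pi> i \<in> {..<n}" if "i \<in> {..<n}" for i
    proof -
      have "set us \<subseteq> {..<n}" "i < length us" using us that by (auto simp: arrangements_def)
      then have "us ! i \<in> {..<n}" by (metis nth_mem subsetD)
      then show ?thesis using that by (simp add: \<pi>_def)
    qed
  qed (auto simp: \<pi>_def)
  moreover have "us = map \<pi> [0..<n]"
    using us by (intro nth_equalityI) (auto simp: arrangements_def \<pi>_def)
  ultimately show "\<exists>\<pi>\<in>{\<pi>. \<pi> permutes {..<n}}. us = map \<pi> [0..<n]" by blast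
qed

lemma pact_punit:
  assumes \<pi>: "\<pi> permutes {..<length w}" and t: "t < length w"
  shows "pact p \<pi> (punit p t x \<phi>) w = punit p (\<pi> t) x (pact p \<pi> \<phi>) w"
proof -
  have pos: "punit p t x \<psi> v = pos p (upar p x) (\<lambda>g. if g = fst x then 1 else 0) (\<lambda>_. snd x) t \<psi> v"
    if "t < length v" for t \<psi> v
    using that by (simp add: punit_def pos_def)
  have "\<pi> t < length w" using permutes_in_image[OF \<pi>, of t] t by simp
  then have "punit p (\<pi> t) x (pact p \<pi> \<phi>) w = pact p \<pi> (pos p (upar p x) (\<lambda>g. if g = fst x then 1 else 0) (\<lambda>_. snd x) t \<phi>) w"
    by (subst pact_pos[OF \<pi> t]) (auto simp: pos split: if_splits)
  then show ?thesis using t by (simp add: pact_def pos)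
qed

lemma pact_at_positions:
  assumes \<pi>: "\<pi> permutes {..<n}"
  shows "length w = n \<Longrightarrow> set us \<subseteq> {..<n} \<Longrightarrow> pact p \<pi> (at_positions p us xs \<phi>) w = at_positions p (map \<pi> us) xs (pact p \<pi> \<phi>) w"
proof (induction us arbitrary: xs w)
  case (Cons u us)
  show ?case
  proof (cases xs)
    case (Cons x xs')
    have "pact p \<pi> (at_positions p (u # us) xs \<phi>) w = punit p (\<pi> u) x (pact p \<pi> (at_positions p us xs' \<phi>)) w"
      using pact_punit[of \<pi> w u p x] \<pi> Cons.prems by (simp add: Cons at_positions_def)
    also have "\<dots> = punit p (\<pi> u) x (at_positions p (map \<pi> us) xs' (pact p \<pi> \<phi>)) w"
      using Cons.IH Cons.prems by (intro punit_cong) simp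
    finally show ?thesis by (simp add: Cons at_positions_def)
  qed (simp add: at_positions_def)
qed (simp add: at_positions_def)

lemma at_positions_cong:
  "(\<And>v. length v = length w \<Longrightarrow> \<phi> v = \<psi> v) \<Longrightarrow> at_positions p us xs \<phi> w = at_positions p us xs \<psi> w"
proof (induction us arbitrary: xs w)
  case (Cons u us)
  then show ?case
    by (cases xs) (auto simp: at_positions_def intro!: punit_cong)
qed (simp add: at_positions_def)

lemma pact_inv:
  assumes \<pi>: "\<pi> permutes {..<length w}"
  shows "pact p \<pi> (pact p (pinv \<pi>) \<phi>) w = \<phi> w"
  by (simp add: pact_def psg_inv[OF \<pi>] permute_list_inv[OF \<pi>])

text \<open>If there are as many operators as positions, then the sum runs over all permutations, and the
  terms are the conjugates of a single one.\<close>

lemma Sop_permutes: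
  assumes "length xs = n" "length w = n"
  shows "Sop p n xs {} \<phi> w = (\<Sum>\<pi> | \<pi> permutes {..<n}. pact p \<pi> (at_positions p [0..<n] xs (pact p (pinv \<pi>) \<phi>)) w)"
proof -
  have "Sop p n xs {} \<phi> w = (\<Sum>\<pi> | \<pi> permutes {..<n}. at_positions p (map \<pi> [0..<n]) xs \<phi> w)"
    unfolding Sop_arrangements assms(1)
    by (rule sum.reindex_bij_betw[OF arrangements_permutes, symmetric])
  also have "\<dots> = (\<Sum>\<pi> | \<pi> permutes {..<n}. pact p \<pi> (at_positions p [0..<n] xs (pact p (pinv \<pi>) \<phi>)) w)"
  proof (intro sum.cong refl)
    fix \<pi> assume "\<pi> \<in> {\<pi>. \<pi> permutes {..<n}}"
    then have \<pi>: "\<pi> permutes {..<n}" by simp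
    have "at_positions p (map \<pi> [0..<n]) xs \<phi> w = at_positions p (map \<pi> [0..<n]) xs (pact p \<pi> (pact p (pinv \<pi>) \<phi>)) w"
      using \<pi> assms(2) by (intro at_positions_cong) (simp add: pact_inv)
    then show "at_positions p (map \<pi> [0..<n]) xs \<phi> w = pact p \<pi> (at_positions p [0..<n] xs (pact p (pinv \<pi>) \<phi>)) w"
      using pact_at_positions[OF \<pi> assms(2), of "[0..<n]" p xs] by (simp add: subset_eq)
  qed
  finally show ?thesis .
qed

text \<open>Acting once at each position, the matrix units compose to a matrix unit of the space of words.\<close>

lemma at_positions_unit:
  assumes "length is = length js"
  shows "\<exists>c. c \<noteq> 0 \<and> (\<forall>\<phi> v. length v = length is \<longrightarrow>
    at_positions p [length u..<length u + length is] (zip is js) \<phi> (u @ v) = (if v = is then c * \<phi> (u @ js) else 0))"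
  using assms
proof (induction "is" js arbitrary: u rule: list_induct2)
  case Nil
  then show ?case by (intro exI[of _ 1]) (simp add: at_positions_def)
next
  case (Cons i "is" j js)
  from Cons.IH[of "u @ [j]"] obtain c where c: "c \<noteq> 0" "\<And>\<phi> v. length v = length is \<Longrightarrow>
    at_positions p [Suc (length u)..<Suc (length u) + length is] (zip is js) \<phi> (u @ j # v) = (if v = is then c * \<phi> (u @ j # js) else 0)"
    by auto
  let ?s = "sg ((p i + p j) * wpar p u)"
  have "at_positions p [length u..<length u + length (i # is)] (zip (i # is) (j # js)) \<phi> (u @ v) = (if v = i # is then (?s * c) * \<phi> (u @ j # js) else 0)"
    if len: "length v = length (i # is)" for \<phi> v
  proof -
    obtain v0 v' where v: "v = v0 # v'" "length v' = length is" using len by (cases v) auto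
    have "[length u..<length u + length (i # is)] = length u # [Suc (length u)..<Suc (length u) + length is]"
      by (subst upt_conv_Cons) simp_all
    then have "at_positions p [length u..<length u + length (i # is)] (zip (i # is) (j # js)) \<phi> (u @ v)
      = punit p (length u) (i, j) (at_positions p [Suc (length u)..<Suc (length u) + length is] (zip is js) \<phi>) (u @ v0 # v')"
      by (simp add: at_positions_def v)
    also have "\<dots> = (if v0 = i then ?s * at_positions p [Suc (length u)..<Suc (length u) + length is] (zip is js) \<phi> (u @ j # v') else 0)"
      by (simp add: punit_def)
    finally show ?thesis using c(2)[OF v(2)] v by auto
  qed
  then show ?case using c(1) by (intro exI[of _ "?s * c"]) auto
qed

lemma permute_list_eq_iff:
  assumes "\<pi> permutes {..<length v}" "length v = length w"
  shows "permute_list \<pi> v = w \<longleftrightarrow> v = permute_list (pinv \<pi>) w"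
  using permute_list_inv[OF assms(1)] permute_list_inv[of \<pi> w] assms by metis

lemma sum_swap_pairs:
  "(\<Sum>a\<in>A. \<Sum>b\<in>B. \<Sum>c\<in>C. \<Sum>d\<in>D. f a b c d) = (\<Sum>c\<in>C. \<Sum>d\<in>D. \<Sum>a\<in>A. \<Sum>b\<in>B. f a b c d)"
proof -
  have "(\<Sum>b\<in>B. \<Sum>c\<in>C. \<Sum>d\<in>D. f a b c d) = (\<Sum>c\<in>C. \<Sum>d\<in>D. \<Sum>b\<in>B. f a b c d)" for a
    by (subst sum.swap) (intro sum.cong refl sum.swap)
  then have "(\<Sum>a\<in>A. \<Sum>b\<in>B. \<Sum>c\<in>C. \<Sum>d\<in>D. f a b c d) = (\<Sum>a\<in>A. \<Sum>c\<in>C. \<Sum>d\<in>D. \<Sum>b\<in>B. f a b c d)"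
    by simp
  also have "\<dots> = (\<Sum>c\<in>C. \<Sum>d\<in>D. \<Sum>a\<in>A. \<Sum>b\<in>B. f a b c d)"
    by (subst sum.swap) (intro sum.cong refl sum.swap)
  finally show ?thesis .
qed

text \<open>Functions on the words of length \<open>n\<close> over a finite alphabet, and operators on them given by
  matrices, which are called kernels.\<close>

locale finite_words =
  fixes p :: "'g \<Rightarrow> bit" and I :: "'g set" and n :: nat
  assumes fin: "finite I"
begin

definition B :: "'g list set" where
  "B = {w. length w = n \<and> set w \<subseteq> I}"

abbreviation Pn :: "(nat \<Rightarrow> nat) set" where
  "Pn \<equiv> {\<pi>. \<pi> permutes {..<n}}"

text \<open>The action of a matrix unit of the general linear Lie superalgebra on functions of words.\<close>

definition diag_sum :: "'g \<times> 'g \<Rightarrow> ('g list \<Rightarrow> complex) \<Rightarrow> 'g list \<Rightarrow> complex" where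
  "diag_sum x \<phi> w = (\<Sum>t<n. punit p t x \<phi> w)"

definition apply_kernel :: "('g list \<Rightarrow> 'g list \<Rightarrow> complex) \<Rightarrow> ('g list \<Rightarrow> complex) \<Rightarrow> 'g list \<Rightarrow> complex" where
  "apply_kernel F \<phi> w = (\<Sum>j\<in>B. F w j * \<phi> j)"

definition commuting :: "('g list \<Rightarrow> 'g list \<Rightarrow> complex) \<Rightarrow> bool" where
  "commuting F \<longleftrightarrow> (\<forall>x\<in>I \<times> I. \<forall>\<phi>. \<forall>w\<in>B. apply_kernel F (diag_sum x \<phi>) w = diag_sum x (apply_kernel F \<phi>) w)"

lemma finite_B: "finite B"
  unfolding B_def using finite_lists_length_eq[OF fin, of n] by (simp add: conj_commute)

lemma finite_Pn: "finite Pn"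
  by (rule finite_permutations) simp

lemma B_length: "w \<in> B \<Longrightarrow> length w = n"
  by (simp add: B_def)

lemma B_permute: "\<pi> permutes {..<n} \<Longrightarrow> w \<in> B \<Longrightarrow> permute_list \<pi> w \<in> B"
  by (simp add: B_def)

lemma B_update: "w \<in> B \<Longrightarrow> b \<in> I \<Longrightarrow> w[t := b] \<in> B"
  using set_update_subset_insert[of w t b] by (auto simp: B_def)

lemma kernel_diff: "apply_kernel F (\<lambda>w. f w - g w) w = apply_kernel F f w - apply_kernel F g w"
  by (simp add: apply_kernel_def right_diff_distrib sum_subtractf)

lemma kernel_sum_list: "apply_kernel F (\<lambda>w. \<Sum>(c, ys)\<leftarrow>L. c * f ys w) w = (\<Sum>(c, ys)\<leftarrow>L. c * apply_kernel F (f ys) w)"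
  by (induction L) (auto simp: apply_kernel_def distrib_left sum.distrib sum_distrib_left mult_ac)

lemma diag_sum_cong: "x \<in> I \<times> I \<Longrightarrow> w \<in> B \<Longrightarrow> (\<And>v. v \<in> B \<Longrightarrow> \<phi> v = \<psi> v) \<Longrightarrow> diag_sum x \<phi> w = diag_sum x \<psi> w"
  unfolding diag_sum_def punit_def by (intro sum.cong refl) (auto simp: B_update mem_Times_iff)

lemma commuting_combination:
  assumes "\<And>s. s \<in> S \<Longrightarrow> commuting (R s)" "commuting F"
  shows "commuting (\<lambda>i j. F i j - (\<Sum>s\<in>S. c s * R s i j))"
proof -
  have ker: "apply_kernel (\<lambda>i j. F i j - (\<Sum>s\<in>S. c s * R s i j)) \<phi> w = apply_kernel F \<phi> w - (\<Sum>s\<in>S. c s * apply_kernel (R s) \<phi> w)" for \<phi> w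
    unfolding apply_kernel_def left_diff_distrib sum_subtractf sum_distrib_right sum_distrib_left mult.assoc
    by (subst (2) sum.swap) simp
  have tot: "diag_sum x (\<lambda>w. \<phi> w - (\<Sum>s\<in>S. c s * \<psi> s w)) w = diag_sum x \<phi> w - (\<Sum>s\<in>S. c s * diag_sum x (\<psi> s) w)" for x \<phi> \<psi> w
    unfolding diag_sum_def punit_diff punit_sum punit_scale sum_subtractf sum_distrib_left
    by (subst sum.swap) simp
  show ?thesis
    unfolding commuting_def ker tot
  proof (intro ballI allI)
    fix x \<phi> w assume x: "x \<in> I \<times> I" and w: "w \<in> B"
    have "apply_kernel (R s) (diag_sum x \<phi>) w = diag_sum x (apply_kernel (R s) \<phi>) w" if "s \<in> S" for s
      by (rule assms(1)[OF that, unfolded commuting_def, rule_format, OF x w])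
    moreover have "apply_kernel F (diag_sum x \<phi>) w = diag_sum x (apply_kernel F \<phi>) w"
      by (rule assms(2)[unfolded commuting_def, rule_format, OF x w])
    ultimately show "apply_kernel F (diag_sum x \<phi>) w - (\<Sum>s\<in>S. c s * apply_kernel (R s) (diag_sum x \<phi>) w)
      = diag_sum x (apply_kernel F \<phi>) w - (\<Sum>s\<in>S. c s * diag_sum x (apply_kernel (R s) \<phi>) w)" by simp
  qed
qed

text \<open>Acting first with \<open>zs\<close> at distinct positions and then with \<open>x\<close> anywhere differs from acting with
  \<open>x # zs\<close> at distinct positions by the terms in which \<open>x\<close> is absorbed, and these have fewer operators.\<close>

lemma commuting_Sop:
  assumes F: "commuting F" and "set xs \<subseteq> I \<times> I" "w \<in> B"
  shows "apply_kernel F (Sop p n xs {} \<phi>) w = Sop p n xs {} (apply_kernel F \<phi>) w"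
  using assms(2,3)
proof (induction "length xs" arbitrary: xs w rule: less_induct)
  case less
  show ?case
  proof (cases xs)
    case (Cons x zs)
    have x: "x \<in> I \<times> I" and zs: "set zs \<subseteq> I \<times> I" using less.prems Cons by auto
    have rec: "Sop p n xs {} \<psi> = (\<lambda>w. diag_sum x (Sop p n zs {} \<psi>) w - (\<Sum>(c, ys)\<leftarrow>absorb p x zs. c * Sop p n ys {} \<psi> w))" for \<psi>
      using Sop_absorb[where A = "{}" and n = n and p = p and x = x and xs = zs and \<phi> = \<psi>]
      by (simp add: Cons diag_sum_def fun_eq_iff sum_subtractf algebra_simps)
    have IH: "apply_kernel F (Sop p n ys {} \<phi>) v = Sop p n ys {} (apply_kernel F \<phi>) v"
      if "length ys = length zs" "set ys \<subseteq> I \<times> I" "v \<in> B" for ys v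
      using less.hyps[of ys v] that Cons by simp
    have "apply_kernel F (Sop p n xs {} \<phi>) w = apply_kernel F (diag_sum x (Sop p n zs {} \<phi>)) w
        - (\<Sum>(c, ys)\<leftarrow>absorb p x zs. c * apply_kernel F (Sop p n ys {} \<phi>) w)"
      unfolding rec kernel_diff kernel_sum_list ..
    also have "apply_kernel F (diag_sum x (Sop p n zs {} \<phi>)) w = diag_sum x (apply_kernel F (Sop p n zs {} \<phi>)) w"
      by (rule F[unfolded commuting_def, rule_format, OF x less.prems(2)])
    also have "\<dots> = diag_sum x (Sop p n zs {} (apply_kernel F \<phi>)) w"
      using x less.prems(2) zs by (intro diag_sum_cong IH) auto
    also have "(\<Sum>(c, ys)\<leftarrow>absorb p x zs. c * apply_kernel F (Sop p n ys {} \<phi>) w)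
       = (\<Sum>(c, ys)\<leftarrow>absorb p x zs. c * Sop p n ys {} (apply_kernel F \<phi>) w)"
    proof (intro arg_cong[of _ _ sum_list] map_cong refl, clarify)
      fix c ys assume "(c, ys) \<in> set (absorb p x zs)"
      then show "c * apply_kernel F (Sop p n ys {} \<phi>) w = c * Sop p n ys {} (apply_kernel F \<phi>) w"
        using IH[of ys w] absorb_length absorb_set[OF _ x zs] less.prems(2) by metis
    qed
    finally show ?thesis unfolding rec .
  qed simp
qed

text \<open>The relation between a kernel that commutes with the diagonal action and the permutations,
  obtained by letting it commute with the symmetrisation of a single matrix unit.\<close>

lemma commuting_star:
  assumes F: "commuting F" and B: "a \<in> B" "b \<in> B" "i \<in> B" "j \<in> B"
  shows "(\<Sum>\<pi>\<in>Pn. sg (psg p \<pi> i) * sg (psg p \<pi> j) * F a (permute_list \<pi> i) * (if permute_list \<pi> j = b then 1 else 0))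
    = (\<Sum>\<pi>\<in>Pn. sg (psg p \<pi> i) * sg (psg p \<pi> j) * F (permute_list \<pi> j) b * (if permute_list \<pi> i = a then 1 else 0))"
proof -
  have len: "length i = n" "length j = n" using B by (simp_all add: B_length)
  have "length i = length j" using len by simp
  from at_positions_unit[OF this, of p "[]"] obtain c where cc: "c \<noteq> 0 \<and>
    (\<forall>\<phi> v. length v = length i \<longrightarrow> at_positions p [length ([] :: 'g list)..<length ([] :: 'g list) + length i] (zip i j) \<phi> ([] @ v)
      = (if v = i then c * \<phi> ([] @ j) else 0))" ..
  note c0 = conjunct1[OF cc] and all = conjunct2[OF cc]
  have c1: "at_positions p [0..<n] (zip i j) \<phi> v = (if v = i then c * \<phi> j else 0)" if "length v = n" for \<phi> v
    using all[rule_format, of v \<phi>] that by (simp add: len)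
  note c = c0 c1
  have perm: "permute_list \<pi> v = i \<longleftrightarrow> v = permute_list (pinv \<pi>) i" if "\<pi> permutes {..<n}" "length v = n" for \<pi> v
    using permute_list_eq_iff[of \<pi> v i] that len by simp
  have Sop: "Sop p n (zip i j) {} \<phi> v = (\<Sum>\<pi>\<in>Pn. if v = permute_list (pinv \<pi>) i
      then c * (sg (psg p (pinv \<pi>) i) * sg (psg p (pinv \<pi>) j) * \<phi> (permute_list (pinv \<pi>) j)) else 0)"
    if v: "length v = n" for \<phi> v
  proof -
    have "Sop p n (zip i j) {} \<phi> v = (\<Sum>\<pi>\<in>Pn. pact p \<pi> (at_positions p [0..<n] (zip i j) (pact p (pinv \<pi>) \<phi>)) v)"
      using len by (intro Sop_permutes v) simp
    also have "\<dots> = (\<Sum>\<pi>\<in>Pn. if v = permute_list (pinv \<pi>) i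
      then c * (sg (psg p (pinv \<pi>) i) * sg (psg p (pinv \<pi>) j) * \<phi> (permute_list (pinv \<pi>) j)) else 0)"
    proof (intro sum.cong refl)
      fix \<pi> assume "\<pi> \<in> Pn"
      then have \<pi>: "\<pi> permutes {..<n}" by simp
      have "psg p \<pi> v = psg p (pinv \<pi>) i" if "permute_list \<pi> v = i"
        using psg_inv[of \<pi> v p] \<pi> v that by simp
      then show "pact p \<pi> (at_positions p [0..<n] (zip i j) (pact p (pinv \<pi>) \<phi>)) v = (if v = permute_list (pinv \<pi>) i
        then c * (sg (psg p (pinv \<pi>) i) * sg (psg p (pinv \<pi>) j) * \<phi> (permute_list (pinv \<pi>) j)) else 0)"
        using perm[OF \<pi> v] v by (auto simp: pact_def c(2))
    qed
    finally show ?thesis .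
  qed
  \<comment> \<open>Applied to the indicator function of \<open>b\<close>, the kernel gives its column \<open>b\<close>.\<close>
  define \<delta> where "\<delta> v = (if v = b then 1 else 0 :: complex)" for v
  have inv_perm: "(\<Sum>\<pi>\<in>Pn. f (pinv \<pi>)) = (\<Sum>\<pi>\<in>Pn. f \<pi>)" for f :: "(nat \<Rightarrow> nat) \<Rightarrow> complex"
    by (rule sum_permutations_inverse[symmetric])
  have "apply_kernel F (Sop p n (zip i j) {} \<delta>) a = (\<Sum>\<pi>\<in>Pn. \<Sum>v\<in>B. if v = permute_list (pinv \<pi>) i
      then F a v * (c * (sg (psg p (pinv \<pi>) i) * sg (psg p (pinv \<pi>) j) * \<delta> (permute_list (pinv \<pi>) j))) else 0)"
  proof -
    have "apply_kernel F (Sop p n (zip i j) {} \<delta>) a = (\<Sum>v\<in>B. \<Sum>\<pi>\<in>Pn. if v = permute_list (pinv \<pi>) i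
      then F a v * (c * (sg (psg p (pinv \<pi>) i) * sg (psg p (pinv \<pi>) j) * \<delta> (permute_list (pinv \<pi>) j))) else 0)"
      unfolding apply_kernel_def by (intro sum.cong refl) (auto simp: Sop B_length sum_distrib_left intro!: sum.cong)
    then show ?thesis by (subst (asm) sum.swap)
  qed
  also have "\<dots> = (\<Sum>\<pi>\<in>Pn. F a (permute_list (pinv \<pi>) i) * (c * (sg (psg p (pinv \<pi>) i) * sg (psg p (pinv \<pi>) j) * \<delta> (permute_list (pinv \<pi>) j))))"
    using B by (intro sum.cong refl) (simp add: finite_B B_permute permutes_inv)
  also have "\<dots> = c * (\<Sum>\<pi>\<in>Pn. sg (psg p \<pi> i) * sg (psg p \<pi> j) * F a (permute_list \<pi> i) * (if permute_list \<pi> j = b then 1 else 0))"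
    using inv_perm[of "\<lambda>\<pi>. F a (permute_list \<pi> i) * (c * (sg (psg p \<pi> i) * sg (psg p \<pi> j) * \<delta> (permute_list \<pi> j)))"]
    by (simp add: \<delta>_def sum_distrib_left mult_ac)
  finally have L: "apply_kernel F (Sop p n (zip i j) {} \<delta>) a = c * (\<Sum>\<pi>\<in>Pn. sg (psg p \<pi> i) * sg (psg p \<pi> j) * F a (permute_list \<pi> i) * (if permute_list \<pi> j = b then 1 else 0))" .
  have ker: "apply_kernel F \<delta> v = F v b" for v
  proof -
    have "apply_kernel F \<delta> v = (\<Sum>u\<in>B. if u = b then F v u else 0)"
      unfolding apply_kernel_def \<delta>_def by (intro sum.cong) auto
    then show ?thesis using B(2) finite_B by simp
  qed
  have "Sop p n (zip i j) {} (apply_kernel F \<delta>) a = c * (\<Sum>\<pi>\<in>Pn. sg (psg p \<pi> i) * sg (psg p \<pi> j) * F (permute_list \<pi> j) b * (if permute_list \<pi> i = a then 1 else 0))"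
  proof -
    let ?h = "\<lambda>\<pi>. if a = permute_list \<pi> i then c * (sg (psg p \<pi> i) * sg (psg p \<pi> j) * F (permute_list \<pi> j) b) else 0"
    have "Sop p n (zip i j) {} (apply_kernel F \<delta>) a = (\<Sum>\<pi>\<in>Pn. ?h (pinv \<pi>))"
      unfolding Sop[OF B_length[OF B(1)]] ker ..
    also have "\<dots> = (\<Sum>\<pi>\<in>Pn. ?h \<pi>)" by (rule inv_perm)
    also have "\<dots> = c * (\<Sum>\<pi>\<in>Pn. sg (psg p \<pi> i) * sg (psg p \<pi> j) * F (permute_list \<pi> j) b * (if permute_list \<pi> i = a then 1 else 0))"
      unfolding sum_distrib_left by (intro sum.cong refl) auto
    finally show ?thesis .
  qed
  moreover have "set (zip i j) \<subseteq> I \<times> I"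
    using B by (auto simp: B_def dest: set_zip_leftD set_zip_rightD)
  ultimately show ?thesis
    using commuting_Sop[OF F _ B(1), of "zip i j" \<delta>] L c(1) by simp
qed

definition signed_perm :: "(nat \<Rightarrow> nat) \<Rightarrow> 'g list \<Rightarrow> 'g list \<Rightarrow> complex" where
  "signed_perm \<pi> i j = (if i = permute_list \<pi> j then sg (psg p \<pi> j) else 0)"

lemma commuting_signed_perm:
  assumes \<pi>: "\<pi> permutes {..<n}"
  shows "commuting (signed_perm \<pi>)"
proof -
  have \<pi>': "pinv \<pi> permutes {..<n}" by (rule permutes_inv[OF \<pi>])
  have ker: "apply_kernel (signed_perm \<pi>) \<phi> w = pact p (pinv \<pi>) \<phi> w" if w: "w \<in> B" for \<phi> w
  proof -
    have "apply_kernel (signed_perm \<pi>) \<phi> w = (\<Sum>j\<in>B. if j = permute_list (pinv \<pi>) w then sg (psg p \<pi> j) * \<phi> j else 0)"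
    proof -
      have "w = permute_list \<pi> j \<longleftrightarrow> j = permute_list (pinv \<pi>) w" if "j \<in> B" for j
        using permute_list_eq_iff[of \<pi> j w] \<pi> B_length[OF w] B_length[OF that] by metis
      then show ?thesis
        unfolding apply_kernel_def signed_perm_def by (intro sum.cong refl) simp
    qed
    also have "\<dots> = sg (psg p \<pi> (permute_list (pinv \<pi>) w)) * \<phi> (permute_list (pinv \<pi>) w)"
      using B_permute[OF \<pi>' w] finite_B by simp
    also have "psg p \<pi> (permute_list (pinv \<pi>) w) = psg p (pinv \<pi>) w"
      using psg_inv[of "pinv \<pi>" w p] \<pi>' B_length[OF w] by (simp add: permutes_inv_inv[OF \<pi>])
    finally show ?thesis by (simp add: pact_def)
  qed
  have "apply_kernel (signed_perm \<pi>) (diag_sum x \<phi>) w = diag_sum x (apply_kernel (signed_perm \<pi>) \<phi>) w" if x: "x \<in> I \<times> I" and w: "w \<in> B" for x \<phi> w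
  proof -
    have "apply_kernel (signed_perm \<pi>) (diag_sum x \<phi>) w = (\<Sum>t<n. pact p (pinv \<pi>) (punit p t x \<phi>) w)"
      unfolding ker[OF w] by (simp add: diag_sum_def pact_def sum_distrib_left)
    also have "\<dots> = (\<Sum>t<n. punit p (pinv \<pi> t) x (pact p (pinv \<pi>) \<phi>) w)"
      using \<pi>' B_length[OF w] by (intro sum.cong refl pact_punit) auto
    also have "\<dots> = diag_sum x (pact p (pinv \<pi>) \<phi>) w"
      using sum.permute[OF \<pi>', of "\<lambda>t. punit p t x (pact p (pinv \<pi>) \<phi>) w"] by (simp add: diag_sum_def comp_def)
    also have "\<dots> = diag_sum x (apply_kernel (signed_perm \<pi>) \<phi>) w"
      by (rule diag_sum_cong[OF x w]) (simp add: ker)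
    finally show ?thesis .
  qed
  then show ?thesis unfolding commuting_def by blast
qed

end

text \<open>Orthogonal projection to the span of finitely many functions on a finite set.\<close>

lemma orthogonal_remainder:
  fixes v :: "'q \<Rightarrow> complex" and R :: "'s \<Rightarrow> 'q \<Rightarrow> complex"
  assumes Q: "finite Q" and S: "finite S"
  shows "\<exists>c. \<forall>s\<in>S. (\<Sum>q\<in>Q. (v q - (\<Sum>t\<in>S. c t * R t q)) * cnj (R s q)) = 0"
  using S
proof (induction S arbitrary: v)
  case (insert s S)
  from insert.IH[of v] obtain c where c: "\<And>t. t \<in> S \<Longrightarrow> (\<Sum>q\<in>Q. (v q - (\<Sum>t\<in>S. c t * R t q)) * cnj (R t q)) = 0" by blast
  from insert.IH[of "R s"] obtain d where d: "\<And>t. t \<in> S \<Longrightarrow> (\<Sum>q\<in>Q. (R s q - (\<Sum>t\<in>S. d t * R t q)) * cnj (R t q)) = 0" by blast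
  define v' where "v' q = v q - (\<Sum>t\<in>S. c t * R t q)" for q
  define s' where "s' q = R s q - (\<Sum>t\<in>S. d t * R t q)" for q
  \<comment> \<open>One step of the orthogonalisation; if \<open>R s\<close> depends on the previous functions, then \<open>s'\<close> vanishes.\<close>
  define \<alpha> where "\<alpha> = (if (\<Sum>q\<in>Q. s' q * cnj (s' q)) = 0 then 0 else (\<Sum>q\<in>Q. v' q * cnj (s' q)) / (\<Sum>q\<in>Q. s' q * cnj (s' q)))"
  define e where "e t = (if t = s then \<alpha> else c t - \<alpha> * d t)" for t
  have rem: "v q - (\<Sum>t\<in>insert s S. e t * R t q) = v' q - \<alpha> * s' q" for q
  proof -
    have "(\<Sum>t\<in>S. e t * R t q) = (\<Sum>t\<in>S. c t * R t q) - \<alpha> * (\<Sum>t\<in>S. d t * R t q)"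
      using insert.hyps by (auto simp: e_def sum_distrib_left sum_subtractf[symmetric] algebra_simps intro!: sum.cong)
    then show ?thesis
      using insert.hyps by (simp add: v'_def s'_def e_def algebra_simps)
  qed
  have orthS: "(\<Sum>q\<in>Q. (v' q - \<alpha> * s' q) * cnj (R t q)) = 0" if "t \<in> S" for t
    using c[OF that] d[OF that] by (simp add: v'_def[symmetric] s'_def[symmetric] left_diff_distrib sum_subtractf mult.assoc sum_distrib_left[symmetric])
  have zero: "(\<Sum>q\<in>Q. (v' q - \<alpha> * s' q) * cnj (s' q)) = 0"
  proof (cases "(\<Sum>q\<in>Q. s' q * cnj (s' q)) = 0")
    case True
    have "(\<Sum>q\<in>Q. (cmod (s' q))\<^sup>2) = 0"
    proof -
      have "complex_of_real (\<Sum>q\<in>Q. (cmod (s' q))\<^sup>2) = 0"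
        using True by (simp only: of_real_sum complex_norm_square)
      then show ?thesis by (simp only: of_real_eq_0_iff)
    qed
    then have "s' q = 0" if "q \<in> Q" for q
      using Q that by (simp add: sum_nonneg_eq_0_iff)
    then show ?thesis by simp
  next
    case False
    then show ?thesis
      unfolding left_diff_distrib sum_subtractf mult.assoc sum_distrib_left[symmetric] by (simp add: \<alpha>_def)
  qed
  have "(\<Sum>q\<in>Q. (v' q - \<alpha> * s' q) * cnj (R s q)) = 0"
  proof -
    have "(\<Sum>q\<in>Q. (v' q - \<alpha> * s' q) * cnj (R s q)) = (\<Sum>q\<in>Q. (v' q - \<alpha> * s' q) * cnj (s' q))
        + (\<Sum>q\<in>Q. \<Sum>t\<in>S. cnj (d t) * ((v' q - \<alpha> * s' q) * cnj (R t q)))"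
      unfolding sum.distrib[symmetric]
    proof (intro sum.cong refl)
      fix q
      have "cnj (R s q) = cnj (s' q) + (\<Sum>t\<in>S. cnj (d t) * cnj (R t q))"
        by (simp add: s'_def)
      then show "(v' q - \<alpha> * s' q) * cnj (R s q) = (v' q - \<alpha> * s' q) * cnj (s' q)
          + (\<Sum>t\<in>S. cnj (d t) * ((v' q - \<alpha> * s' q) * cnj (R t q)))"
        by (simp only: distrib_left sum_distrib_left mult.left_commute)
    qed
    also have "(\<Sum>q\<in>Q. \<Sum>t\<in>S. cnj (d t) * ((v' q - \<alpha> * s' q) * cnj (R t q)))
        = (\<Sum>t\<in>S. cnj (d t) * (\<Sum>q\<in>Q. (v' q - \<alpha> * s' q) * cnj (R t q)))"
      by (subst sum.swap) (simp add: sum_distrib_left)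
    finally show ?thesis by (simp add: zero orthS)
  qed
  then show ?case using orthS by (intro exI[of _ e]) (simp add: rem)
qed simp

context finite_words
begin

text \<open>A kernel orthogonal to all signed permutations makes the two sides of the relation above
  orthogonal to each other, so both vanish; on the diagonal this leaves a nonzero multiple of the
  kernel.\<close>

lemma commuting_orthogonal_zero:
  assumes F: "commuting F" and orth: "\<And>\<sigma>. \<sigma> permutes {..<n} \<Longrightarrow> (\<Sum>j\<in>B. sg (psg p \<sigma> j) * F (permute_list \<sigma> j) j) = 0"
    and ab: "a \<in> B" "i \<in> B"
  shows "F a i = 0"
proof -
  \<comment> \<open>\<open>L\<close> is the common value of the two sides; in its square norm each side is used once, which
    leaves the scalar products \<open>G\<close> with signed permutations.\<close>
  define L where "L a b i j = (\<Sum>\<pi>\<in>Pn. sg (psg p \<pi> i) * sg (psg p \<pi> j) * F a (permute_list \<pi> i) * (if permute_list \<pi> j = b then 1 else 0))" for a b i j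
  define G where "G \<pi> \<tau> = (\<Sum>j\<in>B. sg (psg p \<pi> j) * sg (psg p \<tau> j) * F (permute_list \<pi> j) (permute_list \<tau> j))" for \<pi> \<tau>
  have G0: "G \<pi> \<tau> = 0" if \<pi>: "\<pi> permutes {..<n}" and \<tau>: "\<tau> permutes {..<n}" for \<pi> \<tau>
  proof -
    have \<tau>': "pinv \<tau> permutes {..<n}" by (rule permutes_inv[OF \<tau>])
    have "G \<pi> \<tau> = (\<Sum>j\<in>B. sg (psg p (pinv \<tau> \<circ> \<pi>) j) * F (permute_list (pinv \<tau> \<circ> \<pi>) j) j)"
      unfolding G_def
    proof (rule sum.reindex_bij_witness[where j = "permute_list \<tau>" and i = "permute_list (pinv \<tau>)"])
      fix j assume j: "j \<in> B"
      then have len: "length j = n" by (rule B_length)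
      show "permute_list (pinv \<tau>) (permute_list \<tau> j) = j" "permute_list \<tau> (permute_list (pinv \<tau>) j) = j"
        using permute_list_inv[of \<tau> j] \<tau> len by auto
      show "permute_list \<tau> j \<in> B" "permute_list (pinv \<tau>) j \<in> B" using j \<tau> \<tau>' by (auto intro: B_permute)
      have "permute_list (pinv \<tau> \<circ> \<pi>) (permute_list \<tau> j) = permute_list \<pi> j"
        using permute_list_compose[of \<pi> "permute_list \<tau> j" "pinv \<tau>"] permute_list_inv[of \<tau> j] \<pi> \<tau> len by simp
      moreover have "psg p (pinv \<tau> \<circ> \<pi>) (permute_list \<tau> j) = psg p \<tau> j + psg p \<pi> j"
        using psg_compose[of "pinv \<tau>" "permute_list \<tau> j" \<pi> p] permute_list_inv[of \<tau> j] psg_inv[of \<tau> j p] \<pi> \<tau> \<tau>' len by simp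
      ultimately show "sg (psg p (pinv \<tau> \<circ> \<pi>) (permute_list \<tau> j)) * F (permute_list (pinv \<tau> \<circ> \<pi>) (permute_list \<tau> j)) (permute_list \<tau> j)
        = sg (psg p \<pi> j) * sg (psg p \<tau> j) * F (permute_list \<pi> j) (permute_list \<tau> j)"
        by (simp add: sg_add mult_ac)
    qed
    also have "\<dots> = 0" by (rule orth[OF permutes_compose[OF \<pi> \<tau>']])
    finally show ?thesis .
  qed
  have "(\<Sum>i\<in>B. \<Sum>j\<in>B. \<Sum>a\<in>B. \<Sum>b\<in>B. L a b i j * cnj (L a b i j)) = (\<Sum>\<pi>\<in>Pn. \<Sum>\<tau>\<in>Pn. G \<pi> \<tau> * cnj (G \<pi> \<tau>))"
  proof -
    have ab: "(\<Sum>a\<in>B. \<Sum>b\<in>B. L a b i j * cnj (L a b i j)) = (\<Sum>\<pi>\<in>Pn. \<Sum>\<tau>\<in>Pn.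
        (sg (psg p \<pi> j) * sg (psg p \<tau> j) * F (permute_list \<pi> j) (permute_list \<tau> j)) *
        cnj (sg (psg p \<pi> i) * sg (psg p \<tau> i) * F (permute_list \<pi> i) (permute_list \<tau> i)))"
      if ij: "i \<in> B" "j \<in> B" for i j
    proof -
      let ?f = "\<lambda>\<pi> \<tau> a b. if a = permute_list \<pi> i then (if b = permute_list \<tau> j then
        (sg (psg p \<pi> i) * sg (psg p \<pi> j) * F (permute_list \<pi> j) b) * cnj (sg (psg p \<tau> i) * sg (psg p \<tau> j) * F a (permute_list \<tau> i)) else 0) else 0"
      have "(\<Sum>a\<in>B. \<Sum>b\<in>B. L a b i j * cnj (L a b i j)) = (\<Sum>a\<in>B. \<Sum>b\<in>B. \<Sum>\<pi>\<in>Pn. \<Sum>\<tau>\<in>Pn. ?f \<pi> \<tau> a b)"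
      proof (intro sum.cong refl)
        fix a b assume "a \<in> B" "b \<in> B"
        then have "L a b i j = (\<Sum>\<pi>\<in>Pn. sg (psg p \<pi> i) * sg (psg p \<pi> j) * F (permute_list \<pi> j) b * (if permute_list \<pi> i = a then 1 else 0))"
          unfolding L_def using ij by (intro commuting_star[OF F])
        then have "L a b i j * cnj (L a b i j) = (\<Sum>\<pi>\<in>Pn. sg (psg p \<pi> i) * sg (psg p \<pi> j) * F (permute_list \<pi> j) b * (if permute_list \<pi> i = a then 1 else 0))
            * cnj (\<Sum>\<tau>\<in>Pn. sg (psg p \<tau> i) * sg (psg p \<tau> j) * F a (permute_list \<tau> i) * (if permute_list \<tau> j = b then 1 else 0))"
          by (simp add: L_def)
        also have "\<dots> = (\<Sum>\<pi>\<in>Pn. \<Sum>\<tau>\<in>Pn. ?f \<pi> \<tau> a b)"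
          unfolding cnj_sum sum_product by (intro sum.cong refl) auto
        finally show "L a b i j * cnj (L a b i j) = (\<Sum>\<pi>\<in>Pn. \<Sum>\<tau>\<in>Pn. ?f \<pi> \<tau> a b)" .
      qed
      also have "\<dots> = (\<Sum>\<pi>\<in>Pn. \<Sum>\<tau>\<in>Pn. \<Sum>a\<in>B. \<Sum>b\<in>B. ?f \<pi> \<tau> a b)"
        by (rule sum_swap_pairs)
      also have "\<dots> = (\<Sum>\<pi>\<in>Pn. \<Sum>\<tau>\<in>Pn.
        (sg (psg p \<pi> j) * sg (psg p \<tau> j) * F (permute_list \<pi> j) (permute_list \<tau> j)) *
        cnj (sg (psg p \<pi> i) * sg (psg p \<tau> i) * F (permute_list \<pi> i) (permute_list \<tau> i)))"
      proof (intro sum.cong refl)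
        fix \<pi> \<tau> assume "\<pi> \<in> Pn" "\<tau> \<in> Pn"
        then have "permute_list \<pi> i \<in> B" "permute_list \<tau> j \<in> B" using ij B_permute by auto
        moreover have "(\<Sum>a\<in>B. \<Sum>b\<in>B. ?f \<pi> \<tau> a b) = (\<Sum>a\<in>B. if a = permute_list \<pi> i then \<Sum>b\<in>B. (if b = permute_list \<tau> j then
          (sg (psg p \<pi> i) * sg (psg p \<pi> j) * F (permute_list \<pi> j) b) * cnj (sg (psg p \<tau> i) * sg (psg p \<tau> j) * F a (permute_list \<tau> i)) else 0) else 0)"
          by (intro sum.cong refl) auto
        ultimately show "(\<Sum>a\<in>B. \<Sum>b\<in>B. ?f \<pi> \<tau> a b) = (sg (psg p \<pi> j) * sg (psg p \<tau> j) * F (permute_list \<pi> j) (permute_list \<tau> j)) *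
          cnj (sg (psg p \<pi> i) * sg (psg p \<tau> i) * F (permute_list \<pi> i) (permute_list \<tau> i))"
          by (simp add: finite_B mult_ac)
      qed
      finally show ?thesis .
    qed
    have "(\<Sum>i\<in>B. \<Sum>j\<in>B. \<Sum>a\<in>B. \<Sum>b\<in>B. L a b i j * cnj (L a b i j)) = (\<Sum>i\<in>B. \<Sum>j\<in>B. \<Sum>\<pi>\<in>Pn. \<Sum>\<tau>\<in>Pn.
        (sg (psg p \<pi> j) * sg (psg p \<tau> j) * F (permute_list \<pi> j) (permute_list \<tau> j)) *
        cnj (sg (psg p \<pi> i) * sg (psg p \<tau> i) * F (permute_list \<pi> i) (permute_list \<tau> i)))"
      by (intro sum.cong refl ab)
    also have "\<dots> = (\<Sum>\<pi>\<in>Pn. \<Sum>\<tau>\<in>Pn. \<Sum>i\<in>B. \<Sum>j\<in>B.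
        (sg (psg p \<pi> j) * sg (psg p \<tau> j) * F (permute_list \<pi> j) (permute_list \<tau> j)) *
        cnj (sg (psg p \<pi> i) * sg (psg p \<tau> i) * F (permute_list \<pi> i) (permute_list \<tau> i)))"
      by (rule sum_swap_pairs)
    also have "\<dots> = (\<Sum>\<pi>\<in>Pn. \<Sum>\<tau>\<in>Pn. G \<pi> \<tau> * cnj (G \<pi> \<tau>))"
      unfolding G_def cnj_sum sum_product by (rule sum.cong[OF refl sum.cong[OF refl sum.swap]])
    finally show ?thesis .
  qed
  also have "\<dots> = 0" using G0 by simp
  finally have "complex_of_real (\<Sum>i\<in>B. \<Sum>j\<in>B. \<Sum>a\<in>B. \<Sum>b\<in>B. (cmod (L a b i j))\<^sup>2) = 0"
    by (simp only: of_real_sum complex_norm_square)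
  then have "(\<Sum>i\<in>B. \<Sum>j\<in>B. \<Sum>a\<in>B. \<Sum>b\<in>B. (cmod (L a b i j))\<^sup>2) = 0"
    by (simp only: of_real_eq_0_iff)
  then have "L a i i i = 0"
    using ab finite_B by (auto simp: sum_nonneg_eq_0_iff sum_nonneg)
  moreover have "L a i i i = (\<Sum>\<pi>\<in>Pn. if permute_list \<pi> i = i then F a i else 0)"
    unfolding L_def by (intro sum.cong refl) auto
  moreover have "\<dots> = of_nat (card {\<pi>\<in>Pn. permute_list \<pi> i = i}) * F a i"
    using finite_Pn by (simp add: sum.If_cases Int_def)
  moreover have "card {\<pi>\<in>Pn. permute_list \<pi> i = i} \<noteq> 0"
  proof -
    have "id \<in> {\<pi>\<in>Pn. permute_list \<pi> i = i}" using permutes_id[of "{..<n}"] by simp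
    then have "{\<pi>\<in>Pn. permute_list \<pi> i = i} \<noteq> {}" by blast
    then show ?thesis using finite_Pn by (simp add: card_eq_0_iff)
  qed
  ultimately show ?thesis by simp
qed

text \<open>The remainder after projection to the span of the signed permutations still commutes with the
  diagonal action, and it is orthogonal to the signed permutations.\<close>

theorem double_centralizer:
  assumes F: "commuting F"
  shows "\<exists>c. \<forall>i\<in>B. \<forall>j\<in>B. F i j = (\<Sum>\<pi>\<in>Pn. c \<pi> * signed_perm \<pi> i j)"
proof -
  have "finite (B \<times> B)" using finite_B by simp
  from orthogonal_remainder[OF this finite_Pn, of "\<lambda>(i, j). F i j" "\<lambda>\<pi> (i, j). signed_perm \<pi> i j"]
  obtain c where c: "\<And>\<sigma>. \<sigma> permutes {..<n} \<Longrightarrow> (\<Sum>(i, j)\<in>B \<times> B. (F i j - (\<Sum>\<pi>\<in>Pn. c \<pi> * signed_perm \<pi> i j)) * cnj (signed_perm \<sigma> i j)) = 0"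
    by (auto simp: case_prod_unfold)
  define F' where "F' i j = F i j - (\<Sum>\<pi>\<in>Pn. c \<pi> * signed_perm \<pi> i j)" for i j
  have "commuting F'"
    unfolding F'_def by (rule commuting_combination[OF commuting_signed_perm F]) simp
  moreover have "(\<Sum>j\<in>B. sg (psg p \<sigma> j) * F' (permute_list \<sigma> j) j) = 0" if \<sigma>: "\<sigma> permutes {..<n}" for \<sigma>
  proof -
    have "(\<Sum>(i, j)\<in>B \<times> B. F' i j * cnj (signed_perm \<sigma> i j)) = (\<Sum>i\<in>B. \<Sum>j\<in>B. F' i j * cnj (signed_perm \<sigma> i j))"
      by (simp add: sum.cartesian_product)
    also have "\<dots> = (\<Sum>j\<in>B. \<Sum>i\<in>B. if i = permute_list \<sigma> j then sg (psg p \<sigma> j) * F' i j else 0)"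
      by (subst sum.swap) (intro sum.cong refl, simp add: signed_perm_def)
    also have "\<dots> = (\<Sum>j\<in>B. sg (psg p \<sigma> j) * F' (permute_list \<sigma> j) j)"
      using B_permute[OF \<sigma>] finite_B by (intro sum.cong refl) simp
    finally show ?thesis using c[OF \<sigma>] by (simp add: F'_def)
  qed
  ultimately have "F' i j = 0" if "i \<in> B" "j \<in> B" for i j
    using commuting_orthogonal_zero that by blast
  then show ?thesis by (intro exI[of _ c]) (simp add: F'_def)
qed

end


section \<open>Symmetrisation\<close>

text \<open>Modulo supercommutativity a permutation of the letters costs its sign.\<close>

lemma scong_permute:
  assumes "w \<in> lists G" "\<pi> permutes {..<length w}"
  shows "scong G p (elt w) (scale (sg (psg p \<pi> w)) (elt (permute_list \<pi> w)))"
proof -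
  have "\<forall>w. length w = n \<longrightarrow> w \<in> lists G \<longrightarrow> scong G p (elt w) (scale (sg (psg p \<pi> w)) (elt (permute_list \<pi> w)))"
    if "\<pi> permutes {..<n}" for n
    using that
  proof (induction rule: permutes_adj_induct)
    case id
    show ?case unfolding psg_id permute_list_id by (simp add: scong_refl)
  next
    case (adj \<pi> t)
    show ?case
    proof (intro allI impI)
      fix w :: "'a list" assume w: "length w = n" "w \<in> lists G"
      obtain u g h v where uv: "w = u @ [g, h] @ v" "length u = t"
        using split_adj[of t w] adj w by blast
      let ?w = "u @ [h, g] @ v"
      have \<tau>: "permute_list (adj t) w = ?w" "psg p (adj t) w = p g * p h"
        using permute_adj[of u g h v] psg_adj[of p u g h v] uv by auto
      have "adj t permutes {..<n}" using adj by (intro adj_permutes)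
      then have comp: "permute_list (adj t \<circ> \<pi>) w = permute_list \<pi> ?w" "psg p (adj t \<circ> \<pi>) w = p g * p h + psg p \<pi> ?w"
        using permute_list_compose[of \<pi> w "adj t"] psg_compose[of "adj t" w \<pi> p] adj w \<tau> by auto
      have "scong G p (elt w) (scale (sg (p g * p h)) (elt ?w))"
        unfolding uv using w uv by (intro scong_swap) auto
      also have "scong G p (scale (sg (p g * p h)) (elt ?w)) (scale (sg (p g * p h)) (scale (sg (psg p \<pi> ?w)) (elt (permute_list \<pi> ?w))))"
        using adj.IH w uv by (intro scong_scale) auto
      finally show "scong G p (elt w) (scale (sg (psg p (adj t \<circ> \<pi>) w)) (elt (permute_list (adj t \<circ> \<pi>) w)))"
        by (simp add: comp sg_add)
    qed
  qed
  then show ?thesis using assms by blast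
qed

abbreviation perms :: "'g list \<Rightarrow> (nat \<Rightarrow> nat) set" where
  "perms w \<equiv> {\<pi>. \<pi> permutes {..<length w}}"

text \<open>Signed symmetrisation, the average over the signed permutations of each word.\<close>

definition Sym :: "('g \<Rightarrow> bit) \<Rightarrow> 'g falg \<Rightarrow> 'g falg" where
  "Sym p f = linext (\<lambda>u. scale (1 / fact (length u))
     (\<Sum>\<pi>\<in>perms u. scale (sg (psg p \<pi> u)) (elt (permute_list \<pi> u)))) f"

lemma lin_Sym: "lin (Sym p)"
  unfolding Sym_def[abs_def] by (rule lin_linext)

lemma card_perms: "card (perms w) = fact (length w)"
  using card_permutations[of "{..<length w}" "length w"] by simp

lemma Sym_cong:
  assumes "f \<in> fa G"
  shows "scong G p (Sym p f) f"
proof -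
  have "Sym p f - f \<in> relid G (scr G p)"
  proof (rule lin_in[where h = "\<lambda>f. Sym p f - f", OF lin_minus[OF lin_Sym lin_id] subsp_scr])
    fix w assume "w \<in> Poly_Mapping.keys f"
    then have w: "w \<in> lists G" using assms by (auto dest: fa_keys)
    have "scong G p (\<Sum>\<pi>\<in>perms w. scale (sg (psg p \<pi> w)) (elt (permute_list \<pi> w))) (\<Sum>\<pi>\<in>perms w. elt w)"
      using w by (intro scong_sum scong_sym[OF scong_permute]) auto
    from scong_scale[OF this, of "1 / fact (length w)"]
    have "scong G p (Sym p (elt w)) (scale (1 / fact (length w)) (\<Sum>\<pi>\<in>perms w. elt w))"
      by (simp add: Sym_def)
    also have "(\<Sum>\<pi>\<in>perms w. elt w) = scale (fact (length w)) (elt w)"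
      using scale_sum_scalar[of "\<lambda>_. 1" "perms w" "elt w"] card_perms[of w] by simp
    finally show "Sym p (elt w) - elt w \<in> relid G (scr G p)" by (simp add: cong_def)
  qed
  then show ?thesis by (simp add: cong_def)
qed

text \<open>On coefficient functions the symmetrisation is the average of the signed permutations.\<close>

lemma lookup_Sym: "lk (Sym p f) w = (\<Sum>\<pi>\<in>perms w. pact p \<pi> (lk f) w) / fact (length w)"
proof -
  have word: "lk (Sym p (elt u)) w = (\<Sum>\<pi>\<in>perms w. pact p \<pi> (lk (elt u)) w) / fact (length w)" for u
  proof (cases "length u = length w")
    case True
    have "(\<Sum>\<pi>\<in>perms u. sg (psg p \<pi> u) * (if permute_list \<pi> u = w then 1 else 0))
      = (\<Sum>\<pi>\<in>perms w. pact p (pinv \<pi>) (lk (elt u)) w)"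
      unfolding True
    proof (intro sum.cong refl)
      fix \<pi> assume "\<pi> \<in> perms w"
      then have \<pi>: "\<pi> permutes {..<length u}" using True by simp
      show "sg (psg p \<pi> u) * (if permute_list \<pi> u = w then 1 else 0) = pact p (pinv \<pi>) (lk (elt u)) w"
        using permute_list_eq_iff[OF \<pi>, of w] psg_inv[OF \<pi>, of p] True
        by (auto simp: pact_def lookup_single when_def)
    qed
    also have "\<dots> = (\<Sum>\<pi>\<in>perms w. pact p \<pi> (lk (elt u)) w)"
      by (rule sum_permutations_inverse[symmetric])
    finally show ?thesis
      using True by (simp add: Sym_def lookup_sum lookup_single when_def)
  next
    case False
    then have "permute_list \<pi> u \<noteq> w" "u \<noteq> permute_list \<pi> w" for \<pi> by auto
    then show ?thesis by (simp add: Sym_def lookup_sum lookup_single when_def pact_def)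
  qed
  have "lk (Sym p f) w = (\<Sum>u\<in>Poly_Mapping.keys f. lk f u * lk (Sym p (elt u)) w)"
    by (subst lin_expand[OF lin_Sym]) (simp add: lookup_sum)
  also have "\<dots> = (\<Sum>\<pi>\<in>perms w. \<Sum>u\<in>Poly_Mapping.keys f. lk f u * pact p \<pi> (lk (elt u)) w) / fact (length w)"
    unfolding word by (simp add: sum_divide_distrib sum_distrib_left) (rule sum.swap)
  also have "\<dots> = (\<Sum>\<pi>\<in>perms w. pact p \<pi> (lk f) w) / fact (length w)"
  proof -
    have "(\<Sum>u\<in>Poly_Mapping.keys f. lk f u * pact p \<pi> (lk (elt u)) w) = pact p \<pi> (lk f) w" for \<pi>
      using arg_cong[OF expand_elt[of f], of "\<lambda>x. lk x (permute_list \<pi> w)"]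
      by (simp add: pact_def lookup_sum sum_distrib_left mult.left_commute)
    then show ?thesis by simp
  qed
  finally show ?thesis .
qed

lemma sum_perms_compose:
  assumes "\<pi> permutes S"
  shows "(\<Sum>\<sigma> | \<sigma> permutes S. f (\<pi> \<circ> \<sigma>)) = (\<Sum>\<sigma> | \<sigma> permutes S. f \<sigma>)"
  by (rule setum_permutations_compose_left[OF assms, symmetric])

lemma Sym_equivariant:
  assumes \<pi>: "\<pi> permutes {..<length w}"
  shows "lk (Sym p f) (permute_list \<pi> w) = sg (psg p \<pi> w) * lk (Sym p f) w"
proof -
  have "(\<Sum>\<sigma>\<in>perms w. pact p \<sigma> (lk f) (permute_list \<pi> w)) = (\<Sum>\<sigma>\<in>perms w. sg (psg p \<pi> w) * pact p (\<pi> \<circ> \<sigma>) (lk f) w)"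
  proof (intro sum.cong refl)
    fix \<sigma> assume "\<sigma> \<in> perms w"
    then have \<sigma>: "\<sigma> permutes {..<length w}" by simp
    show "pact p \<sigma> (lk f) (permute_list \<pi> w) = sg (psg p \<pi> w) * pact p (\<pi> \<circ> \<sigma>) (lk f) w"
      by (simp only: pact_def permute_list_compose[OF \<sigma>] psg_compose[OF \<pi> \<sigma>] sg_add mult.assoc sg_mult_self)
  qed
  also have "\<dots> = sg (psg p \<pi> w) * (\<Sum>\<sigma>\<in>perms w. pact p \<sigma> (lk f) w)"
    unfolding sum_distrib_left[symmetric] using sum_perms_compose[OF \<pi>, of "\<lambda>\<sigma>. pact p \<sigma> (lk f) w"] by simp
  finally show ?thesis by (simp add: lookup_Sym)
qed

text \<open>Exchanging two letters only reindexes the average.\<close>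

lemma Sym_relid:
  assumes "x \<in> relid G (scr G p)"
  shows "Sym p x = 0"
proof -
  have "Sym p x \<in> {0}"
  proof (rule scr_lin_in[OF lin_Sym subsp_zero _ assms])
    fix u v :: "'a list" and g h
    let ?w = "u @ [g, h] @ v" and ?w' = "u @ [h, g] @ v" and ?t = "length u"
    have t: "adj ?t permutes {..<length ?w}" by (rule adj_permutes) simp
    have "(\<Sum>\<pi>\<in>perms ?w'. scale (sg (psg p \<pi> ?w')) (elt (permute_list \<pi> ?w')))
       = (\<Sum>\<pi>\<in>perms ?w. scale (sg (p g * p h)) (scale (sg (psg p (adj ?t \<circ> \<pi>) ?w)) (elt (permute_list (adj ?t \<circ> \<pi>) ?w))))"
    proof (rule sum.cong)
      fix \<pi> assume "\<pi> \<in> perms ?w"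
      then have \<pi>: "\<pi> permutes {..<length ?w}" by simp
      show "scale (sg (psg p \<pi> ?w')) (elt (permute_list \<pi> ?w'))
        = scale (sg (p g * p h)) (scale (sg (psg p (adj ?t \<circ> \<pi>) ?w)) (elt (permute_list (adj ?t \<circ> \<pi>) ?w)))"
        by (simp only: permute_list_compose[OF \<pi>] psg_compose[OF t \<pi>] permute_adj psg_adj sg_add scale_simps sg_mult_self)
    qed simp
    also have "\<dots> = scale (sg (p g * p h)) (\<Sum>\<pi>\<in>perms ?w. scale (sg (psg p \<pi> ?w)) (elt (permute_list \<pi> ?w)))"
      unfolding scale_sum[symmetric]
      using sum_perms_compose[OF t, of "\<lambda>\<pi>. scale (sg (psg p \<pi> ?w)) (elt (permute_list \<pi> ?w))"] by simp
    finally show "Sym p (elt ?w) - scale (sg (p g * p h)) (Sym p (elt ?w')) \<in> {0}"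
      by (simp add: Sym_def scale_diff)
  qed
  then show ?thesis by simp
qed

lemma lookup_gen_mult: "lk (gen g * x) (h # w) = (if h = g then lk x w else 0)" "lk (gen g * x) [] = 0"
proof -
  have "lk (gen g * x) v = (case v of [] \<Rightarrow> 0 | h # w \<Rightarrow> if h = g then lk x w else 0)" for v
  proof -
    have "lk (gen g * x) v = (\<Sum>u\<in>Poly_Mapping.keys x. lk x u * lk (elt (g # u)) v)"
      by (subst lin_expand[OF lin_const_mult[OF lin_id]]) (simp add: lookup_sum gen_elt)
    also have "\<dots> = (\<Sum>u\<in>Poly_Mapping.keys x. lk x u * (case v of [] \<Rightarrow> 0 | h # w \<Rightarrow> if h = g then lk (elt u) w else 0))"
      by (intro sum.cong refl) (auto simp: lookup_single when_def split: list.splits)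
    also have "\<dots> = (case v of [] \<Rightarrow> 0 | h # w \<Rightarrow> if h = g then lk x w else 0)"
      using arg_cong[OF expand_elt[of x], of "\<lambda>x. lk x (tl v)"]
      by (cases v) (simp_all add: lookup_sum)
    finally show ?thesis .
  qed
  then show "lk (gen g * x) (h # w) = (if h = g then lk x w else 0)" "lk (gen g * x) [] = 0" by simp_all
qed

text \<open>On coefficient functions a superderivation that is linear in the letters becomes a sum of
  operators at the positions, provided that each letter arises from a single one.\<close>

lemma lookup_sder:
  assumes d: "\<And>g. d g = (\<Sum>g'\<in>S g. scale (\<kappa> g') (gen g'))" and S: "\<And>g. finite (S g)"
    and S_iff: "\<And>g g'. \<kappa> g' \<noteq> 0 \<Longrightarrow> g' \<in> S g \<longleftrightarrow> \<rho> g' = g"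
  shows "lk (sder p e d f) w = (\<Sum>t<length w. pos p e \<kappa> \<rho> t (lk f) w)"
proof -
  have d_mult: "lk (d g * x) (h # w) = (if \<rho> h = g then \<kappa> h * lk x w else 0)" "lk (d g * x) [] = 0" for g x h w
  proof -
    have "lk (d g * x) (h # w) = (\<Sum>g'\<in>S g. if h = g' then \<kappa> g' * lk x w else 0)"
      by (simp add: d sum_distrib_right scale_mult lookup_sum lookup_gen_mult if_distrib cong: if_cong)
    also have "\<dots> = (if \<rho> h = g then \<kappa> h * lk x w else 0)"
      using S S_iff[of h g] by (cases "\<kappa> h = 0") auto
    finally show "lk (d g * x) (h # w) = (if \<rho> h = g then \<kappa> h * lk x w else 0)" .
    show "lk (d g * x) [] = 0"
      by (simp add: d sum_distrib_right scale_mult lookup_sum lookup_gen_mult)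
  qed
  have word: "lk (sder p e d (elt u)) w = (\<Sum>t<length w. pos p e \<kappa> \<rho> t (lk (elt u)) w)" for u w
  proof (induction u arbitrary: w)
    case Nil
    have "w[t := x] \<noteq> []" "[] \<noteq> w[t := x]" if "t < length w" for t and x using that by (cases w; cases t; simp)+
    then show ?case by (simp add: pos_def lookup_single when_def)
  next
    case (Cons g u)
    show ?case
    proof (cases w)
      case Nil
      then show ?thesis by (simp add: lookup_add d_mult lookup_gen_mult)
    next
      case (Cons h v)
      have "lk (sder p e d (elt (g # u))) w = (if \<rho> h = g then \<kappa> h * lk (elt u) v else 0)
          + sg (e * p g) * (if h = g then (\<Sum>t<length v. pos p e \<kappa> \<rho> t (lk (elt u)) v) else 0)"
        using Cons.IH[of v] by (simp add: Cons lookup_add d_mult lookup_gen_mult)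
      also have "(if \<rho> h = g then \<kappa> h * lk (elt u) v else 0) = pos p e \<kappa> \<rho> 0 (lk (elt (g # u))) w"
        by (simp add: pos_def Cons lookup_single when_def eq_commute)
      also have "sg (e * p g) * (if h = g then (\<Sum>t<length v. pos p e \<kappa> \<rho> t (lk (elt u)) v) else 0)
          = (\<Sum>t<length v. pos p e \<kappa> \<rho> (Suc t) (lk (elt (g # u))) w)"
        by (simp add: pos_def Cons lookup_single when_def sum_distrib_left distrib_left sg_add mult_ac)
      finally show ?thesis by (simp add: Cons sum.lessThan_Suc_shift del: sum.lessThan_Suc)
    qed
  qed
  have "lk (sder p e d f) w = (\<Sum>u\<in>Poly_Mapping.keys f. lk f u * lk (sder p e d (elt u)) w)"
    by (subst lin_expand[OF lin_sder]) (simp add: lookup_sum)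
  also have "\<dots> = (\<Sum>t<length w. \<Sum>u\<in>Poly_Mapping.keys f. lk f u * pos p e \<kappa> \<rho> t (lk (elt u)) w)"
    unfolding word sum_distrib_left by (rule sum.swap)
  also have "\<dots> = (\<Sum>t<length w. pos p e \<kappa> \<rho> t (lk f) w)"
  proof (intro sum.cong refl)
    fix t
    have "(\<Sum>u\<in>Poly_Mapping.keys f. lk f u * lk (elt u) v) = lk f v" for v
      using arg_cong[OF expand_elt[of f], of "\<lambda>x. lk x v"] by (simp add: lookup_sum)
    from this[of "w[t := \<rho> (w ! t)]"]
    show "(\<Sum>u\<in>Poly_Mapping.keys f. lk f u * pos p e \<kappa> \<rho> t (lk (elt u)) w) = pos p e \<kappa> \<rho> t (lk f) w"
      unfolding pos_def by (simp only: mult.left_commute[of "lk f _"] sum_distrib_left[symmetric])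
  qed
  finally show ?thesis .
qed

text \<open>The superderivation is a sum over all positions, and signed permutations only permute its terms.\<close>

lemma Sym_sder:
  assumes d: "\<And>g. d g = (\<Sum>g'\<in>S g. scale (\<kappa> g') (gen g'))" and S: "\<And>g. finite (S g)"
    and S_iff: "\<And>g g'. \<kappa> g' \<noteq> 0 \<Longrightarrow> g' \<in> S g \<longleftrightarrow> \<rho> g' = g"
    and \<kappa>: "\<And>g. \<kappa> g \<noteq> 0 \<Longrightarrow> p (\<rho> g) = p g + e"
  shows "sder p e d (Sym p f) = Sym p (sder p e d f)"
proof (rule poly_mapping_eqI)
  fix w
  have lookup: "lk (sder p e d f) w = (\<Sum>t<length w. pos p e \<kappa> \<rho> t (lk f) w)" for f w
    by (rule lookup_sder[where S = S, OF d S]) (rule S_iff)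
  have "lk (sder p e d (Sym p f)) w = (\<Sum>\<pi>\<in>perms w. \<Sum>t<length w. pos p e \<kappa> \<rho> t (pact p \<pi> (lk f)) w) / fact (length w)"
  proof -
    have "pos p e \<kappa> \<rho> t (lk (Sym p f)) w = (\<Sum>\<pi>\<in>perms w. pos p e \<kappa> \<rho> t (pact p \<pi> (lk f)) w) / fact (length w)" for t
      by (simp add: pos_def lookup_Sym sum_distrib_left)
    then show ?thesis unfolding lookup sum_divide_distrib by (simp add: sum_divide_distrib) (rule sum.swap)
  qed
  also have "\<dots> = (\<Sum>\<pi>\<in>perms w. pact p \<pi> (lk (sder p e d f)) w) / fact (length w)"
  proof (intro arg_cong[where f = "\<lambda>x. x / fact (length w)"] sum.cong refl)
    fix \<pi> assume "\<pi> \<in> perms w"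
    then have \<pi>: "\<pi> permutes {..<length w}" by simp
    have "(\<Sum>t<length w. pos p e \<kappa> \<rho> t (pact p \<pi> (lk f)) w) = (\<Sum>t<length w. pos p e \<kappa> \<rho> (\<pi> t) (pact p \<pi> (lk f)) w)"
      using sum.permute[OF \<pi>, of "\<lambda>t. pos p e \<kappa> \<rho> t (pact p \<pi> (lk f)) w"] by (simp add: comp_def)
    also have "\<dots> = (\<Sum>t<length w. pact p \<pi> (pos p e \<kappa> \<rho> t (lk f)) w)"
      by (intro sum.cong refl pact_pos[OF \<pi>, symmetric] \<kappa>) auto
    finally show "(\<Sum>t<length w. pos p e \<kappa> \<rho> t (pact p \<pi> (lk f)) w) = pact p \<pi> (lk (sder p e d f)) w"
      by (simp add: pact_def lookup sum_distrib_left)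
  qed
  finally show "lk (sder p e d (Sym p f)) w = lk (Sym p (sder p e d f)) w"
    by (simp add: lookup_Sym)
qed



section \<open>Rows and columns\<close>

lemma psg_map:
  assumes "\<pi> permutes {..<length w}"
  shows "psg p \<pi> (map f w) = psg (\<lambda>x. p (f x)) \<pi> w"
proof -
  have "\<pi> i < length w" if "i < length w" for i
    using permutes_in_image[OF assms, of i] that by simp
  then show ?thesis unfolding psg_def length_map by (intro pairsum_cong) auto
qed

lemma wpar_permute: "\<pi> permutes {..<length w} \<Longrightarrow> wpar p (permute_list \<pi> w) = wpar p w"
  unfolding wpar_def by (metis mset_map mset_permute_list sum_mset_sum_list)

text \<open>Reading each letter as a pair of factors of parities \<open>g\<close> and \<open>f\<close>, in this order, it is the parity
  of the transpositions that move all first factors to the left of all second ones.\<close>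

primrec cross :: "('g \<Rightarrow> bit) \<Rightarrow> ('g \<Rightarrow> bit) \<Rightarrow> 'g list \<Rightarrow> bit" where
  "cross f g [] = 0"
| "cross f g (x # w) = f x * wpar g w + cross f g w"

lemma cross_append: "cross f g (u @ v) = cross f g u + wpar f u * wpar g v + cross f g v"
  by (induction u) (auto simp: algebra_simps)

text \<open>Permuting the pairs amounts to permuting both factors.\<close>

lemma cross_permute:
  assumes "\<pi> permutes {..<length w}"
  shows "cross f g (permute_list \<pi> w) + psg g \<pi> w + psg (\<lambda>x. f x + g x) \<pi> w = cross f g w + psg f \<pi> w"
proof -
  have "\<forall>w. length w = n \<longrightarrow>
      cross f g (permute_list \<pi> w) + psg g \<pi> w + psg (\<lambda>x. f x + g x) \<pi> w = cross f g w + psg f \<pi> w"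
    if "\<pi> permutes {..<n}" for n
    using that
  proof (induction rule: permutes_adj_induct)
    case id
    show ?case unfolding psg_id permute_list_id by simp
  next
    case (adj \<pi> t)
    show ?case
    proof (intro allI impI)
      fix w :: "'a list" assume w: "length w = n"
      obtain u x y v where uv: "w = u @ [x, y] @ v" "length u = t"
        using split_adj[of t w] adj w by blast
      let ?w = "u @ [y, x] @ v"
      have \<tau>: "permute_list (adj t) w = ?w" "psg p (adj t) w = p x * p y" for p
        using permute_adj[of u x y v] psg_adj[of p u x y v] uv by auto
      have t: "adj t permutes {..<length w}" using adj w by (intro adj_permutes) simp
      have \<pi>: "\<pi> permutes {..<length w}" using adj w by simp
      have comp: "permute_list (adj t \<circ> \<pi>) w = permute_list \<pi> ?w" "psg p (adj t \<circ> \<pi>) w = p x * p y + psg p \<pi> ?w" for p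
        by (simp_all only: permute_list_compose[OF \<pi>] psg_compose[OF t \<pi>] \<tau>)
      have IH: "cross f g (permute_list \<pi> ?w) + psg g \<pi> ?w + psg (\<lambda>x. f x + g x) \<pi> ?w = cross f g ?w + psg f \<pi> ?w"
        using adj.IH[rule_format, of ?w] w uv by simp
      have cr: "cross f g w = cross f g ?w + f x * g y + f y * g x"
        by (simp add: uv cross_append algebra_simps)
      have "cross f g (permute_list (adj t \<circ> \<pi>) w) + psg g (adj t \<circ> \<pi>) w + psg (\<lambda>x. f x + g x) (adj t \<circ> \<pi>) w
        = (cross f g (permute_list \<pi> ?w) + psg g \<pi> ?w + psg (\<lambda>x. f x + g x) \<pi> ?w) + g x * g y + (f x + g x) * (f y + g y)"
        unfolding comp by (simp only: ac_simps)
      also have "\<dots> = cross f g w + psg f (adj t \<circ> \<pi>) w"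
        unfolding IH cr comp by (simp add: algebra_simps)
      finally show "cross f g (permute_list (adj t \<circ> \<pi>) w) + psg g (adj t \<circ> \<pi>) w + psg (\<lambda>x. f x + g x) (adj t \<circ> \<pi>) w
        = cross f g w + psg f (adj t \<circ> \<pi>) w" .
    qed
  qed
  then show ?thesis using assms by blast
qed

lemma cross_update:
  assumes "t < length w" "f y = f (w ! t)"
  shows "cross f g (w[t := y]) = cross f g w + (g y + g (w ! t)) * wpar f (take t w)"
proof -
  let ?u = "take t w" and ?v = "drop (Suc t) w" and ?x = "w ! t"
  have w: "w = ?u @ [?x] @ ?v" using assms by (simp add: id_take_nth_drop)
  have w': "w[t := y] = ?u @ [y] @ ?v" using assms by (simp add: upd_conv_take_nth_drop)
  have "cross f g (w[t := y]) = cross f g (?u @ [?x] @ ?v) + (g y + g ?x) * wpar f ?u"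
    unfolding w' using assms(2) by (simp add: cross_append algebra_simps)
  then show ?thesis unfolding w[symmetric] .
qed

lemma cross_update_self:
  assumes "t < length w"
  shows "cross f f (w[t := y]) = cross f f w + (f y + f (w ! t)) * (wpar f w + f (w ! t))"
proof -
  let ?u = "take t w" and ?v = "drop (Suc t) w" and ?x = "w ! t"
  have w: "w = ?u @ [?x] @ ?v" using assms by (simp add: id_take_nth_drop)
  have w': "w[t := y] = ?u @ [y] @ ?v" using assms by (simp add: upd_conv_take_nth_drop)
  have "cross f f (w[t := y]) = cross f f (?u @ [?x] @ ?v) + (f y + f ?x) * (wpar f (?u @ [?x] @ ?v) + f ?x)"
    unfolding w' by (simp add: cross_append algebra_simps)
  then show ?thesis unfolding w[symmetric] .
qed

lemma wpar_zip:
  "length a = length i \<Longrightarrow> wpar (\<lambda>x. p (fst x)) (zip a i) = wpar p a"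
  "length a = length i \<Longrightarrow> wpar (\<lambda>x. p (snd x)) (zip a i) = wpar p i"
  by (induction a i rule: list_induct2) auto

lemma wpar_gpar_zip: "length a = length i \<Longrightarrow> wpar (gpar k m) (zip a i) = wpar (par k) a + wpar (par m) i"
  by (induction a i rule: list_induct2) (auto simp: ac_simps)

abbreviation words :: "nat \<Rightarrow> nat \<Rightarrow> nat list set" where
  "words d N \<equiv> {w. length w = N \<and> set w \<subseteq> {..<d}}"

lemma finite_words_set: "finite (words d N)"
  using finite_lists_length_eq[of "{..<d}" N] by (simp add: conj_commute)

lemma sum_words_Suc: "(\<Sum>w\<in>words d (Suc N). f w) = (\<Sum>i<d. \<Sum>w\<in>words d N. f (i # w))"
proof -
  have "words d (Suc N) = (\<lambda>(i, w). i # w) ` ({..<d} \<times> words d N)"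
    by (auto simp: length_Suc_conv image_iff)
  moreover have "inj_on (\<lambda>(i, w). i # w) ({..<d} \<times> words d N)" by (auto simp: inj_on_def)
  ultimately show ?thesis by (simp add: sum.reindex sum.cartesian_product case_prod_unfold)
qed

lemma sum_split: "(\<Sum>t<N + N'. f t) = (\<Sum>t<N. f t) + (\<Sum>t<N'. f (N + t))" for N N' :: nat and f :: "nat \<Rightarrow> complex"
  by (induction N') (auto simp: algebra_simps)

lemma zip_lists: "set a \<subseteq> A \<Longrightarrow> set i \<subseteq> B \<Longrightarrow> zip a i \<in> lists (A \<times> B)"
  using set_zip_leftD[of _ _ a i] set_zip_rightD[of _ _ a i] by (fastforce simp: in_lists_conv_set)

context
  fixes k l r s m n :: nat
begin

abbreviation GP where "GP \<equiv> P_gens k l r s m n"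
abbreviation pp where "pp \<equiv> ppar k r m"
abbreviation X where "X \<equiv> X_elem k r m n"

abbreviation tword :: "nat list \<Rightarrow> nat list \<Rightarrow> nat list \<Rightarrow> nat list \<Rightarrow> pgen list" where
  "tword a i b j \<equiv> map Inl (zip a i) @ map Inr (zip b j)"

lemma tword_mem:
  "set a \<subseteq> {..<k + l} \<Longrightarrow> set i \<subseteq> {..<m + n} \<Longrightarrow> map Inl (zip a i) \<in> lists GP"
  "set b \<subseteq> {..<r + s} \<Longrightarrow> set j \<subseteq> {..<m + n} \<Longrightarrow> map Inr (zip b j) \<in> lists GP"
  using zip_lists[of a "{..<k + l}" i "{..<m + n}"] zip_lists[of b "{..<r + s}" j "{..<m + n}"]
  by (auto simp: in_lists_conv_set)

text \<open>The sign that makes a kernel out of the coefficients of an invariant.  The first and the last two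
  summands move the columns \<open>i\<close> and \<open>j\<close> to the left of the rows \<open>a\<close> and \<open>b\<close>; the second one reverses
  the order of \<open>j\<close>, since the T-bar span a dual representation.\<close>

definition tsign :: "nat list \<Rightarrow> nat list \<Rightarrow> nat list \<Rightarrow> nat list \<Rightarrow> bit" where
  "tsign a i b j = cross (\<lambda>x. par k (fst x)) (\<lambda>x. par m (snd x)) (zip a i) + cross (par m) (par m) j
     + wpar (par k) a * wpar (par m) j + cross (\<lambda>x. par r (fst x)) (\<lambda>x. par m (snd x)) (zip b j)"

text \<open>The element of the free algebra whose kernel is the identity.\<close>

definition contraction :: "nat list \<Rightarrow> nat list \<Rightarrow> pgen falg" where
  "contraction a b = (\<Sum>j\<in>words (m + n) (length b). scale (sg (tsign a j b j)) (elt (tword a j b j)))"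

text \<open>The sum over the first letter of \<open>j\<close> splits off: moving the first T-bar next to the first T gives
  an element X, and \<^const>\<open>tsign\<close> has just the signs that this requires, up to a factor that depends on
  the rows only.\<close>

lemma contraction_X:
  assumes "length a = length b" "set a \<subseteq> {..<k + l}" "set b \<subseteq> {..<r + s}"
  shows "\<exists>e. scong GP pp (contraction a b) (scale (sg e) (fhom X (elt (zip a b))))"
  using assms
proof (induction a b rule: list_induct2)
  case Nil
  have "words (m + n) 0 = {[]}" by auto
  then have "contraction [] [] = scale (sg 0) (fhom X (elt (zip [] [])))"
    by (simp add: contraction_def tsign_def one_elt)
  then show ?case by (metis scong_refl)
next
  case (Cons a as b bs)
  from Cons obtain e where e: "scong GP pp (contraction as bs) (scale (sg e) (fhom X (elt (zip as bs))))" by auto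
  have ab: "a < k + l" "b < r + s" "set as \<subseteq> {..<k + l}" "set bs \<subseteq> {..<r + s}" using Cons.prems by auto
  let ?A = "par k a" and ?B = "par r b" and ?As = "wpar (par k) as"
  define c where "c = ?A * ?B + ?B * ?As"
  let ?S = "\<Sum>i<m + n. \<Sum>j\<in>words (m + n) (length bs).
      scale (sg c) (scale (sg (?A * (?B + par m i))) (gen (Inl (a, i)) * gen (Inr (b, i)))
         * scale (sg (tsign as j bs j)) (elt (tword as j bs j)))"
  have "contraction (a # as) (b # bs) = (\<Sum>i<m + n. \<Sum>j\<in>words (m + n) (length bs).
      scale (sg (tsign (a # as) (i # j) (b # bs) (i # j))) (elt (tword (a # as) (i # j) (b # bs) (i # j))))"
    unfolding contraction_def length_Cons sum_words_Suc ..
  then have "scong GP pp (contraction (a # as) (b # bs)) ?S"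
  proof (simp only:, intro scong_sum)
    fix i j assume i: "i \<in> {..<m + n}" and j: "j \<in> words (m + n) (length bs)"
    let ?u = "map Inl (zip as j) :: pgen list" and ?v = "map Inr (zip bs j) :: pgen list"
    let ?I = "par m i" and ?J = "wpar (par m) j"
    have len: "length as = length j" "length bs = length j" using j Cons.hyps by auto
    have u: "?u \<in> lists GP" by (rule tword_mem) (use ab j in auto)
    have v: "?v \<in> lists GP" by (rule tword_mem) (use ab j in auto)
    have "scong GP pp (elt ?u * elt [Inr (b, i)]) (scale (sg ((?As + ?J) * (?B + ?I))) (elt [Inr (b, i)] * elt ?u))"
      using u i ab len by (intro scong_commute) (auto simp: wpar_map wpar_gpar_zip)
    then have "scong GP pp (elt [Inl (a, i)] * (elt ?u * elt [Inr (b, i)]) * elt ?v)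
        (elt [Inl (a, i)] * scale (sg ((?As + ?J) * (?B + ?I))) (elt [Inr (b, i)] * elt ?u) * elt ?v)"
    proof (intro scong_mult scong_refl)
      show "scale (sg ((?As + ?J) * (?B + ?I))) (elt [Inr (b, i)] * elt ?u) \<in> fa GP"
        using u i ab by (intro fa_linear fa_mult) auto
      show "elt [Inl (a, i)] * (elt ?u * elt [Inr (b, i)]) \<in> fa GP"
        using u i ab by (intro fa_mult) auto
    qed (use i ab v in auto)
    then have "scong GP pp (elt (tword (a # as) (i # j) (b # bs) (i # j)))
        (scale (sg ((?As + ?J) * (?B + ?I))) (gen (Inl (a, i)) * gen (Inr (b, i)) * elt (tword as j bs j)))"
      by (simp add: gen_elt scale_mult)
    from scong_scale[OF this]
    have "scong GP pp (scale (sg (tsign (a # as) (i # j) (b # bs) (i # j))) (elt (tword (a # as) (i # j) (b # bs) (i # j))))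
       (scale (sg (tsign (a # as) (i # j) (b # bs) (i # j)) * sg ((?As + ?J) * (?B + ?I)))
         (gen (Inl (a, i)) * gen (Inr (b, i)) * elt (tword as j bs j)))"
      by simp
    moreover have "tsign (a # as) (i # j) (b # bs) (i # j) + (?As + ?J) * (?B + ?I)
        = c + ?A * (?B + ?I) + tsign as j bs j"
      using len by (simp add: tsign_def c_def wpar_zip algebra_simps)
    ultimately show "scong GP pp (scale (sg (tsign (a # as) (i # j) (b # bs) (i # j))) (elt (tword (a # as) (i # j) (b # bs) (i # j))))
      (scale (sg c) (scale (sg (?A * (?B + ?I))) (gen (Inl (a, i)) * gen (Inr (b, i)))
         * scale (sg (tsign as j bs j)) (elt (tword as j bs j))))"
      by (simp only: sg_add[symmetric] scale_mult scale_simps ac_simps)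
  qed
  also have "?S = scale (sg c) (X (a, b) * contraction as bs)"
    by (simp only: X_elem_simp contraction_def sum_product scale_sum)
  also have "scong GP pp (scale (sg c) (X (a, b) * contraction as bs))
      (scale (sg c) (X (a, b) * scale (sg e) (fhom X (elt (zip as bs)))))"
  proof (intro scong_scale scong_mult scong_refl e)
    show "X (a, b) \<in> fa GP" using ab by (intro X_elem_fa) simp
    have "elt (zip as bs) \<in> fa (M_gens k l r s)" using zip_lists[OF ab(3,4)] by (simp add: M_gens_def)
    then show "scale (sg e) (fhom X (elt (zip as bs))) \<in> fa GP" by (intro fa_linear fhom_X_fa)
  qed
  also have "scale (sg c) (X (a, b) * scale (sg e) (fhom X (elt (zip as bs))))
      = scale (sg (c + e)) (fhom X (elt (zip (a # as) (b # bs))))"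
    by (simp add: scale_mult sg_add)
  finally show ?case by blast
qed

text \<open>Permuting the columns of the T is the same as permuting their rows by the inverse, up to a sign
  that does not depend on the columns.\<close>

lemma permuted_contraction:
  assumes \<pi>: "\<pi> permutes {..<length b}" and a: "length a = length b" "set a \<subseteq> {..<k + l}" and b: "set b \<subseteq> {..<r + s}"
  shows "\<exists>e. scong GP pp
    (\<Sum>j\<in>words (m + n) (length b). scale (sg (tsign a (permute_list \<pi> j) b j) * sg (psg (par m) \<pi> j)) (elt (tword a (permute_list \<pi> j) b j)))
    (scale (sg e) (contraction (permute_list (pinv \<pi>) a) b))"
proof -
  let ?a = "permute_list (pinv \<pi>) a"
  have a': "permute_list \<pi> ?a = a" using permute_list_inv(2)[of \<pi> a] \<pi> a by simp
  have len: "length ?a = length b" using a by simp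
  have set: "set ?a \<subseteq> {..<k + l}" using a permutes_inv[OF \<pi>] by simp
  define e where "e = psg (par k) \<pi> ?a"
  have "scong GP pp
    (\<Sum>j\<in>words (m + n) (length b). scale (sg (tsign a (permute_list \<pi> j) b j) * sg (psg (par m) \<pi> j)) (elt (tword a (permute_list \<pi> j) b j)))
    (\<Sum>j\<in>words (m + n) (length b). scale (sg e) (scale (sg (tsign ?a j b j)) (elt (tword ?a j b j))))"
  proof (intro scong_sum)
    fix j assume j: "j \<in> words (m + n) (length b)"
    let ?w = "zip ?a j" and ?v = "map Inr (zip b j) :: pgen list"
    let ?z = "map Inl ?w :: pgen list"
    have lenj: "length ?a = length j" using j len by simp
    then have w: "\<pi> permutes {..<length ?w}" "length ?w = length b" using \<pi> len by auto
    have \<pi>w: "permute_list \<pi> ?w = zip a (permute_list \<pi> j)"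
      using permute_list_zip[of \<pi> "{..<length ?a}" ?a j] \<pi> lenj len a' by simp
    then have \<pi>z: "permute_list \<pi> ?z = map Inl (zip a (permute_list \<pi> j))"
      using permute_list_map[of \<pi> ?w "Inl :: _ \<Rightarrow> pgen"] w by simp
    have z: "?z \<in> lists GP" by (rule tword_mem) (use set j in auto)
    have v: "?v \<in> lists GP" by (rule tword_mem) (use b j in auto)
    have "set (permute_list \<pi> ?z) = set ?z" using w by (intro set_permute_list) simp
    then have \<pi>z_mem: "permute_list \<pi> ?z \<in> lists GP" using z unfolding lists_eq_set by simp
    have "scong GP pp (scale (sg (psg pp \<pi> ?z)) (elt (permute_list \<pi> ?z)) * elt ?v) (elt ?z * elt ?v)"
    proof (intro scong_mult scong_sym[OF scong_permute] scong_refl)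
      show "scale (sg (psg pp \<pi> ?z)) (elt (permute_list \<pi> ?z)) \<in> fa GP"
        by (intro fa_linear) (simp only: fa_elt \<pi>z_mem)
      show "elt ?v \<in> fa GP" using v by (simp only: fa_elt)
    qed (use z w in simp_all)
    from scong_scale[OF this, of "sg (psg pp \<pi> ?z)"]
    have "scong GP pp (elt (tword a (permute_list \<pi> j) b j)) (scale (sg (psg pp \<pi> ?z)) (elt (tword ?a j b j)))"
      by (simp add: scale_mult \<pi>z)
    from scong_scale[OF this, of "sg (tsign a (permute_list \<pi> j) b j) * sg (psg (par m) \<pi> j)"]
    have *: "scong GP pp (scale (sg (tsign a (permute_list \<pi> j) b j) * sg (psg (par m) \<pi> j)) (elt (tword a (permute_list \<pi> j) b j)))
       (scale (sg (tsign a (permute_list \<pi> j) b j) * sg (psg (par m) \<pi> j) * sg (psg pp \<pi> ?z)) (elt (tword ?a j b j)))"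
      by simp
    have "psg pp \<pi> ?z = psg (\<lambda>x. par k (fst x) + par m (snd x)) \<pi> ?w"
      unfolding psg_map[OF w(1)] by (simp add: gpar_def case_prod_unfold)
    moreover have "psg (par m) \<pi> j = psg (\<lambda>x. par m (snd x)) \<pi> ?w" "e = psg (\<lambda>x. par k (fst x)) \<pi> ?w"
      using psg_map[OF w(1), of "par m" snd] psg_map[OF w(1), of "par k" fst] lenj by (simp_all add: e_def)
    moreover have "wpar (par k) a = wpar (par k) ?a"
      using wpar_permute[of \<pi> ?a "par k"] \<pi> a' a by simp
    ultimately have "tsign a (permute_list \<pi> j) b j + psg (par m) \<pi> j + psg pp \<pi> ?z = e + tsign ?a j b j"
      using cross_permute[OF w(1), of "\<lambda>x. par k (fst x)" "\<lambda>x. par m (snd x)"]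
      unfolding tsign_def \<pi>w by (simp add: algebra_simps)
    then show "scong GP pp (scale (sg (tsign a (permute_list \<pi> j) b j) * sg (psg (par m) \<pi> j)) (elt (tword a (permute_list \<pi> j) b j)))
       (scale (sg e) (scale (sg (tsign ?a j b j)) (elt (tword ?a j b j))))"
      using * by (simp add: sg_add[symmetric])
  qed
  then show ?thesis unfolding contraction_def scale_sum[symmetric] by blast
qed

section \<open>The equations of invariance\<close>

context
  fixes p q :: nat
begin

abbreviation \<epsilon> where "\<epsilon> \<equiv> par m p + par m q"

text \<open>The superderivation by which the matrix unit in row \<open>p\<close> and column \<open>q\<close> acts, in the form used
  for reading it on coefficient functions: a letter \<open>g\<close> arises from the letter \<open>unit_source g\<close> only,
  with the coefficient \<open>unit_coeff g\<close>.\<close>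

primrec unit_coeff :: "pgen \<Rightarrow> complex" where
  "unit_coeff (Inl x) = (if snd x = p then 1 else 0)"
| "unit_coeff (Inr x) = (if snd x = q then - sg (par m p * \<epsilon>) else 0)"

primrec unit_targets :: "pgen \<Rightarrow> pgen set" where
  "unit_targets (Inl x) = (if snd x = q then {Inl (fst x, p)} else {})"
| "unit_targets (Inr x) = (if snd x = p then {Inr (fst x, q)} else {})"

primrec unit_source :: "pgen \<Rightarrow> pgen" where
  "unit_source (Inl x) = Inl (fst x, q)"
| "unit_source (Inr x) = Inr (fst x, p)"

definition unit_der :: "pgen \<Rightarrow> pgen falg" where
  "unit_der g = (\<Sum>g'\<in>unit_targets g. scale (unit_coeff g') (gen g'))"

lemma finite_unit_targets: "finite (unit_targets g)"
  by (cases g) auto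

lemma unit_targets_iff: "unit_coeff g' \<noteq> 0 \<Longrightarrow> g' \<in> unit_targets g \<longleftrightarrow> unit_source g' = g"
  by (cases g; cases g') (auto split: if_splits)

lemma unit_source_parity: "unit_coeff g \<noteq> 0 \<Longrightarrow> pp (unit_source g) = pp g + \<epsilon>"
  by (cases g) (auto simp: gpar_def ac_simps split: if_splits)

lemma gl_rep_unit:
  assumes pq: "p < m + n" "q < m + n" and f: "f \<in> fa GP"
  shows "gl_rep k r m n (mat_unit (m + n) (p, q)) f = sder pp \<epsilon> unit_der f"
proof -
  have "sder pp e (gl_on_gen m n (homog_part m e (mat_unit (m + n) (p, q)))) f
      = (if e = \<epsilon> then sder pp \<epsilon> unit_der f else 0)" for e
  proof -
    have entry: "homog_part m e (mat_unit (m + n) (p, q)) $$ (c, i) = (if c = p then if i = q \<and> e = \<epsilon> then 1 else 0 else 0)"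
      if "c < m + n" "i < m + n" for c i
      using that by (auto simp: homog_part_def mat_unit_def)
    have entry': "homog_part m e (mat_unit (m + n) (p, q)) $$ (i, d) = (if d = q then if i = p \<and> e = \<epsilon> then 1 else 0 else 0)"
      if "d < m + n" "i < m + n" for d i
      using entry[of i d] that by auto
    have "sder pp e (gl_on_gen m n (homog_part m e (mat_unit (m + n) (p, q)))) f
        = sder pp e (if e = \<epsilon> then unit_der else (\<lambda>_. 0)) f"
    proof (rule sder_cong[OF _ f])
      fix g assume "g \<in> GP"
      then show "gl_on_gen m n (homog_part m e (mat_unit (m + n) (p, q))) g = (if e = \<epsilon> then unit_der else (\<lambda>_. 0)) g"
      proof (cases rule: P_gens_cases)
        case (1 a i)
        have "(\<Sum>c<m + n. scale (homog_part m e (mat_unit (m + n) (p, q)) $$ (c, i)) (gen (Inl (a, c) :: pgen)))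
          = (\<Sum>c<m + n. if c = p then scale (if i = q \<and> e = \<epsilon> then 1 else 0) (gen (Inl (a, c) :: pgen)) else 0)"
          using 1 by (intro sum.cong refl) (simp add: entry)
        from this show ?thesis unfolding 1(1) gl_on_gen_simps by (simp only:) (use pq in \<open>simp add: unit_der_def\<close>)
      next
        case (2 b i)
        have "(\<Sum>d<m + n. scale (sg (par m i * (par m d + par m i)) * homog_part m e (mat_unit (m + n) (p, q)) $$ (i, d)) (gen (Inr (b, d) :: pgen)))
          = (\<Sum>d<m + n. if d = q then scale (sg (par m i * (par m d + par m i)) * (if i = p \<and> e = \<epsilon> then 1 else 0)) (gen (Inr (b, d) :: pgen)) else 0)"
          using 2 by (intro sum.cong refl) (simp add: entry')
        from this show ?thesis unfolding 2(1) gl_on_gen_simps by (simp only:) (use pq in \<open>simp add: unit_der_def add.commute\<close>)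
      qed
    qed
    then show ?thesis by (simp add: sder_zero)
  qed
  then have "gl_rep k r m n (mat_unit (m + n) (p, q)) f = (\<Sum>e\<in>{0, 1}. if e = \<epsilon> then sder pp \<epsilon> unit_der f else 0)"
    unfolding gl_rep_def by simp
  moreover have "\<epsilon> \<in> {0, 1}" by (cases \<epsilon>) auto
  ultimately show ?thesis by (simp only: sum.delta finite.intros if_True)
qed

text \<open>The value of the superderivation on the symmetrisation is the symmetrisation of a relation, hence
  zero in the free algebra.\<close>

lemma Sym_invariant:
  assumes "sder pp \<epsilon> unit_der f \<in> relid GP (scr GP pp)"
  shows "(\<Sum>t<length w. pos pp \<epsilon> unit_coeff unit_source t (lk (Sym pp f)) w) = 0"
proof -
  have "sder pp \<epsilon> unit_der (Sym pp f) = Sym pp (sder pp \<epsilon> unit_der f)"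
    by (rule Sym_sder[where S = unit_targets and \<kappa> = unit_coeff and \<rho> = unit_source])
       (erule unit_targets_iff unit_source_parity | rule unit_der_def finite_unit_targets)+
  also have "\<dots> = 0" by (rule Sym_relid[OF assms])
  finally have 0: "sder pp \<epsilon> unit_der (Sym pp f) = 0" .
  have "lk (sder pp \<epsilon> unit_der (Sym pp f)) w = (\<Sum>t<length w. pos pp \<epsilon> unit_coeff unit_source t (lk (Sym pp f)) w)"
    by (rule lookup_sder[where S = unit_targets])
       (erule unit_targets_iff | rule unit_der_def finite_unit_targets)+
  then show ?thesis by (simp add: 0)
qed

lemma pos_tword_left:
  assumes "t < length i" "length a = length i"
  shows "pos pp \<epsilon> unit_coeff unit_source t \<phi> (tword a i b j) = (if i ! t = p
    then sg (\<epsilon> * (wpar (par k) (take t a) + wpar (par m) (take t i))) * \<phi> (tword a (i[t := q]) b j) else 0)"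
proof -
  have "zip a (i[t := q]) = (zip a i)[t := (a ! t, q)]"
    using zip_update[of a t "a ! t" i q] by simp
  then have "(tword a i b j)[t := Inl (a ! t, q)] = tword a (i[t := q]) b j"
    using assms by (simp add: list_update_append map_update)
  moreover have "tword a i b j ! t = Inl (a ! t, i ! t)" using assms by (simp add: nth_append)
  moreover have "wpar pp (take t (tword a i b j)) = wpar (par k) (take t a) + wpar (par m) (take t i)"
    using assms by (simp add: take_map take_zip wpar_map wpar_gpar_zip)
  ultimately show ?thesis unfolding pos_def by simp
qed

lemma pos_tword_right:
  assumes "t < length j" "length b = length j" "length a = length i"
  shows "pos pp \<epsilon> unit_coeff unit_source (length i + t) \<phi> (tword a i b j) = (if j ! t = q
    then - (sg (par m p * \<epsilon>) * sg (\<epsilon> * (wpar (par k) a + wpar (par m) i + wpar (par r) (take t b) + wpar (par m) (take t j)))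
      * \<phi> (tword a i b (j[t := p]))) else 0)"
proof -
  have "zip b (j[t := p]) = (zip b j)[t := (b ! t, p)]"
    using zip_update[of b t "b ! t" j p] by simp
  then have "(tword a i b j)[length i + t := Inr (b ! t, p)] = tword a i b (j[t := p])"
    using assms by (simp add: list_update_append map_update)
  moreover have "tword a i b j ! (length i + t) = Inr (b ! t, j ! t)" using assms by (simp add: nth_append)
  moreover have "wpar pp (take (length i + t) (tword a i b j))
      = wpar (par k) a + wpar (par m) i + wpar (par r) (take t b) + wpar (par m) (take t j)"
    using assms by (simp add: take_map take_zip wpar_map wpar_gpar_zip ac_simps)
  ultimately show ?thesis unfolding pos_def by simp
qed

end

definition invariant :: "pgen falg \<Rightarrow> bool" where
  "invariant f \<longleftrightarrow> f \<in> fa GP \<and> (\<forall>x\<in>carrier_mat (m + n) (m + n). gl_rep k r m n x f \<in> relid GP (scr GP pp))"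

context
  fixes f :: "pgen falg" and a b :: "nat list"
  assumes f: "invariant f"
begin

abbreviation coeff where "coeff i j \<equiv> lk (Sym pp f) (tword a i b j)"

text \<open>The two sums collect the T and the T-bar.\<close>

lemma coeff_invariant:
  assumes pq: "p < m + n" "q < m + n" and len: "length a = length i" "length b = length j"
  shows "(\<Sum>t<length i. if i ! t = p then sg ((par m p + par m q) * (wpar (par k) (take t a) + wpar (par m) (take t i))) * coeff (i[t := q]) j else 0)
    = (\<Sum>t<length j. if j ! t = q then sg (par m p * (par m p + par m q)) * sg ((par m p + par m q) * (wpar (par k) a + wpar (par m) i + wpar (par r) (take t b) + wpar (par m) (take t j))) * coeff i (j[t := p]) else 0)"
    (is "?L = ?R")
proof -
  have "mat_unit (m + n) (p, q) \<in> carrier_mat (m + n) (m + n)" by (simp add: mat_unit_def)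
  then have "sder pp (par m p + par m q) (unit_der p q) f \<in> relid GP (scr GP pp)"
    using f gl_rep_unit[OF pq, of f] unfolding invariant_def by metis
  from Sym_invariant[OF this, of "tword a i b j"] len
  have "(\<Sum>t<length i. pos pp (par m p + par m q) (unit_coeff p q) (unit_source p q) t (lk (Sym pp f)) (tword a i b j))
    + (\<Sum>t<length j. pos pp (par m p + par m q) (unit_coeff p q) (unit_source p q) (length i + t) (lk (Sym pp f)) (tword a i b j)) = 0"
    by (simp add: sum_split)
  also have "(\<Sum>t<length i. pos pp (par m p + par m q) (unit_coeff p q) (unit_source p q) t (lk (Sym pp f)) (tword a i b j)) = ?L"
    using len by (intro sum.cong refl) (simp add: pos_tword_left)
  also have "(\<Sum>t<length j. pos pp (par m p + par m q) (unit_coeff p q) (unit_source p q) (length i + t) (lk (Sym pp f)) (tword a i b j)) = - ?R"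
    unfolding sum_negf[symmetric] using len by (intro sum.cong refl) (simp add: pos_tword_right)
  finally show ?thesis by simp
qed

text \<open>A diagonal matrix unit multiplies the coefficient by the difference of the multiplicities of a
  column in \<open>i\<close> and in \<open>j\<close>.\<close>

lemma coeff_weight:
  assumes c: "coeff i j \<noteq> 0" and i: "set i \<subseteq> {..<m + n}" and j: "set j \<subseteq> {..<m + n}"
    and len: "length a = length i" "length b = length j"
  shows "mset i = mset j"
proof (rule multiset_eqI)
  have count: "count (mset v) p = card {t \<in> {..<length v}. v ! t = p}" for v :: "nat list" and p
    by (simp add: count_mset count_list_eq_length_filter length_filter_conv_card eq_commute[of p])
  fix p
  show "count (mset i) p = count (mset j) p"
  proof (cases "p < m + n")
    case True
    have "(\<Sum>t<length v. if v ! t = p then z else 0) = of_nat (count (mset v) p) * z" for v and z :: complex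
      by (simp add: count sum.If_cases Int_def)
    moreover have "(\<Sum>t<length i. if i ! t = p then coeff i j else 0) = (\<Sum>t<length j. if j ! t = p then coeff i j else 0)"
    proof -
      have "(if i ! t = p then coeff (i[t := p]) j else 0) = (if i ! t = p then coeff i j else 0)"
        "(if j ! t = p then coeff i (j[t := p]) else 0) = (if j ! t = p then coeff i j else 0)" for t by auto
      then show ?thesis using coeff_invariant[OF True True len] by (simp only: bit_add_self sg_0 mult_zero_left mult_zero_right mult_1_left)
    qed
    ultimately show ?thesis using c by simp
  next
    case False
    then have "p \<notin> set i" "p \<notin> set j" using i j by auto
    then show ?thesis by (metis count_mset_0_iff)
  qed
qed

definition kernel :: "nat list \<Rightarrow> nat list \<Rightarrow> complex" where
  "kernel i j = sg (tsign a i b j) * coeff i j"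

lemma tsign_update_left:
  assumes "t < length i" "length a = length i"
  shows "tsign a (i[t := q]) b j = tsign a i b j + (par m q + par m (i ! t)) * wpar (par k) (take t a)"
proof -
  have "zip a (i[t := q]) = (zip a i)[t := (a ! t, q)]"
    using zip_update[of a t "a ! t" i q] by simp
  then show ?thesis
    using assms cross_update[of t "zip a i" "\<lambda>x. par k (fst x)" "(a ! t, q)" "\<lambda>x. par m (snd x)"]
    by (simp add: tsign_def take_zip wpar_zip ac_simps)
qed

lemma tsign_update_right:
  assumes "t < length j" "length b = length j"
  shows "tsign a i b (j[t := p]) = tsign a i b j
    + (par m p + par m (j ! t)) * (wpar (par m) j + par m (j ! t) + wpar (par k) a + wpar (par r) (take t b))"
proof -
  have "zip b (j[t := p]) = (zip b j)[t := (b ! t, p)]"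
    using zip_update[of b t "b ! t" j p] by simp
  then show ?thesis
    using assms cross_update[of t "zip b j" "\<lambda>x. par r (fst x)" "(b ! t, p)" "\<lambda>x. par m (snd x)"]
      cross_update_self[of t j "par m" p] wpar_update[of t j "par m" p]
    by (simp add: tsign_def take_zip wpar_zip algebra_simps)
qed

text \<open>The sign of the kernel absorbs all signs that involve the rows.  The remaining one depends on
  the total parities of the two words of columns, which are related since a coefficient vanishes
  unless these words are rearrangements of each other.\<close>

lemma kernel_invariant:
  assumes pq: "p < m + n" "q < m + n" and i: "i \<in> words (m + n) (length a)" and j: "j \<in> words (m + n) (length b)"
  shows "(\<Sum>t<length i. if i ! t = p then sg ((par m p + par m q) * wpar (par m) (take t i)) * kernel (i[t := q]) j else 0)
    = (\<Sum>t<length j. if j ! t = q then sg ((par m p + par m q) * wpar (par m) (take t j)) * kernel i (j[t := p]) else 0)"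
proof -
  let ?e = "par m p + par m q"
  have len: "length a = length i" "length b = length j" using i j by auto
  have "(\<Sum>t<length i. if i ! t = p then sg (?e * wpar (par m) (take t i)) * kernel (i[t := q]) j else 0)
     = sg (tsign a i b j) * (\<Sum>t<length i. if i ! t = p then sg (?e * (wpar (par k) (take t a) + wpar (par m) (take t i))) * coeff (i[t := q]) j else 0)"
    unfolding sum_distrib_left
  proof (intro sum.cong refl)
    fix t assume t: "t \<in> {..<length i}"
    then have t': "t < length i" by simp
    show "(if i ! t = p then sg (?e * wpar (par m) (take t i)) * kernel (i[t := q]) j else 0)
     = sg (tsign a i b j) * (if i ! t = p then sg (?e * (wpar (par k) (take t a) + wpar (par m) (take t i))) * coeff (i[t := q]) j else 0)"
      using tsign_update_left[OF t' len(1), of q j] by (simp add: kernel_def distrib_left sg_add ac_simps)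
  qed
  also have "\<dots> = sg (tsign a i b j) * (\<Sum>t<length j. if j ! t = q then sg (par m p * ?e) * sg (?e * (wpar (par k) a + wpar (par m) i + wpar (par r) (take t b) + wpar (par m) (take t j))) * coeff i (j[t := p]) else 0)"
    unfolding coeff_invariant[OF pq len] ..
  also have "\<dots> = (\<Sum>t<length j. if j ! t = q then sg (?e * wpar (par m) (take t j)) * kernel i (j[t := p]) else 0)"
    unfolding sum_distrib_left
  proof (intro sum.cong refl)
    fix t assume t: "t \<in> {..<length j}"
    then have t': "t < length j" by simp
    show "sg (tsign a i b j) * (if j ! t = q then sg (par m p * ?e) * sg (?e * (wpar (par k) a + wpar (par m) i + wpar (par r) (take t b) + wpar (par m) (take t j))) * coeff i (j[t := p]) else 0)
      = (if j ! t = q then sg (?e * wpar (par m) (take t j)) * kernel i (j[t := p]) else 0)"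
    proof (cases "j ! t = q \<and> coeff i (j[t := p]) \<noteq> 0")
      case True
      have "set (j[t := p]) \<subseteq> {..<m + n}" using set_update_subset_insert[of j t p] j pq by auto
      then have "mset i = mset (j[t := p])" using True i len by (intro coeff_weight) auto
      then have "wpar (par m) i = wpar (par m) (j[t := p])"
        unfolding wpar_def by (metis mset_map sum_mset_sum_list)
      then have wi: "wpar (par m) i = wpar (par m) j + ?e"
        using wpar_update[OF t', of "par m" p] True by simp
      have "tsign a i b j + (par m p * ?e + ?e * (wpar (par k) a + wpar (par m) i + wpar (par r) (take t b) + wpar (par m) (take t j)))
          = ?e * wpar (par m) (take t j) + tsign a i b (j[t := p])"
        using True unfolding tsign_update_right[OF t' len(2), of i p] wi by (simp add: algebra_simps)
      then show ?thesis using True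
        by (simp add: kernel_def sg_add[symmetric] mult.assoc[symmetric])
    qed (auto simp: kernel_def)
  qed
  finally show ?thesis .
qed

end

lemma sum_updated_words:
  assumes "p < d" "q < d"
  shows "(\<Sum>j\<in>words d N. if j ! t = q \<and> t < N then f (j[t := p]) j else 0)
    = (\<Sum>j\<in>words d N. if j ! t = p \<and> t < N then f j (j[t := q]) else 0)" (is "?L = ?R")
proof (cases "t < N")
  case True
  have upd: "v[t := x] \<in> words d N" if "v \<in> words d N" "x < d" for v x
    using that set_update_subset_insert[of v t x] by auto
  have "?L = (\<Sum>j | j \<in> words d N \<and> j ! t = q. f (j[t := p]) j)"
    using True finite_words_set by (simp add: sum.If_cases Int_def)
  also have "\<dots> = (\<Sum>j | j \<in> words d N \<and> j ! t = p. f j (j[t := q]))"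
    using True by (intro sum.reindex_bij_witness[where i = "\<lambda>j. j[t := q]" and j = "\<lambda>j. j[t := p]"])
      (use upd assms in \<open>auto simp: list_update_same_conv\<close>)
  also have "\<dots> = ?R"
    using True finite_words_set by (simp add: sum.If_cases Int_def)
  finally show ?thesis .
qed simp

text \<open>The equations of invariance say that the kernel commutes with the matrix units, after a change
  of the summation variable in its second argument.\<close>

lemma kernel_commuting:
  assumes f: "invariant f" and len: "length a = length b"
  shows "finite_words.commuting (par m) {..<m + n} (length b) (kernel f a b)"
proof -
  interpret W: finite_words "par m" "{..<m + n}" "length b" by unfold_locales simp
  let ?F = "kernel f a b" and ?N = "length b"
  show ?thesis
    unfolding W.commuting_def
  proof (intro ballI allI)
    fix x \<phi> w assume x: "x \<in> {..<m + n} \<times> {..<m + n}" and w: "w \<in> W.B"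
    obtain p q where pq: "x = (p, q)" "p < m + n" "q < m + n" using x by auto
    have w': "w \<in> words (m + n) ?N" using w by (simp add: W.B_def)
    let ?e = "par m p + par m q"
    have "W.apply_kernel ?F (W.diag_sum x \<phi>) w
       = (\<Sum>j\<in>words (m + n) ?N. \<Sum>t<?N. if j ! t = p \<and> t < ?N then ?F w j * (sg (?e * wpar (par m) (take t j)) * \<phi> (j[t := q])) else 0)"
      unfolding W.apply_kernel_def W.diag_sum_def W.B_def
      by (intro sum.cong refl) (auto simp: punit_def pq sum_distrib_left intro!: sum.cong)
    also have "\<dots> = (\<Sum>t<?N. \<Sum>j\<in>words (m + n) ?N. if j ! t = p \<and> t < ?N then ?F w j * (sg (?e * wpar (par m) (take t j)) * \<phi> (j[t := q])) else 0)"
      by (rule sum.swap)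
    also have "\<dots> = (\<Sum>t<?N. \<Sum>j\<in>words (m + n) ?N. if j ! t = q \<and> t < ?N then ?F w (j[t := p]) * (sg (?e * wpar (par m) (take t (j[t := p]))) * \<phi> j) else 0)"
      by (intro sum.cong refl sum_updated_words[symmetric] pq)
    also have "\<dots> = (\<Sum>j\<in>words (m + n) ?N. (\<Sum>t<?N. if j ! t = q then sg (?e * wpar (par m) (take t j)) * ?F w (j[t := p]) else 0) * \<phi> j)"
      unfolding sum_distrib_right by (subst sum.swap) (auto intro!: sum.cong simp: mult_ac)
    also have "\<dots> = (\<Sum>j\<in>words (m + n) ?N. (\<Sum>t<?N. if w ! t = p then sg (?e * wpar (par m) (take t w)) * ?F (w[t := q]) j else 0) * \<phi> j)"
    proof (intro sum.cong refl)
      fix j assume j: "j \<in> words (m + n) ?N"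
      have w'': "w \<in> words (m + n) (length a)" using w' len by simp
      show "(\<Sum>t<?N. if j ! t = q then sg (?e * wpar (par m) (take t j)) * ?F w (j[t := p]) else 0) * \<phi> j
         = (\<Sum>t<?N. if w ! t = p then sg (?e * wpar (par m) (take t w)) * ?F (w[t := q]) j else 0) * \<phi> j"
        using kernel_invariant[OF f pq(2,3) w'' j] w' j by simp
    qed
    also have "\<dots> = (\<Sum>t<?N. \<Sum>j\<in>words (m + n) ?N. if w ! t = p then sg (?e * wpar (par m) (take t w)) * (?F (w[t := q]) j * \<phi> j) else 0)"
      unfolding sum_distrib_right by (subst sum.swap) (auto intro!: sum.cong)
    also have "\<dots> = W.diag_sum x (W.apply_kernel ?F \<phi>) w"
      unfolding W.apply_kernel_def W.diag_sum_def W.B_def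
      by (intro sum.cong refl) (use w' in \<open>auto simp: punit_def pq sum_distrib_left\<close>)
    finally show "W.apply_kernel ?F (W.diag_sum x \<phi>) w = W.diag_sum x (W.apply_kernel ?F \<phi>) w" .
  qed
qed

section \<open>Generation of the invariants\<close>

text \<open>The elements of the free algebra that represent an element of the image.\<close>

definition X_image :: "pgen falg set" where
  "X_image = {y. \<exists>z\<in>fa (M_gens k l r s). scong GP pp y (fhom X z)}"

lemma X_imageI: "z \<in> fa (M_gens k l r s) \<Longrightarrow> scong GP pp y (fhom X z) \<Longrightarrow> y \<in> X_image"
  by (auto simp: X_image_def)

lemma X_image_cong: "scong GP pp y y' \<Longrightarrow> y' \<in> X_image \<Longrightarrow> y \<in> X_image"
  by (auto simp: X_image_def intro: scong_trans)

lemma subsp_X_image: "subsp X_image"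
proof -
  have "0 \<in> X_image" by (rule X_imageI[of 0]) (simp_all add: lin_0[OF lin_fhom] scong_refl)
  moreover have "x + y \<in> X_image" if "x \<in> X_image" "y \<in> X_image" for x y
  proof -
    from that obtain z z' where z: "z \<in> fa (M_gens k l r s)" "scong GP pp x (fhom X z)"
      "z' \<in> fa (M_gens k l r s)" "scong GP pp y (fhom X z')" by (auto simp: X_image_def)
    show ?thesis
      by (rule X_imageI[of "z + z'"]) (use z in \<open>auto simp: lin_add[OF lin_fhom] intro: scong_add\<close>)
  qed
  moreover have "scale c x \<in> X_image" if "x \<in> X_image" for c x
  proof -
    from that obtain z where z: "z \<in> fa (M_gens k l r s)" "scong GP pp x (fhom X z)" by (auto simp: X_image_def)
    show ?thesis
      by (rule X_imageI[of "scale c z"]) (use z in \<open>auto simp: lin_scale[OF lin_fhom] intro: scong_scale\<close>)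
  qed
  ultimately show ?thesis by (simp add: subsp_def)
qed

lemma contraction_image:
  assumes "length a = length b" "set a \<subseteq> {..<k + l}" "set b \<subseteq> {..<r + s}"
  shows "contraction a b \<in> X_image"
proof -
  from contraction_X[OF assms] obtain e where e: "scong GP pp (contraction a b) (scale (sg e) (fhom X (elt (zip a b))))" ..
  have "elt (zip a b) \<in> fa (M_gens k l r s)" using zip_lists[OF assms(2,3)] by (simp add: M_gens_def)
  then have "fhom X (elt (zip a b)) \<in> X_image" by (rule X_imageI) (rule scong_refl)
  then show ?thesis by (rule X_image_cong[OF e subsp_scale[OF subsp_X_image]])
qed

text \<open>The kernel is a combination of signed permutations, and each of these contributes a product of
  elements X.\<close>

lemma shape_in_image:
  assumes f: "invariant f" and a: "set a \<subseteq> {..<k + l}" and b: "set b \<subseteq> {..<r + s}"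
  shows "(\<Sum>i\<in>words (m + n) (length a). \<Sum>j\<in>words (m + n) (length b).
      scale (lk (Sym pp f) (tword a i b j)) (elt (tword a i b j))) \<in> X_image"
proof (cases "length a = length b")
  case False
  have "lk (Sym pp f) (tword a i b j) = 0" if "i \<in> words (m + n) (length a)" "j \<in> words (m + n) (length b)" for i j
  proof (rule ccontr)
    assume "lk (Sym pp f) (tword a i b j) \<noteq> 0"
    from coeff_weight[OF f this] have "mset i = mset j" using that by simp
    from mset_eq_length[OF this] show False using that False by simp
  qed
  then show ?thesis by (simp add: subsp_0[OF subsp_X_image])
next
  case True
  let ?N = "length b"
  interpret W: finite_words "par m" "{..<m + n}" ?N by unfold_locales simp
  from W.double_centralizer[OF kernel_commuting[OF f True]] obtain c where
    c: "\<And>i j. i \<in> W.B \<Longrightarrow> j \<in> W.B \<Longrightarrow> kernel f a b i j = (\<Sum>\<pi>\<in>W.Pn. c \<pi> * W.signed_perm \<pi> i j)" by blast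
  have "(\<Sum>i\<in>W.B. \<Sum>j\<in>W.B. scale (lk (Sym pp f) (tword a i b j)) (elt (tword a i b j)))
     = (\<Sum>i\<in>W.B. \<Sum>j\<in>W.B. \<Sum>\<pi>\<in>W.Pn. if i = permute_list \<pi> j then scale (c \<pi>) (scale (sg (tsign a i b j) * sg (psg (par m) \<pi> j)) (elt (tword a i b j))) else 0)"
  proof (intro sum.cong refl)
    fix i j assume ij: "i \<in> W.B" "j \<in> W.B"
    have "lk (Sym pp f) (tword a i b j) = sg (tsign a i b j) * kernel f a b i j"
      by (simp add: kernel_def[OF f])
    also have "\<dots> = (\<Sum>\<pi>\<in>W.Pn. if i = permute_list \<pi> j then c \<pi> * (sg (tsign a i b j) * sg (psg (par m) \<pi> j)) else 0)"
      unfolding c[OF ij] sum_distrib_left by (intro sum.cong refl) (simp add: W.signed_perm_def mult_ac)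
    finally show "scale (lk (Sym pp f) (tword a i b j)) (elt (tword a i b j))
      = (\<Sum>\<pi>\<in>W.Pn. if i = permute_list \<pi> j then scale (c \<pi>) (scale (sg (tsign a i b j) * sg (psg (par m) \<pi> j)) (elt (tword a i b j))) else 0)"
      by (simp only: scale_sum_scalar) (intro sum.cong refl, simp)
  qed
  also have "\<dots> = (\<Sum>\<pi>\<in>W.Pn. \<Sum>j\<in>W.B. \<Sum>i\<in>W.B. if i = permute_list \<pi> j then scale (c \<pi>) (scale (sg (tsign a i b j) * sg (psg (par m) \<pi> j)) (elt (tword a i b j))) else 0)"
    by (subst sum.swap) (subst (2) sum.swap, subst sum.swap, rule refl)
  also have "\<dots> = (\<Sum>\<pi>\<in>W.Pn. scale (c \<pi>) (\<Sum>j\<in>words (m + n) ?N. scale (sg (tsign a (permute_list \<pi> j) b j) * sg (psg (par m) \<pi> j)) (elt (tword a (permute_list \<pi> j) b j))))"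
  proof (intro sum.cong refl)
    fix \<pi> assume "\<pi> \<in> W.Pn"
    then have "permute_list \<pi> j \<in> W.B" if "j \<in> W.B" for j using W.B_permute[of \<pi> j] that by simp
    then show "(\<Sum>j\<in>W.B. \<Sum>i\<in>W.B. if i = permute_list \<pi> j then scale (c \<pi>) (scale (sg (tsign a i b j) * sg (psg (par m) \<pi> j)) (elt (tword a i b j))) else 0)
      = scale (c \<pi>) (\<Sum>j\<in>words (m + n) ?N. scale (sg (tsign a (permute_list \<pi> j) b j) * sg (psg (par m) \<pi> j)) (elt (tword a (permute_list \<pi> j) b j)))"
      unfolding scale_sum W.B_def[symmetric] by (intro sum.cong refl) (simp add: W.finite_B)
  qed
  also have "\<dots> \<in> X_image"
  proof (rule subsp_sum[OF subsp_X_image], rule subsp_scale[OF subsp_X_image])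
    fix \<pi> assume "\<pi> \<in> W.Pn"
    then have \<pi>: "\<pi> permutes {..<?N}" by simp
    from permuted_contraction[OF \<pi> True a b] obtain e where e: "scong GP pp
      (\<Sum>j\<in>words (m + n) ?N. scale (sg (tsign a (permute_list \<pi> j) b j) * sg (psg (par m) \<pi> j)) (elt (tword a (permute_list \<pi> j) b j)))
      (scale (sg e) (contraction (permute_list (pinv \<pi>) a) b))" ..
    have "set (permute_list (pinv \<pi>) a) = set a" using permutes_inv[OF \<pi>] True by (intro set_permute_list) simp
    then have "contraction (permute_list (pinv \<pi>) a) b \<in> X_image" using True a b by (intro contraction_image) auto
    then show "(\<Sum>j\<in>words (m + n) ?N. scale (sg (tsign a (permute_list \<pi> j) b j) * sg (psg (par m) \<pi> j)) (elt (tword a (permute_list \<pi> j) b j))) \<in> X_image"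
      by (rule X_image_cong[OF e subsp_scale[OF subsp_X_image]])
  qed
  finally show ?thesis unfolding True W.B_def .
qed

text \<open>The shape of a word records which letters are T, which are T-bar, and their rows.\<close>

definition shape_words :: "(nat + nat) list \<Rightarrow> pgen list set" where
  "shape_words \<sigma> = {w \<in> lists GP. map (map_sum fst fst) w = \<sigma>}"

lemma finite_shape_words: "finite (shape_words \<sigma>)"
proof (rule finite_subset)
  show "shape_words \<sigma> \<subseteq> {w. set w \<subseteq> GP \<and> length w = length \<sigma>}" by (auto simp: shape_words_def)
  show "finite {w. set w \<subseteq> GP \<and> length w = length \<sigma>}"
    by (rule finite_lists_length_eq) (simp add: P_gens_def)
qed

text \<open>In a sorted shape the words are given by the columns of the T and of the T-bar.\<close>

lemma sum_shape_words:
  assumes a: "set a \<subseteq> {..<k + l}" and b: "set b \<subseteq> {..<r + s}"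
  shows "(\<Sum>w\<in>shape_words (map Inl a @ map Inr b). h w)
    = (\<Sum>i\<in>words (m + n) (length a). \<Sum>j\<in>words (m + n) (length b). h (tword a i b j))"
proof -
  have left: "\<exists>i\<in>words (m + n) (length a). u = map Inl (zip a i)"
    if "u \<in> lists GP" "map (map_sum fst fst) u = map Inl a" for u and a :: "nat list"
  proof (rule bexI[of _ "map (\<lambda>g. snd (projl g)) u"])
    have u: "\<exists>a i. g = Inl (a, i) \<and> i < m + n" if "g \<in> set u" for g
    proof -
      have "map_sum fst fst g \<in> set (map Inl a)" using that \<open>map (map_sum fst fst) u = map Inl a\<close> by (metis imageI set_map)
      moreover have "g \<in> GP" using that \<open>u \<in> lists GP\<close> by (simp add: in_lists_conv_set)
      ultimately show ?thesis by (cases g) auto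
    qed
    have "length u = length a" using that(2) by (metis length_map)
    then show "map (\<lambda>g. snd (projl g)) u \<in> words (m + n) (length a)" using u by fastforce
    show "u = map Inl (zip a (map (\<lambda>g. snd (projl g)) u))"
    proof (rule nth_equalityI)
      fix t assume t: "t < length u"
      have "map_sum fst fst (u ! t) = Inl (a ! t)"
        using arg_cong[OF that(2), of "\<lambda>v. v ! t"] t \<open>length u = length a\<close> by simp
      then show "u ! t = map Inl (zip a (map (\<lambda>g. snd (projl g)) u)) ! t"
        using t \<open>length u = length a\<close> by (cases "u ! t") auto
    qed (simp add: \<open>length u = length a\<close>)
  qed
  have right: "\<exists>j\<in>words (m + n) (length b). u = map Inr (zip b j)"
    if "u \<in> lists GP" "map (map_sum fst fst) u = map Inr b" for u and b :: "nat list"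
  proof (rule bexI[of _ "map (\<lambda>g. snd (projr g)) u"])
    have u: "\<exists>b j. g = Inr (b, j) \<and> j < m + n" if "g \<in> set u" for g
    proof -
      have "map_sum fst fst g \<in> set (map Inr b)" using that \<open>map (map_sum fst fst) u = map Inr b\<close> by (metis imageI set_map)
      moreover have "g \<in> GP" using that \<open>u \<in> lists GP\<close> by (simp add: in_lists_conv_set)
      ultimately show ?thesis by (cases g) auto
    qed
    have "length u = length b" using that(2) by (metis length_map)
    then show "map (\<lambda>g. snd (projr g)) u \<in> words (m + n) (length b)" using u by fastforce
    show "u = map Inr (zip b (map (\<lambda>g. snd (projr g)) u))"
    proof (rule nth_equalityI)
      fix t assume t: "t < length u"
      have "map_sum fst fst (u ! t) = Inr (b ! t)"
        using arg_cong[OF that(2), of "\<lambda>v. v ! t"] t \<open>length u = length b\<close> by simp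
      then show "u ! t = map Inr (zip b (map (\<lambda>g. snd (projr g)) u)) ! t"
        using t \<open>length u = length b\<close> by (cases "u ! t") auto
    qed (simp add: \<open>length u = length b\<close>)
  qed
  have "shape_words (map Inl a @ map Inr b) = (\<lambda>(i, j). tword a i b j) ` (words (m + n) (length a) \<times> words (m + n) (length b))"
    (is "?S = ?I")
  proof (intro equalityI subsetI)
    fix w assume "w \<in> ?S"
    then obtain u v where "w = u @ v" "u \<in> lists GP" "v \<in> lists GP"
      "map (map_sum fst fst) u = map Inl a" "map (map_sum fst fst) v = map Inr b"
    proof -
      have "map (map_sum fst fst) w = map Inl a @ map Inr b" "w \<in> lists GP"
        using \<open>w \<in> ?S\<close> by (simp_all add: shape_words_def)
      then obtain u v where "w = u @ v" "map Inl a = map (map_sum fst fst) u" "map Inr b = map (map_sum fst fst) v"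
        unfolding map_eq_append_conv by blast
      then show thesis using \<open>w \<in> lists GP\<close> that[of u v] by (simp add: in_lists_conv_set)
    qed
    with left[of u a] right[of v b] show "w \<in> ?I" by auto
  next
    fix w assume "w \<in> ?I"
    then obtain i j where w: "w = tword a i b j" and i: "i \<in> words (m + n) (length a)" and j: "j \<in> words (m + n) (length b)" by auto
    have "map Inl (zip a i) \<in> lists GP" by (rule tword_mem) (use a i in auto)
    moreover have "map Inr (zip b j) \<in> lists GP" by (rule tword_mem) (use b j in auto)
    moreover have "map (map_sum fst fst) (map Inl u :: pgen list) = (map Inl (map fst u) :: (nat + nat) list)"
      "map (map_sum fst fst) (map Inr u :: pgen list) = (map Inr (map fst u) :: (nat + nat) list)"
      for u :: "(nat \<times> nat) list" by (induction u) auto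
    ultimately show "w \<in> ?S" using i j by (simp add: shape_words_def w del: map_map)
  qed
  moreover have "inj_on (\<lambda>(i, j). tword a i b j) (words (m + n) (length a) \<times> words (m + n) (length b))"
  proof (rule inj_onI, clarify)
    fix i j i' j' assume len: "length i = length a" "length j = length b" "length i' = length a" "length j' = length b"
      and eq: "tword a i b j = tword a i' b j'"
    have "map Inl (zip a i) = (map Inl (zip a i') :: pgen list)" "map Inr (zip b j) = (map Inr (zip b j') :: pgen list)"
      using eq len by auto
    then have "zip a i = zip a i'" "zip b j = zip b j'" by (auto simp: inj_map_eq_map)
    then have "map snd (zip a i) = map snd (zip a i')" "map snd (zip b j) = map snd (zip b j')" by simp_all
    then show "i = i' \<and> j = j'" using len by simp
  qed
  ultimately show ?thesis by (simp add: sum.reindex sum.cartesian_product case_prod_unfold)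
qed

lemma Sym_fa: "f \<in> fa G \<Longrightarrow> Sym p f \<in> fa G"
  by (rule cong_fa[OF scr_fa Sym_cong])

text \<open>The terms of a symmetrised element may be sorted, one arrangement of the two kinds of
  letters at a time.\<close>

lemma shape_permute:
  assumes \<pi>: "\<pi> permutes {..<length \<sigma>}"
  shows "scong GP pp (\<Sum>w\<in>shape_words \<sigma>. scale (lk (Sym pp f) w) (elt w))
    (\<Sum>w\<in>shape_words (permute_list \<pi> \<sigma>). scale (lk (Sym pp f) w) (elt w))"
proof -
  have len: "\<pi> permutes {..<length w}" if "w \<in> shape_words \<sigma>" for w
    using that \<pi> by (auto simp: shape_words_def)
  have "scong GP pp (\<Sum>w\<in>shape_words \<sigma>. scale (lk (Sym pp f) w) (elt w))
    (\<Sum>w\<in>shape_words \<sigma>. scale (lk (Sym pp f) (permute_list \<pi> w)) (elt (permute_list \<pi> w)))"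
  proof (intro scong_sum)
    fix w assume w: "w \<in> shape_words \<sigma>"
    then have "w \<in> lists GP" by (simp add: shape_words_def)
    from scong_scale[OF scong_permute[OF this len[OF w], of pp], of "lk (Sym pp f) w"]
    show "scong GP pp (scale (lk (Sym pp f) w) (elt w)) (scale (lk (Sym pp f) (permute_list \<pi> w)) (elt (permute_list \<pi> w)))"
      by (simp add: Sym_equivariant[OF len[OF w]] mult.commute)
  qed
  also have "(\<Sum>w\<in>shape_words \<sigma>. scale (lk (Sym pp f) (permute_list \<pi> w)) (elt (permute_list \<pi> w)))
    = (\<Sum>w\<in>shape_words (permute_list \<pi> \<sigma>). scale (lk (Sym pp f) w) (elt w))"
  proof (rule sum.reindex_bij_witness[where i = "permute_list (pinv \<pi>)" and j = "permute_list \<pi>"])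
    fix w assume w: "w \<in> shape_words \<sigma>"
    show "permute_list (pinv \<pi>) (permute_list \<pi> w) = w" by (rule permute_list_inv[OF len[OF w]])
    have "set (permute_list \<pi> w) = set w" by (rule set_permute_list[OF len[OF w]])
    moreover have "map (map_sum fst fst) (permute_list \<pi> w) = permute_list \<pi> (map (map_sum fst fst) w)"
      by (rule permute_list_map[OF len[OF w], symmetric])
    ultimately show "permute_list \<pi> w \<in> shape_words (permute_list \<pi> \<sigma>)"
      using w by (simp add: shape_words_def lists_eq_set)
  next
    fix w assume w: "w \<in> shape_words (permute_list \<pi> \<sigma>)"
    then have "map (map_sum fst fst) w = permute_list \<pi> \<sigma>" by (simp add: shape_words_def)
    from arg_cong[OF this, of length] have \<pi>w: "\<pi> permutes {..<length w}" using \<pi> by simp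
    show "permute_list \<pi> (permute_list (pinv \<pi>) w) = w" by (rule permute_list_inv[OF \<pi>w])
    have "set (permute_list (pinv \<pi>) w) = set w" by (rule set_permute_list[OF permutes_inv[OF \<pi>w]])
    moreover have "map (map_sum fst fst) (permute_list (pinv \<pi>) w) = permute_list (pinv \<pi>) (map (map_sum fst fst) w)"
      by (rule permute_list_map[OF permutes_inv[OF \<pi>w], symmetric])
    ultimately show "permute_list (pinv \<pi>) w \<in> shape_words \<sigma>"
      using w permute_list_inv(1)[OF \<pi>] by (simp add: shape_words_def lists_eq_set)
  qed simp
  finally show ?thesis .
qed

text \<open>The symmetrisation of an invariant is a sum over shapes, each of which may be sorted.\<close>

lemma invariant_in_image:
  assumes f: "invariant f"
  shows "f \<in> X_image"
proof -
  let ?g = "Sym pp f" and ?sh = "map (map_sum fst fst) :: pgen list \<Rightarrow> (nat + nat) list"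
  have fa: "f \<in> fa GP" using f by (simp add: invariant_def)
  have g: "w \<in> lists GP" if "w \<in> Poly_Mapping.keys ?g" for w
    using fa_keys[OF Sym_fa[OF fa] that] .
  have part: "(\<Sum>w\<in>shape_words \<sigma>. scale (lk ?g w) (elt w)) \<in> X_image" if \<sigma>: "\<sigma> \<in> ?sh ` Poly_Mapping.keys ?g" for \<sigma>
  proof -
    \<comment> \<open>Sorting the shape puts the T to the left.\<close>
    define a where "a = map projl (filter isl \<sigma>)"
    define b where "b = map projr (filter (\<lambda>x. \<not> isl x) \<sigma>)"
    have \<sigma>_mem: "(\<forall>x. Inl x \<in> set \<sigma> \<longrightarrow> x < k + l) \<and> (\<forall>x. Inr x \<in> set \<sigma> \<longrightarrow> x < r + s)"
    proof -
      obtain w where w: "\<sigma> = ?sh w" "w \<in> lists GP" using \<sigma> g by blast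
      have "case x of Inl y \<Rightarrow> y < k + l | Inr y \<Rightarrow> y < r + s" if x: "x \<in> set \<sigma>" for x
      proof -
        obtain h where h: "x = map_sum fst fst h" "h \<in> set w" using x w(1) by auto
        have "h \<in> GP" using h(2) w(2) by (simp add: in_lists_conv_set)
        then show ?thesis by (cases rule: P_gens_cases) (simp_all add: h(1))
      qed
      then show ?thesis by fastforce
    qed
    have a: "set a \<subseteq> {..<k + l}"
    proof
      fix x assume "x \<in> set a"
      then obtain y where "y \<in> set \<sigma>" "isl y" "x = projl y" by (auto simp: a_def)
      then have "Inl x \<in> set \<sigma>" by simp
      then show "x \<in> {..<k + l}" using \<sigma>_mem by blast
    qed
    have b: "set b \<subseteq> {..<r + s}"
    proof
      fix x assume "x \<in> set b"
      then obtain y where "y \<in> set \<sigma>" "\<not> isl y" "x = projr y" by (auto simp: b_def)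
      then have "Inr x \<in> set \<sigma>" by simp
      then show "x \<in> {..<r + s}" using \<sigma>_mem by blast
    qed
    have "map Inl a = filter isl \<sigma>" "map Inr b = filter (\<lambda>x. \<not> isl x) \<sigma>"
      by (auto simp: a_def b_def intro!: map_idI)
    then have "mset (map Inl a @ map Inr b) = mset \<sigma>"
      using multiset_partition[of "mset \<sigma>" isl] by (simp only: mset_append mset_filter)
    then obtain \<pi> where \<pi>: "\<pi> permutes {..<length \<sigma>}" "permute_list \<pi> \<sigma> = map Inl a @ map Inr b"
      by (rule mset_eq_permutation)
    have "(\<Sum>w\<in>shape_words (permute_list \<pi> \<sigma>). scale (lk ?g w) (elt w)) \<in> X_image"
      unfolding \<pi>(2) sum_shape_words[OF a b] by (rule shape_in_image[OF f a b])
    then show ?thesis by (rule X_image_cong[OF shape_permute[OF \<pi>(1)]])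
  qed
  have "?g = (\<Sum>w\<in>Poly_Mapping.keys ?g. scale (lk ?g w) (elt w))" by (rule expand_elt)
  also have "\<dots> = (\<Sum>\<sigma>\<in>?sh ` Poly_Mapping.keys ?g. \<Sum>w | w \<in> Poly_Mapping.keys ?g \<and> ?sh w = \<sigma>. scale (lk ?g w) (elt w))"
    by (rule sum.group[symmetric]) auto
  also have "\<dots> = (\<Sum>\<sigma>\<in>?sh ` Poly_Mapping.keys ?g. \<Sum>w\<in>shape_words \<sigma>. scale (lk ?g w) (elt w))"
    by (intro sum.cong refl sum.mono_neutral_left finite_shape_words) (use g in \<open>auto simp: shape_words_def in_keys_iff\<close>)
  also have "\<dots> \<in> X_image"
    by (intro subsp_sum[OF subsp_X_image] part)
  finally have "?g \<in> X_image" .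
  then show ?thesis by (rule X_image_cong[OF scong_sym[OF Sym_cong[OF fa]]])
qed

theorem Psi_surj: "Psi k l r s m n ` carrier (M_alg k l r s) = carrier (X_alg k l r s m n)"
proof (intro equalityI subsetI)
  fix y assume "y \<in> Psi k l r s m n ` carrier (M_alg k l r s)"
  then show "y \<in> carrier (X_alg k l r s m n)" using Psi_in_X by (auto simp: carrier_M)
next
  fix y assume "y \<in> carrier (X_alg k l r s m n)"
  then obtain f where y: "y = P_class k l r s m n f" and f: "invariant f"
    by (auto simp: carrier_X invariant_def)
  from invariant_in_image[OF f] obtain z where z: "z \<in> fa (M_gens k l r s)" "scong GP pp f (fhom X z)"
    by (auto simp: X_image_def)
  have "f \<in> fa GP" using f by (simp add: invariant_def)
  then have "y = Psi k l r s m n (M_class k l r s z)"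
    unfolding y Psi_class[OF z(1)] using z by (simp add: P_class_eq fhom_X_fa)
  then show "y \<in> Psi k l r s m n ` carrier (M_alg k l r s)" using z(1) by (auto simp: carrier_M)
qed

end


theorem theorem6p2:
  fixes k l r s m n :: nat
  shows "Psi k l r s m n \<in> superalgebra_hom (M_alg k l r s) (X_alg k l r s m n)
    \<and> (\<forall>a<k + l. \<forall>b<r + s. Psi k l r s m n (M_class k l r s (gen (a, b)))
          = P_class k l r s m n (X_elem k r m n (a, b)))
    \<and> Psi k l r s m n ` carrier (M_alg k l r s) = carrier (X_alg k l r s m n)
    \<and> (\<forall>m' n'. max k r \<le> m' \<longrightarrow> max l s \<le> n' \<longrightarrow>
         (\<forall>Z\<in>carrier (UU k l r s). \<forall>f\<in>carrier (M_alg k l r s).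
            Psi k l r s m n (M_act k l r s m' n' Z f)
              = X_act k l r s m n Z (Psi k l r s m n f)))"
  by (intro conjI allI impI ballI Psi_superalgebra_hom Psi_gen Psi_surj Psi_equivariant)

end
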